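(* An adornment groundable datalog program $\Pi$ over a database instance with at most $N$ tuples per EDB relation can be evaluated in time $O\bigl(f(\Pi)\cdot|\Pi|\cdot N^{\mathsf{ew}(\Pi)}\bigr)$.
   Context: Datalog. Standard positive datalog programs: finite sets of rules $q(\bar s)\gets p_1(\bar s_1),\dots,p_\mu(\bar s_\mu)$ whose terms are variables or constants; $|\Pi|$ is the number of rules. A predicate is IDB if it is the head predicate of a rule with non-empty body, otherwise EDB. Evaluating means computing all IDB relations of the least fixpoint. "$\_$" denotes a fresh existentially quantified variable. A datalog program is adornment groundable if, for every rule, (1) every EDB atom either has a variable that is not shared with any other (body) atom and appears in the rule's head, or has all its variables appearing in the rule's head; and (2) each variable of an IDB body atom appears in the head or in some EDB atom of the rule. Edge-cover width and $f(\Pi)$. Let $\Pi'$ be the output of the following algorithm on $\Pi$. Here $q_\rho$ denotes a new predicate for an IDB predicate $q$ and a rule $\rho$ (adornment) with head predicate $q$ and only EDB body atoms. Start with $\Pi'=\emptyset$. Repeat until a fixpoint: for each rule $R: q(\bar s)\gets \bigwedge_{i=1}^{l}p_i(\bar s_i)\wedge\mathcal E$ of $\Pi$ ($p_i$ IDB, $\mathcal E$ a conjunction of EDB atoms, $l\ge0$), and each choice $(\rho_1,\dots,\rho_l)$ such that for each $i$ some rule of $\Pi'$ has head atom ${p_i}_{\rho_i}(\bar v_i)$: rename these head atoms with their adornments to ${p_i}_{\rho_i'}(\bar v_i')$, $\rho_i'=p_i(\bar v_i')\gets\mathcal B_i$, so that they and $R$ are pairwise variable-disjoint; let $\sigma$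 be a simultaneous mgu of the pairs $(\bar s_i,\bar v_i')$ (skip if none); let $\rho=g_{\mathsf{out}}\bigl(q(\sigma(\bar s))\gets\bigwedge_i\sigma(\mathcal B_i)\wedge\sigma(\mathcal E)\bigr)$; add the rule $q_\rho(\sigma(\bar s))\gets\bigwedge_i{p_i}_{\rho_i}(\sigma(\bar s_i))\wedge\sigma(\mathcal E)$ to $\Pi'$ unless an identical rule up to variable renaming is already present. The function $g_{\mathsf{out}}$ replaces each body argument not occurring in the head by $\_$ and then removes each body atom $e(\bar t)$ for which another body atom $e(\bar t')$ satisfies, for each position $i$, $t_i=t_i'$ or $t_i=\_$ (keeping one of identical atoms); in particular atoms with only $\_$ are removed. For an adornment $\rho: q(\bar s)\gets e_1(\bar t_1),\dots,e_\mu(\bar t_\mu)$, $\mathsf{ew}(q_\rho)$ is the minimum of $\sum_i x_i$ over $0\le x_i\le1$ assigned to the hyperedges $\mathsf{vars}(\bar t_i)$ such that each $v\in\mathsf{vars}(\bar s)$ is covered with total weight at least $1$ (fractional edge cover). $\mathsf{ew}(\Pi)$ is the maximum of $\mathsf{ew}(q_\rho)$ over all $q_\rho$ in $\Pi'$. $f(\Pi)$, which depends only on $\Pi$, is the maximum over IDB predicates $q$ of $\Pi$ of the number of different adornments $\rho$ (up to variable renaming) with $q_\rho$ in $\Pi'$; thus every IDB relation has size at most $f(\Pi)\cdot N^{\mathsf{ew}(\Pi)}$. *)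

theory Defs
  imports "HOL-Analysis.Analysis"
begin

section \<open>Datalog\<close>

datatype 'c trm = Var nat | Const 'c

type_synonym ('p, 'c) atom = "'p \<times> 'c trm list"

datatype ('p, 'c) dl_rule =
  Rule (rhead: "('p, 'c) atom") (rbody: "('p, 'c) atom list")

type_synonym ('p, 'c) program = "('p, 'c) dl_rule set"

primrec trm_vars :: "'c trm \<Rightarrow> nat set" where
  "trm_vars (Var x) = {x}"
| "trm_vars (Const c) = {}"

definition args_vars :: "'c trm list \<Rightarrow> nat set" where
  "args_vars ts = (\<Union>t\<in>set ts. trm_vars t)"

definition atom_vars :: "('p, 'c) atom \<Rightarrow> nat set" where
  "atom_vars a = args_vars (snd a)"

definition rule_vars :: "('p, 'c) dl_rule \<Rightarrow> nat set" where
  "rule_vars r = atom_vars (rhead r) \<union> (\<Union>a\<in>set (rbody r). atom_vars a)"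

definition atoms_of :: "('p, 'c) dl_rule \<Rightarrow> ('p, 'c) atom list" where
  "atoms_of r = rhead r # rbody r"

definition idb :: "('p, 'c) program \<Rightarrow> 'p set" where
  "idb P = {fst (rhead r) | r. r \<in> P \<and> rbody r \<noteq> []}"

definition edb :: "('p, 'c) program \<Rightarrow> 'p set" where
  "edb P = (\<Union>r\<in>P. fst ` set (atoms_of r)) - idb P"

definition idb_atoms :: "('p, 'c) program \<Rightarrow> ('p, 'c) dl_rule \<Rightarrow> ('p, 'c) atom list" where
  "idb_atoms P r = filter (\<lambda>a. fst a \<in> idb P) (rbody r)"

definition edb_atoms :: "('p, 'c) program \<Rightarrow> ('p, 'c) dl_rule \<Rightarrow> ('p, 'c) atom list" where
  "edb_atoms P r = filter (\<lambda>a. fst a \<notin> idb P) (rbody r)"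

text \<open>The usual conventions for positive datalog: finitely many rules, a fixed arity
  \<open>ar p\<close> of every predicate \<open>p\<close>, and range restriction (safety). In particular rules with
  an empty body are ground facts.\<close>

definition datalog_program :: "('p \<Rightarrow> nat) \<Rightarrow> ('p, 'c) program \<Rightarrow> bool" where
  "datalog_program ar P \<longleftrightarrow> finite P \<and>
     (\<forall>r\<in>P. (\<forall>a\<in>set (atoms_of r). length (snd a) = ar (fst a)) \<and>
            atom_vars (rhead r) \<subseteq> (\<Union>a\<in>set (rbody r). atom_vars a))"

definition rule_size :: "('p, 'c) dl_rule \<Rightarrow> nat" where
  "rule_size r = sum_list (map (\<lambda>a. 1 + length (snd a)) (atoms_of r))"

definition adornment_groundable :: "('p, 'c) program \<Rightarrow> bool" where
  "adornment_groundable P \<longleftrightarrow>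
     (\<forall>r\<in>P.
        (\<forall>i<length (rbody r). fst (rbody r ! i) \<notin> idb P \<longrightarrow>
           (\<exists>x\<in>atom_vars (rbody r ! i).
               (\<forall>j<length (rbody r). j \<noteq> i \<longrightarrow> x \<notin> atom_vars (rbody r ! j)) \<and>
               x \<in> atom_vars (rhead r)) \<or>
           atom_vars (rbody r ! i) \<subseteq> atom_vars (rhead r)) \<and>
        (\<forall>a\<in>set (idb_atoms P r). \<forall>x\<in>atom_vars a.
           x \<in> atom_vars (rhead r) \<or> (\<exists>b\<in>set (edb_atoms P r). x \<in> atom_vars b)))"

type_synonym ('p, 'c) fact = "'p \<times> 'c list"

primrec trm_val :: "(nat \<Rightarrow> 'c) \<Rightarrow> 'c trm \<Rightarrow> 'c" where
  "trm_val \<nu> (Var x) = \<nu> x"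
| "trm_val \<nu> (Const c) = c"

definition ground :: "(nat \<Rightarrow> 'c) \<Rightarrow> ('p, 'c) atom \<Rightarrow> ('p, 'c) fact" where
  "ground \<nu> a = (fst a, map (trm_val \<nu>) (snd a))"

definition consequence :: "('p, 'c) program \<Rightarrow> ('p, 'c) fact set \<Rightarrow> ('p, 'c) fact set \<Rightarrow> ('p, 'c) fact set" where
  "consequence P D I = D \<union> {ground \<nu> (rhead r) | \<nu> r. r \<in> P \<and> (\<forall>a\<in>set (rbody r). ground \<nu> a \<in> I)}"

definition least_fixpoint :: "('p, 'c) program \<Rightarrow> ('p, 'c) fact set \<Rightarrow> ('p, 'c) fact set" where
  "least_fixpoint P D = lfp (consequence P D)"

definition relation :: "('p, 'c) program \<Rightarrow> ('p, 'c) fact set \<Rightarrow> 'p \<Rightarrow> 'c list set" where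
  "relation P D p = {t. (p, t) \<in> least_fixpoint P D}"

text \<open>An instance lists the tuples of every relation, in an arbitrary order and without
  repetitions; it contains no tuples for IDB predicates.\<close>

type_synonym ('p, 'c) tables = "'p \<Rightarrow> 'c list list"

definition facts_of :: "('p, 'c) tables \<Rightarrow> ('p, 'c) fact set" where
  "facts_of T = {(p, t). t \<in> set (T p)}"

definition edb_instance :: "('p \<Rightarrow> nat) \<Rightarrow> ('p, 'c) program \<Rightarrow> ('p, 'c) tables \<Rightarrow> bool" where
  "edb_instance ar P T \<longleftrightarrow>
     (\<forall>p. distinct (T p) \<and> (\<forall>t\<in>set (T p). length t = ar p)) \<and> (\<forall>p\<in>idb P. T p = [])"

text \<open>A predicate defined only by facts of the program is EDB, so the extension of an EDB
  predicate consists of its tuples in the instance together with its facts in the program.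
  It is this extension whose size is bounded.\<close>

definition edb_tuples_at_most :: "('p, 'c) program \<Rightarrow> ('p, 'c) tables \<Rightarrow> nat \<Rightarrow> bool" where
  "edb_tuples_at_most P T N \<longleftrightarrow> (\<forall>e\<in>edb P. card (relation P (facts_of T) e) \<le> N)"


section \<open>Substitutions and most general unifiers\<close>

type_synonym 'c sbst = "nat \<Rightarrow> 'c trm"

primrec subst :: "'c sbst \<Rightarrow> 'c trm \<Rightarrow> 'c trm" where
  "subst \<sigma> (Var x) = \<sigma> x"
| "subst \<sigma> (Const c) = Const c"

definition subst_atom :: "'c sbst \<Rightarrow> ('p, 'c) atom \<Rightarrow> ('p, 'c) atom" where
  "subst_atom \<sigma> a = (fst a, map (subst \<sigma>) (snd a))"

definition unifier :: "'c sbst \<Rightarrow> ('c trm list \<times> 'c trm list) list \<Rightarrow> bool" where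
  "unifier \<sigma> E \<longleftrightarrow> (\<forall>(s, v)\<in>set E. map (subst \<sigma>) s = map (subst \<sigma>) v)"

definition is_mgu :: "'c sbst \<Rightarrow> ('c trm list \<times> 'c trm list) list \<Rightarrow> bool" where
  "is_mgu \<sigma> E \<longleftrightarrow> unifier \<sigma> E \<and> (\<forall>\<tau>. unifier \<tau> E \<longrightarrow> (\<exists>\<gamma>. \<forall>x. \<tau> x = subst \<gamma> (\<sigma> x)))"


section \<open>Adornments and the adorned program\<close>

text \<open>In the body of an adornment, \<open>None\<close> stands for the anonymous variable \<open>_\<close>; distinct
  occurrences denote distinct fresh variables. Bodies are sets since \<open>gout\<close> keeps only one of
  several identical atoms.\<close>

type_synonym ('p, 'c) batom = "'p \<times> 'c trm option list"

datatype ('p, 'c) adornment =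
  Adornment (ahead: "('p, 'c) atom") (abody: "('p, 'c) batom set")

definition batom_vars :: "('p, 'c) batom \<Rightarrow> nat set" where
  "batom_vars b = (\<Union>t\<in>{t. Some t \<in> set (snd b)}. trm_vars t)"

definition subst_batom :: "'c sbst \<Rightarrow> ('p, 'c) batom \<Rightarrow> ('p, 'c) batom" where
  "subst_batom \<sigma> b = (fst b, map (map_option (subst \<sigma>)) (snd b))"

definition batom_of :: "('p, 'c) atom \<Rightarrow> ('p, 'c) batom" where
  "batom_of a = (fst a, map Some (snd a))"

definition blank :: "'c trm set \<Rightarrow> ('p, 'c) batom \<Rightarrow> ('p, 'c) batom" where
  "blank H b = (fst b, map (\<lambda>u. case u of None \<Rightarrow> None | Some t \<Rightarrow> if t \<in> H then Some t else None) (snd b))"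

definition subsumed_by :: "('p, 'c) batom \<Rightarrow> ('p, 'c) batom \<Rightarrow> bool" where
  "subsumed_by b b' \<longleftrightarrow> fst b = fst b' \<and> list_all2 (\<lambda>u u'. u = u' \<or> u = None) (snd b) (snd b')"

text \<open>Mutually subsuming atoms are identical, so removing all subsumed atoms at once is the
  same as removing them one by one. An atom all of whose arguments are blank (which includes
  atoms without arguments) is removed even if there is no other atom that subsumes it.\<close>

definition prune :: "('p, 'c) batom set \<Rightarrow> ('p, 'c) batom set" where
  "prune B = {b \<in> B. (\<exists>u\<in>set (snd b). u \<noteq> None) \<and> \<not> (\<exists>b'\<in>B. b' \<noteq> b \<and> subsumed_by b b')}"

definition gout :: "('p, 'c) atom \<Rightarrow> ('p, 'c) batom set \<Rightarrow> ('p, 'c) adornment" where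
  "gout h B = Adornment h (prune (blank (set (snd h)) ` B))"

text \<open>The predicate \<open>q_\<rho>\<close> is represented by \<open>\<rho>\<close>; \<open>q\<close> is the head predicate of \<open>\<rho>\<close>.\<close>

type_synonym ('p, 'c) aatom = "('p, 'c) adornment \<times> 'c trm list"

datatype ('p, 'c) adorned_rule =
  Adorned_Rule "('p, 'c) aatom" "('p, 'c) aatom list" "('p, 'c) atom list"

definition aatom_vars :: "('p, 'c) aatom \<Rightarrow> nat set" where
  "aatom_vars h = args_vars (snd h) \<union> atom_vars (ahead (fst h)) \<union> (\<Union>b\<in>abody (fst h). batom_vars b)"

definition rename_adornment :: "(nat \<Rightarrow> nat) \<Rightarrow> ('p, 'c) adornment \<Rightarrow> ('p, 'c) adornment" where
  "rename_adornment \<pi> \<rho> =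
     Adornment (subst_atom (Var \<circ> \<pi>) (ahead \<rho>)) (subst_batom (Var \<circ> \<pi>) ` abody \<rho>)"

definition rename_aatom :: "(nat \<Rightarrow> nat) \<Rightarrow> ('p, 'c) aatom \<Rightarrow> ('p, 'c) aatom" where
  "rename_aatom \<pi> h = (rename_adornment \<pi> (fst h), map (subst (Var \<circ> \<pi>)) (snd h))"

text \<open>The fixpoint of the algorithm. Instead of adding a rule only once up to renaming, all
  rules arising from any choice of the renamings and of the mgu are collected; rules and
  adornments are identified up to renaming when they are counted. In the rule below, \<open>hs\<close>
  lists the chosen head atoms \<open>(\<rho>\<^sub>i, v\<^sub>i)\<close> and \<open>hs'\<close> their renamed versions.\<close>

inductive_set adorned_program :: "('p, 'c) program \<Rightarrow> ('p, 'c) adorned_rule set"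
  for P :: "('p, 'c) program" where
  adorn: "\<lbrakk> R \<in> P; fst (rhead R) \<in> idb P;
      \<forall>h\<in>set hs. \<exists>B E. Adorned_Rule h B E \<in> adorned_program P;
      map (\<lambda>h. fst (ahead (fst h))) hs = map fst (idb_atoms P R);
      list_all2 (\<lambda>h h'. \<exists>\<pi>. bij \<pi> \<and> h' = rename_aatom \<pi> h) hs hs';
      \<forall>i<length hs'. aatom_vars (hs' ! i) \<inter> rule_vars R = {} \<and>
         (\<forall>j<i. aatom_vars (hs' ! i) \<inter> aatom_vars (hs' ! j) = {});
      is_mgu \<sigma> (zip (map snd (idb_atoms P R)) (map snd hs'));
      \<rho> = gout (subst_atom \<sigma> (rhead R))
             ((\<Union>h'\<in>set hs'. subst_batom \<sigma> ` abody (fst h')) \<union>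
              (\<lambda>a. batom_of (subst_atom \<sigma> a)) ` set (edb_atoms P R)) \<rbrakk>
    \<Longrightarrow> Adorned_Rule (\<rho>, map (subst \<sigma>) (snd (rhead R)))
          (zip (map fst hs) (map (\<lambda>a. map (subst \<sigma>) (snd a)) (idb_atoms P R)))
          (map (subst_atom \<sigma>) (edb_atoms P R)) \<in> adorned_program P"

definition adornments :: "('p, 'c) program \<Rightarrow> ('p, 'c) adornment set" where
  "adornments P = {\<rho>. \<exists>vs B E. Adorned_Rule (\<rho>, vs) B E \<in> adorned_program P}"

definition variants :: "(('p, 'c) adornment \<times> ('p, 'c) adornment) set" where
  "variants = {(\<rho>, \<rho>'). \<exists>\<pi>. bij \<pi> \<and> \<rho>' = rename_adornment \<pi> \<rho>}"

text \<open>The element 0 inserted here and in \<open>ew_program\<close> matters only if there are no IDB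
  predicates or no adornments, respectively. The sets are finite: up to renaming there are
  finitely many adornments, and \<open>ew\<close> is invariant under renaming.\<close>

definition num_adornments :: "('p, 'c) program \<Rightarrow> nat" where
  "num_adornments P =
     Max (insert 0 ((\<lambda>q. card ({\<rho> \<in> adornments P. fst (ahead \<rho>) = q} // variants)) ` idb P))"

definition fractional_edge_cover :: "('p, 'c) adornment \<Rightarrow> (('p, 'c) batom \<Rightarrow> real) \<Rightarrow> bool" where
  "fractional_edge_cover \<rho> x \<longleftrightarrow>
     (\<forall>b\<in>abody \<rho>. 0 \<le> x b \<and> x b \<le> 1) \<and>
     (\<forall>v\<in>atom_vars (ahead \<rho>). (\<Sum>b\<in>{b \<in> abody \<rho>. v \<in> batom_vars b}. x b) \<ge> 1)"

definition ew :: "('p, 'c) adornment \<Rightarrow> real" where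
  "ew \<rho> = Inf {(\<Sum>b\<in>abody \<rho>. x b) | x. fractional_edge_cover \<rho> x}"

definition ew_program :: "('p, 'c) program \<Rightarrow> real" where
  "ew_program P = Max (insert 0 (ew ` adornments P))"


section \<open>The machine model\<close>

text \<open>Running time refers to a random access machine with dictionaries, given as an imperative
  language with a timed big-step semantics. The memory is an array whose cells are addressed by
  lists of values (constants of the domain, which can only be copied and compared, and
  numbers, which can only be incremented and compared). The input relations are read-only:
  \<open>Card p\<close> is the number of tuples of \<open>p\<close>, \<open>Comp p e j\<close> the \<open>j\<close>-th component of the tuple at
  index \<open>e\<close>, and \<open>Member p es\<close> tests membership. Output tuples are produced by \<open>Emit\<close>. Every
  operation costs 1 plus the cost of its arguments; hence accessing a cell or emitting a tuple
  costs time proportional to the length of the address or tuple.\<close>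

datatype 'c val = Cst 'c | Num nat

datatype ('p, 'c) exp =
    Lit "'c val"
  | Cell "('p, 'c) exp list"
  | Succ "('p, 'c) exp"
  | Card 'p
  | Comp 'p "('p, 'c) exp" nat
  | Member 'p "('p, 'c) exp list"

datatype ('p, 'c) bexp =
    Eq "('p, 'c) exp" "('p, 'c) exp"
  | Less "('p, 'c) exp" "('p, 'c) exp"
  | Not "('p, 'c) bexp"
  | And "('p, 'c) bexp" "('p, 'c) bexp"

datatype ('p, 'c) com =
    Skip
  | Assign "('p, 'c) exp list" "('p, 'c) exp"
  | Emit 'p "('p, 'c) exp list"
  | Seq "('p, 'c) com" "('p, 'c) com"
  | If "('p, 'c) bexp" "('p, 'c) com" "('p, 'c) com"
  | While "('p, 'c) bexp" "('p, 'c) com"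

type_synonym 'c mem = "'c val list \<Rightarrow> 'c val"

text \<open>Ill-typed operations (such as incrementing a constant) and accesses out of range
  yield \<open>Num 0\<close>.\<close>

fun succ_val :: "'c val \<Rightarrow> 'c val" where
  "succ_val (Num n) = Num (Suc n)"
| "succ_val (Cst c) = Num 0"

fun comp_val :: "'c list list \<Rightarrow> 'c val \<Rightarrow> nat \<Rightarrow> 'c val" where
  "comp_val ts (Num i) j =
     (if i < length ts \<and> j < length (ts ! i) then Cst (ts ! i ! j) else Num 0)"
| "comp_val ts (Cst c) j = Num 0"

fun less_val :: "'c val \<Rightarrow> 'c val \<Rightarrow> bool" where
  "less_val (Num m) (Num n) \<longleftrightarrow> m < n"
| "less_val _ _ \<longleftrightarrow> False"

fun exp_val :: "('p, 'c) tables \<Rightarrow> 'c mem \<Rightarrow> ('p, 'c) exp \<Rightarrow> 'c val" where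
  "exp_val T m (Lit v) = v"
| "exp_val T m (Cell es) = m (map (exp_val T m) es)"
| "exp_val T m (Succ e) = succ_val (exp_val T m e)"
| "exp_val T m (Card p) = Num (length (T p))"
| "exp_val T m (Comp p e j) = comp_val (T p) (exp_val T m e) j"
| "exp_val T m (Member p es) =
     Num (if map (exp_val T m) es \<in> map Cst ` set (T p) then 1 else 0)"

fun exp_cost :: "('p, 'c) exp \<Rightarrow> nat" where
  "exp_cost (Lit v) = 1"
| "exp_cost (Cell es) = 1 + sum_list (map exp_cost es)"
| "exp_cost (Succ e) = 1 + exp_cost e"
| "exp_cost (Card p) = 1"
| "exp_cost (Comp p e j) = 1 + exp_cost e"
| "exp_cost (Member p es) = 1 + sum_list (map exp_cost es)"

primrec bexp_val :: "('p, 'c) tables \<Rightarrow> 'c mem \<Rightarrow> ('p, 'c) bexp \<Rightarrow> bool" where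
  "bexp_val T m (Eq e e') \<longleftrightarrow> exp_val T m e = exp_val T m e'"
| "bexp_val T m (Less e e') \<longleftrightarrow> less_val (exp_val T m e) (exp_val T m e')"
| "bexp_val T m (Not b) \<longleftrightarrow> \<not> bexp_val T m b"
| "bexp_val T m (And b b') \<longleftrightarrow> bexp_val T m b \<and> bexp_val T m b'"

primrec bexp_cost :: "('p, 'c) bexp \<Rightarrow> nat" where
  "bexp_cost (Eq e e') = 1 + exp_cost e + exp_cost e'"
| "bexp_cost (Less e e') = 1 + exp_cost e + exp_cost e'"
| "bexp_cost (Not b) = 1 + bexp_cost b"
| "bexp_cost (And b b') = 1 + bexp_cost b + bexp_cost b'"

text \<open>A state consists of the memory and the set of facts emitted so far; \<open>exec T c s t s'\<close>
  means that \<open>c\<close> started in \<open>s\<close> terminates in \<open>s'\<close> after time \<open>t\<close>. The empty command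
  takes no time.\<close>

type_synonym ('p, 'c) state = "'c mem \<times> ('p, 'c) fact set"

inductive exec :: "('p, 'c) tables \<Rightarrow> ('p, 'c) com \<Rightarrow> ('p, 'c) state \<Rightarrow> nat \<Rightarrow> ('p, 'c) state \<Rightarrow> bool"
  for T :: "('p, 'c) tables" where
  Skip: "exec T Skip s 0 s"
| Assign: "exec T (Assign es e) (m, out) (1 + sum_list (map exp_cost es) + exp_cost e)
     (m(map (exp_val T m) es := exp_val T m e), out)"
| Emit: "map (exp_val T m) es = map Cst cs \<Longrightarrow>
     exec T (Emit p es) (m, out) (1 + sum_list (map exp_cost es)) (m, insert (p, cs) out)"
| Seq: "exec T c s t s' \<Longrightarrow> exec T c' s' t' s'' \<Longrightarrow> exec T (Seq c c') s (t + t') s''"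
| IfTrue: "bexp_val T (fst s) b \<Longrightarrow> exec T c s t s' \<Longrightarrow>
     exec T (If b c c') s (1 + bexp_cost b + t) s'"
| IfFalse: "\<not> bexp_val T (fst s) b \<Longrightarrow> exec T c' s t s' \<Longrightarrow>
     exec T (If b c c') s (1 + bexp_cost b + t) s'"
| WhileFalse: "\<not> bexp_val T (fst s) b \<Longrightarrow> exec T (While b c) s (1 + bexp_cost b) s"
| WhileTrue: "bexp_val T (fst s) b \<Longrightarrow> exec T c s t s' \<Longrightarrow> exec T (While b c) s' t' s'' \<Longrightarrow>
     exec T (While b c) s (1 + bexp_cost b + t + t') s''"

inductive_cases exec_SkipE: "exec T Skip s t s'"
inductive_cases exec_AssignE: "exec T (Assign es e) s t s'"
inductive_cases exec_EmitE: "exec T (Emit p es) s t s'"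
inductive_cases exec_SeqE: "exec T (Seq c c') s t s'"
inductive_cases exec_IfE: "exec T (If b c c') s t s'"
inductive_cases exec_WhileE: "exec T (While b c) s t s'"

lemma inj_Cst: "inj Cst"
  by (simp add: inj_def)

lemma exec_deterministic:
  "exec T c s t s' \<Longrightarrow> exec T c s t' s'' \<Longrightarrow> t' = t \<and> s'' = s'"
proof (induction arbitrary: t' s'' rule: exec.induct)
  case (Skip s)
  then show ?case by (auto elim: exec_SkipE)
next
  case (Assign es e m out)
  then show ?case by (auto elim: exec_AssignE)
next
  case (Emit m es cs p out)
  show ?case
    by (rule exec_EmitE[OF Emit.prems]) (use Emit.hyps in \<open>auto dest: map_injective[OF _ inj_Cst]\<close>)
next
  case (Seq c s t s' c' u s2)
  from Seq.prems obtain t1 s1 t2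
    where *: "t' = t1 + t2" "exec T c s t1 s1" "exec T c' s1 t2 s''"
    by (rule exec_SeqE)
  with Seq.IH(1)[OF *(2)] Seq.IH(2)[of t2 s''] show ?case by simp
next
  case (IfTrue s b c t s' c')
  from IfTrue.prems IfTrue.hyps obtain t1
    where *: "t' = 1 + bexp_cost b + t1" "exec T c s t1 s''"
    by (auto elim: exec_IfE)
  with IfTrue.IH[OF *(2)] show ?case by simp
next
  case (IfFalse s b c' t s' c)
  from IfFalse.prems IfFalse.hyps obtain t1
    where *: "t' = 1 + bexp_cost b + t1" "exec T c' s t1 s''"
    by (auto elim: exec_IfE)
  with IfFalse.IH[OF *(2)] show ?case by simp
next
  case (WhileFalse s b c)
  then show ?case by (auto elim: exec_WhileE)
next
  case (WhileTrue s b c t s' u s2)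
  from WhileTrue.prems WhileTrue.hyps obtain t1 s1 t2
    where *: "t' = 1 + bexp_cost b + t1 + t2" "exec T c s t1 s1" "exec T (While b c) s1 t2 s''"
    by (auto elim: exec_WhileE)
  with WhileTrue.IH(1)[OF *(2)] WhileTrue.IH(2)[of t2 s''] show ?case by simp
qed

text \<open>Evaluation computes exactly the IDB relations of the least fixpoint, starting from an
  empty memory.\<close>

definition evaluates_in :: "('p, 'c) com \<Rightarrow> ('p, 'c) program \<Rightarrow> ('p, 'c) tables \<Rightarrow> nat \<Rightarrow> bool" where
  "evaluates_in c P T t \<longleftrightarrow>
     (\<exists>m out. exec T c ((\<lambda>_. Num 0), {}) t (m, out) \<and>
        (\<forall>q\<in>idb P. {u. (q, u) \<in> out} = relation P (facts_of T) q))"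

end

(*
  A ground instance of a rule R whose body holds is captured by an adornment rho of R: the mgu
  factors the instance. Groundability makes the pairs (R, rho), with rho up to renaming, into
  join queries of bounded size. Their edges are the EDB atoms of R with a non-head variable
  (each has a private head variable, so every fractional edge cover of rho gives it weight 1) and
  one atom of rho for each remaining set of variables. An edge cover of rho thus covers the whole
  query at no greater weight, and the worst-case optimal join, which extends a partial answer
  along the edge with the fewest candidates, lists the answers in time O(N^ew): by Hoelder's
  inequality, applied to one variable at a time, the time spent below a partial answer is at most
  the product of the powers |S_e|^(x_e), where S_e is the part of the edge e that is compatible
  with the partial answer and x is the cover. Every answer that satisfies the EDB atoms of R
  yields a ground Horn clause over IDB facts. Linear-time forward chaining on these clauses
  derives the IDB relations, and a second run of the joins outputs them.
*)
theory Submission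
  imports Defs
begin

section \<open>Most general unifiers of function-free equations, and the variables and constants
  that occur in them\<close>

section \<open>Unification\<close>

text \<open>The constant may depend only on the bound \<open>k\<close> on the rule sizes. Adornment
  bodies have no such bound, since their atoms range over all EDB predicates; what is bounded is the
  number of variable sets, whence at most \<open>k + 2 ^ k\<close> edges per query. Dropping atoms
  and blanking arguments makes a query an approximation from above: completeness comes from the
  adornments, soundness from testing the EDB atoms of the rule on each answer. IDB atoms never take
  part in a join; the second groundability condition makes each answer determine their arguments, so
  recursion is postponed to the propositional clauses, and there are at most as many of these as
  answers. The queries depend on the program alone and are compiled into the code, whose length is
  not charged. The joins run again at the end because \<open>Emit\<close> fixes its predicate in the
  code, whereas a derived atom is stored with its predicate as a number; inside a query the head
  predicate is known.\<close>

text \<open>Without function symbols an mgu can be read off: the terms on which all unifiers agree form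
  classes, and each variable is mapped to a representative of its class.\<close>

definition unif_eq :: "('c trm list \<times> 'c trm list) list \<Rightarrow> 'c trm \<Rightarrow> 'c trm \<Rightarrow> bool" where
  "unif_eq E s t \<longleftrightarrow> (\<forall>\<tau>. unifier \<tau> E \<longrightarrow> subst \<tau> s = subst \<tau> t)"

definition mgu_of :: "('c trm list \<times> 'c trm list) list \<Rightarrow> 'c sbst" where
  "mgu_of E x = (if \<exists>c. unif_eq E (Var x) (Const c)
     then Const (SOME c. unif_eq E (Var x) (Const c))
     else Var (LEAST y. unif_eq E (Var x) (Var y)))"

definition eqs_vars :: "('c trm list \<times> 'c trm list) list \<Rightarrow> nat set" where
  "eqs_vars E = (\<Union>(s, v)\<in>set E. args_vars s \<union> args_vars v)"

lemma unif_eq_sym: "unif_eq E s t \<Longrightarrow> unif_eq E t s"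
  by (simp add: unif_eq_def)

lemma unif_eq_cong: "unif_eq E s t \<Longrightarrow> unif_eq E s = unif_eq E t"
  by (auto simp: unif_eq_def fun_eq_iff)

lemma unif_eq_mgu_of: "unif_eq E (Var x) (mgu_of E x)"
proof (cases "\<exists>c. unif_eq E (Var x) (Const c)")
  case True
  then show ?thesis by (auto simp: mgu_of_def intro: someI_ex)
next
  case False
  have "unif_eq E (Var x) (Var (LEAST y. unif_eq E (Var x) (Var y)))"
    by (rule LeastI[of _ x]) (simp add: unif_eq_def)
  with False show ?thesis by (simp add: mgu_of_def)
qed

text \<open>Both choices in \<open>mgu_of\<close> look only at the predicate
  \<open>unif_eq E (Var x)\<close>, which is the same for all variables of a class, so equivalent
  variables get the same image. A class contains at most one constant because a unifier exists, and
  it cannot identify two constants.\<close>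

lemma mgu_of_cong:
  assumes "unifier \<tau> E" "unif_eq E s t"
  shows "subst (mgu_of E) s = subst (mgu_of E) t"
proof -
  have const: "mgu_of E x = Const c" if "unif_eq E (Var x) (Const c)" for x c
  proof -
    have "unif_eq E (Var x) (mgu_of E x)" by (rule unif_eq_mgu_of)
    moreover have "\<exists>c. unif_eq E (Var x) (Const c)" using that by blast
    then have "\<exists>d. mgu_of E x = Const d" by (simp add: mgu_of_def)
    then obtain d where d: "mgu_of E x = Const d" by blast
    ultimately have "unif_eq E (Const c) (Const d)"
      using that by (auto simp: unif_eq_def)
    with assms(1) d show ?thesis by (auto simp: unif_eq_def)
  qed
  show ?thesis
  proof (cases s)
    case (Var x)
    show ?thesis
    proof (cases t)
      case (Var y)
      have "unif_eq E (Var x) = unif_eq E (Var y)"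
        using assms(2) \<open>s = Var x\<close> Var by (intro unif_eq_cong) simp
      then show ?thesis using \<open>s = Var x\<close> Var by (simp add: mgu_of_def)
    next
      case (Const c)
      then show ?thesis using \<open>s = Var x\<close> assms(2) const by simp
    qed
  next
    case (Const c)
    show ?thesis
    proof (cases t)
      case (Var y)
      then show ?thesis using \<open>s = Const c\<close> assms(2) const[of y c] by (simp add: unif_eq_sym)
    next
      case (Const d)
      then show ?thesis using \<open>s = Const c\<close> assms by (auto simp: unif_eq_def)
    qed
  qed
qed

text \<open>A unifier agrees on a variable and its representative, so the unifier itself serves as
  the factor.\<close>

lemma mgu_of_factor: "unifier \<tau> E \<Longrightarrow> subst \<tau> (mgu_of E x) = \<tau> x"
  using unif_eq_mgu_of[of E x] by (auto simp: unif_eq_def)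

lemma is_mgu_mgu_of:
  assumes "unifier \<tau> E"
  shows "is_mgu (mgu_of E) E"
proof -
  have "map (subst (mgu_of E)) s = map (subst (mgu_of E)) v" if "(s, v) \<in> set E" for s v
  proof -
    have eq: "map (subst \<tau>) s = map (subst \<tau>) v" if "unifier \<tau> E" for \<tau>
      using \<open>(s, v) \<in> set E\<close> that by (auto simp: unifier_def)
    have len: "length s = length v" using eq[OF assms] by (rule map_eq_imp_length_eq)
    have "unif_eq E (s ! i) (v ! i)" if "i < length s" for i
      unfolding unif_eq_def
    proof (intro allI impI)
      fix \<tau> :: "'a sbst" assume "unifier \<tau> E"
      then have "map (subst \<tau>) s ! i = map (subst \<tau>) v ! i" by (simp add: eq)
      with that len show "subst \<tau> (s ! i) = subst \<tau> (v ! i)" by simp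
    qed
    then show ?thesis using len mgu_of_cong[OF assms] by (auto intro!: nth_equalityI)
  qed
  then have "unifier (mgu_of E) E" by (auto simp: unifier_def)
  moreover have "\<exists>\<gamma>. \<forall>x. \<tau>' x = subst \<gamma> (mgu_of E x)" if "unifier \<tau>' E" for \<tau>'
    using mgu_of_factor[OF that] by (intro exI[of _ \<tau>']) simp
  ultimately show ?thesis by (auto simp: is_mgu_def)
qed

lemma subst_cong_vars: "(\<And>x. x \<in> trm_vars t \<Longrightarrow> \<sigma> x = \<tau> x) \<Longrightarrow> subst \<sigma> t = subst \<tau> t"
  by (cases t) auto

lemma map_subst_cong_vars:
  "(\<And>x. x \<in> args_vars ts \<Longrightarrow> \<sigma> x = \<tau> x) \<Longrightarrow> map (subst \<sigma>) ts = map (subst \<tau>) ts"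
  by (auto simp: args_vars_def intro!: subst_cong_vars)

text \<open>A unifier changed at a variable outside the equations is still a unifier, so no other
  term can be forced to agree with that variable.\<close>

lemma unif_eq_fresh:
  assumes "unifier \<tau> E" "x \<notin> eqs_vars E" "unif_eq E (Var x) t"
  shows "t = Var x"
proof (rule ccontr)
  assume t: "t \<noteq> Var x"
  have upd: "unifier (\<tau>(x := u)) E" for u
    unfolding unifier_def
  proof clarify
    fix s v assume sv: "(s, v) \<in> set E"
    then have "x \<notin> args_vars s" "x \<notin> args_vars v" using assms(2) by (auto simp: eqs_vars_def)
    then have "map (subst (\<tau>(x := u))) s = map (subst \<tau>) s" "map (subst (\<tau>(x := u))) v = map (subst \<tau>) v"
      by (auto intro!: map_subst_cong_vars simp del: map_eq_conv)
    moreover have "map (subst \<tau>) s = map (subst \<tau>) v"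
      using assms(1) sv by (auto simp: unifier_def)
    ultimately show "map (subst (\<tau>(x := u))) s = map (subst (\<tau>(x := u))) v" by simp
  qed
  have "u = subst \<tau> t" for u
  proof -
    have "subst (\<tau>(x := u)) (Var x) = subst (\<tau>(x := u)) t"
      using assms(3) upd by (auto simp: unif_eq_def)
    then show ?thesis using t by (cases t) auto
  qed
  \<comment> \<open>\<open>u\<close> is arbitrary while \<open>subst \<tau> t\<close> is fixed, so
    any two terms would coincide.\<close>
  then have "Var 0 = (Var 1 :: 'a trm)" by metis
  then show False by simp
qed

text \<open>The private variable of an EDB atom does not occur in the equations. That it survives
  unification, and that nothing else is mapped to it, keeps it private in the adornment.\<close>

lemma mgu_of_fresh:
  assumes "unifier \<tau> E" "x \<notin> eqs_vars E"
  shows "mgu_of E x = Var x" "mgu_of E y = Var x \<Longrightarrow> y = x"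
proof -
  show "mgu_of E x = Var x" using unif_eq_fresh[OF assms unif_eq_mgu_of] .
  assume "mgu_of E y = Var x"
  then have "unif_eq E (Var x) (Var y)" using unif_eq_mgu_of[of E y] by (simp add: unif_eq_sym)
  from unif_eq_fresh[OF assms this] show "y = x" by simp
qed

definition eqs_consts :: "('c trm list \<times> 'c trm list) list \<Rightarrow> 'c set" where
  "eqs_consts E = {c. \<exists>(s, v)\<in>set E. Const c \<in> set s \<union> set v}"

text \<open>If \<open>c\<close> is absent from the equations, turning every \<open>Const c\<close>
  in the image of \<open>\<sigma>\<close> into a variable gives another unifier, but one that is no
  instance of \<open>\<sigma>\<close>. Hence adornment heads contain only constants of the program,
  one of the reasons why there are finitely many of them up to renaming.\<close>

lemma is_mgu_consts:
  assumes "is_mgu \<sigma> E" "\<sigma> x = Const c"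
  shows "c \<in> eqs_consts E"
proof (rule ccontr)
  assume c: "c \<notin> eqs_consts E"
  define r :: "'a trm \<Rightarrow> 'a trm" where "r t = (if t = Const c then Var 0 else t)" for t
  have r: "subst (r \<circ> \<sigma>) t = r (subst \<sigma> t)" if "Const c \<noteq> t" for t
    using that by (cases t) (auto simp: r_def)
  have "unifier (r \<circ> \<sigma>) E"
    unfolding unifier_def
  proof clarify
    fix s v assume sv: "(s, v) \<in> set E"
    then have "Const c \<notin> set s" "Const c \<notin> set v" using c by (auto simp: eqs_consts_def)
    moreover have "map (subst (r \<circ> \<sigma>)) ts = map r (map (subst \<sigma>) ts)" if "Const c \<notin> set ts" for ts
      using that by (induction ts) (simp_all add: r del: comp_apply)
    ultimately have "map (subst (r \<circ> \<sigma>)) s = map r (map (subst \<sigma>) s)"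
      "map (subst (r \<circ> \<sigma>)) v = map r (map (subst \<sigma>) v)"
      by blast+
    moreover have "map (subst \<sigma>) s = map (subst \<sigma>) v"
      using assms(1) sv by (auto simp: is_mgu_def unifier_def)
    ultimately show "map (subst (r \<circ> \<sigma>)) s = map (subst (r \<circ> \<sigma>)) v" by simp
  qed
  then obtain \<gamma> where "(r \<circ> \<sigma>) x = subst \<gamma> (\<sigma> x)" using assms(1) by (auto simp: is_mgu_def)
  then show False using assms(2) by (simp add: r_def)
qed

section \<open>Permutations of the variables and the variant relation on adornments\<close>

section \<open>Renaming\<close>

lemma bij_avoiding:
  fixes A B :: "nat set"
  assumes "finite A" "finite B"
  obtains \<pi> where "bij \<pi>" "\<pi> ` A \<inter> B = {}"
proof -
  obtain n where n: "A \<union> B \<subseteq> {..<n}"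
    using assms finite_nat_iff_bounded by (metis finite_Un)
  \<comment> \<open>Swaps the first two blocks of \<open>n\<close> numbers: an involution that moves
    the first block, which contains both sets, off itself.\<close>
  define \<pi> where "\<pi> v = (if v < n then v + n else if v < 2 * n then v - n else v)" for v
  have "\<pi> (\<pi> v) = v" for v by (auto simp: \<pi>_def)
  then have "bij \<pi>" by (rule involuntory_imp_bij)
  moreover have "\<pi> ` A \<inter> B = {}" using n by (auto simp: \<pi>_def)
  ultimately show thesis by (rule that)
qed

text \<open>The complements of two finite sets of equal size are both countably infinite, so a
  bijection between the finite sets extends to a permutation. It provides the normal forms of
  adornments.\<close>

lemma bij_into_initial_segment:
  fixes A :: "nat set"
  assumes "finite A"
  obtains \<pi> where "bij \<pi>" "\<pi> ` A = {..<card A}"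
proof -
  obtain f where f: "bij_betw f A {..<card A}"
    using ex_bij_betw_finite_nat[OF assms] by (auto simp: atLeast0LessThan)
  have inf: "infinite (- A)" "infinite (- {..<card A})"
    using assms infinite_UNIV_nat by (metis finite_compl, metis finite_compl finite_lessThan)
  have "bij_betw (from_nat_into (- {..<card A}) \<circ> to_nat_on (- A)) (- A) (- {..<card A})"
    using inf by (intro bij_betw_trans[OF to_nat_on_infinite bij_betw_from_nat_into]) auto
  then obtain g where g: "bij_betw g (- A) (- {..<card A})" by blast
  define \<pi> where "\<pi> v = (if v \<in> A then f v else g v)" for v
  have 1: "bij_betw \<pi> A {..<card A}" "bij_betw \<pi> (- A) (- {..<card A})"
    using f g bij_betw_cong[of A \<pi> f "{..<card A}"] bij_betw_cong[of "- A" \<pi> g "- {..<card A}"]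
    by (simp_all add: \<pi>_def)
  have "bij_betw \<pi> (A \<union> - A) ({..<card A} \<union> - {..<card A})"
    using 1 by (intro bij_betw_combine) auto
  moreover have "{..<card A} \<union> - {..<card A} = UNIV" "A \<union> - A = UNIV" by blast+
  ultimately have "bij \<pi>" by metis
  then show thesis using that 1(1) by (auto simp: bij_betw_def)
qed

lemma subst_Var: "subst Var = id"
proof
  fix t :: "'a trm" show "subst Var t = id t" by (cases t) auto
qed

lemma subst_rename_comp: "subst (Var \<circ> \<pi>) (subst (Var \<circ> \<pi>') t) = subst (Var \<circ> (\<pi> \<circ> \<pi>')) t"
  by (cases t) auto

lemma subst_atom_comp: "subst_atom (Var \<circ> \<pi>) (subst_atom (Var \<circ> \<pi>') a) = subst_atom (Var \<circ> (\<pi> \<circ> \<pi>')) a"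
  by (simp add: subst_atom_def subst_rename_comp)

lemma subst_batom_comp: "subst_batom (Var \<circ> \<pi>) (subst_batom (Var \<circ> \<pi>') b) = subst_batom (Var \<circ> (\<pi> \<circ> \<pi>')) b"
proof -
  have "subst (Var \<circ> \<pi>) \<circ> subst (Var \<circ> \<pi>') = (subst (Var \<circ> (\<pi> \<circ> \<pi>')) :: 'b trm \<Rightarrow> 'b trm)"
    by (simp add: fun_eq_iff subst_rename_comp del: comp_apply) (simp add: subst_rename_comp)
  then show ?thesis by (simp add: subst_batom_def option.map_comp)
qed

lemma rename_adornment_comp:
  "rename_adornment \<pi> (rename_adornment \<pi>' \<rho>) = rename_adornment (\<pi> \<circ> \<pi>') \<rho>"
  by (simp add: rename_adornment_def subst_atom_comp image_image subst_batom_comp)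

lemma rename_adornment_id: "rename_adornment id \<rho> = \<rho>"
  by (cases \<rho>) (simp add: rename_adornment_def subst_atom_def subst_batom_def subst_Var option.map_id0)

lemma equiv_variants: "equiv UNIV (variants :: (('p, 'c) adornment \<times> ('p, 'c) adornment) set)"
    (is "equiv UNIV ?V")
proof (rule equivI)
  show "?V \<subseteq> UNIV \<times> UNIV" by simp
  show "refl_on UNIV ?V"
    by (auto simp: refl_on_def variants_def intro!: exI[of _ id] simp: rename_adornment_id)
  show "sym ?V"
  proof (rule symI)
    fix \<rho> \<rho>' :: "('p, 'c) adornment" assume "(\<rho>, \<rho>') \<in> variants"
    then obtain \<pi> where "bij \<pi>" "\<rho>' = rename_adornment \<pi> \<rho>" by (auto simp: variants_def)
    then have "bij (inv \<pi>)" "\<rho> = rename_adornment (inv \<pi>) \<rho>'"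
      by (auto simp: bij_imp_bij_inv rename_adornment_comp bij_is_inj rename_adornment_id)
    then show "(\<rho>', \<rho>) \<in> variants" by (auto simp: variants_def)
  qed
  show "trans ?V"
  proof (rule transI)
    fix a b c :: "('p, 'c) adornment" assume "(a, b) \<in> variants" "(b, c) \<in> variants"
    then obtain \<pi> \<pi>' where "bij \<pi>" "b = rename_adornment \<pi> a" "bij \<pi>'" "c = rename_adornment \<pi>' b"
      by (auto simp: variants_def)
    then have "bij (\<pi>' \<circ> \<pi>)" "c = rename_adornment (\<pi>' \<circ> \<pi>) a"
      by (auto simp: rename_adornment_comp bij_comp simp del: comp_apply)
    then show "(a, c) \<in> variants" unfolding variants_def by blast
  qed
qed

lemma args_vars_rename: "args_vars (map (subst (Var \<circ> \<pi>)) ts) = \<pi> ` args_vars ts"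
proof -
  have "trm_vars (subst (Var \<circ> \<pi>) t) = \<pi> ` trm_vars t" for t :: "'a trm" by (cases t) auto
  then show ?thesis by (auto simp: args_vars_def)
qed

lemma atom_vars_rename: "atom_vars (subst_atom (Var \<circ> \<pi>) a) = \<pi> ` atom_vars a"
  by (simp add: atom_vars_def subst_atom_def args_vars_rename)

lemma mem_batom_vars: "x \<in> batom_vars b \<longleftrightarrow> Some (Var x) \<in> set (snd b)"
proof
  assume "x \<in> batom_vars b"
  then obtain t where t: "Some t \<in> set (snd b)" "x \<in> trm_vars t" by (auto simp: batom_vars_def)
  from t(2) have "t = Var x" by (cases t) auto
  with t(1) show "Some (Var x) \<in> set (snd b)" by simp
next
  assume "Some (Var x) \<in> set (snd b)"
  then show "x \<in> batom_vars b" unfolding batom_vars_def by (intro UN_I[of "Var x"]) auto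
qed

lemma mem_args_vars: "x \<in> args_vars ts \<longleftrightarrow> Var x \<in> set ts"
proof
  assume "x \<in> args_vars ts"
  then obtain t where t: "t \<in> set ts" "x \<in> trm_vars t" by (auto simp: args_vars_def)
  from t(2) have "t = Var x" by (cases t) auto
  with t show "Var x \<in> set ts" by simp
next
  assume "Var x \<in> set ts"
  then show "x \<in> args_vars ts" unfolding args_vars_def by (intro UN_I[of "Var x"]) auto
qed

lemma mem_atom_vars: "x \<in> atom_vars a \<longleftrightarrow> Var x \<in> set (snd a)"
  by (simp add: atom_vars_def mem_args_vars)

lemma batom_vars_batom_of: "batom_vars (batom_of a) = atom_vars a"
  by (auto simp: mem_batom_vars mem_atom_vars batom_of_def)

lemma finite_trm_vars: "finite (trm_vars t)" by (cases t) auto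

lemma finite_args_vars: "finite (args_vars ts)"
  by (simp add: args_vars_def finite_trm_vars)

lemma finite_atom_vars: "finite (atom_vars a)" by (simp add: atom_vars_def finite_args_vars)

lemma finite_batom_vars: "finite (batom_vars b)"
proof -
  have "batom_vars b = (\<lambda>x. Some (Var x)) -` set (snd b)" by (auto simp: mem_batom_vars)
  moreover have "finite ((\<lambda>x. Some (Var x)) -` set (snd b))"
    by (rule finite_vimageI) (auto simp: inj_def)
  ultimately show ?thesis by simp
qed

lemma batom_vars_rename: "batom_vars (subst_batom (Var \<circ> \<pi>) b) = \<pi> ` batom_vars b"
proof (intro equalityI subsetI)
  fix x assume "x \<in> batom_vars (subst_batom (Var \<circ> \<pi>) b)"
  then obtain w where w: "w \<in> set (snd b)" "Some (Var x) = map_option (subst (Var \<circ> \<pi>)) w"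
    by (auto simp: mem_batom_vars subst_batom_def)
  from w(2) obtain u where "w = Some u" "subst (Var \<circ> \<pi>) u = Var x"
    by (cases w) auto
  with w(1) have u: "Some u \<in> set (snd b)" "subst (Var \<circ> \<pi>) u = Var x" by auto
  from u(2) obtain y where "u = Var y" "x = \<pi> y" by (cases u) auto
  with u(1) show "x \<in> \<pi> ` batom_vars b" by (auto simp: mem_batom_vars)
next
  fix x assume "x \<in> \<pi> ` batom_vars b"
  then obtain y where "Some (Var y) \<in> set (snd b)" "x = \<pi> y" by (auto simp: mem_batom_vars)
  then have "map_option (subst (Var \<circ> \<pi>)) (Some (Var y)) \<in> map_option (subst (Var \<circ> \<pi>)) ` set (snd b)" "x = \<pi> y"
    by blast+
  then show "x \<in> batom_vars (subst_batom (Var \<circ> \<pi>) b)"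
    by (simp add: mem_batom_vars subst_batom_def)
qed

lemma finite_rule_vars: "finite (rule_vars r)"
  by (simp add: rule_vars_def finite_atom_vars)

section \<open>Invariants of the derived adornments and their finiteness up to renaming\<close>

section \<open>Adornments\<close>

definition consts_of :: "('p, 'c) program \<Rightarrow> 'c set" where
  "consts_of P = {c. \<exists>r\<in>P. \<exists>a\<in>set (atoms_of r). Const c \<in> set (snd a)}"

text \<open>Invariant of all derived adornments. The conditions on constants and terms serve
  finiteness; the last one, that the body covers the head variables, guarantees that a fractional
  edge cover exists.\<close>

definition good :: "('p \<Rightarrow> nat) \<Rightarrow> ('p, 'c) program \<Rightarrow> ('p, 'c) adornment \<Rightarrow> bool" where
  "good ar P \<rho> \<longleftrightarrow> fst (ahead \<rho>) \<in> idb P \<and> length (snd (ahead \<rho>)) = ar (fst (ahead \<rho>)) \<and>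
     (\<forall>c. Const c \<in> set (snd (ahead \<rho>)) \<longrightarrow> c \<in> consts_of P) \<and> finite (abody \<rho>) \<and>
     (\<forall>b\<in>abody \<rho>. fst b \<in> edb P \<and> length (snd b) = ar (fst b) \<and>
        (\<forall>t. Some t \<in> set (snd b) \<longrightarrow> t \<in> set (snd (ahead \<rho>)))) \<and>
     atom_vars (ahead \<rho>) \<subseteq> (\<Union>b\<in>abody \<rho>. batom_vars b)"

lemma goodD:
  assumes "good ar P \<rho>"
  shows "fst (ahead \<rho>) \<in> idb P" "length (snd (ahead \<rho>)) = ar (fst (ahead \<rho>))"
    "\<And>c. Const c \<in> set (snd (ahead \<rho>)) \<Longrightarrow> c \<in> consts_of P" "finite (abody \<rho>)"
    "\<And>b. b \<in> abody \<rho> \<Longrightarrow> fst b \<in> edb P" "\<And>b. b \<in> abody \<rho> \<Longrightarrow> length (snd b) = ar (fst b)"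
    "\<And>b t. b \<in> abody \<rho> \<Longrightarrow> Some t \<in> set (snd b) \<Longrightarrow> t \<in> set (snd (ahead \<rho>))"
    "\<And>x. x \<in> atom_vars (ahead \<rho>) \<Longrightarrow> \<exists>b\<in>abody \<rho>. x \<in> batom_vars b"
  using assms by (auto simp: good_def)

lemma subsumed_by_mem: "subsumed_by b b' \<Longrightarrow> Some t \<in> set (snd b) \<Longrightarrow> Some t \<in> set (snd b')"
  unfolding subsumed_by_def list_all2_conv_all_nth in_set_conv_nth by (metis option.distinct(1))

lemma subsumed_by_trans: "subsumed_by b b' \<Longrightarrow> subsumed_by b' b'' \<Longrightarrow> subsumed_by b b''"
  unfolding subsumed_by_def list_all2_conv_all_nth by metis

lemma subsumed_by_refl: "subsumed_by b b"
  by (simp add: subsumed_by_def list_all2_refl)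

lemma subsumed_by_count:
  assumes "subsumed_by b b'" "b \<noteq> b'"
  shows "length (filter (\<lambda>u. u \<noteq> None) (snd b)) < length (filter (\<lambda>u. u \<noteq> None) (snd b'))"
proof -
  have "length (filter (\<lambda>u. u \<noteq> None) us) \<le> length (filter (\<lambda>u. u \<noteq> None) vs) \<and>
      (us \<noteq> vs \<longrightarrow> length (filter (\<lambda>u. u \<noteq> None) us) < length (filter (\<lambda>u. u \<noteq> None) vs))"
    if "list_all2 (\<lambda>u u'. u = u' \<or> u = None) us vs" for us vs :: "'d option list"
    using that by (induction rule: list_all2_induct) auto
  with assms show ?thesis by (cases b, cases b') (auto simp: subsumed_by_def)
qed

text \<open>Among the atoms of \<open>B\<close> that subsume \<open>b\<close>, one with the most
  non-blank arguments is subsumed by no other atom, since proper subsumption increases their number.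
  The argument \<open>t\<close> ensures that it is not removed for being all blank.\<close>

lemma prune_subsumer:
  assumes "finite B" "b \<in> B" "Some t \<in> set (snd b)"
  shows "\<exists>b'\<in>prune B. subsumed_by b b'"
proof -
  let ?n = "\<lambda>b :: ('a, 'b) batom. length (filter (\<lambda>u. u \<noteq> None) (snd b))"
  let ?S = "{b' \<in> B. subsumed_by b b'}"
  have "b \<in> ?S" using assms subsumed_by_refl by blast
  then have S: "finite ?S" "?S \<noteq> {}" using assms(1) by (simp, blast)
  have "Max (?n ` ?S) \<in> ?n ` ?S" using S by (intro Max_in) auto
  then obtain b' where b': "b' \<in> ?S" "Max (?n ` ?S) = ?n b'" by blast
  have max: "?n b'' \<le> ?n b'" if "b'' \<in> ?S" for b''
    using that S by (subst b'(2)[symmetric], intro Max_ge) auto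
  have "Some t \<in> set (snd b')" using b' assms(3) subsumed_by_mem by blast
  moreover have "\<not> subsumed_by b' b''" if "b'' \<in> B" "b'' \<noteq> b'" for b''
    using that b'(1) max[of b''] subsumed_by_count[of b' b''] subsumed_by_trans[of b b' b''] by auto
  ultimately have "b' \<in> prune B" using b'(1) by (auto simp: prune_def)
  with b'(1) show ?thesis by blast
qed

lemma mem_blank: "Some t \<in> set (snd (blank H b)) \<longleftrightarrow> Some t \<in> set (snd b) \<and> t \<in> H"
proof
  assume "Some t \<in> set (snd (blank H b))"
  then obtain u where u: "u \<in> set (snd b)"
      "Some t = (case u of None \<Rightarrow> None | Some t \<Rightarrow> if t \<in> H then Some t else None)"
    by (auto simp: blank_def)
  from u(2) have "u = Some t \<and> t \<in> H" by (auto split: option.splits if_splits)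
  with u(1) show "Some t \<in> set (snd b) \<and> t \<in> H" by simp
next
  assume "Some t \<in> set (snd b) \<and> t \<in> H"
  then show "Some t \<in> set (snd (blank H b))"
    by (auto simp: blank_def intro!: image_eqI[of _ _ "Some t"])
qed

text \<open>Blanking spares the head variables, and an atom that is pruned leaves behind one that
  contains all of its terms, so no head variable becomes uncovered.\<close>

lemma good_gout:
  assumes "fst h \<in> idb P" "length (snd h) = ar (fst h)" "finite B"
    and "\<And>c. Const c \<in> set (snd h) \<Longrightarrow> c \<in> consts_of P"
    and "\<And>b. b \<in> B \<Longrightarrow> fst b \<in> edb P \<and> length (snd b) = ar (fst b)"
    and "\<And>x. x \<in> atom_vars h \<Longrightarrow> \<exists>b\<in>B. x \<in> batom_vars b"
  shows "good ar P (gout h B)"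
  unfolding good_def
proof (intro conjI ballI allI impI subsetI)
  let ?B = "blank (set (snd h)) ` B"
  show "finite (abody (gout h B))" using assms(3) by (auto simp: gout_def prune_def)
  fix b assume b: "b \<in> abody (gout h B)"
  then have "b \<in> ?B" by (auto simp: gout_def prune_def)
  then obtain b0 where b0: "b0 \<in> B" "b = blank (set (snd h)) b0" by blast
  then show "fst b \<in> edb P" "length (snd b) = ar (fst b)"
    using assms(5)[of b0] by (auto simp: blank_def)
  fix t assume "Some t \<in> set (snd b)"
  then show "t \<in> set (snd (ahead (gout h B)))" using b0 by (simp add: mem_blank gout_def)
next
  fix x assume "x \<in> atom_vars (ahead (gout h B))"
  then have x: "x \<in> atom_vars h" by (simp add: gout_def)
  with assms(6) obtain b where "b \<in> B" "x \<in> batom_vars b" by blast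
  then have b: "b \<in> B" "Some (Var x) \<in> set (snd (blank (set (snd h)) b))"
    using x by (auto simp: mem_blank mem_batom_vars mem_atom_vars)
  then obtain b' where b': "b' \<in> prune (blank (set (snd h)) ` B)" "subsumed_by (blank (set (snd h)) b) b'"
    using prune_subsumer[of "blank (set (snd h)) ` B" "blank (set (snd h)) b" "Var x"] assms(3) by blast
  from subsumed_by_mem[OF b'(2) b(2)] b'(1) show "x \<in> (\<Union>b\<in>abody (gout h B). batom_vars b)"
    by (auto simp: gout_def mem_batom_vars)
qed (use assms in \<open>auto simp: gout_def\<close>)

lemma ahead_rename: "ahead (rename_adornment \<pi> \<rho>) = subst_atom (Var \<circ> \<pi>) (ahead \<rho>)"
  by (simp add: rename_adornment_def)

lemma abody_rename: "abody (rename_adornment \<pi> \<rho>) = subst_batom (Var \<circ> \<pi>) ` abody \<rho>"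
  by (simp add: rename_adornment_def)

lemma mem_subst_batom:
  "Some t \<in> set (snd (subst_batom \<sigma> b)) \<longleftrightarrow> (\<exists>u. Some u \<in> set (snd b) \<and> subst \<sigma> u = t)"
proof
  assume "Some t \<in> set (snd (subst_batom \<sigma> b))"
  then obtain w where w: "w \<in> set (snd b)" "Some t = map_option (subst \<sigma>) w"
    by (auto simp: subst_batom_def)
  from w(2) obtain u where "w = Some u" "subst \<sigma> u = t" by (cases w) auto
  with w(1) show "\<exists>u. Some u \<in> set (snd b) \<and> subst \<sigma> u = t" by blast
next
  assume "\<exists>u. Some u \<in> set (snd b) \<and> subst \<sigma> u = t"
  then obtain u where "Some u \<in> set (snd b)" "subst \<sigma> u = t" by blast
  then have "map_option (subst \<sigma>) (Some u) \<in> map_option (subst \<sigma>) ` set (snd b)" by blast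
  then show "Some t \<in> set (snd (subst_batom \<sigma> b))"
    using \<open>subst \<sigma> u = t\<close> by (simp add: subst_batom_def)
qed

lemma subst_eq_Var: "subst \<sigma> t = Var x \<longleftrightarrow> (\<exists>z. t = Var z \<and> \<sigma> z = Var x)"
  by (cases t) auto

lemma mem_subst_atom: "t \<in> set (snd (subst_atom \<sigma> a)) \<longleftrightarrow> (\<exists>u\<in>set (snd a). subst \<sigma> u = t)"
  by (auto simp: subst_atom_def)

lemma fst_subst[simp]: "fst (subst_atom \<sigma> a) = fst a" "fst (subst_batom \<sigma> b) = fst b"
    "fst (batom_of a) = fst a" "fst (blank H b) = fst b"
  by (simp_all add: subst_atom_def subst_batom_def batom_of_def blank_def)

lemma length_subst[simp]: "length (snd (subst_atom \<sigma> a)) = length (snd a)"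
    "length (snd (subst_batom \<sigma> b)) = length (snd b)"
    "length (snd (batom_of a)) = length (snd a)" "length (snd (blank H b)) = length (snd b)"
  by (simp_all add: subst_atom_def subst_batom_def batom_of_def blank_def)

lemma good_rename:
  assumes "good ar P \<rho>"
  shows "good ar P (rename_adornment \<pi> \<rho>)"
  unfolding good_def ahead_rename abody_rename
proof (intro conjI ballI allI impI subsetI)
  fix c assume "Const c \<in> set (snd (subst_atom (Var \<circ> \<pi>) (ahead \<rho>)))"
  then obtain u where u: "u \<in> set (snd (ahead \<rho>))" "subst (Var \<circ> \<pi>) u = Const c"
    by (auto simp: mem_subst_atom)
  from u(2) have "u = Const c" by (cases u) auto
  with u(1) show "c \<in> consts_of P" using goodD(3)[OF assms] by simp
next
  fix b assume "b \<in> subst_batom (Var \<circ> \<pi>) ` abody \<rho>"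
  then obtain b0 where b0: "b0 \<in> abody \<rho>" "b = subst_batom (Var \<circ> \<pi>) b0" by blast
  then show "fst b \<in> edb P" "length (snd b) = ar (fst b)"
    using goodD(5,6)[OF assms] by (auto simp: subst_batom_def)
  fix t assume "Some t \<in> set (snd b)"
  then show "t \<in> set (snd (subst_atom (Var \<circ> \<pi>) (ahead \<rho>)))"
    using b0 goodD(7)[OF assms b0(1)] by (auto simp: mem_subst_batom mem_subst_atom)
next
  fix x assume "x \<in> atom_vars (subst_atom (Var \<circ> \<pi>) (ahead \<rho>))"
  then obtain y where "x = \<pi> y" "y \<in> atom_vars (ahead \<rho>)" by (auto simp: atom_vars_rename)
  then show "x \<in> \<Union> (batom_vars ` subst_batom (Var \<circ> \<pi>) ` abody \<rho>)"
    using goodD(8)[OF assms, of y] by (auto simp: batom_vars_rename)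
qed (use goodD[OF assms] in auto)

lemma edb_atom_edb: "R \<in> P \<Longrightarrow> a \<in> set (edb_atoms P R) \<Longrightarrow> fst a \<in> edb P"
  by (auto simp: edb_atoms_def edb_def atoms_of_def)

lemma datalog_programD:
  assumes "datalog_program ar P" "R \<in> P"
  shows "length (snd (rhead R)) = ar (fst (rhead R))"
    "\<And>a. a \<in> set (rbody R) \<Longrightarrow> length (snd a) = ar (fst a)"
    "\<And>x. x \<in> atom_vars (rhead R) \<Longrightarrow> \<exists>a\<in>set (rbody R). x \<in> atom_vars a"
  using assms by (simp_all add: datalog_program_def atoms_of_def) blast

lemma set_idb_edb_atoms: "set (rbody R) = set (idb_atoms P R) \<union> set (edb_atoms P R)"
  by (auto simp: idb_atoms_def edb_atoms_def)

text \<open>The second conjunct says that the argument list of an adorned head repeats the head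
  arguments of its adornment, so the terms that are unified are covered by the adornment's
  body.\<close>

lemma good_adorned:
  assumes P: "datalog_program ar P" and "Adorned_Rule h B E \<in> adorned_program P"
  shows "good ar P (fst h) \<and> snd h = snd (ahead (fst h))"
  using assms(2)
proof (induction "Adorned_Rule h B E" arbitrary: h B E)
  case (adorn R hs hs' \<sigma> \<rho>)
  have hs: "good ar P (fst h) \<and> snd h = snd (ahead (fst h))" if "h \<in> set hs" for h
    using adorn(3) that by blast
  have hs': "good ar P (fst h) \<and> snd h = snd (ahead (fst h))" if "h \<in> set hs'" for h
  proof -
    obtain i where i: "i < length hs'" "h = hs' ! i" using \<open>h \<in> set hs'\<close> by (auto simp: in_set_conv_nth)
    then obtain \<pi> where "h = rename_aatom \<pi> (hs ! i)" "hs ! i \<in> set hs"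
      using adorn(5) by (auto simp: list_all2_conv_all_nth)
    then show ?thesis using hs[of "hs ! i"]
      by (simp add: rename_aatom_def good_rename ahead_rename subst_atom_def)
  qed
  have len: "length hs' = length (idb_atoms P R)"
    using arg_cong[OF adorn(4), of length] list_all2_lengthD[OF adorn(5)] by simp
  have unif: "map (subst \<sigma>) (snd (idb_atoms P R ! i)) = map (subst \<sigma>) (snd (hs' ! i))"
    if "i < length hs'" for i
  proof -
    have "(snd (idb_atoms P R ! i), snd (hs' ! i)) \<in> set (zip (map snd (idb_atoms P R)) (map snd hs'))"
      using that len by (auto simp: set_zip intro!: exI[of _ i])
    then show ?thesis using adorn(7) by (auto simp: is_mgu_def unifier_def)
  qed
  let ?B = "(\<Union>h'\<in>set hs'. subst_batom \<sigma> ` abody (fst h')) \<union>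
              (\<lambda>a. batom_of (subst_atom \<sigma> a)) ` set (edb_atoms P R)"
  have "good ar P (gout (subst_atom \<sigma> (rhead R)) ?B)"
  proof (rule good_gout)
    show "fst (subst_atom \<sigma> (rhead R)) \<in> idb P" using adorn(2) by simp
    show "length (snd (subst_atom \<sigma> (rhead R))) = ar (fst (subst_atom \<sigma> (rhead R)))"
      using datalog_programD(1)[OF P adorn(1)] by simp
    show "finite ?B" using hs' by (fastforce simp: good_def)
  next
    fix c assume "Const c \<in> set (snd (subst_atom \<sigma> (rhead R)))"
    then obtain u where u: "u \<in> set (snd (rhead R))" "subst \<sigma> u = Const c" by (auto simp: mem_subst_atom)
    show "c \<in> consts_of P"
    proof (cases u)
      case (Const d)
      then show ?thesis using u adorn(1) by (auto simp: consts_of_def atoms_of_def)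
    next
      case (Var z)
      \<comment> \<open>A constant introduced by the unifier stems from an equation, hence from the
        rule or from the head of an adornment, where the induction hypothesis applies.\<close>
      then have "c \<in> eqs_consts (zip (map snd (idb_atoms P R)) (map snd hs'))"
        using u is_mgu_consts[OF adorn(7)] by auto
      then obtain s v where sv: "(s, v) \<in> set (zip (map snd (idb_atoms P R)) (map snd hs'))"
          "Const c \<in> set s \<union> set v" by (auto simp: eqs_consts_def)
      then obtain i where i: "i < length hs'" "s = snd (idb_atoms P R ! i)" "v = snd (hs' ! i)"
        by (auto simp: set_zip)
      have mem: "idb_atoms P R ! i \<in> set (rbody R)" "hs' ! i \<in> set hs'"
        using i(1) len nth_mem[of i "idb_atoms P R"] by (auto simp: idb_atoms_def)
      show ?thesis
      proof (cases "Const c \<in> set s")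
        case True
        then show ?thesis using mem(1) i adorn(1) by (auto simp: consts_of_def atoms_of_def)
      next
        case False
        then show ?thesis using sv(2) i hs'[OF mem(2)] goodD(3)[of ar P "fst (hs' ! i)" c] by auto
      qed
    qed
  next
    fix b assume "b \<in> ?B"
    then consider h' b' where "h' \<in> set hs'" "b' \<in> abody (fst h')" "b = subst_batom \<sigma> b'"
      | a where "a \<in> set (edb_atoms P R)" "b = batom_of (subst_atom \<sigma> a)" by blast
    then show "fst b \<in> edb P \<and> length (snd b) = ar (fst b)"
    proof cases
      case 1
      then show ?thesis using hs'[of h'] goodD(5,6)[of ar P "fst h'" b'] by auto
    next
      case 2
      then have "a \<in> set (rbody R)" by (simp add: edb_atoms_def)
      then show ?thesis
        using 2 datalog_programD(2)[OF P adorn(1)] edb_atom_edb[OF adorn(1)] by auto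
    qed
  next
    fix x assume "x \<in> atom_vars (subst_atom \<sigma> (rhead R))"
    then obtain z where z: "z \<in> atom_vars (rhead R)" "\<sigma> z = Var x"
      by (auto simp: mem_atom_vars mem_subst_atom subst_eq_Var)
    \<comment> \<open>Safety puts the variable into a body atom. If that is an IDB atom, unification
      carries the variable to the head of the chosen adornment, whose body covers it.\<close>
    then obtain a where a: "a \<in> set (rbody R)" "z \<in> atom_vars a"
      using datalog_programD(3)[OF P adorn(1)] by blast
    have x: "Var x \<in> set (map (subst \<sigma>) (snd a))"
      using a(2) z(2) by (force simp: mem_atom_vars)
    show "\<exists>b\<in>?B. x \<in> batom_vars b"
    proof (cases "a \<in> set (edb_atoms P R)")
      case True
      have "x \<in> batom_vars (batom_of (subst_atom \<sigma> a))"
        using x by (simp add: batom_vars_batom_of mem_atom_vars subst_atom_def)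
      with True show ?thesis by blast
    next
      case False
      then have "a \<in> set (idb_atoms P R)" using a(1) set_idb_edb_atoms[of R P] by blast
      then obtain i where i: "i < length hs'" "a = idb_atoms P R ! i"
        using len by (auto simp: in_set_conv_nth)
      then have "Var x \<in> set (map (subst \<sigma>) (snd (hs' ! i)))" using x unif[OF i(1)] by (simp only: i(2))
      then obtain w where w: "Var w \<in> set (snd (hs' ! i))" "\<sigma> w = Var x"
        by (auto simp: subst_eq_Var eq_commute[of "Var x"])
      have mem: "hs' ! i \<in> set hs'" using i by simp
      then have "w \<in> atom_vars (ahead (fst (hs' ! i)))" using w(1) hs'[OF mem] by (simp add: mem_atom_vars)
      then obtain b where b: "b \<in> abody (fst (hs' ! i))" "w \<in> batom_vars b"
        using goodD(8)[of ar P "fst (hs' ! i)" w] hs'[OF mem] by blast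
      then have "x \<in> batom_vars (subst_batom \<sigma> b)"
        using w(2) by (auto simp: mem_batom_vars mem_subst_batom subst_eq_Var)
      with b(1) mem show ?thesis by blast
    qed
  qed
  then show ?case using adorn(8) by (simp add: gout_def subst_atom_def)
qed

lemma good_adornments:
  assumes "datalog_program ar P" "\<rho> \<in> adornments P"
  shows "good ar P \<rho>"
  using assms good_adorned[OF assms(1)] by (fastforce simp: adornments_def)

lemma finite_idb: "finite P \<Longrightarrow> finite (idb P)"
proof -
  assume "finite P"
  moreover have "idb P \<subseteq> (\<lambda>r. fst (rhead r)) ` P" by (auto simp: idb_def)
  ultimately show ?thesis using finite_surj by blast
qed

lemma finite_edb: "finite P \<Longrightarrow> finite (edb P)"
  by (simp add: edb_def)

lemma finite_consts_of:
  assumes "finite P"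
  shows "finite (consts_of P)"
proof -
  have "Const ` consts_of P \<subseteq> (\<Union>r\<in>P. \<Union>a\<in>set (atoms_of r). set (snd a))"
    by (auto simp: consts_of_def)
  then have "finite (Const ` consts_of P :: 'b trm set)"
    using assms by (elim finite_subset) auto
  then show ?thesis by (rule finite_imageD) (auto simp: inj_on_def)
qed

text \<open>Normalising the head determines the variables of the body as well, since all non-blank
  body terms of a good adornment occur in the head.\<close>

definition normal_adornments :: "('p \<Rightarrow> nat) \<Rightarrow> ('p, 'c) program \<Rightarrow> ('p, 'c) adornment set" where
  "normal_adornments ar P =
     {\<rho>. good ar P \<rho> \<and> atom_vars (ahead \<rho>) \<subseteq> {..<length (snd (ahead \<rho>))}}"

lemma card_atom_vars: "card (atom_vars a) \<le> length (snd a)"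
proof -
  have "Var ` atom_vars a \<subseteq> set (snd a)" by (auto simp: mem_atom_vars)
  then have "card (Var ` atom_vars a :: 'b trm set) \<le> card (set (snd a))" by (intro card_mono) auto
  then show ?thesis using card_length[of "snd a"] by (simp add: card_image inj_on_def)
qed

lemma normal_variant:
  assumes "good ar P \<rho>"
  shows "\<exists>\<rho>'\<in>normal_adornments ar P. (\<rho>, \<rho>') \<in> variants"
proof -
  obtain \<pi> where \<pi>: "bij \<pi>" "\<pi> ` atom_vars (ahead \<rho>) = {..<card (atom_vars (ahead \<rho>))}"
    using bij_into_initial_segment[OF finite_atom_vars] by blast
  then have "rename_adornment \<pi> \<rho> \<in> normal_adornments ar P"
    using good_rename[OF assms, of \<pi>] card_atom_vars[of "ahead \<rho>"]
    by (auto simp: normal_adornments_def ahead_rename atom_vars_rename)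
  with \<pi>(1) show ?thesis by (auto simp: variants_def)
qed

text \<open>Heads range over lists of bounded length over a finite set of terms, and bodies over the
  subsets of a finite set of atoms.\<close>

lemma finite_normal_adornments:
  assumes "finite P"
  shows "finite (normal_adornments ar P)"
proof -
  define M where "M = (\<Sum>p\<in>idb P \<union> edb P. ar p)"
  have M: "ar p \<le> M" if "p \<in> idb P \<union> edb P" for p
    unfolding M_def using that assms by (intro member_le_sum) (auto simp: finite_idb finite_edb)
  define X where "X = (Var ` {..<M} \<union> Const ` consts_of P :: 'b trm set)"
  define L where "L = {ts. set ts \<subseteq> X \<and> length ts \<le> M}"
  define L' where "L' = {us. set us \<subseteq> insert None (Some ` X) \<and> length us \<le> M}"
  have X: "finite X" using assms by (simp add: X_def finite_consts_of)
  then have fin: "finite L" "finite L'"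
    unfolding L_def L'_def by (intro finite_lists_length_le; simp)+
  have "normal_adornments ar P \<subseteq>
      (\<lambda>(h, B). Adornment h B) ` ((idb P \<times> L) \<times> Pow (edb P \<times> L'))"
  proof
    fix \<rho> assume \<rho>: "\<rho> \<in> normal_adornments ar P"
    then have g: "good ar P \<rho>" and v: "atom_vars (ahead \<rho>) \<subseteq> {..<length (snd (ahead \<rho>))}"
      by (auto simp: normal_adornments_def)
    have len: "length (snd (ahead \<rho>)) \<le> M" using goodD(1,2)[OF g] M by auto
    have h: "set (snd (ahead \<rho>)) \<subseteq> X"
    proof
      fix t assume t: "t \<in> set (snd (ahead \<rho>))"
      show "t \<in> X"
      proof (cases t)
        case (Var x)
        then have "x < M" using t v len by (force simp: mem_atom_vars subset_iff)
        then show ?thesis using Var by (simp add: X_def)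
      qed (use t goodD(3)[OF g] in \<open>auto simp: X_def\<close>)
    qed
    have "abody \<rho> \<subseteq> edb P \<times> L'"
    proof
      fix b assume b: "b \<in> abody \<rho>"
      have "u \<in> insert None (Some ` X)" if "u \<in> set (snd b)" for u
      proof (cases u)
        case (Some t)
        then show ?thesis using that goodD(7)[OF g b, of t] h by auto
      qed simp
      then show "b \<in> edb P \<times> L'"
        using goodD(5,6)[OF g b] M by (cases b) (auto simp: L'_def)
    qed
    moreover have "ahead \<rho> \<in> idb P \<times> L" using h len goodD(1)[OF g] by (cases "ahead \<rho>") (auto simp: L_def)
    ultimately show "\<rho> \<in> (\<lambda>(h, B). Adornment h B) ` ((idb P \<times> L) \<times> Pow (edb P \<times> L'))"
      by (intro image_eqI[of _ _ "(ahead \<rho>, abody \<rho>)"]) auto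
  qed
  then show ?thesis
    by (rule finite_subset) (use fin assms in \<open>simp add: finite_idb finite_edb\<close>)
qed

lemma finite_adornment_classes:
  assumes "datalog_program ar P" "A \<subseteq> adornments P"
  shows "finite (A // variants)"
proof -
  have "A // variants \<subseteq> (\<lambda>\<rho>. variants `` {\<rho>}) ` normal_adornments ar P"
  proof
    fix X assume "X \<in> A // variants"
    then obtain \<rho> where \<rho>: "\<rho> \<in> A" "X = variants `` {\<rho>}" by (auto elim: quotientE)
    then obtain \<rho>' where "\<rho>' \<in> normal_adornments ar P" "(\<rho>, \<rho>') \<in> variants"
      using assms good_adornments normal_variant by (metis subsetD)
    with \<rho> show "X \<in> (\<lambda>\<rho>. variants `` {\<rho>}) ` normal_adornments ar P"
      using equiv_class_eq[OF equiv_variants] by blast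
  qed
  moreover have "finite P" using assms by (simp add: datalog_program_def)
  ultimately show ?thesis by (meson finite_imageI finite_normal_adornments finite_subset)
qed

text \<open>Renaming by a permutation is injective on body atoms, so a cover can be transported
  without changing its total weight. The reverse inclusion arises from the inverse
  permutation.\<close>

lemma ew_sums_rename:
  assumes "bij \<pi>"
  shows "{(\<Sum>b\<in>abody \<rho>. x b) | x. fractional_edge_cover \<rho> x} \<subseteq>
    {(\<Sum>b\<in>abody (rename_adornment \<pi> \<rho>). x b) | x. fractional_edge_cover (rename_adornment \<pi> \<rho>) x}"
proof clarify
  fix x assume x: "fractional_edge_cover \<rho> x"
  let ?f = "subst_batom (Var \<circ> \<pi>) :: ('a, 'b) batom \<Rightarrow> ('a, 'b) batom"
  let ?g = "subst_batom (Var \<circ> inv \<pi>) :: ('a, 'b) batom \<Rightarrow> ('a, 'b) batom"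
  have gf: "?g (?f b) = b" for b
  proof -
    have "inv \<pi> \<circ> \<pi> = id" using assms by (simp add: bij_is_inj)
    then have "?g (?f b) = subst_batom (Var \<circ> id) b" unfolding subst_batom_comp by simp
    then show ?thesis by (simp add: subst_batom_def subst_Var option.map_id0)
  qed
  then have inj: "inj_on ?f A" for A by (metis inj_on_inverseI)
  have sums: "(\<Sum>b\<in>?f ` B. x (?g b)) = (\<Sum>b\<in>B. x b)" for B
    by (simp add: sum.reindex[OF inj] gf)
  have "fractional_edge_cover (rename_adornment \<pi> \<rho>) (\<lambda>b. x (?g b))"
    unfolding fractional_edge_cover_def ahead_rename abody_rename atom_vars_rename
  proof (intro conjI ballI)
    fix v assume "v \<in> \<pi> ` atom_vars (ahead \<rho>)"
    then obtain w where w: "w \<in> atom_vars (ahead \<rho>)" "v = \<pi> w" by blast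
    have "v \<in> batom_vars (?f b) \<longleftrightarrow> w \<in> batom_vars b" for b
      using assms w(2) by (auto simp: batom_vars_rename bij_def inj_def)
    then have "{b \<in> ?f ` abody \<rho>. v \<in> batom_vars b} = ?f ` {b \<in> abody \<rho>. w \<in> batom_vars b}" by auto
    then show "1 \<le> (\<Sum>b | b \<in> ?f ` abody \<rho> \<and> v \<in> batom_vars b. x (?g b))"
      using x w(1) by (simp add: sums fractional_edge_cover_def)
  qed (use x in \<open>auto simp: gf fractional_edge_cover_def\<close>)
  moreover have "(\<Sum>b\<in>abody \<rho>. x b) = (\<Sum>b\<in>abody (rename_adornment \<pi> \<rho>). x (?g b))"
    by (simp add: abody_rename sums)
  ultimately show "\<exists>y. (\<Sum>b\<in>abody \<rho>. x b) = (\<Sum>b\<in>abody (rename_adornment \<pi> \<rho>). y b) \<and>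
      fractional_edge_cover (rename_adornment \<pi> \<rho>) y" by blast
qed

lemma ew_rename:
  assumes "bij \<pi>"
  shows "ew (rename_adornment \<pi> \<rho>) = ew \<rho>"
proof -
  have "rename_adornment (inv \<pi>) (rename_adornment \<pi> \<rho>) = \<rho>"
    using assms by (simp add: rename_adornment_comp bij_is_inj rename_adornment_id)
  then show ?thesis
    using ew_sums_rename[OF assms, of \<rho>] ew_sums_rename[OF bij_imp_bij_inv[OF assms], of "rename_adornment \<pi> \<rho>"]
    unfolding ew_def by (intro arg_cong[of _ _ Inf]) auto
qed

text \<open>The set of adornments can be infinite because all renamings are collected; the set of
  their widths is finite, which gives the maximum in \<open>ew_program\<close> its meaning.\<close>

lemma finite_ew:
  assumes "datalog_program ar P"
  shows "finite (ew ` adornments P)"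
proof -
  have "ew ` adornments P \<subseteq> ew ` normal_adornments ar P"
  proof clarify
    fix \<rho> assume "\<rho> \<in> adornments P"
    then obtain \<rho>' \<pi> where "\<rho>' \<in> normal_adornments ar P" "bij \<pi>" "\<rho>' = rename_adornment \<pi> \<rho>"
      using assms good_adornments normal_variant by (fastforce simp: variants_def)
    then show "ew \<rho> \<in> ew ` normal_adornments ar P" using ew_rename by (metis image_eqI)
  qed
  moreover have "finite P" using assms by (simp add: datalog_program_def)
  ultimately show ?thesis by (meson finite_imageI finite_normal_adornments finite_subset)
qed

lemma ew_le_ew_program:
  assumes "datalog_program ar P" "\<rho> \<in> adornments P"
  shows "ew \<rho> \<le> ew_program P"
  unfolding ew_program_def using assms finite_ew[OF assms(1)] by (intro Max_ge) auto

lemma ew_program_nonneg: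
  assumes "datalog_program ar P"
  shows "0 \<le> ew_program P"
  unfolding ew_program_def using finite_ew[OF assms] by (intro Max_ge) auto

lemma card_classes_le:
  assumes "datalog_program ar P" "q \<in> idb P"
  shows "card ({\<rho> \<in> adornments P. fst (ahead \<rho>) = q} // variants) \<le> num_adornments P"
  unfolding num_adornments_def
  using assms finite_idb[of P] by (intro Max_ge) (auto simp: datalog_program_def)

section \<open>Every ground derivation is captured by an adornment\<close>

section \<open>Completeness of the adorned program\<close>

definition sat :: "('p \<Rightarrow> 'c list set) \<Rightarrow> (nat \<Rightarrow> 'c) \<Rightarrow> ('p, 'c) batom \<Rightarrow> bool" where
  "sat E \<mu> b \<longleftrightarrow> (\<exists>t\<in>E (fst b).
     list_all2 (\<lambda>u c. case u of None \<Rightarrow> True | Some s \<Rightarrow> trm_val \<mu> s = c) (snd b) t)"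

lemma trm_val_subst: "trm_val \<mu> (subst \<sigma> t) = trm_val (\<lambda>x. trm_val \<mu> (\<sigma> x)) t"
  by (cases t) auto

lemma trm_val_cong: "(\<And>x. x \<in> trm_vars t \<Longrightarrow> \<mu> x = \<mu>' x) \<Longrightarrow> trm_val \<mu> t = trm_val \<mu>' t"
  by (cases t) auto

lemma map_trm_val_cong:
  "(\<And>x. x \<in> args_vars ts \<Longrightarrow> \<mu> x = \<mu>' x) \<Longrightarrow> map (trm_val \<mu>) ts = map (trm_val \<mu>') ts"
  by (auto simp: args_vars_def intro!: trm_val_cong)

lemma sat_subst: "sat E \<mu> (subst_batom \<sigma> b) \<longleftrightarrow> sat E (\<lambda>x. trm_val \<mu> (\<sigma> x)) b"
proof -
  have "(case map_option (subst \<sigma>) u of None \<Rightarrow> True | Some s \<Rightarrow> trm_val \<mu> s = c) \<longleftrightarrow>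
      (case u of None \<Rightarrow> True | Some s \<Rightarrow> trm_val (\<lambda>x. trm_val \<mu> (\<sigma> x)) s = c)" for u c
    by (cases u) (auto simp: trm_val_subst)
  then show ?thesis by (simp add: sat_def subst_batom_def list_all2_map1)
qed

lemma sat_rename: "sat E \<mu> (subst_batom (Var \<circ> \<pi>) b) \<longleftrightarrow> sat E (\<lambda>x. \<mu> (\<pi> x)) b"
  by (simp add: sat_subst)

lemma sat_cong:
  assumes "\<And>x. x \<in> batom_vars b \<Longrightarrow> \<mu> x = \<mu>' x"
  shows "sat E \<mu> b \<longleftrightarrow> sat E \<mu>' b"
proof -
  have eq: "(case u of None \<Rightarrow> True | Some s \<Rightarrow> trm_val \<mu> s = c) \<longleftrightarrow>
      (case u of None \<Rightarrow> True | Some s \<Rightarrow> trm_val \<mu>' s = c)" if "u \<in> set (snd b)" for u c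
  proof (cases u)
    case (Some t)
    have "trm_val \<mu> t = trm_val \<mu>' t"
      using that Some assms by (intro trm_val_cong) (auto simp: batom_vars_def)
    then show ?thesis using Some by simp
  qed simp
  have "list_all2 (\<lambda>u c. case u of None \<Rightarrow> True | Some s \<Rightarrow> trm_val \<mu> s = c) (snd b) t \<longleftrightarrow>
    list_all2 (\<lambda>u c. case u of None \<Rightarrow> True | Some s \<Rightarrow> trm_val \<mu>' s = c) (snd b) t" for t
    using eq by (intro list.rel_cong_simp refl) (simp add: simp_implies_def)
  then show ?thesis by (simp add: sat_def)
qed

lemma sat_blank:
  assumes "sat E \<mu> b"
  shows "sat E \<mu> (blank H b)"
proof -
  have "list_all2 (\<lambda>u c. case u of None \<Rightarrow> True | Some s \<Rightarrow> trm_val \<mu> s = c) (snd (blank H b)) t"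
    if "list_all2 (\<lambda>u c. case u of None \<Rightarrow> True | Some s \<Rightarrow> trm_val \<mu> s = c) (snd b) t" for t
    using that unfolding blank_def snd_conv list_all2_map1
    by (rule list_all2_mono) (auto split: option.splits)
  with assms show ?thesis by (auto simp: sat_def)
qed

lemma sat_batom_of: "sat E \<mu> (batom_of a) \<longleftrightarrow> map (trm_val \<mu>) (snd a) \<in> E (fst a)"
proof -
  have "list_all2 (\<lambda>s c. trm_val \<mu> s = c) ts t \<longleftrightarrow> map (trm_val \<mu>) ts = t" for ts t
    by (auto simp: list_all2_conv_all_nth list_eq_iff_nth_eq)
  then show ?thesis by (auto simp: sat_def batom_of_def list_all2_map1)
qed

lemma aatom_vars_rename: "aatom_vars (rename_aatom \<pi> h) = \<pi> ` aatom_vars h"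
  by (auto simp: aatom_vars_def rename_aatom_def ahead_rename abody_rename args_vars_rename
      atom_vars_rename batom_vars_rename)

text \<open>The head atoms are renamed one after the other, with the set \<open>A\<close> of
  forbidden variables growing each time. Disjointness then allows the separate valuations of the
  adornments and of the rule to be merged into a single \<open>\<nu>'\<close>.\<close>

lemma rename_apart:
  assumes "finite A" "\<forall>hm\<in>set hms. finite (aatom_vars (fst hm))"
  shows "\<exists>hs' \<nu>'. list_all2 (\<lambda>(h, \<mu>) h'. \<exists>\<pi>. bij \<pi> \<and> h' = rename_aatom \<pi> h \<and>
        (\<forall>x\<in>aatom_vars h. \<nu>' (\<pi> x) = \<mu> x)) hms hs' \<and> (\<forall>x\<in>A. \<nu>' x = \<nu> x) \<and>
      (\<forall>i<length hs'. aatom_vars (hs' ! i) \<inter> A = {} \<and>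
        (\<forall>j<i. aatom_vars (hs' ! i) \<inter> aatom_vars (hs' ! j) = {}))"
  using assms
proof (induction hms arbitrary: A \<nu>)
  case Nil
  then show ?case by (intro exI[of _ "[]"] exI[of _ \<nu>]) simp
next
  case (Cons hm hms)
  obtain h \<mu> where hm: "hm = (h, \<mu>)" by (cases hm)
  have fin: "finite (aatom_vars h)" using Cons.prems(2) hm by simp
  obtain \<pi> where \<pi>: "bij \<pi>" "\<pi> ` aatom_vars h \<inter> A = {}"
    using bij_avoiding[OF fin Cons.prems(1)] by blast
  let ?h = "rename_aatom \<pi> h"
  define \<nu>1 where "\<nu>1 x = (if x \<in> aatom_vars ?h then \<mu> (inv \<pi> x) else \<nu> x)" for x
  have "finite (A \<union> aatom_vars ?h)" using Cons.prems(1) fin by (simp add: aatom_vars_rename)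
  from Cons.IH[OF this, of \<nu>1] Cons.prems(2) obtain hs' \<nu>' where
    IH: "list_all2 (\<lambda>(h, \<mu>) h'. \<exists>\<pi>. bij \<pi> \<and> h' = rename_aatom \<pi> h \<and>
        (\<forall>x\<in>aatom_vars h. \<nu>' (\<pi> x) = \<mu> x)) hms hs'"
      "\<And>x. x \<in> A \<union> aatom_vars ?h \<Longrightarrow> \<nu>' x = \<nu>1 x"
      "\<And>i. i < length hs' \<Longrightarrow> aatom_vars (hs' ! i) \<inter> (A \<union> aatom_vars ?h) = {}"
      "\<And>i j. i < length hs' \<Longrightarrow> j < i \<Longrightarrow> aatom_vars (hs' ! i) \<inter> aatom_vars (hs' ! j) = {}"
    by fastforce
  have "\<nu>' (\<pi> x) = \<mu> x" if "x \<in> aatom_vars h" for x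
    using that IH(2)[of "\<pi> x"] \<pi>(1) by (simp add: \<nu>1_def aatom_vars_rename bij_is_inj)
  then have "list_all2 (\<lambda>(h, \<mu>) h'. \<exists>\<pi>. bij \<pi> \<and> h' = rename_aatom \<pi> h \<and>
        (\<forall>x\<in>aatom_vars h. \<nu>' (\<pi> x) = \<mu> x)) (hm # hms) (?h # hs')"
    using IH(1) hm \<pi>(1) by auto
  moreover have "\<forall>x\<in>A. \<nu>' x = \<nu> x"
    using IH(2) \<pi>(2) by (auto simp: \<nu>1_def aatom_vars_rename)
  moreover have "aatom_vars ((?h # hs') ! i) \<inter> A = {} \<and>
        (\<forall>j<i. aatom_vars ((?h # hs') ! i) \<inter> aatom_vars ((?h # hs') ! j) = {})"
    if "i < length (?h # hs')" for i
  proof (cases i)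
    case 0
    then show ?thesis using \<pi>(2) by (simp add: aatom_vars_rename)
  next
    case (Suc i')
    have "aatom_vars (hs' ! i') \<inter> aatom_vars ((?h # hs') ! j) = {}" if "j < i" for j
      using that IH(3)[of i'] IH(4)[of i' "j - 1"] \<open>i < _\<close> Suc by (cases j) auto
    then show ?thesis using IH(3)[of i'] that Suc by auto
  qed
  ultimately show ?case by blast
qed

text \<open>What the query needs to know about the derivation of \<open>\<rho>\<close> from
  \<open>R\<close>: each EDB atom with a variable outside the head leaves its blanked image in the
  body, and it owns a head variable that is fixed by the unifier and shared with no other EDB atom
  or atom of the adornment.\<close>

definition adorns :: "('p, 'c) program \<Rightarrow> ('p, 'c) dl_rule \<Rightarrow> 'c sbst \<Rightarrow> ('p, 'c) adornment \<Rightarrow> bool" where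
  "adorns P R \<sigma> \<rho> \<longleftrightarrow> \<rho> \<in> adornments P \<and> ahead \<rho> = subst_atom \<sigma> (rhead R) \<and>
     (\<forall>a\<in>set (edb_atoms P R). \<not> atom_vars a \<subseteq> atom_vars (rhead R) \<longrightarrow>
        blank (set (snd (ahead \<rho>))) (batom_of (subst_atom \<sigma> a)) \<in> abody \<rho> \<and>
        (\<exists>x\<in>atom_vars a \<inter> atom_vars (rhead R). \<sigma> x = Var x \<and>
           (\<forall>b\<in>abody \<rho>. x \<in> batom_vars b \<longrightarrow>
              b = blank (set (snd (ahead \<rho>))) (batom_of (subst_atom \<sigma> a))) \<and>
           (\<forall>a'\<in>set (edb_atoms P R). x \<in> atom_vars a' \<longrightarrow> a' = a) \<and>
           (\<forall>z. \<sigma> z = Var x \<longrightarrow> z = x)))"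

lemma ground_eq: "ground \<nu> a = ground \<mu> b \<longleftrightarrow>
    fst a = fst b \<and> map (trm_val \<nu>) (snd a) = map (trm_val \<mu>) (snd b)"
  by (simp add: ground_def)

text \<open>The IDB facts of the ground instance come with ground instances of their adornments.
  Together these form a ground unifier, so an mgu exists and the instance factors through it.
  Private variables never enter an equation and hence survive both unification and pruning.\<close>

lemma adorns_complete:
  fixes \<nu> :: "nat \<Rightarrow> 'c"
  assumes P: "datalog_program ar P" and grd: "adornment_groundable P"
    and R: "R \<in> P" "fst (rhead R) \<in> idb P"
    and edb: "\<And>a. a \<in> set (edb_atoms P R) \<Longrightarrow> map (trm_val \<nu>) (snd a) \<in> E (fst a)"
    and idb: "\<And>a. a \<in> set (idb_atoms P R) \<Longrightarrow>
      \<exists>\<rho>\<in>adornments P. \<exists>\<mu>. ground \<mu> (ahead \<rho>) = ground \<nu> a \<and> (\<forall>b\<in>abody \<rho>. sat E \<mu> b)"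
  shows "\<exists>\<sigma> \<rho> \<mu>. adorns P R \<sigma> \<rho> \<and> (\<forall>x\<in>rule_vars R. trm_val \<mu> (\<sigma> x) = \<nu> x) \<and>
    (\<forall>b\<in>abody \<rho>. sat E \<mu> b)"
proof -
  have "\<forall>a\<in>set (idb_atoms P R). \<exists>F. fst F \<in> adornments P \<and>
      ground (snd F) (ahead (fst F)) = ground \<nu> a \<and> (\<forall>b\<in>abody (fst F). sat E (snd F) b)"
    using idb by fastforce
  then obtain F where F: "\<forall>a\<in>set (idb_atoms P R). fst (F a) \<in> adornments P \<and>
      ground (snd (F a)) (ahead (fst (F a))) = ground \<nu> a \<and>
      (\<forall>b\<in>abody (fst (F a)). sat E (snd (F a)) b)"
    by (rule bchoice[THEN exE])
  define as where "as = idb_atoms P R"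
  define hms where "hms = map (\<lambda>a. ((fst (F a), snd (ahead (fst (F a)))), snd (F a))) as"
  have fin: "finite (aatom_vars h)" if "(h, \<mu>) \<in> set hms" for h \<mu>
  proof -
    have "h \<in> (\<lambda>a. (fst (F a), snd (ahead (fst (F a))))) ` set (idb_atoms P R)"
      using imageI[OF that, of fst] by (simp add: hms_def as_def image_image)
    then obtain a where a: "a \<in> set (idb_atoms P R)" "h = (fst (F a), snd (ahead (fst (F a))))"
      by blast
    then have "finite (abody (fst (F a)))" using F good_adornments[OF P] goodD(4) by blast
    then show ?thesis
      using a by (simp add: aatom_vars_def finite_args_vars finite_atom_vars finite_batom_vars)
  qed
  obtain hs' \<nu>' where
    ren: "list_all2 (\<lambda>(h, \<mu>) h'. \<exists>\<pi>. bij \<pi> \<and> h' = rename_aatom \<pi> h \<and>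
        (\<forall>x\<in>aatom_vars h. \<nu>' (\<pi> x) = \<mu> x)) hms hs'"
    and \<nu>': "\<forall>x\<in>rule_vars R. \<nu>' x = \<nu> x"
    and apart: "\<forall>i<length hs'. aatom_vars (hs' ! i) \<inter> rule_vars R = {} \<and>
        (\<forall>j<i. aatom_vars (hs' ! i) \<inter> aatom_vars (hs' ! j) = {})"
    using rename_apart[where A = "rule_vars R" and hms = hms and \<nu> = \<nu>, OF finite_rule_vars] fin
    by fastforce
  have len: "length hs' = length as" using list_all2_lengthD[OF ren] by (simp add: hms_def)
  have hs': "\<exists>\<pi>. bij \<pi> \<and> hs' ! i = rename_aatom \<pi> (fst (hms ! i)) \<and>
      (\<forall>x\<in>aatom_vars (fst (hms ! i)). \<nu>' (\<pi> x) = snd (hms ! i) x)" if "i < length as" for i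
    using list_all2_nthD2[OF ren, of i] that len by (auto simp: case_prod_beta)
  have nth: "as ! i \<in> set (idb_atoms P R)" if "i < length as" for i
    using that by (simp add: as_def)
  define eqs where "eqs = zip (map snd as) (map snd hs')"
  \<comment> \<open>The ground unifier: each variable is sent to the constant that is its
    value.\<close>
  define \<tau> where "\<tau> = Const \<circ> \<nu>'"
  have \<tau>: "subst \<tau> t = Const (trm_val \<nu>' t)" for t by (cases t) (auto simp: \<tau>_def)
  have rv: "args_vars (snd a) \<subseteq> rule_vars R" if "a \<in> set (rbody R)" for a
    using that by (auto simp: rule_vars_def atom_vars_def)
  have val_body: "map (trm_val \<nu>') (snd a) = map (trm_val \<nu>) (snd a)" if "a \<in> set (rbody R)" for a
    using \<nu>' rv[OF that] by (intro map_trm_val_cong) blast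
  have val_hs': "map (trm_val \<nu>') (snd (hs' ! i)) = map (trm_val \<nu>) (snd (as ! i))"
    if i: "i < length as" for i
  proof -
    obtain \<pi> where \<pi>: "hs' ! i = rename_aatom \<pi> (fst (hms ! i))"
      "\<forall>x\<in>aatom_vars (fst (hms ! i)). \<nu>' (\<pi> x) = snd (hms ! i) x" using hs'[OF i] by blast
    have "map (trm_val \<nu>') (snd (hs' ! i)) = map (trm_val (\<lambda>x. \<nu>' (\<pi> x))) (snd (fst (hms ! i)))"
      by (simp add: \<pi>(1) rename_aatom_def trm_val_subst)
    also have "\<dots> = map (trm_val (snd (hms ! i))) (snd (fst (hms ! i)))"
      using \<pi>(2) by (intro map_trm_val_cong) (auto simp: aatom_vars_def)
    also have "\<dots> = map (trm_val \<nu>) (snd (as ! i))"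
      using F nth[OF that] that by (simp add: hms_def ground_eq)
    finally show ?thesis .
  qed
  have as_body: "a \<in> set (rbody R)" if "a \<in> set as" for a
    using that by (auto simp: as_def idb_atoms_def)
  have "unifier \<tau> eqs"
    unfolding unifier_def eqs_def
  proof clarify
    fix s v assume "(s, v) \<in> set (zip (map snd as) (map snd hs'))"
    then obtain i where i: "i < length as" "s = snd (as ! i)" "v = snd (hs' ! i)"
      by (auto simp: set_zip len)
    have "map (subst \<tau>) ts = map Const (map (trm_val \<nu>') ts)" for ts by (simp add: \<tau>)
    then show "map (subst \<tau>) s = map (subst \<tau>) v"
      using val_hs'[OF i(1)] val_body[OF as_body[OF nth_mem[OF i(1)]]] by (simp only: i)
  qed
  define \<sigma> where "\<sigma> = mgu_of eqs"
  have mgu: "is_mgu \<sigma> eqs" using is_mgu_mgu_of[OF \<open>unifier \<tau> eqs\<close>] by (simp add: \<sigma>_def)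
  have fresh: "\<sigma> x = Var x" "\<sigma> y = Var x \<Longrightarrow> y = x" if "x \<notin> eqs_vars eqs" for x y
    using mgu_of_fresh[OF \<open>unifier \<tau> eqs\<close> that] by (auto simp: \<sigma>_def)
  \<comment> \<open>Since \<open>\<tau>\<close> is its own factor through \<open>\<sigma>\<close>,
    the valuation \<open>\<nu>'\<close> also evaluates the terms after unification.\<close>
  have fac: "trm_val \<nu>' (\<sigma> x) = \<nu>' x" for x
    using mgu_of_factor[OF \<open>unifier \<tau> eqs\<close>, of x] by (simp add: \<sigma>_def \<tau>) (simp add: \<tau>_def)
  define B where "B = (\<Union>h'\<in>set hs'. subst_batom \<sigma> ` abody (fst h')) \<union>
              (\<lambda>a. batom_of (subst_atom \<sigma> a)) ` set (edb_atoms P R)"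
  define \<rho> where "\<rho> = gout (subst_atom \<sigma> (rhead R)) B"
  have "Adorned_Rule (\<rho>, map (subst \<sigma>) (snd (rhead R)))
          (zip (map fst (map fst hms)) (map (\<lambda>a. map (subst \<sigma>) (snd a)) (idb_atoms P R)))
          (map (subst_atom \<sigma>) (edb_atoms P R)) \<in> adorned_program P"
  proof (rule adorned_program.adorn[OF R])
    show "\<forall>h\<in>set (map fst hms). \<exists>B E. Adorned_Rule h B E \<in> adorned_program P"
    proof
      fix h assume "h \<in> set (map fst hms)"
      then have "h \<in> (\<lambda>a. (fst (F a), snd (ahead (fst (F a))))) ` set (idb_atoms P R)"
        by (simp add: hms_def as_def image_image)
      then obtain a where a: "a \<in> set (idb_atoms P R)" "h = (fst (F a), snd (ahead (fst (F a))))"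
        by blast
      then obtain vs B' E' where "Adorned_Rule (fst (F a), vs) B' E' \<in> adorned_program P"
        using F by (auto simp: adornments_def)
      then show "\<exists>B E. Adorned_Rule h B E \<in> adorned_program P"
        using good_adorned[OF P] a(2) by fastforce
    qed
    show "map (\<lambda>h. fst (ahead (fst h))) (map fst hms) = map fst (idb_atoms P R)"
      using F by (auto simp: hms_def as_def ground_eq)
    show "list_all2 (\<lambda>h h'. \<exists>\<pi>. bij \<pi> \<and> h' = rename_aatom \<pi> h) (map fst hms) hs'"
      unfolding list_all2_map1 using ren by (rule list_all2_mono) auto
    show "is_mgu \<sigma> (zip (map snd (idb_atoms P R)) (map snd hs'))"
      using mgu by (simp add: eqs_def as_def)
  qed (use apart \<rho>_def B_def in blast)+
  then have \<rho>: "\<rho> \<in> adornments P" by (auto simp: adornments_def)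
  have head: "ahead \<rho> = subst_atom \<sigma> (rhead R)" by (simp add: \<rho>_def gout_def)
  define H where "H = set (snd (ahead \<rho>))"
  have body: "abody \<rho> = prune (blank H ` B)" by (simp add: \<rho>_def gout_def H_def)
  have satB: "sat E \<nu>' b" if b: "b \<in> B" for b
  proof -
    consider h' b' where "h' \<in> set hs'" "b' \<in> abody (fst h')" "b = subst_batom \<sigma> b'"
      | a where "a \<in> set (edb_atoms P R)" "b = batom_of (subst_atom \<sigma> a)"
      using b unfolding B_def by blast
    then show ?thesis
    proof cases
      case 1
      then obtain i where i: "i < length as" "h' = hs' ! i" using len by (auto simp: in_set_conv_nth)
      obtain \<pi> where \<pi>: "hs' ! i = rename_aatom \<pi> (fst (hms ! i))"
        "\<forall>x\<in>aatom_vars (fst (hms ! i)). \<nu>' (\<pi> x) = snd (hms ! i) x" using hs'[OF i(1)] by blast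
      then obtain b0 where b0: "b0 \<in> abody (fst (fst (hms ! i)))" "b' = subst_batom (Var \<circ> \<pi>) b0"
        using 1(2) i(2) unfolding rename_aatom_def by (simp only: fst_conv abody_rename) blast
      have "sat E (snd (hms ! i)) b0" using F nth[OF i(1)] i(1) b0(1) by (simp add: hms_def)
      moreover have "batom_vars b0 \<subseteq> aatom_vars (fst (hms ! i))" using b0(1) by (auto simp: aatom_vars_def)
      ultimately have "sat E (\<lambda>x. \<nu>' (\<pi> x)) b0"
        using \<pi>(2) sat_cong[of b0 "\<lambda>x. \<nu>' (\<pi> x)" "snd (hms ! i)" E] by blast
      then show ?thesis using 1(3) b0(2) by (simp add: sat_subst fac)
    next
      case 2
      then have "a \<in> set (rbody R)" by (simp add: edb_atoms_def)
      then have "map (trm_val (\<lambda>x. trm_val \<nu>' (\<sigma> x))) (snd a) \<in> E (fst a)"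
        using edb[OF 2(1)] val_body[of a] by (simp only: fac)
      moreover have "map (trm_val \<nu>') (map (subst \<sigma>) (snd a)) = map (trm_val (\<lambda>x. trm_val \<nu>' (\<sigma> x))) (snd a)"
        by (simp add: trm_val_subst)
      ultimately show ?thesis
        unfolding 2(2) sat_batom_of subst_atom_def fst_conv snd_conv by (simp only:)
    qed
  qed
  have sat: "\<forall>b\<in>abody \<rho>. sat E \<nu>' b"
  proof
    fix b assume "b \<in> abody \<rho>"
    then obtain b0 where "b0 \<in> B" "b = blank H b0" unfolding body prune_def by blast
    then show "sat E \<nu>' b" using satB sat_blank by blast
  qed
  have priv: "blank H (batom_of (subst_atom \<sigma> a)) \<in> abody \<rho> \<and>
        (\<exists>x\<in>atom_vars a \<inter> atom_vars (rhead R). \<sigma> x = Var x \<and>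
           (\<forall>b\<in>abody \<rho>. x \<in> batom_vars b \<longrightarrow> b = blank H (batom_of (subst_atom \<sigma> a))) \<and>
           (\<forall>a'\<in>set (edb_atoms P R). x \<in> atom_vars a' \<longrightarrow> a' = a) \<and>
           (\<forall>z. \<sigma> z = Var x \<longrightarrow> z = x))"
    if a: "a \<in> set (edb_atoms P R)" "\<not> atom_vars a \<subseteq> atom_vars (rhead R)" for a
  proof -
    obtain i where i: "i < length (rbody R)" "a = rbody R ! i" "fst a \<notin> idb P"
      using a(1) by (auto simp: edb_atoms_def in_set_conv_nth)
    then obtain x where x: "x \<in> atom_vars a" "x \<in> atom_vars (rhead R)"
      "\<And>j. j < length (rbody R) \<Longrightarrow> j \<noteq> i \<Longrightarrow> x \<notin> atom_vars (rbody R ! j)"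
      using grd R(1) a(2) unfolding adornment_groundable_def by metis
    have only: "a' = a" if "a' \<in> set (rbody R)" "x \<in> atom_vars a'" for a'
      using that x(3) i by (metis in_set_conv_nth)
    have xR: "x \<in> rule_vars R" using x(2) by (simp add: rule_vars_def)
    have hvars: "x \<notin> aatom_vars h'" if "h' \<in> set hs'" for h'
      using that apart xR by (metis disjoint_iff in_set_conv_nth)
    \<comment> \<open>The variable belongs to the rule and so to no renamed adornment, and the only
      body atom containing it is an EDB atom, so it is in no IDB atom either.\<close>
    have "x \<notin> eqs_vars eqs"
    proof
      assume "x \<in> eqs_vars eqs"
      then obtain j where j: "j < length as" "x \<in> args_vars (snd (as ! j)) \<union> args_vars (snd (hs' ! j))"
        by (auto simp: eqs_vars_def eqs_def set_zip len)
      have "as ! j \<in> set (rbody R)" "fst (as ! j) \<in> idb P"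
        using nth[OF j(1)] by (auto simp: idb_atoms_def)
      then have "x \<notin> args_vars (snd (as ! j))"
        using only i(3) by (metis atom_vars_def)
      moreover have "x \<notin> args_vars (snd (hs' ! j))"
        using hvars[of "hs' ! j"] j(1) len by (auto simp: aatom_vars_def)
      ultimately show False using j(2) by simp
    qed
    note fr = fresh[OF this]
    have xH: "Var x \<in> H" using x(2) fr(1) by (force simp: H_def head mem_subst_atom mem_atom_vars)
    have uniq: "b0 = batom_of (subst_atom \<sigma> a)"
      if b0: "b0 \<in> B" "Some (Var x) \<in> set (snd b0)" for b0
    proof -
      consider h' b' where "h' \<in> set hs'" "b' \<in> abody (fst h')" "b0 = subst_batom \<sigma> b'"
        | a' where "a' \<in> set (edb_atoms P R)" "b0 = batom_of (subst_atom \<sigma> a')"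
        using b0 unfolding B_def by blast
      then show ?thesis
      proof cases
        case 1
        then obtain w where "Some (Var w) \<in> set (snd b')" "\<sigma> w = Var x"
          using b0(2) by (auto simp: mem_subst_batom subst_eq_Var)
        then have "x \<in> batom_vars b'" using fr(2) by (auto simp: mem_batom_vars)
        then show ?thesis using hvars[OF 1(1)] 1(2) by (auto simp: aatom_vars_def)
      next
        case 2
        then have "Var x \<in> set (snd (subst_atom \<sigma> a'))" using b0(2) by (auto simp: batom_of_def)
        then obtain w where "Var w \<in> set (snd a')" "\<sigma> w = Var x"
          by (auto simp: mem_subst_atom subst_eq_Var)
        then have "x \<in> atom_vars a'" using fr(2) by (auto simp: mem_atom_vars)
        then show ?thesis using only[of a'] 2 by (simp add: edb_atoms_def)
      qed
    qed
    let ?b = "blank H (batom_of (subst_atom \<sigma> a))"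
    have "Some (Var x) \<in> set (snd (batom_of (subst_atom \<sigma> a)))"
      using x(1) fr(1) by (force simp: batom_of_def mem_subst_atom mem_atom_vars)
    then have xb: "Some (Var x) \<in> set (snd ?b)" unfolding mem_blank using xH by blast
    have bB: "?b \<in> blank H ` B" unfolding B_def using a(1) by blast
    have uniq': "b = ?b" if b: "b \<in> blank H ` B" "Some (Var x) \<in> set (snd b)" for b
    proof -
      obtain b0 where "b0 \<in> B" "b = blank H b0" using b by blast
      then show ?thesis using uniq[of b0] b(2) by (simp add: mem_blank)
    qed
    \<comment> \<open>An atom that subsumes \<open>?b\<close> contains the private variable too, and
      \<open>?b\<close> is the only such atom.\<close>
    have "?b \<in> abody \<rho>"
      unfolding body prune_def using bB xb uniq' subsumed_by_mem[OF _ xb] by blast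
    moreover have "b = ?b" if "b \<in> abody \<rho>" "x \<in> batom_vars b" for b
      using that uniq'[of b] unfolding body prune_def mem_batom_vars by blast
    ultimately show ?thesis
      using x(1,2) fr only unfolding edb_atoms_def by (intro conjI bexI[of _ x]) auto
  qed
  have "adorns P R \<sigma> \<rho>"
    unfolding adorns_def using \<rho> head priv H_def by blast
  moreover have "\<forall>x\<in>rule_vars R. trm_val \<nu>' (\<sigma> x) = \<nu> x" using fac \<nu>' by simp
  ultimately show ?thesis using sat by blast
qed

lemma mono_consequence: "mono (consequence P D)"
  unfolding mono_def consequence_def by blast

lemma least_fixpoint_unfold: "least_fixpoint P D = consequence P D (least_fixpoint P D)"
  unfolding least_fixpoint_def by (rule lfp_unfold[OF mono_consequence])

lemma least_fixpoint_rule: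
  assumes "R \<in> P" "\<And>a. a \<in> set (rbody R) \<Longrightarrow> ground \<nu> a \<in> least_fixpoint P D"
  shows "ground \<nu> (rhead R) \<in> least_fixpoint P D"
proof -
  have "ground \<nu> (rhead R) \<in> consequence P D (least_fixpoint P D)"
    unfolding consequence_def using assms by blast
  then show ?thesis using least_fixpoint_unfold by blast
qed

lemma ground_relation: "ground \<nu> a \<in> least_fixpoint P D \<longleftrightarrow>
    map (trm_val \<nu>) (snd a) \<in> relation P D (fst a)"
  by (simp add: ground_def relation_def)

text \<open>Fixpoint induction. EDB atoms are evaluated in the final relations at every stage, so
  the satisfaction of the adornment bodies passes unchanged from stage to stage.\<close>

lemma idb_fact_adorned:
  assumes P: "datalog_program ar P" and grd: "adornment_groundable P" and T: "edb_instance ar P T"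
    and "f \<in> least_fixpoint P (facts_of T)" "fst f \<in> idb P"
  shows "\<exists>\<rho>\<in>adornments P. \<exists>\<mu>. ground \<mu> (ahead \<rho>) = f \<and>
    (\<forall>b\<in>abody \<rho>. sat (relation P (facts_of T)) \<mu> b)"
proof -
  let ?E = "relation P (facts_of T)"
  let ?Q = "\<lambda>f. fst f \<in> idb P \<longrightarrow> (\<exists>\<rho>\<in>adornments P. \<exists>\<mu>. ground \<mu> (ahead \<rho>) = f \<and>
    (\<forall>b\<in>abody \<rho>. sat ?E \<mu> b))"
  have "?Q f"
    using assms(4) unfolding least_fixpoint_def
  proof (rule lfp_induct_set[OF _ mono_consequence])
    fix f assume "f \<in> consequence P (facts_of T) (lfp (consequence P (facts_of T)) \<inter> {f. ?Q f})"
    then consider "f \<in> facts_of T"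
      | \<nu> R where "R \<in> P" "f = ground \<nu> (rhead R)"
        "\<forall>a\<in>set (rbody R). ground \<nu> a \<in> least_fixpoint P (facts_of T) \<and> ?Q (ground \<nu> a)"
      by (auto simp: consequence_def least_fixpoint_def)
    then show "?Q f"
    proof cases
      case 1
      then have "fst f \<notin> idb P" using T by (auto simp: facts_of_def edb_instance_def)
      then show ?thesis by blast
    next
      case 2
      show ?thesis
      proof
        assume "fst f \<in> idb P"
        then have "fst (rhead R) \<in> idb P" using 2(2) by (simp add: ground_def)
        have edb: "map (trm_val \<nu>) (snd a) \<in> ?E (fst a)" if "a \<in> set (edb_atoms P R)" for a
          using that 2(3) by (auto simp: edb_atoms_def simp flip: ground_relation)
        have idb: "\<exists>\<rho>\<in>adornments P. \<exists>\<mu>. ground \<mu> (ahead \<rho>) = ground \<nu> a \<and> (\<forall>b\<in>abody \<rho>. sat ?E \<mu> b)"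
          if "a \<in> set (idb_atoms P R)" for a
        proof -
          have "fst (ground \<nu> a) \<in> idb P" "?Q (ground \<nu> a)"
            using that 2(3) by (auto simp: idb_atoms_def ground_def)
          then show ?thesis by blast
        qed
        obtain \<sigma> \<rho> \<mu> where *: "adorns P R \<sigma> \<rho>" "\<forall>x\<in>rule_vars R. trm_val \<mu> (\<sigma> x) = \<nu> x"
          "\<forall>b\<in>abody \<rho>. sat ?E \<mu> b"
          using adorns_complete[OF P grd 2(1) \<open>fst (rhead R) \<in> idb P\<close> edb idb] by blast
        have "map (trm_val \<mu>) (snd (ahead \<rho>)) = map (trm_val (\<lambda>x. trm_val \<mu> (\<sigma> x))) (snd (rhead R))"
          using *(1) by (simp add: adorns_def subst_atom_def trm_val_subst)
        also have "\<dots> = map (trm_val \<nu>) (snd (rhead R))"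
          using *(2) by (intro map_trm_val_cong) (auto simp: rule_vars_def atom_vars_def)
        finally have "ground \<mu> (ahead \<rho>) = f"
          using *(1) 2(2) by (simp add: ground_eq adorns_def)
        then show "\<exists>\<rho>\<in>adornments P. \<exists>\<mu>. ground \<mu> (ahead \<rho>) = f \<and> (\<forall>b\<in>abody \<rho>. sat ?E \<mu> b)"
          using *(1,3) unfolding adorns_def by blast
      qed
    qed
  qed
  with assms(5) show ?thesis by blast
qed

lemma rule_instance_adorned:
  assumes P: "datalog_program ar P" and grd: "adornment_groundable P" and T: "edb_instance ar P T"
    and R: "R \<in> P" "fst (rhead R) \<in> idb P"
    and body: "\<And>a. a \<in> set (rbody R) \<Longrightarrow> ground \<nu> a \<in> least_fixpoint P (facts_of T)"
  shows "\<exists>\<sigma> \<rho> \<mu>. adorns P R \<sigma> \<rho> \<and> (\<forall>x\<in>rule_vars R. trm_val \<mu> (\<sigma> x) = \<nu> x) \<and>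
    (\<forall>b\<in>abody \<rho>. sat (relation P (facts_of T)) \<mu> b)"
proof (rule adorns_complete[OF P grd R])
  fix a assume "a \<in> set (edb_atoms P R)"
  then show "map (trm_val \<nu>) (snd a) \<in> relation P (facts_of T) (fst a)"
    using body by (auto simp: edb_atoms_def simp flip: ground_relation)
next
  fix a assume "a \<in> set (idb_atoms P R)"
  then have "a \<in> set (rbody R)" "fst (ground \<nu> a) \<in> idb P" by (auto simp: idb_atoms_def ground_def)
  then show "\<exists>\<rho>\<in>adornments P. \<exists>\<mu>. ground \<mu> (ahead \<rho>) = ground \<nu> a \<and>
      (\<forall>b\<in>abody \<rho>. sat (relation P (facts_of T)) \<mu> b)"
    using idb_fact_adorned[OF P grd T body] by blast
qed

section \<open>From a rule and an adornment to a join query of bounded size whose covers are no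
  heavier\<close>

section \<open>The join queries of an adorned rule\<close>

datatype ('p, 'c) job = Job (jedges: "('p, 'c) batom list") (jhead: "('p, 'c) atom")
  (jidb: "('p, 'c) atom list") (jedb: "('p, 'c) atom list")

definition job_vars :: "('p, 'c) job \<Rightarrow> nat set" where
  "job_vars J = (\<Union>b\<in>set (jedges J). batom_vars b)"

definition job_cover :: "('p, 'c) job \<Rightarrow> (('p, 'c) batom \<Rightarrow> real) \<Rightarrow> bool" where
  "job_cover J x \<longleftrightarrow> (\<forall>b\<in>set (jedges J). 0 \<le> x b) \<and>
     (\<forall>v\<in>job_vars J. 1 \<le> (\<Sum>b\<in>{b \<in> set (jedges J). v \<in> batom_vars b}. x b))"

text \<open>\<open>k + 2 ^ k\<close> counts the EDB atoms with a non-head variable and one edge per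
  set of head variables; \<open>2 * k\<close> counts the variables of the adornment's head and those
  of the rule.\<close>

definition job_ok :: "('p \<Rightarrow> nat) \<Rightarrow> ('p, 'c) program \<Rightarrow> nat \<Rightarrow> ('p, 'c) job \<Rightarrow> bool" where
  "job_ok ar P k J \<longleftrightarrow> distinct (jedges J) \<and> length (jedges J) \<le> k + 2 ^ k \<and> card (job_vars J) \<le> 2 * k \<and>
     (\<forall>b\<in>set (jedges J). fst b \<in> edb P \<and> length (snd b) = ar (fst b) \<and> length (snd b) \<le> k \<and>
        batom_vars b \<noteq> {}) \<and>
     (\<forall>a\<in>set (jhead J # jidb J @ jedb J). atom_vars a \<subseteq> job_vars J \<and> length (snd a) \<le> k) \<and>
     length (jidb J) \<le> k \<and> length (jedb J) \<le> k \<and>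
     fst (jhead J) \<in> idb P \<and> (\<forall>a\<in>set (jidb J). fst a \<in> idb P) \<and> (\<forall>a\<in>set (jedb J). fst a \<in> edb P)"

text \<open>Source of soundness: an instance of the query's atoms is an instance of a rule of the
  program.\<close>

definition job_rule :: "('p, 'c) program \<Rightarrow> ('p, 'c) job \<Rightarrow> bool" where
  "job_rule P J \<longleftrightarrow> (\<exists>R\<in>P. \<exists>\<theta>. jhead J = subst_atom \<theta> (rhead R) \<and>
     jidb J = map (subst_atom \<theta>) (idb_atoms P R) \<and> jedb J = map (subst_atom \<theta>) (edb_atoms P R))"

text \<open>Expresses that the covers of the query get at least as light as
  \<open>ew_program P\<close>, in the form in which this is applied: a bound that holds for every
  cover passes to the width. This form copes with \<open>ew\<close> being an infimum.\<close>

definition job_width :: "('p, 'c) program \<Rightarrow> ('p, 'c) job \<Rightarrow> bool" where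
  "job_width P J \<longleftrightarrow> (\<forall>N\<ge>1. \<forall>M::real.
     (\<forall>x. job_cover J x \<longrightarrow> M \<le> N powr (\<Sum>b\<in>set (jedges J). x b)) \<longrightarrow> M \<le> N powr ew_program P)"

lemma rule_size_bounds:
  assumes "rule_size r \<le> k"
  shows "a \<in> set (atoms_of r) \<Longrightarrow> length (snd a) \<le> k" "length (rbody r) \<le> k" "card (rule_vars r) \<le> k"
proof -
  have len: "length (concat (map snd as)) + length as = sum_list (map (\<lambda>a. 1 + length (snd a)) as)"
    for as :: "('a, 'b) atom list"
    by (induction as) auto
  show "length (snd a) \<le> k" if "a \<in> set (atoms_of r)"
    using member_le_sum_list[of "1 + length (snd a)" "map (\<lambda>a. 1 + length (snd a)) (atoms_of r)"]
      that assms by (simp add: rule_size_def)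
  show "length (rbody r) \<le> k"
    using len[of "atoms_of r"] assms by (simp add: rule_size_def atoms_of_def)
  have "Var ` rule_vars r \<subseteq> set (concat (map snd (atoms_of r)))"
    by (auto simp: rule_vars_def atoms_of_def mem_atom_vars)
  then have "card (Var ` rule_vars r :: 'b trm set) \<le> length (concat (map snd (atoms_of r)))"
    by (meson card_length card_mono finite_set le_trans)
  then show "card (rule_vars r) \<le> k"
    using len[of "atoms_of r"] assms by (simp add: rule_size_def card_image inj_on_def)
qed

locale adorned_rule_query =
  fixes ar :: "'p \<Rightarrow> nat" and P :: "('p, 'c) program" and R :: "('p, 'c) dl_rule"
    and \<sigma> :: "'c sbst" and \<rho> :: "('p, 'c) adornment"
  assumes P: "datalog_program ar P" and grd: "adornment_groundable P" and R: "R \<in> P"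
    and ad: "adorns P R \<sigma> \<rho>"
begin

definition H :: "'c trm set" where "H = set (snd (ahead \<rho>))"

definition double :: "nat \<Rightarrow> nat" where "double v = 2 * v"

text \<open>The query uses the even variables for the variables of the adornment and the odd ones for
  the variables of the rule that the head of the adornment does not determine.\<close>

definition \<theta> :: "'c sbst" where
  "\<theta> x = (if \<sigma> x \<in> H then subst (Var \<circ> double) (\<sigma> x) else Var (2 * x + 1))"

definition open_atoms :: "('p, 'c) atom set" where
  "open_atoms = {a \<in> set (edb_atoms P R). \<not> atom_vars a \<subseteq> atom_vars (rhead R)}"

definition img :: "('p, 'c) atom \<Rightarrow> ('p, 'c) batom" where
  "img a = blank H (batom_of (subst_atom \<sigma> a))"

definition rest :: "('p, 'c) batom set" where "rest = abody \<rho> - img ` open_atoms"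

text \<open>The rule size does not bound the number of atoms in an adornment, but it bounds the
  number of their variable sets; hence one representative for each set.\<close>

definition rep :: "nat set \<Rightarrow> ('p, 'c) batom" where
  "rep V = (SOME b. b \<in> rest \<and> batom_vars b = V)"

text \<open>These atoms enter the query without blanks, so that the variables outside the head also
  receive values from them.\<close>

definition open_edges :: "('p, 'c) batom set" where
  "open_edges = (\<lambda>a. batom_of (subst_atom \<theta> a)) ` open_atoms"

definition rest_edges :: "('p, 'c) batom set" where
  "rest_edges = (\<lambda>V. subst_batom (Var \<circ> double) (rep V)) ` (batom_vars ` rest - {{}})"

definition job :: "('p, 'c) job" where
  "job = Job (SOME es. distinct es \<and> set es = open_edges \<union> rest_edges) (subst_atom \<theta> (rhead R))
     (map (subst_atom \<theta>) (idb_atoms P R)) (map (subst_atom \<theta>) (edb_atoms P R))"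

lemma good: "good ar P \<rho>" and head: "ahead \<rho> = subst_atom \<sigma> (rhead R)"
  using ad good_adornments[OF P] by (auto simp: adorns_def)

lemma finite_rest: "finite rest" using goodD(4)[OF good] by (simp add: rest_def)

lemma finite_edges: "finite open_edges" "finite rest_edges"
  by (simp_all add: open_edges_def open_atoms_def rest_edges_def finite_rest)

lemma jedges: "distinct (jedges job)" "set (jedges job) = open_edges \<union> rest_edges"
proof -
  have "\<exists>es. distinct es \<and> set es = open_edges \<union> rest_edges"
    using finite_distinct_list finite_edges by (metis finite_Un)
  from someI_ex[OF this] show "distinct (jedges job)" "set (jedges job) = open_edges \<union> rest_edges"
    by (simp_all add: job_def)
qed

lemma open_priv:
  assumes "a \<in> open_atoms"
  obtains x where "x \<in> atom_vars a" "x \<in> atom_vars (rhead R)" "\<sigma> x = Var x"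
    "\<And>b. b \<in> abody \<rho> \<Longrightarrow> x \<in> batom_vars b \<Longrightarrow> b = img a"
    "\<And>a'. a' \<in> set (edb_atoms P R) \<Longrightarrow> x \<in> atom_vars a' \<Longrightarrow> a' = a"
    "\<And>z. \<sigma> z = Var x \<Longrightarrow> z = x"
proof -
  have "\<exists>x\<in>atom_vars a \<inter> atom_vars (rhead R). \<sigma> x = Var x \<and>
           (\<forall>b\<in>abody \<rho>. x \<in> batom_vars b \<longrightarrow> b = img a) \<and>
           (\<forall>a'\<in>set (edb_atoms P R). x \<in> atom_vars a' \<longrightarrow> a' = a) \<and> (\<forall>z. \<sigma> z = Var x \<longrightarrow> z = x)"
    using ad assms unfolding adorns_def open_atoms_def img_def H_def by blast
  then obtain x where "x \<in> atom_vars a \<inter> atom_vars (rhead R)" "\<sigma> x = Var x \<and>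
           (\<forall>b\<in>abody \<rho>. x \<in> batom_vars b \<longrightarrow> b = img a) \<and>
           (\<forall>a'\<in>set (edb_atoms P R). x \<in> atom_vars a' \<longrightarrow> a' = a) \<and> (\<forall>z. \<sigma> z = Var x \<longrightarrow> z = x)"
    by (rule bexE)
  then show thesis by (intro that[of x]) auto
qed

lemma img_abody: "a \<in> open_atoms \<Longrightarrow> img a \<in> abody \<rho>"
  using ad unfolding adorns_def open_atoms_def img_def H_def by blast

lemma head_H: "x \<in> atom_vars (rhead R) \<Longrightarrow> \<sigma> x \<in> H"
  by (force simp: H_def head mem_subst_atom mem_atom_vars)

lemma mem_img: "Some t \<in> set (snd (img a)) \<longleftrightarrow> t \<in> H \<and> (\<exists>u\<in>set (snd a). subst \<sigma> u = t)"
proof -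
  have "Some t \<in> set (snd (batom_of (subst_atom \<sigma> a))) \<longleftrightarrow> t \<in> set (snd (subst_atom \<sigma> a))"
    by (auto simp: batom_of_def)
  then show ?thesis unfolding img_def mem_blank mem_subst_atom by blast
qed

lemma img_vars: "v \<in> batom_vars (img a) \<longleftrightarrow> Var v \<in> H \<and> (\<exists>z\<in>atom_vars a. \<sigma> z = Var v)"
  unfolding mem_batom_vars mem_img by (auto simp: subst_eq_Var mem_atom_vars)

text \<open>The private variable in a blanked image reveals the atom it comes from. Hence distinct
  open atoms pay for their edges with the weights of distinct atoms of the adornment.\<close>

lemma inj_img: "inj_on img open_atoms"
proof (rule inj_onI)
  fix a a' assume a: "a \<in> open_atoms" "a' \<in> open_atoms" "img a = img a'"
  obtain x where x: "x \<in> atom_vars a" "x \<in> atom_vars (rhead R)" "\<sigma> x = Var x"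
    "\<And>a'. a' \<in> set (edb_atoms P R) \<Longrightarrow> x \<in> atom_vars a' \<Longrightarrow> a' = a"
    "\<And>z. \<sigma> z = Var x \<Longrightarrow> z = x"
    using a(1) by (rule open_priv) blast
  have "x \<in> batom_vars (img a)" using x head_H[OF x(2)] by (auto simp: img_vars)
  then have "x \<in> atom_vars a'" using a(3) x(5) by (auto simp: img_vars)
  then show "a = a'" using x(4)[of a'] a(2) by (simp add: open_atoms_def)
qed

lemma mem_open_vars:
  "v \<in> atom_vars (subst_atom \<theta> a) \<longleftrightarrow> (\<exists>z\<in>atom_vars a. \<theta> z = Var v)"
  by (auto simp: mem_atom_vars mem_subst_atom subst_eq_Var)

lemma img_vars_double: "v \<in> batom_vars (img a) \<Longrightarrow> double v \<in> atom_vars (subst_atom \<theta> a)"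
  unfolding mem_open_vars img_vars by (auto simp: \<theta>_def intro!: bexI)

lemma rep: "b \<in> rest \<Longrightarrow> rep (batom_vars b) \<in> rest \<and> batom_vars (rep (batom_vars b)) = batom_vars b"
  unfolding rep_def by (rule someI[of _ b]) simp

lemma inj_double: "inj double" by (simp add: inj_def double_def)

lemma rest_edge_vars:
  "V \<in> batom_vars ` rest \<Longrightarrow> batom_vars (subst_batom (Var \<circ> double) (rep V)) = double ` V"
  using rep by (auto simp: batom_vars_rename)

lemma rest_vars: "b \<in> abody \<rho> \<Longrightarrow> batom_vars b \<subseteq> atom_vars (ahead \<rho>)"
  unfolding mem_batom_vars[abs_def] using goodD(7)[OF good, of b] by (auto simp: mem_batom_vars mem_atom_vars)

lemma job_vars_eq: "job_vars job = (\<Union>a\<in>open_atoms. atom_vars (subst_atom \<theta> a)) \<union>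
    (\<Union>b\<in>rest. double ` batom_vars b)"
proof -
  have "(\<Union>b\<in>rest_edges. batom_vars b) = (\<Union>V\<in>batom_vars ` rest - {{}}. double ` V)"
    unfolding rest_edges_def by (auto simp: rest_edge_vars)
  also have "\<dots> = (\<Union>b\<in>rest. double ` batom_vars b)" by auto
  finally show ?thesis
    by (simp add: job_vars_def jedges open_edges_def UN_Un batom_vars_batom_of)
qed

lemma double_job_vars: "v \<in> atom_vars (ahead \<rho>) \<Longrightarrow> double v \<in> job_vars job"
proof -
  assume "v \<in> atom_vars (ahead \<rho>)"
  then obtain b where b: "b \<in> abody \<rho>" "v \<in> batom_vars b" using goodD(8)[OF good] by blast
  show ?thesis
  proof (cases "b \<in> rest")
    case True
    then show ?thesis using b by (auto simp: job_vars_eq)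
  next
    case False
    then obtain a where "a \<in> open_atoms" "b = img a" using b(1) by (auto simp: rest_def)
    then show ?thesis using b(2) img_vars_double[of v a] unfolding job_vars_eq by blast
  qed
qed

text \<open>An answer of the query grounds the whole rule: head variables are covered by the body of
  \<open>\<rho>\<close>, EDB variables outside the head lie in open atoms, and the second
  groundability condition leaves no other variables.\<close>

lemma \<theta>_job_vars:
  assumes "x \<in> rule_vars R"
  shows "trm_vars (\<theta> x) \<subseteq> job_vars job"
proof -
  have hd: "trm_vars (\<theta> x) \<subseteq> job_vars job" if "x \<in> atom_vars (rhead R)"
  proof (cases "\<sigma> x")
    case (Var v)
    then have "v \<in> atom_vars (ahead \<rho>)" using head_H[OF that] by (simp add: H_def mem_atom_vars)
    then show ?thesis using double_job_vars head_H[OF that] Var by (simp add: \<theta>_def)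
  qed (use head_H[OF that] in \<open>simp add: \<theta>_def\<close>)
  have ed: "trm_vars (\<theta> x) \<subseteq> job_vars job" if "a \<in> set (edb_atoms P R)" "x \<in> atom_vars a" for a
  proof (cases "a \<in> open_atoms")
    case True
    have "trm_vars (\<theta> x) \<subseteq> atom_vars (subst_atom \<theta> a)"
      using that(2) by (cases "\<theta> x") (auto simp: mem_open_vars)
    then show ?thesis using True by (auto simp: job_vars_eq)
  next
    case False
    then show ?thesis using that hd by (auto simp: open_atoms_def)
  qed
  show ?thesis
  proof (cases "x \<in> atom_vars (rhead R)")
    case False
    then obtain a where a: "a \<in> set (rbody R)" "x \<in> atom_vars a"
      using assms by (auto simp: rule_vars_def)
    then consider "a \<in> set (idb_atoms P R)" | "a \<in> set (edb_atoms P R)"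
      using set_idb_edb_atoms[of R P] by blast
    then show ?thesis
    proof cases
      case 1
      then obtain b where "b \<in> set (edb_atoms P R)" "x \<in> atom_vars b"
        using grd R a False unfolding adornment_groundable_def by blast
      then show ?thesis by (rule ed)
    qed (use ed a in blast)
  qed (rule hd)
qed

lemma subst_job_vars:
  assumes "a \<in> set (atoms_of R)"
  shows "atom_vars (subst_atom \<theta> a) \<subseteq> job_vars job"
proof
  fix v assume "v \<in> atom_vars (subst_atom \<theta> a)"
  then obtain z where "z \<in> atom_vars a" "\<theta> z = Var v" by (auto simp: mem_open_vars)
  moreover from this have "z \<in> rule_vars R" using assms by (auto simp: rule_vars_def atoms_of_def)
  ultimately show "v \<in> job_vars job" using \<theta>_job_vars[of z] by simp
qed

lemma job_ok:
  assumes k: "\<forall>r\<in>P. rule_size r \<le> k"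
  shows "job_ok ar P k job"
proof -
  note size = rule_size_bounds[OF k[rule_format, OF R]]
  have ar_le: "ar p \<le> k" if p: "p \<in> edb P" for p
  proof -
    obtain r a where "r \<in> P" "a \<in> set (atoms_of r)" "p = fst a" using p unfolding edb_def by blast
    then show ?thesis
      using rule_size_bounds(1)[of r k a] k P by (auto simp: datalog_program_def)
  qed
  have hv: "card (atom_vars (ahead \<rho>)) \<le> k"
    using card_atom_vars[of "ahead \<rho>"] size(1)[of "rhead R"] by (simp add: head atoms_of_def)
  have "card open_edges \<le> card (set (edb_atoms P R))"
    unfolding open_edges_def open_atoms_def
    by (rule order.trans[OF card_image_le card_mono]) auto
  also have "\<dots> \<le> length (rbody R)"
    using card_length[of "edb_atoms P R"] length_filter_le[of "\<lambda>a. fst a \<notin> idb P" "rbody R"]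
    unfolding edb_atoms_def by linarith
  finally have 1: "card open_edges \<le> k" using size(2) by simp
  have "card rest_edges \<le> card (batom_vars ` rest - {{}})"
    unfolding rest_edges_def using finite_rest by (intro card_image_le) auto
  also have "\<dots> \<le> card (Pow (atom_vars (ahead \<rho>)))"
    using rest_vars by (intro card_mono) (auto simp: finite_atom_vars rest_def)
  also have "\<dots> \<le> 2 ^ k" using hv by (simp add: card_Pow finite_atom_vars)
  finally have 2: "card rest_edges \<le> 2 ^ k" .
  have len: "length (jedges job) \<le> k + 2 ^ k"
    using 1 2 card_Un_le[of open_edges rest_edges] distinct_card[OF jedges(1)]
    unfolding jedges(2) by linarith
  have "job_vars job \<subseteq> double ` atom_vars (ahead \<rho>) \<union> (\<lambda>x. 2 * x + 1) ` rule_vars R"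
  proof
    fix v assume "v \<in> job_vars job"
    then consider a where "a \<in> open_atoms" "v \<in> atom_vars (subst_atom \<theta> a)"
      | b where "b \<in> rest" "v \<in> double ` batom_vars b" by (auto simp: job_vars_eq)
    then show "v \<in> double ` atom_vars (ahead \<rho>) \<union> (\<lambda>x. 2 * x + 1) ` rule_vars R"
    proof cases
      case 1
      then obtain z where z: "z \<in> atom_vars a" "\<theta> z = Var v" by (auto simp: mem_open_vars)
      have zR: "z \<in> rule_vars R" using z(1) 1(1) by (auto simp: rule_vars_def open_atoms_def edb_atoms_def)
      show ?thesis
      proof (cases "\<sigma> z \<in> H")
        case True
        then obtain w where "\<sigma> z = Var w" "v = double w" using z(2) by (auto simp: \<theta>_def subst_eq_Var)
        then show ?thesis using True by (auto simp: H_def mem_atom_vars)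
      next
        case False
        then show ?thesis using z(2) zR by (auto simp: \<theta>_def)
      qed
    next
      case 2
      then show ?thesis using rest_vars[of b] unfolding rest_def by blast
    qed
  qed
  then have "card (job_vars job) \<le> card (double ` atom_vars (ahead \<rho>) \<union> (\<lambda>x. 2 * x + 1) ` rule_vars R)"
    by (intro card_mono) (auto simp: finite_atom_vars finite_rule_vars)
  also have "\<dots> \<le> card (atom_vars (ahead \<rho>)) + card (rule_vars R)"
    by (intro order.trans[OF card_Un_le] add_mono card_image_le finite_atom_vars finite_rule_vars)
  finally have cv: "card (job_vars job) \<le> 2 * k" using hv size(3) by linarith
  have edge: "fst b \<in> edb P \<and> length (snd b) = ar (fst b) \<and> length (snd b) \<le> k \<and> batom_vars b \<noteq> {}"
    if b: "b \<in> set (jedges job)" for b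
  proof -
    consider a where "a \<in> open_atoms" "b = batom_of (subst_atom \<theta> a)"
      | V where "V \<in> batom_vars ` rest" "V \<noteq> {}" "b = subst_batom (Var \<circ> double) (rep V)"
      using b unfolding jedges open_edges_def rest_edges_def by blast
    then show ?thesis
    proof cases
      case 1
      have a: "a \<in> set (edb_atoms P R)" "a \<in> set (rbody R)"
        using 1(1) by (auto simp: open_atoms_def edb_atoms_def)
      obtain x where x: "x \<in> atom_vars a" "x \<in> atom_vars (rhead R)" "\<sigma> x = Var x"
        using 1(1) by (rule open_priv)
      have "double x \<in> batom_vars b"
        using x head_H[OF x(2)] by (auto simp: 1(2) batom_vars_batom_of mem_open_vars \<theta>_def intro!: bexI[of _ x])
      then show ?thesis
        using 1(2) edb_atom_edb[OF R a(1)] datalog_programD(2)[OF P R a(2)] ar_le by auto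
    next
      case 2
      then have r: "rep V \<in> abody \<rho>" "batom_vars (rep V) = V" using rep by (auto simp: rest_def)
      then show ?thesis
        using 2 goodD(5,6)[OF good r(1)] ar_le rest_edge_vars by (auto simp: batom_vars_rename)
    qed
  qed
  have atoms: "atom_vars a \<subseteq> job_vars job \<and> length (snd a) \<le> k"
    if a: "a \<in> set (jhead job # jidb job @ jedb job)" for a
  proof -
    have "a \<in> subst_atom \<theta> ` set (atoms_of R)"
      using a by (auto simp: job_def atoms_of_def idb_atoms_def edb_atoms_def)
    then obtain a0 where "a0 \<in> set (atoms_of R)" "a = subst_atom \<theta> a0" by blast
    then show ?thesis using subst_job_vars size(1) by simp
  qed
  have "length (jidb job) \<le> k" "length (jedb job) \<le> k"
    using size(2) length_filter_le[of "\<lambda>a. fst a \<in> idb P" "rbody R"]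
      length_filter_le[of "\<lambda>a. fst a \<notin> idb P" "rbody R"]
    unfolding job_def idb_atoms_def edb_atoms_def job.sel length_map by linarith+
  moreover have "fst (jhead job) \<in> idb P" using goodD(1)[OF good] by (simp add: job_def head)
  moreover have "\<forall>a\<in>set (jidb job). fst a \<in> idb P" by (auto simp: job_def idb_atoms_def)
  moreover have "\<forall>a\<in>set (jedb job). fst a \<in> edb P" using edb_atom_edb[OF R] by (auto simp: job_def)
  ultimately show ?thesis
    unfolding job_ok_def using jedges(1) len cv edge atoms by blast
qed

lemma job_rule: "job_rule P job"
  unfolding job_rule_def using R by (intro bexI[of _ R] exI[of _ \<theta>]) (simp_all add: job_def)

text \<open>An open edge gets weight 1, any other edge the total weight of the atoms of
  \<open>rest\<close> with its variable set. The sum does not grow: the private variable of an open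
  atom is covered by its image alone, which therefore has weight at least 1 already.\<close>

lemma cover_exists:
  assumes y: "fractional_edge_cover \<rho> y"
  shows "\<exists>x. job_cover job x \<and> (\<Sum>b\<in>set (jedges job). x b) \<le> (\<Sum>b\<in>abody \<rho>. y b)"
proof -
  define C where "C b = {c \<in> rest. double ` batom_vars c = batom_vars b}" for b :: "('p, 'c) batom"
  define x where "x b = (if b \<in> open_edges then 1 else \<Sum>c\<in>C b. y c)" for b
  have y0: "0 \<le> y b" if "b \<in> abody \<rho>" for b using y that by (simp add: fractional_edge_cover_def)
  have C_abody: "C b \<subseteq> abody \<rho>" "finite (C b)" for b using finite_rest by (simp add: C_def rest_def subset_iff, simp add: C_def)
  have x0: "0 \<le> x b" for b
    unfolding x_def using y0 C_abody(1)[of b] by (simp, intro impI sum_nonneg) blast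
  \<comment> \<open>Edges from different variable sets collect disjoint classes of atoms, so no
    weight is counted twice.\<close>
  have C_disj: "C b \<inter> C b' = {}" if b: "b \<in> rest_edges" "b' \<in> rest_edges" "b \<noteq> b'" for b b'
  proof -
    obtain V V' where V: "V \<in> batom_vars ` rest" "b = subst_batom (Var \<circ> double) (rep V)"
      "V' \<in> batom_vars ` rest" "b' = subst_batom (Var \<circ> double) (rep V')"
      using b unfolding rest_edges_def by blast
    then have "V \<noteq> V'" using b(3) by blast
    then have "double ` V \<noteq> double ` V'" using inj_double by (simp add: inj_image_eq_iff)
    then have "batom_vars b \<noteq> batom_vars b'" using rest_edge_vars V by simp
    then show ?thesis by (auto simp: C_def)
  qed
  have sum_C: "(\<Sum>b\<in>B. \<Sum>c\<in>C b. y c) = (\<Sum>c\<in>(\<Union>b\<in>B. C b). y c)" if "B \<subseteq> rest_edges" for B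
  proof (rule sum.UNION_disjoint[symmetric])
    show "finite B" using that finite_edges(2) by (rule finite_subset)
    show "\<forall>i\<in>B. finite (C i)" using C_abody(2) by blast
    show "\<forall>i\<in>B. \<forall>j\<in>B. i \<noteq> j \<longrightarrow> C i \<inter> C j = {}" using that C_disj by (meson subsetD)
  qed
  have img1: "1 \<le> y (img a)" if a: "a \<in> open_atoms" for a
  proof -
    obtain x where x: "x \<in> atom_vars a" "x \<in> atom_vars (rhead R)" "\<sigma> x = Var x"
      "\<And>b. b \<in> abody \<rho> \<Longrightarrow> x \<in> batom_vars b \<Longrightarrow> b = img a"
      using a by (rule open_priv) blast
    have "x \<in> atom_vars (ahead \<rho>)" using x by (force simp: head mem_atom_vars mem_subst_atom)
    then have "1 \<le> (\<Sum>b\<in>{b \<in> abody \<rho>. x \<in> batom_vars b}. y b)"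
      using y by (simp add: fractional_edge_cover_def)
    moreover have "x \<in> batom_vars (img a)" using x head_H[OF x(2)] by (auto simp: img_vars)
    then have "{b \<in> abody \<rho>. x \<in> batom_vars b} = {img a}" using x(4) img_abody[OF a] by blast
    ultimately show ?thesis by simp
  qed
  have fin: "finite open_atoms" by (simp add: open_atoms_def)
  have "(\<Sum>b\<in>open_edges. x b) = real (card open_edges)" by (simp add: x_def)
  also have "\<dots> \<le> real (card open_atoms)" using fin by (simp add: open_edges_def card_image_le)
  also have "\<dots> \<le> (\<Sum>a\<in>open_atoms. y (img a))"
    using sum_mono[of open_atoms "\<lambda>_. 1" "\<lambda>a. y (img a)"] img1 by simp
  also have "\<dots> = (\<Sum>b\<in>img ` open_atoms. y b)" by (simp add: sum.reindex[OF inj_img])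
  finally have 1: "(\<Sum>b\<in>open_edges. x b) \<le> (\<Sum>b\<in>img ` open_atoms. y b)" .
  have "(\<Sum>b\<in>rest_edges - open_edges. x b) = (\<Sum>b\<in>rest_edges - open_edges. \<Sum>c\<in>C b. y c)"
    by (intro sum.cong) (auto simp: x_def)
  also have "\<dots> = (\<Sum>c\<in>(\<Union>b\<in>rest_edges - open_edges. C b). y c)" by (rule sum_C) auto
  also have "\<dots> \<le> (\<Sum>c\<in>rest. y c)"
    using finite_rest y0 by (intro sum_mono2) (auto simp: C_def rest_def)
  finally have 2: "(\<Sum>b\<in>rest_edges - open_edges. x b) \<le> (\<Sum>c\<in>rest. y c)" .
  have "(\<Sum>b\<in>set (jedges job). x b) = (\<Sum>b\<in>open_edges. x b) + (\<Sum>b\<in>rest_edges - open_edges. x b)"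
    unfolding jedges using finite_edges sum.union_disjoint[of open_edges "rest_edges - open_edges" x] by simp
  also have "\<dots> \<le> (\<Sum>b\<in>img ` open_atoms. y b) + (\<Sum>c\<in>rest. y c)" using 1 2 by simp
  also have "\<dots> = (\<Sum>b\<in>abody \<rho>. y b)"
    unfolding rest_def using goodD(4)[OF good] img_abody by (subst sum.subset_diff[of "img ` open_atoms" "abody \<rho>"]) auto
  finally have total: "(\<Sum>b\<in>set (jedges job). x b) \<le> (\<Sum>b\<in>abody \<rho>. y b)" .
  \<comment> \<open>A variable of an open edge is covered there. Otherwise all atoms of the
    adornment that contain it belong to \<open>rest\<close>, and the edges containing the variable
    collect their weights.\<close>
  have cov: "1 \<le> (\<Sum>b\<in>{b \<in> set (jedges job). v \<in> batom_vars b}. x b)" if v: "v \<in> job_vars job" for v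
  proof (cases "\<exists>e\<in>open_edges. v \<in> batom_vars e")
    case True
    then obtain e where e: "e \<in> open_edges" "v \<in> batom_vars e" by blast
    then have "x e \<le> (\<Sum>b\<in>{b \<in> set (jedges job). v \<in> batom_vars b}. x b)"
      using x0 finite_edges by (intro member_le_sum) (simp_all add: jedges(2))
    then show ?thesis using e by (simp add: x_def)
  next
    case False
    then obtain b0 where b0: "b0 \<in> rest" "v \<in> double ` batom_vars b0"
      using v by (auto simp: job_vars_eq open_edges_def batom_vars_batom_of)
    then obtain w where w: "w \<in> batom_vars b0" "v = double w" by blast
    then have "w \<in> atom_vars (ahead \<rho>)" using b0(1) rest_vars[of b0] unfolding rest_def by blast
    then have "1 \<le> (\<Sum>b\<in>{b \<in> abody \<rho>. w \<in> batom_vars b}. y b)"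
      using y by (simp add: fractional_edge_cover_def)
    also have "\<dots> \<le> (\<Sum>c\<in>(\<Union>b\<in>{b \<in> rest_edges. v \<in> batom_vars b}. C b). y c)"
    proof (rule sum_mono2)
      show "finite (\<Union>b\<in>{b \<in> rest_edges. v \<in> batom_vars b}. C b)" using finite_edges C_abody by auto
      show "{b \<in> abody \<rho>. w \<in> batom_vars b} \<subseteq> (\<Union>b\<in>{b \<in> rest_edges. v \<in> batom_vars b}. C b)"
      proof
        fix c assume c: "c \<in> {b \<in> abody \<rho>. w \<in> batom_vars b}"
        have "c \<in> rest"
        proof (rule ccontr)
          assume "c \<notin> rest"
          then obtain a where "a \<in> open_atoms" "c = img a" using c by (auto simp: rest_def)
          then have "v \<in> batom_vars (batom_of (subst_atom \<theta> a))"
            using c w(2) img_vars_double by (simp add: batom_vars_batom_of)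
          then show False using False \<open>a \<in> open_atoms\<close> by (auto simp: open_edges_def)
        qed
        let ?b = "subst_batom (Var \<circ> double) (rep (batom_vars c))"
        have "?b \<in> rest_edges" unfolding rest_edges_def using c \<open>c \<in> rest\<close> by blast
        moreover have "batom_vars ?b = double ` batom_vars c" using \<open>c \<in> rest\<close> by (simp add: rest_edge_vars)
        ultimately show "c \<in> (\<Union>b\<in>{b \<in> rest_edges. v \<in> batom_vars b}. C b)"
          using c \<open>c \<in> rest\<close> w(2) by (intro UN_I[of ?b]) (simp_all add: C_def)
      qed
      fix c assume "c \<in> (\<Union>b\<in>{b \<in> rest_edges. v \<in> batom_vars b}. C b) - {b \<in> abody \<rho>. w \<in> batom_vars b}"
      then show "0 \<le> y c" using C_abody y0 by blast
    qed
    also have "\<dots> = (\<Sum>b\<in>{b \<in> rest_edges. v \<in> batom_vars b}. \<Sum>c\<in>C b. y c)"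
      by (rule sum_C[symmetric]) auto
    also have "\<dots> = (\<Sum>b\<in>{b \<in> rest_edges. v \<in> batom_vars b}. x b)"
      using False by (intro sum.cong) (auto simp: x_def)
    also have "\<dots> \<le> (\<Sum>b\<in>{b \<in> set (jedges job). v \<in> batom_vars b}. x b)"
      using x0 by (intro sum_mono2) (simp_all add: jedges(2) finite_edges subset_iff)
    finally show ?thesis .
  qed
  have "job_cover job x" unfolding job_cover_def using x0 cov by blast
  then show ?thesis using total by blast
qed

text \<open>In logarithms to base \<open>N\<close>, a bound valid for every cover of the adornment
  is a lower bound of the weights and hence of their infimum.\<close>

lemma job_width: "job_width P job"
  unfolding job_width_def
proof (intro allI impI)
  fix N M :: real
  assume N: "1 \<le> N" and M: "\<forall>x. job_cover job x \<longrightarrow> M \<le> N powr (\<Sum>b\<in>set (jedges job). x b)"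
  let ?S = "{(\<Sum>b\<in>abody \<rho>. y b) | y. fractional_edge_cover \<rho> y}"
  have S: "M \<le> N powr s" if "s \<in> ?S" for s
  proof -
    obtain y where "s = (\<Sum>b\<in>abody \<rho>. y b)" "fractional_edge_cover \<rho> y" using \<open>s \<in> ?S\<close> by blast
    then obtain x where "job_cover job x" "(\<Sum>b\<in>set (jedges job). x b) \<le> s" using cover_exists by blast
    then show ?thesis using M N by (meson order.trans powr_mono)
  qed
  have "fractional_edge_cover \<rho> (\<lambda>_. 1)"
    unfolding fractional_edge_cover_def
  proof (intro conjI ballI)
    fix v assume "v \<in> atom_vars (ahead \<rho>)"
    then obtain b where "b \<in> abody \<rho>" "v \<in> batom_vars b" using goodD(8)[OF good] by blast
    then have "b \<in> {b \<in> abody \<rho>. v \<in> batom_vars b}" by blast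
    moreover have "finite {b \<in> abody \<rho>. v \<in> batom_vars b}" using goodD(4)[OF good] by simp
    ultimately have "card {b \<in> abody \<rho>. v \<in> batom_vars b} \<noteq> 0" using card_0_eq by blast
    then show "1 \<le> (\<Sum>b | b \<in> abody \<rho> \<and> v \<in> batom_vars b. 1::real)" by simp
  qed auto
  then have ne: "?S \<noteq> {}" by blast
  show "M \<le> N powr ew_program P"
  \<comment> \<open>The logarithm asks for a base above 1 and a positive argument. For base 1 all
    powers are 1, and the cover with constant weight 1 shows that there is a bound at all.\<close>
  proof (cases "N = 1 \<or> M \<le> 0")
    case True
    then show ?thesis
    proof
      assume "N = 1"
      then show ?thesis using S ne by auto
    next
      assume "M \<le> 0"
      then show ?thesis by (rule order.trans) simp
    qed
  next
    case False
    then have NM: "1 < N" "0 < M" using N by auto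
    have "log N M \<le> Inf ?S"
    proof (rule cInf_greatest[OF ne])
      fix s assume "s \<in> ?S"
      then show "log N M \<le> s" using S[of s] NM by (simp add: log_le_iff)
    qed
    also have "\<dots> \<le> ew_program P"
      using ew_le_ew_program[OF P, of \<rho>] ad by (simp add: ew_def adorns_def)
    finally show ?thesis using NM by (simp add: log_le_iff)
  qed
qed

text \<open>The query comes from the representative \<open>\<rho>\<close>, the instance from a
  variant \<open>\<rho>'\<close> with another unifier. The unifiers differ by the renaming
  \<open>\<pi>\<close> on head variables, because the heads correspond, and on the non-blank
  variables of open atoms, because their images correspond.\<close>

lemma complete:
  assumes ad': "adorns P R \<sigma>' \<rho>'" and var: "(\<rho>, \<rho>') \<in> variants"
    and \<mu>: "\<And>x. x \<in> rule_vars R \<Longrightarrow> trm_val \<mu> (\<sigma>' x) = \<nu> x"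
    and sat: "\<And>b. b \<in> abody \<rho>' \<Longrightarrow> sat E \<mu> b"
    and edb: "\<And>a. a \<in> set (edb_atoms P R) \<Longrightarrow> map (trm_val \<nu>) (snd a) \<in> E (fst a)"
  shows "\<exists>\<beta>. (\<forall>b\<in>set (jedges job). sat E \<beta> b) \<and> ground \<beta> (jhead job) = ground \<nu> (rhead R) \<and>
    map (ground \<beta>) (jidb job) = map (ground \<nu>) (idb_atoms P R) \<and>
    map (ground \<beta>) (jedb job) = map (ground \<nu>) (edb_atoms P R)"
proof -
  obtain \<pi> where \<pi>: "bij \<pi>" "\<rho>' = rename_adornment \<pi> \<rho>" using var by (auto simp: variants_def)
  interpret q': adorned_rule_query ar P R \<sigma>' \<rho>' by unfold_locales (use P grd R ad' in auto)
  \<comment> \<open>Even variables belong to the adornment and are read through the renaming; odd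
    ones carry the value of the rule variable itself.\<close>
  define \<beta> where "\<beta> v = (if even v then \<mu> (\<pi> (v div 2)) else \<nu> (v div 2))" for v
  have \<beta>: "\<beta> (double v) = \<mu> (\<pi> v)" "\<beta> (2 * v + 1) = \<nu> v" for v by (simp_all add: \<beta>_def double_def)
  have heads: "\<sigma>' z = subst (Var \<circ> \<pi>) (\<sigma> z)" if "z \<in> atom_vars (rhead R)" for z
  proof -
    have "map (subst \<sigma>') (snd (rhead R)) = map (\<lambda>t. subst (Var \<circ> \<pi>) (subst \<sigma> t)) (snd (rhead R))"
      using q'.head \<pi>(2) head by (simp add: ahead_rename subst_atom_def)
    then have "subst \<sigma>' (Var z) = subst (Var \<circ> \<pi>) (subst \<sigma> (Var z))"
      using that by (auto simp: mem_atom_vars)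
    then show ?thesis by simp
  qed
  have opens: "\<sigma>' z = subst (Var \<circ> \<pi>) (\<sigma> z)"
    if a: "a \<in> open_atoms" and z: "z \<in> atom_vars a" "\<sigma> z \<in> H" for a z
  proof -
    have a': "a \<in> q'.open_atoms" using a by (simp add: open_atoms_def q'.open_atoms_def)
    obtain x where x: "x \<in> atom_vars a" "x \<in> atom_vars (rhead R)" "\<sigma>' x = Var x"
      "\<And>b. b \<in> abody \<rho>' \<Longrightarrow> x \<in> batom_vars b \<Longrightarrow> b = q'.img a"
      using a' by (rule q'.open_priv) blast
    have "subst (Var \<circ> \<pi>) (\<sigma> x) = Var x" using heads[OF x(2)] x(3) by simp
    then obtain w where w: "\<sigma> x = Var w" "\<pi> w = x" by (auto simp: subst_eq_Var)
    have "Var w \<in> H" using head_H[OF x(2)] w(1) by simp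
    then have "w \<in> batom_vars (img a)" using x(1) w(1) by (auto simp: img_vars)
    then have "x \<in> batom_vars (subst_batom (Var \<circ> \<pi>) (img a))" using w(2) by (auto simp: batom_vars_rename)
    moreover have "subst_batom (Var \<circ> \<pi>) (img a) \<in> abody \<rho>'"
      using img_abody[OF a] by (simp add: \<pi>(2) abody_rename)
    \<comment> \<open>Both atoms contain the private variable of the variant, so they are the same;
      the claim is then read off at position \<open>j\<close>.\<close>
    ultimately have eq: "subst_batom (Var \<circ> \<pi>) (img a) = q'.img a" using x(4) by blast
    obtain j where j: "j < length (snd a)" "snd a ! j = Var z" using z(1) by (auto simp: mem_atom_vars in_set_conv_nth)
    have "snd (subst_batom (Var \<circ> \<pi>) (img a)) ! j = Some (subst (Var \<circ> \<pi>) (\<sigma> z))"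
      using j z(2) by (simp add: subst_batom_def img_def blank_def batom_of_def subst_atom_def)
    moreover have "snd (q'.img a) ! j = (if \<sigma>' z \<in> q'.H then Some (\<sigma>' z) else None)"
      using j by (simp add: q'.img_def blank_def batom_of_def subst_atom_def)
    ultimately show ?thesis using eq by (auto split: if_splits)
  qed
  have edbs: "trm_val \<beta> (\<theta> z) = \<nu> z" if z: "z \<in> rule_vars R"
    "z \<in> atom_vars (rhead R) \<or> (\<exists>a\<in>set (edb_atoms P R). z \<in> atom_vars a)" for z
  proof (cases "\<sigma> z \<in> H")
    case True
    have "\<sigma>' z = subst (Var \<circ> \<pi>) (\<sigma> z)"
    proof (cases "z \<in> atom_vars (rhead R)")
      case False
      then obtain a where "a \<in> open_atoms" "z \<in> atom_vars a" using z(2) by (auto simp: open_atoms_def)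
      then show ?thesis using opens True by blast
    qed (rule heads)
    moreover have "trm_val \<beta> (\<theta> z) = trm_val \<mu> (subst (Var \<circ> \<pi>) (\<sigma> z))"
      using True by (cases "\<sigma> z") (simp_all add: \<theta>_def \<beta>)
    ultimately show ?thesis using \<mu>[OF z(1)] by simp
  next
    case False
    then show ?thesis using \<beta>(2)[of z] by (simp add: \<theta>_def)
  qed
  have val: "trm_val \<beta> (\<theta> z) = \<nu> z" if z: "z \<in> rule_vars R" for z
  proof (rule edbs[OF z])
    show "z \<in> atom_vars (rhead R) \<or> (\<exists>a\<in>set (edb_atoms P R). z \<in> atom_vars a)"
    proof (rule ccontr)
      assume neg: "\<not> ?thesis"
      then obtain a where "a \<in> set (rbody R)" "z \<in> atom_vars a" using z by (auto simp: rule_vars_def)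
      moreover from this have "a \<in> set (idb_atoms P R)" using neg set_idb_edb_atoms[of R P] by blast
      ultimately show False using grd R neg unfolding adornment_groundable_def by blast
    qed
  qed
  have atom_val: "map (trm_val \<beta>) (map (subst \<theta>) (snd a)) = map (trm_val \<nu>) (snd a)"
    if "a \<in> set (atoms_of R)" for a
  proof -
    have "map (trm_val \<beta>) (map (subst \<theta>) (snd a)) = map (trm_val (\<lambda>z. trm_val \<beta> (\<theta> z))) (snd a)"
      by (simp add: trm_val_subst)
    also have "\<dots> = map (trm_val \<nu>) (snd a)"
      using that val by (intro map_trm_val_cong) (auto simp: rule_vars_def atoms_of_def atom_vars_def)
    finally show ?thesis .
  qed
  then have grnd: "ground \<beta> (subst_atom \<theta> a) = ground \<nu> a" if "a \<in> set (atoms_of R)" for a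
    using that by (simp add: ground_eq) (simp add: subst_atom_def)
  have "sat E \<beta> b" if b: "b \<in> set (jedges job)" for b
  proof -
    consider a where "a \<in> open_atoms" "b = batom_of (subst_atom \<theta> a)"
      | V where "V \<in> batom_vars ` rest" "b = subst_batom (Var \<circ> double) (rep V)"
      using b unfolding jedges open_edges_def rest_edges_def by blast
    then show ?thesis
    proof cases
      case 1
      then have a: "a \<in> set (edb_atoms P R)" by (simp add: open_atoms_def)
      then have "a \<in> set (atoms_of R)" by (simp add: atoms_of_def edb_atoms_def)
      from edb[OF a] show ?thesis
        unfolding 1(2) sat_batom_of subst_atom_def fst_conv snd_conv atom_val[OF \<open>a \<in> set (atoms_of R)\<close>] .
    next
      case 2
      then have "rep V \<in> abody \<rho>" using rep by (auto simp: rest_def)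
      then have "sat E \<mu> (subst_batom (Var \<circ> \<pi>) (rep V))" by (intro sat) (simp add: \<pi>(2) abody_rename)
      then show ?thesis unfolding 2(2) sat_rename \<beta> .
    qed
  qed
  moreover have "ground \<beta> (jhead job) = ground \<nu> (rhead R)"
    "map (ground \<beta>) (jidb job) = map (ground \<nu>) (idb_atoms P R)"
    "map (ground \<beta>) (jedb job) = map (ground \<nu>) (edb_atoms P R)"
    using grnd by (auto simp: job_def atoms_of_def idb_atoms_def edb_atoms_def)
  ultimately show ?thesis by blast
qed

end

text \<open>All instances \<open>T\<close> are quantified here because the queries are fixed before
  the instance is known.\<close>

definition jobs_complete :: "('p \<Rightarrow> nat) \<Rightarrow> ('p, 'c) program \<Rightarrow> ('p, 'c) job set \<Rightarrow> bool" where
  "jobs_complete ar P \<J> \<longleftrightarrow> (\<forall>T R \<nu>. edb_instance ar P T \<and> R \<in> P \<and> fst (rhead R) \<in> idb P \<and>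
     (\<forall>a\<in>set (rbody R). ground \<nu> a \<in> least_fixpoint P (facts_of T)) \<longrightarrow>
     (\<exists>J\<in>\<J>. \<exists>\<beta>. (\<forall>b\<in>set (jedges J). sat (relation P (facts_of T)) \<beta> b) \<and>
        ground \<beta> (jhead J) = ground \<nu> (rhead R) \<and>
        map (ground \<beta>) (jidb J) = map (ground \<nu>) (idb_atoms P R) \<and>
        map (ground \<beta>) (jedb J) = map (ground \<nu>) (edb_atoms P R)))"

text \<open>One query for each rule and each class of its adornments. The adornments of a rule share
  its head predicate, so a rule has at most \<open>num_adornments P\<close> classes; this is where
  the first two factors of the time bound come from.\<close>

lemma jobs_exist:
  fixes P :: "('p, 'c) program"
  assumes P: "datalog_program ar P" and grd: "adornment_groundable P"
    and k: "\<forall>r\<in>P. rule_size r \<le> k"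
  shows "\<exists>Js. length Js \<le> num_adornments P * card P \<and>
    (\<forall>J\<in>set Js. job_ok ar P k J \<and> job_rule P J \<and> job_width P J) \<and> jobs_complete ar P (set Js)"
proof -
  define A where "A R = {\<rho>. \<exists>\<sigma>. adorns P R \<sigma> \<rho>}" for R
  define pick where "pick R X = (SOME s. adorns P R (fst s) (snd s) \<and> snd s \<in> X)" for R X
  define J where "J R X = adorned_rule_query.job P R (fst (pick R X)) (snd (pick R X))" for R X
  define \<J> where "\<J> = (\<Union>R\<in>P. J R ` (A R // variants))"
  have finP: "finite P" using P by (simp add: datalog_program_def)
  have finA: "finite (A R // variants)" for R
    by (rule finite_adornment_classes[OF P]) (auto simp: A_def adorns_def)
  have cardA: "card (A R // variants) \<le> num_adornments P" if "R \<in> P" for R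
  proof (cases "A R = {}")
    case False
    then obtain \<rho> where "\<rho> \<in> A R" by blast
    then obtain \<sigma> where s: "adorns P R \<sigma> \<rho>" by (auto simp: A_def)
    then have "good ar P \<rho>" "fst (ahead \<rho>) = fst (rhead R)"
      using good_adornments[OF P] by (auto simp: adorns_def)
    then have q: "fst (rhead R) \<in> idb P" using goodD(1) by metis
    have "A R // variants \<subseteq> {\<rho> \<in> adornments P. fst (ahead \<rho>) = fst (rhead R)} // variants"
      by (auto simp: A_def adorns_def quotient_def)
    then have "card (A R // variants) \<le> card ({\<rho> \<in> adornments P. fst (ahead \<rho>) = fst (rhead R)} // variants)"
      by (intro card_mono finite_adornment_classes[OF P]) auto
    also have "\<dots> \<le> num_adornments P" by (rule card_classes_le[OF P q])
    finally show ?thesis .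
  qed simp
  have fin: "finite \<J>" using finP finA by (simp add: \<J>_def)
  have "card \<J> \<le> (\<Sum>R\<in>P. card (J R ` (A R // variants)))"
    unfolding \<J>_def by (rule card_UN_le[OF finP])
  also have "\<dots> \<le> (\<Sum>R\<in>P. num_adornments P)"
    by (rule sum_mono) (rule order.trans[OF card_image_le[OF finA] cardA])
  finally have card: "card \<J> \<le> num_adornments P * card P" by (simp add: mult.commute)
  have pick: "adorns P R (fst (pick R X)) (snd (pick R X))" "snd (pick R X) \<in> X"
    if X: "X \<in> A R // variants" for R X
  proof -
    obtain \<rho> where r: "\<rho> \<in> A R" "X = variants `` {\<rho>}" using X by (auto elim: quotientE)
    then obtain \<sigma> where "adorns P R \<sigma> \<rho>" by (auto simp: A_def)
    moreover have "\<rho> \<in> X" using r(2) equiv_class_self[OF equiv_variants] by blast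
    ultimately have "\<exists>s. adorns P R (fst s) (snd s) \<and> snd s \<in> X" by (intro exI[of _ "(\<sigma>, \<rho>)"]) simp
    from someI_ex[OF this] show "adorns P R (fst (pick R X)) (snd (pick R X))" "snd (pick R X) \<in> X"
      by (simp_all add: pick_def)
  qed
  have loc: "adorned_rule_query ar P R (fst (pick R X)) (snd (pick R X))"
    if "R \<in> P" "X \<in> A R // variants" for R X
    using that P grd pick by unfold_locales auto
  have ok: "job_ok ar P k j \<and> job_rule P j \<and> job_width P j" if j: "j \<in> \<J>" for j
  proof -
    obtain R X where RX: "R \<in> P" "X \<in> A R // variants" "j = J R X" using j unfolding \<J>_def by blast
    interpret adorned_rule_query ar P R "fst (pick R X)" "snd (pick R X)" by (rule loc[OF RX(1,2)])
    show ?thesis using job_ok[OF k] job_rule job_width by (simp add: RX(3) J_def)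
  qed
  have "jobs_complete ar P \<J>"
    unfolding jobs_complete_def
  proof (intro allI impI, elim conjE)
    fix T R \<nu> assume T: "edb_instance ar P T" and R: "R \<in> P" "fst (rhead R) \<in> idb P"
      and body: "\<forall>a\<in>set (rbody R). ground \<nu> a \<in> least_fixpoint P (facts_of T)"
    obtain \<sigma>' \<rho>' \<mu> where *: "adorns P R \<sigma>' \<rho>'" "\<forall>x\<in>rule_vars R. trm_val \<mu> (\<sigma>' x) = \<nu> x"
      "\<forall>b\<in>abody \<rho>'. sat (relation P (facts_of T)) \<mu> b"
      using rule_instance_adorned[OF P grd T R] body by blast
    define X where "X = variants `` {\<rho>'}"
    have X: "X \<in> A R // variants" using *(1) by (auto simp: X_def A_def intro: quotientI)
    interpret adorned_rule_query ar P R "fst (pick R X)" "snd (pick R X)" by (rule loc[OF R(1) X])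
    have "(\<rho>', snd (pick R X)) \<in> variants" using pick(2)[OF X] by (simp add: X_def)
    then have var: "(snd (pick R X), \<rho>') \<in> variants"
      using equiv_variants by (meson equivE symD)
    have "\<exists>\<beta>. (\<forall>b\<in>set (jedges (J R X)). sat (relation P (facts_of T)) \<beta> b) \<and>
        ground \<beta> (jhead (J R X)) = ground \<nu> (rhead R) \<and>
        map (ground \<beta>) (jidb (J R X)) = map (ground \<nu>) (idb_atoms P R) \<and>
        map (ground \<beta>) (jedb (J R X)) = map (ground \<nu>) (edb_atoms P R)"
      unfolding J_def
    proof (rule complete[OF *(1) var])
      fix a assume "a \<in> set (edb_atoms P R)"
      then show "map (trm_val \<nu>) (snd a) \<in> relation P (facts_of T) (fst a)"
        using body by (auto simp: edb_atoms_def simp flip: ground_relation)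
    qed (use * in auto)
    moreover have "J R X \<in> \<J>" using R(1) X by (auto simp: \<J>_def)
    ultimately show "\<exists>J\<in>\<J>. \<exists>\<beta>. (\<forall>b\<in>set (jedges J). sat (relation P (facts_of T)) \<beta> b) \<and>
        ground \<beta> (jhead J) = ground \<nu> (rhead R) \<and>
        map (ground \<beta>) (jidb J) = map (ground \<nu>) (idb_atoms P R) \<and>
        map (ground \<beta>) (jedb J) = map (ground \<nu>) (edb_atoms P R)" by blast
  qed
  moreover obtain Js where "distinct Js" "set Js = \<J>" using finite_distinct_list[OF fin] by blast
  ultimately show ?thesis using card ok by (metis distinct_card)
qed

section \<open>Hoelder's inequality for fractional covers and the cost of the backtracking
  search\<close>

section \<open>The size of a join\<close>

text \<open>The weighted inequality of arithmetic and geometric means, extended to exponents of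
  total weight above 1: the mean is at most 1, so raising it to a higher power only decreases
  it.\<close>

lemma prod_powr_le_mean:
  fixes p x :: "'e \<Rightarrow> real"
  assumes "finite E" "\<And>e. e \<in> E \<Longrightarrow> 0 < p e \<and> p e \<le> 1" "\<And>e. e \<in> E \<Longrightarrow> 0 \<le> x e" "1 \<le> sum x E"
  shows "(\<Prod>e\<in>E. p e powr x e) \<le> (\<Sum>e\<in>E. x e / sum x E * p e)"
proof -
  define X where "X = sum x E"
  define w where "w e = x e / X" for e
  define m where "m = (\<Sum>e\<in>E. w e * p e)"
  have X: "1 \<le> X" using assms(4) by (simp add: X_def)
  have w: "sum w E = 1" "\<And>e. e \<in> E \<Longrightarrow> 0 \<le> w e"
    using X assms(3) by (auto simp: w_def X_def simp flip: sum_divide_distrib)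
  have "m \<le> (\<Sum>e\<in>E. w e * 1)"
    unfolding m_def using assms(2) w(2) by (intro sum_mono mult_left_mono) auto
  then have m1: "m \<le> 1" using w(1) by simp
  have "\<exists>e0\<in>E. 0 < w e0"
  proof (rule ccontr)
    assume "\<not> ?thesis"
    then have "\<forall>e\<in>E. w e = 0" using w(2) by force
    then show False using w(1) by simp
  qed
  then obtain e0 where e0: "e0 \<in> E" "0 < w e0" by blast
  have "0 < m"
    unfolding m_def using e0 assms(1,2) w(2) by (intro sum_pos2[of _ e0]) (auto simp: less_imp_le)
  \<comment> \<open>Uses \<open>ln t \<le> t - 1\<close> at \<open>t = p e / m\<close>; by the
    choice of \<open>m\<close> the weighted right-hand sides add up to 0.\<close>
  have "(\<Sum>e\<in>E. w e * ln (p e / m)) \<le> (\<Sum>e\<in>E. w e * (p e / m - 1))"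
    using assms(2) w(2) \<open>0 < m\<close> by (intro sum_mono mult_left_mono ln_le_minus_one) auto
  also have "\<dots> = (\<Sum>e\<in>E. w e * p e) / m - sum w E"
    by (simp add: right_diff_distrib sum_subtractf sum_divide_distrib)
  also have "\<dots> = 0" using \<open>0 < m\<close> w(1) by (simp add: m_def)
  finally have "(\<Sum>e\<in>E. w e * ln (p e / m)) \<le> 0" .
  moreover have "(\<Sum>e\<in>E. w e * ln (p e / m)) = (\<Sum>e\<in>E. w e * (ln (p e) - ln m))"
  proof (intro sum.cong refl)
    fix e assume "e \<in> E"
    then have "0 < p e" using assms(2) by blast
    then show "w e * ln (p e / m) = w e * (ln (p e) - ln m)" using \<open>0 < m\<close> by (simp add: ln_div)
  qed
  ultimately have "(\<Sum>e\<in>E. w e * (ln (p e) - ln m)) \<le> 0" by simp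
  then have "(\<Sum>e\<in>E. w e * ln (p e)) \<le> ln m"
    using w(1) by (simp add: right_diff_distrib sum_subtractf flip: sum_distrib_right)
  then have "X * (\<Sum>e\<in>E. w e * ln (p e)) \<le> X * ln m" using X by simp
  \<comment> \<open>Here total weight at least 1 suffices in place of exactly 1, since
    \<open>ln m \<le> 0\<close>.\<close>
  also have "\<dots> \<le> 1 * ln m" using X m1 \<open>0 < m\<close> by (intro mult_right_mono_neg) auto
  finally have "(\<Sum>e\<in>E. x e * ln (p e)) \<le> ln m"
    using X by (simp add: w_def sum_distrib_left)
  then have "exp (\<Sum>e\<in>E. x e * ln (p e)) \<le> m" using \<open>0 < m\<close> by (metis exp_le_cancel_iff exp_ln)
  moreover have "(\<Prod>e\<in>E. p e powr x e) = exp (\<Sum>e\<in>E. x e * ln (p e))"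
    unfolding exp_sum[OF assms(1)] by (intro prod.cong) (auto simp: powr_def dest: assms(2))
  ultimately show ?thesis by (simp add: m_def w_def X_def)
qed

text \<open>Dividing each \<open>F e\<close> by \<open>G e\<close> brings all values into the unit
  interval and all row sums below 1; then the mean inequality is applied for each \<open>z\<close>
  and the sums are exchanged.\<close>

lemma generalized_Hoelder:
  fixes F :: "'e \<Rightarrow> 'z \<Rightarrow> real" and G x :: "'e \<Rightarrow> real"
  assumes "finite E" "finite Z" "\<And>e z. e \<in> E \<Longrightarrow> z \<in> Z \<Longrightarrow> 0 < F e z" "\<And>e. e \<in> E \<Longrightarrow> 0 < G e"
    "\<And>e. e \<in> E \<Longrightarrow> (\<Sum>z\<in>Z. F e z) \<le> G e" "\<And>e. e \<in> E \<Longrightarrow> 0 \<le> x e" "1 \<le> sum x E"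
  shows "(\<Sum>z\<in>Z. \<Prod>e\<in>E. F e z powr x e) \<le> (\<Prod>e\<in>E. G e powr x e)"
proof -
  define p where "p e z = F e z / G e" for e z
  have p: "0 < p e z \<and> p e z \<le> 1" if "e \<in> E" "z \<in> Z" for e z
  proof -
    have "F e z \<le> (\<Sum>z\<in>Z. F e z)"
      using assms(2,3) that by (intro member_le_sum) (auto simp: less_imp_le)
    then show ?thesis using assms(3)[OF that] assms(4,5)[OF that(1)] by (simp add: p_def)
  qed
  have "(\<Sum>z\<in>Z. \<Prod>e\<in>E. p e z powr x e) \<le> (\<Sum>z\<in>Z. \<Sum>e\<in>E. x e / sum x E * p e z)"
    using assms(1,6,7) p by (intro sum_mono prod_powr_le_mean) auto
  also have "\<dots> = (\<Sum>e\<in>E. x e / sum x E * (\<Sum>z\<in>Z. p e z))"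
    by (subst sum.swap) (simp add: sum_distrib_left)
  also have "\<dots> \<le> (\<Sum>e\<in>E. x e / sum x E * 1)"
  proof (intro sum_mono mult_left_mono)
    fix e assume "e \<in> E"
    then show "(\<Sum>z\<in>Z. p e z) \<le> 1"
      using assms(4,5)[of e] by (simp add: p_def flip: sum_divide_distrib)
    show "0 \<le> x e / sum x E" using assms(6,7) \<open>e \<in> E\<close> by simp
  qed
  also have "\<dots> = 1" using assms(7) by (simp flip: sum_divide_distrib)
  finally have 1: "(\<Sum>z\<in>Z. \<Prod>e\<in>E. p e z powr x e) \<le> 1" .
  have "(\<Prod>e\<in>E. F e z powr x e) = (\<Prod>e\<in>E. G e powr x e) * (\<Prod>e\<in>E. p e z powr x e)" if "z \<in> Z" for z
    unfolding prod.distrib[symmetric]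
  proof (intro prod.cong refl)
    fix e assume e: "e \<in> E"
    have "F e z = G e * p e z" using assms(4)[OF e] by (simp add: p_def)
    moreover have "(G e * p e z) powr x e = G e powr x e * p e z powr x e"
      using assms(4)[OF e] p[OF e that] by (simp add: powr_mult)
    ultimately show "F e z powr x e = G e powr x e * p e z powr x e" by simp
  qed
  then have "(\<Sum>z\<in>Z. \<Prod>e\<in>E. F e z powr x e) =
      (\<Prod>e\<in>E. G e powr x e) * (\<Sum>z\<in>Z. \<Prod>e\<in>E. p e z powr x e)"
    by (simp add: sum_distrib_left)
  also have "\<dots> \<le> (\<Prod>e\<in>E. G e powr x e) * 1" using 1 by (intro mult_left_mono prod_nonneg) auto
  finally show ?thesis by simp
qed

definition proj :: "nat list \<Rightarrow> nat set \<Rightarrow> (nat \<Rightarrow> 'a) \<Rightarrow> 'a list" where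
  "proj D W \<alpha> = map \<alpha> (filter (\<lambda>v. v \<in> W) D)"

text \<open>These words are the marked nodes of a trie for \<open>S\<close>; the root, that is the
  empty word, carries no mark.\<close>

definition pfx :: "'a list set \<Rightarrow> 'a list set" where
  "pfx S = {w. w \<noteq> [] \<and> (\<exists>u. w @ u \<in> S)}"

definition exts :: "'a list set \<Rightarrow> 'a list \<Rightarrow> 'a set" where
  "exts X w = {x. w @ [x] \<in> X}"

lemma proj_append: "proj (D @ [v]) W \<alpha> = proj D W \<alpha> @ (if v \<in> W then [\<alpha> v] else [])"
  by (simp add: proj_def)

lemma proj_upd: "v \<notin> set D \<Longrightarrow> proj D W (\<alpha>(v := z)) = proj D W \<alpha>"
  by (auto simp: proj_def)

lemma finite_exts_pfx: "finite S \<Longrightarrow> finite (exts (pfx S) w)"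
proof -
  assume "finite S"
  moreover have "exts (pfx S) w \<subseteq> (\<lambda>s. s ! length w) ` S"
    by (force simp: exts_def pfx_def image_iff nth_append)
  ultimately show ?thesis using finite_surj by blast
qed

locale join =
  fixes Es :: "'e set" and V :: "'e \<Rightarrow> nat set" and S :: "'e \<Rightarrow> 'a list set"
  assumes fin_Es: "finite Es" and fin_S: "\<And>b. b \<in> Es \<Longrightarrow> finite (S b)"
begin

definition edges_at :: "nat \<Rightarrow> 'e set" where "edges_at v = {b \<in> Es. v \<in> V b}"

definition cands :: "nat list \<Rightarrow> (nat \<Rightarrow> 'a) \<Rightarrow> 'e \<Rightarrow> 'a set" where
  "cands D \<alpha> b = exts (pfx (S b)) (proj D (V b) \<alpha>)"

definition common :: "nat list \<Rightarrow> (nat \<Rightarrow> 'a) \<Rightarrow> nat \<Rightarrow> 'a set" where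
  "common D \<alpha> v = {z. \<forall>b\<in>edges_at v. z \<in> cands D \<alpha> b}"

definition min_deg :: "nat list \<Rightarrow> (nat \<Rightarrow> 'a) \<Rightarrow> nat \<Rightarrow> nat" where
  "min_deg D \<alpha> v = Min ((\<lambda>b. card (cands D \<alpha> b)) ` edges_at v)"

text \<open>Cost of the search: \<open>c\<close> for each partial answer that is extended,
  \<open>c'\<close> for each candidate of its cheapest edge, \<open>cb\<close> for each complete
  answer. With the parameters \<open>0 0 1\<close> it counts the complete answers.\<close>

fun join_cost :: "nat \<Rightarrow> nat \<Rightarrow> nat \<Rightarrow> nat list \<Rightarrow> nat list \<Rightarrow> (nat \<Rightarrow> 'a) \<Rightarrow> nat" where
  "join_cost c c' cb D [] \<alpha> = cb"
| "join_cost c c' cb D (v # vs) \<alpha> = c + c' * min_deg D \<alpha> v +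
     (\<Sum>z\<in>common D \<alpha> v. join_cost c c' cb (D @ [v]) vs (\<alpha>(v := z)))"

definition compat :: "nat list \<Rightarrow> (nat \<Rightarrow> 'a) \<Rightarrow> 'e \<Rightarrow> 'a list set" where
  "compat D \<alpha> b = {s \<in> S b. \<exists>u. s = proj D (V b) \<alpha> @ u}"

text \<open>The maximum with 1 also pays for visiting partial answers that some edge rules out.\<close>

definition \<Phi> :: "('e \<Rightarrow> real) \<Rightarrow> nat list \<Rightarrow> (nat \<Rightarrow> 'a) \<Rightarrow> real" where
  "\<Phi> x D \<alpha> = (\<Prod>b\<in>Es. real (max 1 (card (compat D \<alpha> b))) powr x b)"

lemma finite_edges_at: "finite (edges_at v)" using fin_Es by (simp add: edges_at_def)

lemma finite_cands: "b \<in> Es \<Longrightarrow> finite (cands D \<alpha> b)"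
  by (simp add: cands_def finite_exts_pfx fin_S)

lemma finite_common: "b \<in> edges_at v \<Longrightarrow> finite (common D \<alpha> v)"
  by (rule finite_subset[OF _ finite_cands[of b D \<alpha>]]) (auto simp: common_def edges_at_def)

lemma finite_compat: "b \<in> Es \<Longrightarrow> finite (compat D \<alpha> b)"
  by (simp add: compat_def fin_S)

lemma card_cands_le: 
  assumes "b \<in> Es"
  shows "card (cands D \<alpha> b) \<le> card (compat D \<alpha> b)"
proof -
  let ?w = "proj D (V b) \<alpha>"
  have "cands D \<alpha> b \<subseteq> (\<lambda>s. s ! length ?w) ` compat D \<alpha> b"
    by (force simp: cands_def exts_def pfx_def compat_def image_iff nth_append)
  then show ?thesis using surj_card_le finite_compat[OF assms] by blast
qed

text \<open>Different values of \<open>v\<close> select disjoint parts of the compatible tuples. A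
  common candidate extends to a tuple of every edge at \<open>v\<close>, so each part is non-empty
  and the maximum with 1 changes nothing.\<close>

lemma sum_compat_le:
  assumes b: "b \<in> edges_at v" and v: "v \<notin> set D"
  shows "(\<Sum>z\<in>common D \<alpha> v. max 1 (card (compat (D @ [v]) (\<alpha>(v := z)) b))) \<le> card (compat D \<alpha> b)"
proof -
  have bE: "b \<in> Es" "v \<in> V b" using b by (auto simp: edges_at_def)
  have pr: "proj (D @ [v]) (V b) (\<alpha>(v := z)) = proj D (V b) \<alpha> @ [z]" for z
    using bE v by (simp add: proj_append proj_upd)
  have "compat (D @ [v]) (\<alpha>(v := z)) b \<noteq> {}" if "z \<in> common D \<alpha> v" for z
    using that b by (auto simp: common_def cands_def exts_def pfx_def compat_def pr)
  then have "(\<Sum>z\<in>common D \<alpha> v. max 1 (card (compat (D @ [v]) (\<alpha>(v := z)) b))) =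
      (\<Sum>z\<in>common D \<alpha> v. card (compat (D @ [v]) (\<alpha>(v := z)) b))"
    using finite_compat[OF bE(1)] by (intro sum.cong refl) (simp add: max_def card_gt_0_iff Suc_le_eq)
  also have "\<dots> = card (\<Union>z\<in>common D \<alpha> v. compat (D @ [v]) (\<alpha>(v := z)) b)"
    using finite_common[OF b] finite_compat[OF bE(1)]
    by (intro card_UN_disjoint[symmetric] ballI impI) (simp_all, auto simp: compat_def pr)
  also have "\<dots> \<le> card (compat D \<alpha> b)"
    using finite_compat[OF bE(1)] by (intro card_mono) (auto simp: compat_def pr)
  finally show ?thesis .
qed

lemma \<Phi>_ge_1: "(\<And>b. b \<in> Es \<Longrightarrow> 0 \<le> x b) \<Longrightarrow> 1 \<le> \<Phi> x D \<alpha>"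
  unfolding \<Phi>_def by (intro prod_ge_1 ge_one_powr_ge_zero) auto

lemma \<Phi>_split: "\<Phi> x D \<alpha> = (\<Prod>b\<in>edges_at v. real (max 1 (card (compat D \<alpha> b))) powr x b) *
    (\<Prod>b\<in>Es - edges_at v. real (max 1 (card (compat D \<alpha> b))) powr x b)"
  unfolding \<Phi>_def using fin_Es by (subst mult.commute, intro prod.subset_diff) (auto simp: edges_at_def)

text \<open>The potential of a partial answer pays for all of its extensions: edges without
  \<open>v\<close> keep their factors, and for the edges at \<open>v\<close>, of total weight at
  least 1, this is Hoelder's inequality.\<close>

lemma sum_\<Phi>_le:
  assumes x: "\<And>b. b \<in> Es \<Longrightarrow> 0 \<le> x b" "1 \<le> (\<Sum>b\<in>edges_at v. x b)" and v: "v \<notin> set D"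
  shows "(\<Sum>z\<in>common D \<alpha> v. \<Phi> x (D @ [v]) (\<alpha>(v := z))) \<le> \<Phi> x D \<alpha>"
proof -
  have ne: "edges_at v \<noteq> {}" using x(2) by auto
  then obtain b0 where b0: "b0 \<in> edges_at v" by blast
  let ?r = "\<Prod>b\<in>Es - edges_at v. real (max 1 (card (compat D \<alpha> b))) powr x b"
  have same: "compat (D @ [v]) (\<alpha>(v := z)) b = compat D \<alpha> b" if "b \<in> Es - edges_at v" for b z
    using that v by (auto simp: compat_def edges_at_def proj_append proj_upd)
  have "(\<Sum>z\<in>common D \<alpha> v. \<Phi> x (D @ [v]) (\<alpha>(v := z))) = (\<Sum>z\<in>common D \<alpha> v.
      \<Prod>b\<in>edges_at v. real (max 1 (card (compat (D @ [v]) (\<alpha>(v := z)) b))) powr x b) * ?r"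
    unfolding sum_distrib_right
  proof (intro sum.cong refl)
    fix z
    have "(\<Prod>b\<in>Es - edges_at v. real (max 1 (card (compat (D @ [v]) (\<alpha>(v := z)) b))) powr x b) = ?r"
      by (intro prod.cong refl) (simp only: same)
    then show "\<Phi> x (D @ [v]) (\<alpha>(v := z)) =
        (\<Prod>b\<in>edges_at v. real (max 1 (card (compat (D @ [v]) (\<alpha>(v := z)) b))) powr x b) * ?r"
      by (simp only: \<Phi>_split[where v = v])
  qed
  also have "\<dots> \<le> (\<Prod>b\<in>edges_at v. real (max 1 (card (compat D \<alpha> b))) powr x b) * ?r"
  proof (intro mult_right_mono generalized_Hoelder)
    fix e assume e: "e \<in> edges_at v"
    have "(\<Sum>z\<in>common D \<alpha> v. max 1 (card (compat (D @ [v]) (\<alpha>(v := z)) e))) \<le> max 1 (card (compat D \<alpha> e))"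
      using sum_compat_le[OF e v, of \<alpha>] by linarith
    then show "(\<Sum>z\<in>common D \<alpha> v. real (max 1 (card (compat (D @ [v]) (\<alpha>(v := z)) e))))
        \<le> real (max 1 (card (compat D \<alpha> e)))"
      unfolding of_nat_sum[symmetric] of_nat_le_iff .
    show "0 \<le> x e" using x(1) e by (simp add: edges_at_def)
  qed (use finite_edges_at finite_common[OF b0] x(2) in \<open>auto intro!: prod_nonneg\<close>)
  also have "\<dots> = \<Phi> x D \<alpha>" by (simp add: \<Phi>_split[where v = v])
  finally show ?thesis .
qed

text \<open>The minimum is at most the size of each edge at \<open>v\<close>, and the exponents of
  these edges add up to at least 1, so their product dominates it. Degrees up to 1 are separate
  because a higher exponent helps only for a base of at least 1.\<close>

lemma min_deg_le:
  assumes x: "\<And>b. b \<in> Es \<Longrightarrow> 0 \<le> x b" "1 \<le> (\<Sum>b\<in>edges_at v. x b)"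
  shows "real (min_deg D \<alpha> v) \<le> \<Phi> x D \<alpha>"
proof (cases "min_deg D \<alpha> v \<le> 1")
  case True
  then show ?thesis using \<Phi>_ge_1[of x D \<alpha>] x(1) by force
next
  case False
  let ?m = "real (min_deg D \<alpha> v)" and ?g = "\<lambda>b. real (max 1 (card (compat D \<alpha> b))) powr x b"
  have m: "?m \<le> real (max 1 (card (compat D \<alpha> b)))" if "b \<in> edges_at v" for b
  proof -
    have "min_deg D \<alpha> v \<le> card (cands D \<alpha> b)"
      unfolding min_deg_def using finite_edges_at that by (intro Min_le) auto
    also have "\<dots> \<le> card (compat D \<alpha> b)" using that by (intro card_cands_le) (simp add: edges_at_def)
    finally show ?thesis by linarith
  qed
  have "?m powr 1 \<le> ?m powr (\<Sum>b\<in>edges_at v. x b)" using False x(2) by (intro powr_mono) auto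
  also have "\<dots> = (\<Prod>b\<in>edges_at v. ?m powr x b)" using False finite_edges_at by (intro powr_sum) auto
  also have "\<dots> \<le> (\<Prod>b\<in>edges_at v. ?g b)"
    using m x(1) by (intro prod_mono conjI powr_mono2) (auto simp: edges_at_def)
  also have "\<dots> * 1 \<le> (\<Prod>b\<in>edges_at v. ?g b) * (\<Prod>b\<in>Es - edges_at v. ?g b)"
    using x(1) by (intro mult_left_mono prod_ge_1 prod_nonneg ge_one_powr_ge_zero) auto
  also have "\<dots> = \<Phi> x D \<alpha>" by (simp add: \<Phi>_split[where v = v])
  finally show ?thesis by simp
qed

text \<open>The potentials of all partial answers of one level add up to at most the potential at
  the start, so every level costs at most \<open>c + c'\<close> times the latter.\<close>

lemma join_cost_le:
  assumes x: "\<And>b. b \<in> Es \<Longrightarrow> 0 \<le> x b" and cov: "\<And>v. v \<in> set vs \<Longrightarrow> 1 \<le> (\<Sum>b\<in>edges_at v. x b)"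
    and "distinct vs" "set vs \<inter> set D = {}"
  shows "real (join_cost c c' cb D vs \<alpha>) \<le> real (cb + length vs * (c + c')) * \<Phi> x D \<alpha>"
  using cov assms(3,4)
proof (induction vs arbitrary: D \<alpha>)
  case Nil
  have "1 \<le> \<Phi> x D \<alpha>" using \<Phi>_ge_1[of x D \<alpha>] x by blast
  then show ?case by (simp add: mult_le_cancel_left1)
next
  case (Cons v vs)
  note v = Cons.prems(1)[of v, simplified]
  let ?K = "cb + length vs * (c + c')"
  have D: "v \<notin> set D" using Cons.prems by simp
  have "(\<Sum>z\<in>common D \<alpha> v. real (join_cost c c' cb (D @ [v]) vs (\<alpha>(v := z)))) \<le>
      (\<Sum>z\<in>common D \<alpha> v. real ?K * \<Phi> x (D @ [v]) (\<alpha>(v := z)))"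
    using Cons.prems by (intro sum_mono Cons.IH) auto
  also have "\<dots> \<le> real ?K * \<Phi> x D \<alpha>"
    unfolding sum_distrib_left[symmetric] using sum_\<Phi>_le[of x v D \<alpha>] x v D by (intro mult_left_mono) auto
  finally have 1: "(\<Sum>z\<in>common D \<alpha> v. real (join_cost c c' cb (D @ [v]) vs (\<alpha>(v := z)))) \<le> real ?K * \<Phi> x D \<alpha>" .
  have 2: "real c' * real (min_deg D \<alpha> v) \<le> real c' * \<Phi> x D \<alpha>"
    using min_deg_le[of x v D \<alpha>] x v by (intro mult_left_mono) auto
  have 3: "real c * 1 \<le> real c * \<Phi> x D \<alpha>" using \<Phi>_ge_1[of x D \<alpha>] x by (intro mult_left_mono) auto
  from 1 2 3 show ?case by (simp add: algebra_simps)
qed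

lemma \<Phi>_Nil_le:
  assumes x: "\<And>b. b \<in> Es \<Longrightarrow> 0 \<le> x b" and "\<And>b. b \<in> Es \<Longrightarrow> card (S b) \<le> N" "1 \<le> N"
  shows "\<Phi> x [] \<alpha> \<le> real N powr (\<Sum>b\<in>Es. x b)"
proof -
  have "\<Phi> x [] \<alpha> \<le> (\<Prod>b\<in>Es. real N powr x b)"
    unfolding \<Phi>_def
  proof (intro prod_mono conjI powr_mono2)
    fix b assume b: "b \<in> Es"
    have "card (compat [] \<alpha> b) \<le> card (S b)" using fin_S[OF b] by (intro card_mono) (auto simp: compat_def)
    then show "real (max 1 (card (compat [] \<alpha> b))) \<le> real N" using assms(2)[OF b] assms(3) by simp
  qed (use x in auto)
  also have "\<dots> = real N powr (\<Sum>b\<in>Es. x b)" using assms(3) fin_Es by (intro powr_sum[symmetric]) auto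
  finally show ?thesis .
qed

end

text \<open>The cost divided by its constant factor is a number bounded for all covers at once, to
  which \<open>job_width\<close> applies.\<close>

lemma join_cost_width:
  fixes J :: "('p, 'c) job" and S :: "('p, 'c) batom \<Rightarrow> 'a list set"
  assumes W: "job_width P J" and S: "\<And>b. b \<in> set (jedges J) \<Longrightarrow> finite (S b) \<and> card (S b) \<le> N"
    and N: "1 \<le> N" and vs: "distinct vs" "set vs = job_vars J"
  shows "real (join.join_cost (set (jedges J)) batom_vars S c c' cb [] vs \<alpha>) \<le>
    real (cb + length vs * (c + c')) * real N powr ew_program P"
proof -
  interpret join "set (jedges J)" batom_vars S by unfold_locales (use S in auto)
  define K where "K = real (cb + length vs * (c + c'))"
  let ?T = "real (join_cost c c' cb [] vs \<alpha>)"
  have bound: "?T \<le> K * real N powr (\<Sum>b\<in>set (jedges J). x b)" if x: "job_cover J x" for x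
  proof -
    have x0: "\<And>b. b \<in> set (jedges J) \<Longrightarrow> 0 \<le> x b" using x by (simp add: job_cover_def)
    have "?T \<le> K * \<Phi> x [] \<alpha>"
      unfolding K_def using x vs by (intro join_cost_le) (auto simp: job_cover_def edges_at_def)
    also have "\<dots> \<le> K * real N powr (\<Sum>b\<in>set (jedges J). x b)"
      using S N x0 by (intro mult_left_mono \<Phi>_Nil_le) (auto simp: K_def)
    finally show ?thesis .
  qed
  show ?thesis
  \<comment> \<open>A factor 0 cannot be divided out, but then every charge that occurs is 0 and so
    is the cost.\<close>
  proof (cases "K = 0")
    case True
    then have "cb + length vs * (c + c') = 0" unfolding K_def of_nat_eq_0_iff .
    then have "cb = 0" "vs = [] \<or> (c = 0 \<and> c' = 0)" by auto
    then have "join_cost c c' cb D ws \<beta> = 0" if "ws = vs \<or> c = 0 \<and> c' = 0" for D ws \<beta>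
      using that
    proof (induction ws arbitrary: D \<beta>)
      case (Cons w ws)
      then have "c = 0 \<and> c' = 0" by auto
      then show ?case using Cons by simp
    qed simp
    then have "?T = 0" by simp
    then show ?thesis using True by (simp add: K_def)
  next
    case False
    then have K: "0 < K" unfolding K_def using of_nat_0_le_iff less_eq_real_def by metis
    then have "?T / K \<le> real N powr (\<Sum>b\<in>set (jedges J). x b)" if "job_cover J x" for x
      using bound[OF that] by (simp add: divide_le_eq mult.commute)
    then have "?T / K \<le> real N powr ew_program P"
      using W N unfolding job_width_def by (metis One_nat_def of_nat_1 of_nat_le_iff)
    then show ?thesis using K by (simp add: divide_le_eq mult.commute K_def)
  qed
qed

section \<open>A calculus of total correctness in which running time is part of the
  postcondition\<close>

section \<open>Timed execution\<close>

text \<open>Since the postcondition sees the elapsed time, sequential composition just shifts its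
  time argument, as in \<open>Q (t + t')\<close>.\<close>

definition run :: "('p, 'c) tables \<Rightarrow> ('p, 'c) com \<Rightarrow> 'c mem \<Rightarrow> ('p, 'c) fact set \<Rightarrow>
    (nat \<Rightarrow> 'c mem \<Rightarrow> ('p, 'c) fact set \<Rightarrow> bool) \<Rightarrow> bool" where
  "run T c m out Q \<longleftrightarrow> (\<exists>t m' out'. exec T c (m, out) t (m', out') \<and> Q t m' out')"

lemma run_mono:
  "run T c m out Q \<Longrightarrow> (\<And>t m' out'. Q t m' out' \<Longrightarrow> Q' t m' out') \<Longrightarrow> run T c m out Q'"
  unfolding run_def by blast

lemma run_Skip: "Q 0 m out \<Longrightarrow> run T Skip m out Q"
  unfolding run_def by (blast intro: exec.Skip)

lemma run_Assign:
  "Q (1 + sum_list (map exp_cost es) + exp_cost e) (m(map (exp_val T m) es := exp_val T m e)) out \<Longrightarrow>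
   run T (Assign es e) m out Q"
  unfolding run_def by (blast intro: exec.Assign)

lemma run_Emit:
  "map (exp_val T m) es = map Cst cs \<Longrightarrow>
   Q (1 + sum_list (map exp_cost es)) m (insert (p, cs) out) \<Longrightarrow> run T (Emit p es) m out Q"
  unfolding run_def by (blast intro: exec.Emit)

lemma run_Seq:
  "run T c m out (\<lambda>t m' out'. run T c' m' out' (\<lambda>t'. Q (t + t'))) \<Longrightarrow> run T (Seq c c') m out Q"
  unfolding run_def by (blast intro: exec.Seq)

lemma run_If:
  assumes "bexp_val T m b \<Longrightarrow> run T c m out (\<lambda>t. Q (1 + bexp_cost b + t))"
    and "\<not> bexp_val T m b \<Longrightarrow> run T c' m out (\<lambda>t. Q (1 + bexp_cost b + t))"
  shows "run T (If b c c') m out Q"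
proof (cases "bexp_val T m b")
  case True
  then obtain t m' out' where "exec T c (m, out) t (m', out')" "Q (1 + bexp_cost b + t) m' out'"
    using assms(1) by (auto simp: run_def)
  then show ?thesis using True exec.IfTrue[of T "(m, out)" b c t "(m', out')" c'] by (auto simp: run_def)
next
  case False
  then obtain t m' out' where "exec T c' (m, out) t (m', out')" "Q (1 + bexp_cost b + t) m' out'"
    using assms(2) by (auto simp: run_def)
  then show ?thesis using False exec.IfFalse[of T "(m, out)" b c' t "(m', out')" c] by (auto simp: run_def)
qed

lemma run_WhileTrue:
  assumes "bexp_val T m b"
    and "run T c m out (\<lambda>t m' out'. run T (While b c) m' out' (\<lambda>t'. Q (1 + bexp_cost b + t + t')))"
  shows "run T (While b c) m out Q"
proof -
  obtain t m' out' t' m'' out'' where "exec T c (m, out) t (m', out')"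
    "exec T (While b c) (m', out') t' (m'', out'')" "Q (1 + bexp_cost b + t + t') m'' out''"
    using assms(2) by (auto simp: run_def)
  then show ?thesis
    using assms(1) exec.WhileTrue[of T "(m, out)" b c t "(m', out')" t' "(m'', out'')"]
    by (auto simp: run_def)
qed

lemma run_WhileFalse:
  "\<not> bexp_val T m b \<Longrightarrow> Q (1 + bexp_cost b) m out \<Longrightarrow> run T (While b c) m out Q"
  unfolding run_def using exec.WhileFalse[of T "(m, out)" b c] by auto

definition seqC :: "('p, 'c) com list \<Rightarrow> ('p, 'c) com" where
  "seqC cs = foldr Seq cs Skip"

lemma run_seqC:
  assumes "I 0 0 m out"
    and "\<And>i t m out. i < length cs \<Longrightarrow> I i t m out \<Longrightarrow>
      run T (cs ! i) m out (\<lambda>t'. I (Suc i) (t + t'))"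
    and "\<And>t m out. I (length cs) t m out \<Longrightarrow> Q t m out"
  shows "run T (seqC cs) m out Q"
proof -
  have "run T (seqC (drop i cs)) m out (\<lambda>t'. I (length cs) (t + t'))" if "i \<le> length cs" "I i t m out" for i t m out
    using that
  proof (induction "length cs - i" arbitrary: i t m out)
    case 0
    then show ?case by (auto simp: seqC_def intro: run_Skip)
  next
    case (Suc n)
    then have i: "i < length cs" by simp
    have "run T (seqC (drop (Suc i) cs)) m' out' (\<lambda>t''. I (length cs) (t + (t' + t'')))"
      if "I (Suc i) (t + t') m' out'" for t' m' out'
      using Suc.hyps(1)[of "Suc i" "t + t'" m' out'] Suc.hyps(2) that i by (simp add: add.assoc)
    moreover have "seqC (drop i cs) = Seq (cs ! i) (seqC (drop (Suc i) cs))"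
      using i by (simp add: seqC_def flip: Cons_nth_drop_Suc)
    ultimately show ?case
      using run_mono[OF assms(2)[OF i Suc.prems(2)]] by (auto intro!: run_Seq)
  qed
  from this[of 0 0 m out] assms(1,3) show ?thesis by (auto intro: run_mono)
qed

definition lits :: "'c val list \<Rightarrow> ('p, 'c) exp list" where "lits = map Lit"

lemma lits_simps[simp]: "lits [] = []" "lits (v # vs) = Lit v # lits vs" "lits (vs @ ws) = lits vs @ lits ws"
    "map (exp_val T m) (lits vs) = vs" "sum_list (map exp_cost (lits vs)) = length vs"
    "length (lits vs) = length vs"
  by (auto simp: lits_def comp_def sum_list_triv)

definition forC :: "nat \<Rightarrow> ('p, 'c) exp \<Rightarrow> ('p, 'c) com \<Rightarrow> ('p, 'c) com" where
  "forC j n body = Seq (Assign (lits [Num 0, Num j]) (Lit (Num 0)))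
     (While (Less (Cell (lits [Num 0, Num j])) n)
        (Seq body (Assign (lits [Num 0, Num j]) (Succ (Cell (lits [Num 0, Num j]))))))"

text \<open>\<open>I i t m out\<close> speaks of time \<open>t\<close> spent when the counter is
  \<open>i\<close>. The constants are exact: 4 for the initial assignment,
  \<open>12 + exp_cost n\<close> for one test and one increment, \<open>5 + exp_cost n\<close> for
  the final test. The bound \<open>n\<close> is evaluated anew each time, hence the assumption that
  its value stays \<open>N\<close>.\<close>

lemma run_forC:
  assumes start: "I 0 4 (m([Num 0, Num j] := Num 0)) out"
    and bound: "\<And>i t m out. i \<le> N \<Longrightarrow> I i t m out \<Longrightarrow> m [Num 0, Num j] = Num i \<Longrightarrow> exp_val T m n = Num N"
    and step: "\<And>i t m out. i < N \<Longrightarrow> I i t m out \<Longrightarrow> m [Num 0, Num j] = Num i \<Longrightarrow>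
      run T body m out (\<lambda>t' m' out'. m' [Num 0, Num j] = Num i \<and>
        I (Suc i) (t + (12 + exp_cost n) + t') (m'([Num 0, Num j] := Num (Suc i))) out')"
    and fin: "\<And>t m out. I N t m out \<Longrightarrow> Q (t + (5 + exp_cost n)) m out"
  shows "run T (forC j n body) m out Q"
proof -
  let ?W = "While (Less (Cell (lits [Num 0, Num j])) n)
        (Seq body (Assign (lits [Num 0, Num j]) (Succ (Cell (lits [Num 0, Num j])))))"
  have "run T ?W m out (\<lambda>t'. Q (t + t'))" if "i \<le> N" "I i t m out" "m [Num 0, Num j] = Num i" for i t m out
    using that
  proof (induction "N - i" arbitrary: i t m out)
    case 0
    then have "i = N" by simp
    with 0 have "\<not> bexp_val T m (Less (Cell (lits [Num 0, Num j])) n)" using bound[of N t m out] by simp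
    then show ?case
      using fin[of t m out] 0 \<open>i = N\<close> by (intro run_WhileFalse) (simp_all add: numeral_eq_Suc)
  next
    case (Suc d)
    then have i: "i < N" by simp
    have b: "bexp_val T m (Less (Cell (lits [Num 0, Num j])) n)"
      using bound[of i t m out] Suc.prems i by simp
    have *: "run T ?W (m'([Num 0, Num j] := Num (Suc i))) out' (\<lambda>t''. Q (t + (12 + exp_cost n) + t' + t''))"
      if "I (Suc i) (t + (12 + exp_cost n) + t') (m'([Num 0, Num j] := Num (Suc i))) out'" for t' m' out'
      using Suc.hyps(1)[of "Suc i"] Suc.hyps(2) that i by simp
    show ?case
    proof (rule run_WhileTrue[OF b], rule run_Seq, rule run_mono[OF step[OF i Suc.prems(2,3)]])
      fix t' m' out'
      assume A: "m' [Num 0, Num j] = Num i \<and> I (Suc i) (t + (12 + exp_cost n) + t') (m'([Num 0, Num j] := Num (Suc i))) out'"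
      show "run T (Assign (lits [Num 0, Num j]) (Succ (Cell (lits [Num 0, Num j])))) m' out'
         (\<lambda>t'a m' out'. run T ?W m' out'
            (\<lambda>t'b. Q (t + (1 + bexp_cost (Less (Cell (lits [Num 0, Num j])) n) + (t' + t'a) + t'b))))"
        using *[of t' m' out'] A by (intro run_Assign) (simp add: algebra_simps numeral_eq_Suc)
    qed
  qed
  from this[of 0 4 "m([Num 0, Num j] := Num 0)" out] start show ?thesis
    unfolding forC_def by (intro run_Seq run_Assign) (simp add: numeral_eq_Suc)
qed

definition conjB :: "('p, 'c) bexp list \<Rightarrow> ('p, 'c) bexp" where
  "conjB bs = foldr And bs (Eq (Lit (Num 0)) (Lit (Num 0)))"

lemma conjB_val[simp]: "bexp_val T m (conjB bs) \<longleftrightarrow> (\<forall>b\<in>set bs. bexp_val T m b)"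
  by (induction bs) (auto simp: conjB_def)

lemma conjB_cost: "(\<And>b. b \<in> set bs \<Longrightarrow> bexp_cost b \<le> K) \<Longrightarrow> bexp_cost (conjB bs) \<le> 3 + length bs * (1 + K)"
  by (induction bs) (force simp: conjB_def)+

lemma sum_list_le: "(\<And>x. x \<in> set xs \<Longrightarrow> f x \<le> K) \<Longrightarrow> sum_list (map f xs) \<le> length xs * (K::nat)"
  by (induction xs) force+

text \<open>The first component of an address tells what the cell is used for: 0 loop counters,
  1 query variables, 2 tries of the queries, 5 marks for the EDB facts of the program, 6 clauses,
  8 watch lists (another trie), 10 marks for derived atoms, 11 the queue, 12 scalars.\<close>

definition frame :: "nat set \<Rightarrow> 'c mem \<Rightarrow> 'c mem \<Rightarrow> bool" where
  "frame X m m' \<longleftrightarrow> (\<forall>n r. n \<notin> X \<longrightarrow> m' (Num n # r) = m (Num n # r))"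

lemma frame_refl[simp]: "frame X m m"
  by (simp add: frame_def)

lemma frame_trans: "frame X m m' \<Longrightarrow> frame X m' m'' \<Longrightarrow> frame X m m''"
  by (simp add: frame_def)

lemma frame_mono: "frame X m m' \<Longrightarrow> X \<subseteq> Y \<Longrightarrow> frame Y m m'"
  by (auto simp: frame_def)

lemma frameD: "frame X m m' \<Longrightarrow> n \<notin> X \<Longrightarrow> m' (Num n # r) = m (Num n # r)"
  by (simp add: frame_def)

lemma frame_upd: "n \<in> X \<Longrightarrow> frame X m m' \<Longrightarrow> frame X m (m'(Num n # r := v))"
  by (auto simp: frame_def)

text \<open>Arguments passed to a command are evaluated several times while the command writes to
  memory; this says that writing in the areas \<open>X\<close> does not change their values.\<close>

definition indep :: "('p, 'c) tables \<Rightarrow> nat set \<Rightarrow> ('p, 'c) exp \<Rightarrow> bool" where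
  "indep T X e \<longleftrightarrow> (\<forall>m m'. frame X m m' \<longrightarrow> exp_val T m' e = exp_val T m e)"

lemma indep_map:
  "(\<And>e. e \<in> set es \<Longrightarrow> indep T X e) \<Longrightarrow> frame X m m' \<Longrightarrow> map (exp_val T m') es = map (exp_val T m) es"
  by (auto simp: indep_def)

lemma indep_Lit[simp]: "indep T X (Lit v)" by (simp add: indep_def)

lemma indep_Cell: "n \<notin> X \<Longrightarrow> (\<And>e. e \<in> set es \<Longrightarrow> indep T X e) \<Longrightarrow> indep T X (Cell (Lit (Num n) # es))"
  unfolding indep_def by (auto simp: frame_def) (metis (no_types, lifting) map_eq_conv)

lemma indep_Comp: "indep T X e \<Longrightarrow> indep T X (Comp p e j)"
  by (simp add: indep_def)

section \<open>Tries in memory, with membership tests and enumeration of the one-letter extensions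
  of a word\<close>

section \<open>Tries\<close>

text \<open>Below \<open>pre\<close>, the subtrees 0, 1 and 2 hold a mark for every node \<open>w \<in> X\<close> and, for every
  word, the number of its children and the list of them.\<close>

definition trie :: "'c mem \<Rightarrow> 'c val list \<Rightarrow> 'c val list set \<Rightarrow> bool" where
  "trie m pre X \<longleftrightarrow> (\<forall>w. m (pre @ Num 0 # w) = Num (if w \<in> X then 1 else 0)) \<and>
     (\<forall>w. \<exists>xs. distinct xs \<and> set xs = exts X w \<and> m (pre @ Num 1 # w) = Num (length xs) \<and>
        (\<forall>i<length xs. m (pre @ Num 2 # w @ [Num i]) = xs ! i))"

lemma trie_cong: "trie m pre X \<Longrightarrow> (\<And>r. m' (pre @ r) = m (pre @ r)) \<Longrightarrow> trie m' pre X"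
  by (simp add: trie_def)

lemma trie_frame: "trie m (Num n # pre) X \<Longrightarrow> frame Y m m' \<Longrightarrow> n \<notin> Y \<Longrightarrow> trie m' (Num n # pre) X"
  by (erule trie_cong) (simp add: frame_def)

lemma trie_empty: "(\<And>r. m (pre @ r) = Num 0) \<Longrightarrow> trie m pre {}"
  by (simp add: trie_def exts_def)

text \<open>Finer than \<open>frame\<close>: it separates tries that live in the same area.\<close>

definition under :: "'c val list \<Rightarrow> 'c mem \<Rightarrow> 'c mem \<Rightarrow> bool" where
  "under pre m m' \<longleftrightarrow> (\<forall>a. (\<forall>r. a \<noteq> pre @ r) \<longrightarrow> m' a = m a)"

lemma under_refl[simp]: "under pre m m" by (simp add: under_def)

lemma under_trans: "under pre m m' \<Longrightarrow> under pre m' m'' \<Longrightarrow> under pre m m''"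
  by (simp add: under_def)

lemma under_frame: "under (Num n # pre) m m' \<Longrightarrow> frame {n} m m'"
  by (auto simp: under_def frame_def)

text \<open>The mark is tested before anything is appended, so that the list of children has no
  repetitions and its length is the degree of the node.\<close>

definition addN :: "'c val list \<Rightarrow> ('p, 'c) exp list \<Rightarrow> ('p, 'c) exp \<Rightarrow> ('p, 'c) com" where
  "addN pre ws e = If (Eq (Cell (lits pre @ Lit (Num 0) # ws @ [e])) (Lit (Num 1))) Skip
     (Seq (Assign (lits pre @ Lit (Num 0) # ws @ [e]) (Lit (Num 1)))
     (Seq (Assign (lits pre @ Lit (Num 2) # ws @ [Cell (lits pre @ Lit (Num 1) # ws)]) e)
        (Assign (lits pre @ Lit (Num 1) # ws) (Succ (Cell (lits pre @ Lit (Num 1) # ws))))))"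

lemma trie_insert:
  assumes "trie m pre X" "w @ [v] \<notin> X" "m (pre @ Num 1 # w) = Num l"
  shows "trie (m(pre @ Num 0 # w @ [v] := Num 1, pre @ Num 2 # w @ [Num l] := v,
      pre @ Num 1 # w := Num (Suc l))) pre (insert (w @ [v]) X)"
    (is "trie ?m pre ?X")
  unfolding trie_def
proof (intro conjI allI)
  fix u
  show "?m (pre @ Num 0 # u) = Num (if u \<in> ?X then 1 else 0)"
    using assms(1) by (simp add: trie_def)
  obtain xs where xs: "distinct xs" "set xs = exts X u" "m (pre @ Num 1 # u) = Num (length xs)"
    "\<forall>i<length xs. m (pre @ Num 2 # u @ [Num i]) = xs ! i"
    using assms(1) unfolding trie_def by blast
  show "\<exists>xs. distinct xs \<and> set xs = exts ?X u \<and> ?m (pre @ Num 1 # u) = Num (length xs) \<and>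
      (\<forall>i<length xs. ?m (pre @ Num 2 # u @ [Num i]) = xs ! i)"
  proof (cases "u = w")
    case True
    have "l = length xs" using xs(3) assms(3) True by simp
    then show ?thesis
      using xs assms(2) True
      by (intro exI[of _ "xs @ [v]"]) (auto simp: exts_def nth_append)
  next
    case False
    then have "exts ?X u = exts X u" by (auto simp: exts_def)
    then show ?thesis using xs False by (intro exI[of _ xs]) auto
  qed
qed

lemma run_addN:
  assumes X: "trie m (Num n # pre) X" and ind: "\<And>e'. e' \<in> set (e # ws) \<Longrightarrow> indep T {n} e'"
  shows "run T (addN (Num n # pre) ws e) m out (\<lambda>t m' out'.
    t \<le> 17 + 6 * Suc (length pre) + 6 * sum_list (map exp_cost ws) + 3 * exp_cost e \<and> out' = out \<and>
    under (Num n # pre) m m' \<and> trie m' (Num n # pre) (insert (map (exp_val T m) ws @ [exp_val T m e]) X))"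
proof -
  define w where "w = map (exp_val T m) ws"
  define v where "v = exp_val T m e"
  let ?p = "Num n # pre"
  have val: "map (exp_val T m') ws = w" "exp_val T m' e = v" if "frame {n} m m'" for m'
    using indep_map[of ws T "{n}" m m'] ind that by (auto simp: w_def v_def indep_def)
  have mark: "bexp_val T m (Eq (Cell (lits ?p @ Lit (Num 0) # ws @ [e])) (Lit (Num 1))) \<longleftrightarrow> w @ [v] \<in> X"
    using X val[of m] by (auto simp: trie_def)
  obtain l where l: "m (?p @ Num 1 # w) = Num l" using X unfolding trie_def by blast
  define m1 where "m1 = m(?p @ Num 0 # w @ [v] := Num 1)"
  define m2 where "m2 = m1(?p @ Num 2 # w @ [Num l] := v)"
  define m3 where "m3 = m2(?p @ Num 1 # w := Num (Suc l))"
  have fr: "frame {n} m m1" "frame {n} m m2" by (simp_all add: m1_def m2_def frame_upd)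
  have l12: "m1 (?p @ Num 1 # w) = Num l" "m2 (?p @ Num 1 # w) = Num l" using l by (simp_all add: m1_def m2_def)
  have un: "under ?p m m3" by (auto simp: under_def m1_def m2_def m3_def)
  show ?thesis
    unfolding addN_def
  proof (rule run_If)
    assume "bexp_val T m (Eq (Cell (lits ?p @ Lit (Num 0) # ws @ [e])) (Lit (Num 1)))"
    then have "insert (w @ [v]) X = X" using mark by auto
    then show "run T Skip m out (\<lambda>t m' out'. 1 + bexp_cost (Eq (Cell (lits ?p @ Lit (Num 0) # ws @ [e])) (Lit (Num 1))) + t
        \<le> 17 + 6 * Suc (length pre) + 6 * sum_list (map exp_cost ws) + 3 * exp_cost e \<and> out' = out \<and>
        under ?p m m' \<and> trie m' ?p (insert (map (exp_val T m) ws @ [exp_val T m e]) X))"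
      using X by (intro run_Skip) (simp add: w_def v_def)
  next
    assume "\<not> bexp_val T m (Eq (Cell (lits ?p @ Lit (Num 0) # ws @ [e])) (Lit (Num 1)))"
    then have "w @ [v] \<notin> X" using mark by auto
    then have tr: "trie m3 ?p (insert (w @ [v]) X)"
      using trie_insert[OF X _ l] by (simp add: m1_def m2_def m3_def)
    have e1: "m(map (exp_val T m) (lits ?p @ Lit (Num 0) # ws @ [e]) := exp_val T m (Lit (Num 1))) = m1"
      using val[of m] by (simp add: m1_def)
    have e2: "m1(map (exp_val T m1) (lits ?p @ Lit (Num 2) # ws @ [Cell (lits ?p @ Lit (Num 1) # ws)]) := exp_val T m1 e) = m2"
      using val[OF fr(1)] l12 by (simp add: m2_def)
    have e3: "m2(map (exp_val T m2) (lits ?p @ Lit (Num 1) # ws) := exp_val T m2 (Succ (Cell (lits ?p @ Lit (Num 1) # ws)))) = m3"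
      using val[OF fr(2)] l12 by (simp add: m3_def)
    show "run T (Seq (Assign (lits ?p @ Lit (Num 0) # ws @ [e]) (Lit (Num 1)))
       (Seq (Assign (lits ?p @ Lit (Num 2) # ws @ [Cell (lits ?p @ Lit (Num 1) # ws)]) e)
        (Assign (lits ?p @ Lit (Num 1) # ws) (Succ (Cell (lits ?p @ Lit (Num 1) # ws)))))) m out
      (\<lambda>t m' out'. 1 + bexp_cost (Eq (Cell (lits ?p @ Lit (Num 0) # ws @ [e])) (Lit (Num 1))) + t
        \<le> 17 + 6 * Suc (length pre) + 6 * sum_list (map exp_cost ws) + 3 * exp_cost e \<and> out' = out \<and>
        under ?p m m' \<and> trie m' ?p (insert (map (exp_val T m) ws @ [exp_val T m e]) X))"
      apply (intro run_Seq run_Assign)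
      unfolding e1 e2 e3
      using un tr by (simp add: w_def v_def)
  qed
qed

fun insW :: "'c val list \<Rightarrow> ('p, 'c) exp list \<Rightarrow> ('p, 'c) exp list \<Rightarrow> ('p, 'c) com" where
  "insW pre ws [] = Skip"
| "insW pre ws (e # es) = Seq (addN pre ws e) (insW pre (ws @ [e]) es)"

lemma pfx_insert: "pfx (insert s S) = pfx {s} \<union> pfx S"
  by (auto simp: pfx_def)

lemma pfx_Cons: "pfx {v # s} = insert [v] ((#) v ` pfx {s})"
proof (intro equalityI subsetI)
  fix w assume "w \<in> pfx {v # s}"
  then obtain u where "w \<noteq> []" "w @ u = v # s" by (auto simp: pfx_def)
  then obtain w' where "w = v # w'" "w' @ u = s" by (cases w) auto
  then show "w \<in> insert [v] ((#) v ` pfx {s})" by (cases "w' = []") (auto simp: pfx_def)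
qed (auto simp: pfx_def)

text \<open>\<open>ws\<close> is the part of the word that has been descended already. Each letter
  adds one node, so in the end all prefixes that go beyond \<open>ws\<close> are marked.\<close>

lemma run_insW:
  assumes "trie m (Num n # pre) X" "\<And>e. e \<in> set (ws @ es) \<Longrightarrow> indep T {n} e \<and> exp_cost e \<le> K"
  shows "run T (insW (Num n # pre) ws es) m out (\<lambda>t m' out'.
    t \<le> length es * (23 + 6 * length pre + 6 * K * length (ws @ es) + 3 * K) \<and> out' = out \<and>
    under (Num n # pre) m m' \<and>
    trie m' (Num n # pre) ((@) (map (exp_val T m) ws) ` pfx {map (exp_val T m) es} \<union> X))"
  using assms
proof (induction es arbitrary: m X ws out)
  case Nil
  then show ?case by (auto simp: pfx_def intro!: run_Skip)
next
  case (Cons e es)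
  let ?p = "Num n # pre" and ?B = "23 + 6 * length pre + 6 * K * length (ws @ e # es) + 3 * K"
  have ind: "indep T {n} e'" if "e' \<in> set (ws @ e # es)" for e' using Cons.prems(2)[OF that] by blast
  have cost: "sum_list (map exp_cost ws) \<le> length ws * K"
    using Cons.prems(2) by (intro sum_list_le) auto
  have ce: "exp_cost e \<le> K" using Cons.prems(2)[of e] by simp
  have c1: "17 + 6 * Suc (length pre) + 6 * sum_list (map exp_cost ws) + 3 * exp_cost e \<le> ?B"
    using cost ce by (simp add: algebra_simps)
  show ?case
    unfolding insW.simps
  proof (rule run_Seq, rule run_mono[OF run_addN[where ws = ws and e = e, OF Cons.prems(1)]])
    show "indep T {n} e'" if "e' \<in> set (e # ws)" for e' using that ind by auto
    fix t m' out'
    assume A: "t \<le> 17 + 6 * Suc (length pre) + 6 * sum_list (map exp_cost ws) + 3 * exp_cost e \<and> out' = out \<and>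
      under ?p m m' \<and> trie m' ?p (insert (map (exp_val T m) ws @ [exp_val T m e]) X)"
    then have fr: "frame {n} m m'" using under_frame by blast
    have val: "exp_val T m' e' = exp_val T m e'" if "e' \<in> set (ws @ e # es)" for e'
      using ind[OF that] fr by (simp add: indep_def)
    then have vals: "map (exp_val T m') (ws @ [e]) = map (exp_val T m) ws @ [exp_val T m e]"
      "map (exp_val T m') es = map (exp_val T m) es" by auto
    show "run T (insW ?p (ws @ [e]) es) m' out' (\<lambda>t' m'' out''. t + t' \<le> length (e # es) * ?B \<and> out'' = out \<and>
        under ?p m m'' \<and> trie m'' ?p ((@) (map (exp_val T m) ws) ` pfx {map (exp_val T m) (e # es)} \<union> X))"
    proof (rule run_mono[OF Cons.IH])
      show "trie m' ?p (insert (map (exp_val T m) ws @ [exp_val T m e]) X)" using A by blast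
      show "indep T {n} e' \<and> exp_cost e' \<le> K" if "e' \<in> set ((ws @ [e]) @ es)" for e'
        using that Cons.prems(2) by auto
      fix t' m'' out''
      assume B: "t' \<le> length es * (23 + 6 * length pre + 6 * K * length ((ws @ [e]) @ es) + 3 * K) \<and>
        out'' = out' \<and> under ?p m' m'' \<and> trie m'' ?p ((@) (map (exp_val T m') (ws @ [e])) `
          pfx {map (exp_val T m') es} \<union> insert (map (exp_val T m) ws @ [exp_val T m e]) X)"
      have "(@) (map (exp_val T m') (ws @ [e])) ` pfx {map (exp_val T m') es} \<union>
          insert (map (exp_val T m) ws @ [exp_val T m e]) X =
        (@) (map (exp_val T m) ws) ` pfx {map (exp_val T m) (e # es)} \<union> X"
        unfolding vals list.map(2) pfx_Cons by (auto simp: image_image)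
      moreover have "t + t' \<le> length (e # es) * ?B"
        using A B c1 by auto
      ultimately show "t + t' \<le> length (e # es) * ?B \<and> out'' = out \<and>
        under ?p m m'' \<and> trie m'' ?p ((@) (map (exp_val T m) ws) ` pfx {map (exp_val T m) (e # es)} \<union> X)"
        using A B under_trans by metis
    qed
  qed
qed

lemma run_insert_word:
  assumes "trie m (Num n # pre) (pfx S)" "\<And>e. e \<in> set es \<Longrightarrow> indep T {n} e \<and> exp_cost e \<le> K"
  shows "run T (insW (Num n # pre) [] es) m out (\<lambda>t m' out'.
    t \<le> length es * (23 + 6 * length pre + 6 * K * length es + 3 * K) \<and> out' = out \<and>
    under (Num n # pre) m m' \<and> trie m' (Num n # pre) (pfx (insert (map (exp_val T m) es) S)))"
proof (rule run_mono[OF run_insW[where ws = "[]" and es = es, OF assms(1)]])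
  fix t m' out'
  assume "t \<le> length es * (23 + 6 * length pre + 6 * K * length ([] @ es) + 3 * K) \<and> out' = out \<and>
      under (Num n # pre) m m' \<and>
      trie m' (Num n # pre) ((@) (map (exp_val T m) []) ` pfx {map (exp_val T m) es} \<union> pfx S)"
  moreover have "(@) [] ` A = A" for A :: "'b val list set" by (auto simp: image_iff)
  ultimately show "t \<le> length es * (23 + 6 * length pre + 6 * K * length es + 3 * K) \<and> out' = out \<and>
    under (Num n # pre) m m' \<and> trie m' (Num n # pre) (pfx (insert (map (exp_val T m) es) S))"
    by (simp add: pfx_insert[of _ S])
qed (use assms(2) in auto)

section \<open>The compiled join: the answers it visits and the time it takes\<close>

section \<open>Generic join on tries\<close>

definition varE :: "nat \<Rightarrow> ('p, 'c) exp" where "varE v = Cell (lits [Num 1, Num v])"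

definition prefixE :: "nat list \<Rightarrow> ('p, 'c) batom \<Rightarrow> ('p, 'c) exp list" where
  "prefixE D b = map varE (filter (\<lambda>v. v \<in> batom_vars b) D)"

definition countE :: "(('p, 'c) batom \<Rightarrow> 'c val list) \<Rightarrow> nat list \<Rightarrow> ('p, 'c) batom \<Rightarrow> ('p, 'c) exp" where
  "countE tp D b = Cell (lits (Num 2 # tp b) @ Lit (Num 1) # prefixE D b)"

definition markE :: "(('p, 'c) batom \<Rightarrow> 'c val list) \<Rightarrow> nat list \<Rightarrow> nat \<Rightarrow> ('p, 'c) batom \<Rightarrow> ('p, 'c) exp" where
  "markE tp D v b = Cell (lits (Num 2 # tp b) @ Lit (Num 0) # prefixE D b @ [varE v])"

definition entryE :: "(('p, 'c) batom \<Rightarrow> 'c val list) \<Rightarrow> nat list \<Rightarrow> nat \<Rightarrow> ('p, 'c) batom \<Rightarrow> ('p, 'c) exp" where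
  "entryE tp D v b = Cell (lits (Num 2 # tp b) @ Lit (Num 2) # prefixE D b @ [Cell (lits [Num 0, Num (10 + v)])])"

text \<open>A cascade that runs the first alternative whose test succeeds. It branches on the
  cheapest edge, which could not be selected through a memory cell because edges are fixed in the
  code.\<close>

definition chainC :: "('b \<Rightarrow> ('p, 'c) bexp) \<Rightarrow> ('b \<Rightarrow> ('p, 'c) com) \<Rightarrow> 'b list \<Rightarrow> ('p, 'c) com" where
  "chainC test c bs = foldr (\<lambda>b rest. If (test b) (c b) rest) bs Skip"

text \<open>The loop over the candidates for a variable is duplicated for every edge that may offer the
  fewest of them; the size of the code does not count.\<close>

fun joinC :: "(('p, 'c) batom \<Rightarrow> 'c val list) \<Rightarrow> ('p, 'c) batom list \<Rightarrow> nat list \<Rightarrow> nat list \<Rightarrow>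
    ('p, 'c) com \<Rightarrow> ('p, 'c) com" where
  "joinC tp es D [] body = body"
| "joinC tp es D (v # vs) body =
     chainC (\<lambda>b. conjB (map (\<lambda>b'. Not (Less (countE tp D b') (countE tp D b))) (filter (\<lambda>b. v \<in> batom_vars b) es)))
       (\<lambda>b. forC (10 + v) (countE tp D b) (Seq (Assign (lits [Num 1, Num v]) (entryE tp D v b))
          (If (conjB (map (\<lambda>b'. Eq (markE tp D v b') (Lit (Num 1))) (filter (\<lambda>b. v \<in> batom_vars b) es)))
            (joinC tp es (D @ [v]) vs body) Skip)))
       (filter (\<lambda>b. v \<in> batom_vars b) es)"

lemma run_chainC:
  assumes "\<exists>b\<in>set bs. bexp_val T m (test b)" "\<And>b. b \<in> set bs \<Longrightarrow> bexp_cost (test b) \<le> K"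
    and "\<And>b t0. b \<in> set bs \<Longrightarrow> bexp_val T m (test b) \<Longrightarrow> t0 \<le> length bs * (1 + K) \<Longrightarrow>
      run T (c b) m out (\<lambda>t. Q (t0 + t))"
  shows "run T (chainC test c bs) m out Q"
  using assms
proof (induction bs arbitrary: Q)
  case (Cons b bs)
  have cost: "1 + bexp_cost (test b) \<le> 1 + K" using Cons.prems(2)[of b] by simp
  show ?case
    unfolding chainC_def foldr.simps comp_def
  proof (rule run_If)
    assume "bexp_val T m (test b)"
    then show "run T (c b) m out (\<lambda>t. Q (1 + bexp_cost (test b) + t))"
      using Cons.prems(3)[of b "1 + bexp_cost (test b)"] cost by simp
  next
    assume neg: "\<not> bexp_val T m (test b)"
    have "run T (chainC test c bs) m out (\<lambda>t. Q (1 + bexp_cost (test b) + t))"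
    proof (rule Cons.IH)
      show "\<exists>b\<in>set bs. bexp_val T m (test b)" using Cons.prems(1) neg by auto
      show "bexp_cost (test b') \<le> K" if "b' \<in> set bs" for b' using that Cons.prems(2) by simp
      show "run T (c b') m out (\<lambda>t. Q (1 + bexp_cost (test b) + (t0 + t)))"
        if "b' \<in> set bs" "bexp_val T m (test b')" "t0 \<le> length bs * (1 + K)" for b' t0
      proof -
        have "1 + bexp_cost (test b) + t0 \<le> length (b # bs) * (1 + K)" using that(3) cost by simp
        with Cons.prems(3)[of b' "1 + bexp_cost (test b) + t0"] that show ?thesis by (simp add: add.assoc)
      qed
    qed
    then show "run T (foldr (\<lambda>b. If (test b) (c b)) bs Skip) m out (\<lambda>t. Q (1 + bexp_cost (test b) + t))"
      by (simp add: chainC_def)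
  qed
qed simp

text \<open>For \<open>n\<close> edges and \<open>nv\<close> variables: up to \<open>n\<close> tests
  in the cascade, each comparing up to \<open>n\<close> pairs of counts, and
  \<open>14 + 3 * nv\<close> for entering and leaving the loop.\<close>

definition level_cost :: "nat \<Rightarrow> nat \<Rightarrow> nat" where
  "level_cost n nv = n * (1 + (3 + n * (3 + 2 * (5 + 3 * nv)))) + 14 + 3 * nv"

text \<open>One iteration: the loop overhead, storing the candidate, and testing its mark in up to
  \<open>n\<close> edges.\<close>

definition cand_cost :: "nat \<Rightarrow> nat \<Rightarrow> nat" where
  "cand_cost n nv = 32 + 6 * nv + n * (11 + 3 * nv)"

definition val_of :: "'c mem \<Rightarrow> nat \<Rightarrow> 'c val" where "val_of m v = m [Num 1, Num v]"

lemma prefixE_val: "map (exp_val T m) (prefixE D b) = proj D (batom_vars b) (val_of m)"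
  by (simp add: prefixE_def proj_def val_of_def varE_def comp_def)

lemma prefixE_cost: fixes b :: "('p, 'c) batom" shows "sum_list (map exp_cost (prefixE D b)) \<le> 3 * length D"
proof -
  have "sum_list (map exp_cost (prefixE D b)) = 3 * length (filter (\<lambda>v. v \<in> batom_vars b) D)"
    by (induction D) (auto simp: prefixE_def varE_def)
  then show ?thesis by (simp add: le_trans[OF length_filter_le])
qed

lemma countE_cost: "exp_cost (countE tp D b) \<le> 3 + length (tp b) + 3 * length D"
  using prefixE_cost[of D b] by (simp add: countE_def)

lemma markE_cost: "exp_cost (markE tp D v b) \<le> 6 + length (tp b) + 3 * length D"
  using prefixE_cost[of D b] by (simp add: markE_def varE_def)

lemma entryE_cost: "exp_cost (entryE tp D v b) \<le> 6 + length (tp b) + 3 * length D"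
  using prefixE_cost[of D b] by (simp add: entryE_def)

lemma proj_cong: "(\<And>v. v \<in> set D \<Longrightarrow> \<alpha> v = \<beta> v) \<Longrightarrow> proj D W \<alpha> = proj D W \<beta>"
  by (simp add: proj_def)

context join
begin

text \<open>An edge without any variable in \<open>D\<close> projects to the empty word, which is
  not in \<open>pfx\<close> and hence is allowed explicitly.\<close>

definition admissible :: "nat list \<Rightarrow> (nat \<Rightarrow> 'a) \<Rightarrow> bool" where
  "admissible D \<alpha> \<longleftrightarrow> (\<forall>b\<in>Es. proj D (V b) \<alpha> \<in> insert [] (pfx (S b)))"

lemma cands_cong:
  assumes "\<And>v. v \<in> set D \<Longrightarrow> \<alpha> v = \<beta> v"
  shows "cands D \<alpha> b = cands D \<beta> b"
  using proj_cong[of D \<alpha> \<beta>, OF assms] by (simp add: cands_def)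

lemma join_cost_cong:
  "(\<And>v. v \<in> set D \<Longrightarrow> \<alpha> v = \<beta> v) \<Longrightarrow> join_cost c c' cb D vs \<alpha> = join_cost c c' cb D vs \<beta>"
proof (induction vs arbitrary: D \<alpha> \<beta>)
  case (Cons v vs)
  have c: "cands D \<alpha> = cands D \<beta>" using cands_cong[of D \<alpha> \<beta>] Cons.prems by blast
  have "join_cost c c' cb (D @ [v]) vs (\<alpha>(v := z)) = join_cost c c' cb (D @ [v]) vs (\<beta>(v := z))" for z
    using Cons.prems by (intro Cons.IH) auto
  then show ?case by (simp add: c min_deg_def common_def)
qed simp

lemma admissible_cands:
  assumes "admissible (D @ v # vs) \<beta>" "b \<in> edges_at v"
  shows "\<beta> v \<in> cands D \<beta> b"
proof -
  have b: "b \<in> Es" "v \<in> V b" using assms(2) by (auto simp: edges_at_def)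
  have "proj (D @ v # vs) (V b) \<beta> = (proj D (V b) \<beta> @ [\<beta> v]) @ proj vs (V b) \<beta>"
    using b(2) by (simp add: proj_def)
  then have "(proj D (V b) \<beta> @ [\<beta> v]) @ proj vs (V b) \<beta> \<in> pfx (S b)"
    using assms(1) b(1) by (force simp: admissible_def)
  then show ?thesis by (auto simp: cands_def exts_def pfx_def)
qed

lemma admissible_step:
  assumes "admissible D \<alpha>" "z \<in> common D \<alpha> v" "v \<notin> set D"
    and "\<And>u. u \<in> set D \<Longrightarrow> \<beta> u = \<alpha> u" "\<beta> v = z"
  shows "admissible (D @ [v]) \<beta>"
  unfolding admissible_def
proof
  fix b assume b: "b \<in> Es"
  have "proj D (V b) \<beta> = proj D (V b) \<alpha>" using assms(4) by (rule proj_cong)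
  then show "proj (D @ [v]) (V b) \<beta> \<in> insert [] (pfx (S b))"
  proof (cases "v \<in> V b")
    case True
    then have "z \<in> cands D \<alpha> b" using assms(2) b by (simp add: common_def edges_at_def)
    then show ?thesis
      using \<open>proj D (V b) \<beta> = _\<close> True assms(5) by (simp add: proj_append cands_def exts_def)
  next
    case False
    then show ?thesis
      using \<open>proj D (V b) \<beta> = _\<close> assms(1) b by (simp add: proj_append admissible_def)
  qed
qed

end

text \<open>\<open>R \<beta>s\<close> is the invariant after the body has been run for the answers
  \<open>\<beta>s\<close>; it must tolerate changes to loop counters and query variables.
  \<open>Y\<close> lists the areas that the body may write, which exclude counters, variables and
  tries. The last assumption gives every variable an edge from which its values are
  enumerated.\<close>

locale join_code = join "set es" batom_vars S for es :: "('p, 'c) batom list" and S :: "('p, 'c) batom \<Rightarrow> 'c val list set" +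
  fixes T :: "('p, 'c) tables" and tp :: "('p, 'c) batom \<Rightarrow> 'c val list" and body :: "('p, 'c) com"
    and R :: "(nat \<Rightarrow> 'c val) list \<Rightarrow> 'c mem \<Rightarrow> ('p, 'c) fact set \<Rightarrow> bool" and cb :: nat and Y :: "nat set"
    and vars :: "nat list"
  assumes len_tp: "\<And>b. b \<in> set es \<Longrightarrow> length (tp b) = 2"
    and Y: "Y \<inter> {0, 1, 2} = {}"
    and R_frame: "\<And>\<beta>s m out m'. R \<beta>s m out \<Longrightarrow> frame {0, 1} m m' \<Longrightarrow> R \<beta>s m' out"
    and body: "\<And>\<beta>s m out. R \<beta>s m out \<Longrightarrow> admissible vars (val_of m) \<Longrightarrow>
      run T body m out (\<lambda>t m' out'. t \<le> cb \<and> R (\<beta>s @ [val_of m]) m' out' \<and> frame Y m m')"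
    and vars: "distinct vars" "\<And>v. v \<in> set vars \<Longrightarrow> edges_at v \<noteq> {}"
begin

abbreviation "lc \<equiv> level_cost (length es) (length vars)"
abbreviation "cc \<equiv> cand_cost (length es) (length vars)"

definition tries :: "'c mem \<Rightarrow> bool" where
  "tries m \<longleftrightarrow> (\<forall>b\<in>set es. trie m (Num 2 # tp b) (pfx (S b)))"

lemma tries_frame: "tries m \<Longrightarrow> frame (Y \<union> {0, 1}) m m' \<Longrightarrow> tries m'"
  unfolding tries_def
proof
  fix b assume "\<forall>b\<in>set es. trie m (Num 2 # tp b) (pfx (S b))" "frame (Y \<union> {0, 1}) m m'" "b \<in> set es"
  moreover have "2 \<notin> Y \<union> {0, 1}" using Y by auto
  ultimately show "trie m' (Num 2 # tp b) (pfx (S b))" using trie_frame by blast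
qed

lemma trie_entries:
  assumes "tries m" "b \<in> set es"
  obtains xs where "distinct xs" "set xs = exts (pfx (S b)) w" "m (Num 2 # tp b @ Num 1 # w) = Num (length xs)"
    "\<And>i. i < length xs \<Longrightarrow> m (Num 2 # tp b @ Num 2 # w @ [Num i]) = xs ! i"
proof -
  have "trie m (Num 2 # tp b) (pfx (S b))" using assms by (simp add: tries_def)
  then have "\<exists>xs. distinct xs \<and> set xs = exts (pfx (S b)) w \<and> m ((Num 2 # tp b) @ Num 1 # w) = Num (length xs) \<and>
      (\<forall>i<length xs. m ((Num 2 # tp b) @ Num 2 # w @ [Num i]) = xs ! i)"
    unfolding trie_def by blast
  then show thesis using that by auto
qed

lemma countE_val:
  assumes "tries m" "b \<in> set es"
  shows "exp_val T m (countE tp D b) = Num (card (cands D (val_of m) b))"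
proof -
  obtain xs where xs: "distinct xs" "set xs = exts (pfx (S b)) (proj D (batom_vars b) (val_of m))"
    "m (Num 2 # tp b @ Num 1 # proj D (batom_vars b) (val_of m)) = Num (length xs)"
    by (rule trie_entries[OF assms, of "proj D (batom_vars b) (val_of m)"]) blast
  have "length xs = card (cands D (val_of m) b)"
    unfolding cands_def xs(2)[symmetric] by (rule distinct_card[OF xs(1), symmetric])
  then show ?thesis using xs(3) by (simp add: countE_def prefixE_val)
qed

lemma markE_val:
  assumes "tries m" "b \<in> set es"
  shows "exp_val T m (markE tp D v b) = Num 1 \<longleftrightarrow> val_of m v \<in> cands D (val_of m) b"
  using assms by (simp add: markE_def prefixE_val tries_def trie_def cands_def exts_def varE_def val_of_def)

text \<open>The list \<open>\<gamma>s\<close> represents every admissible extension of the current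
  partial answer, and its length is bounded by the counting instance of \<open>join_cost\<close>.
  The last line protects the variables and counters of the enclosing loops.\<close>

definition joined :: "(nat \<Rightarrow> 'c val) list \<Rightarrow> nat list \<Rightarrow> nat list \<Rightarrow> 'c mem \<Rightarrow> nat \<Rightarrow> 'c mem \<Rightarrow> ('p, 'c) fact set \<Rightarrow> bool" where
  "joined \<beta>s D vs m t m' out' \<longleftrightarrow> t \<le> join_cost lc cc cb D vs (val_of m) \<and>
     (\<exists>\<gamma>s. R (\<beta>s @ \<gamma>s) m' out' \<and> length \<gamma>s \<le> join_cost 0 0 1 D vs (val_of m) \<and>
       (\<forall>\<beta>. (\<forall>u\<in>set D. \<beta> u = val_of m u) \<and> admissible vars \<beta> \<longrightarrow>
          (\<exists>\<gamma>\<in>set \<gamma>s. \<forall>u\<in>set vars. \<gamma> u = \<beta> u))) \<and>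
     frame (Y \<union> {0, 1}) m m' \<and>
     (\<forall>u\<in>set D. val_of m' u = val_of m u \<and> m' [Num 0, Num (10 + u)] = m [Num 0, Num (10 + u)])"

lemma run_join:
  assumes "D @ vs = vars" "R \<beta>s m out" "tries m" "admissible D (val_of m)"
  shows "run T (joinC tp es D vs body) m out (joined \<beta>s D vs m)"
  using assms
proof (induction vs arbitrary: D m out \<beta>s)
  case Nil
  then have [simp]: "D = vars" by simp
  show ?case
    unfolding joinC.simps
  proof (rule run_mono[OF body[OF Nil.prems(2)]])
    show "admissible vars (val_of m)" using Nil.prems(4) by simp
    fix t m' out' assume A: "t \<le> cb \<and> R (\<beta>s @ [val_of m]) m' out' \<and> frame Y m m'"
    have "frame (Y \<union> {0, 1}) m m'" using A frame_mono by blast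
    moreover have "m' (Num n # r) = m (Num n # r)" if "n \<in> {0, 1}" for n r
      using A Y that by (intro frameD[of Y]) auto
    then have "\<forall>u\<in>set D. val_of m' u = val_of m u \<and> m' [Num 0, Num (10 + u)] = m [Num 0, Num (10 + u)]"
      by (simp add: val_of_def)
    ultimately show "joined \<beta>s D [] m t m' out'"
      unfolding joined_def using A by (auto intro!: exI[of _ "[val_of m]"])
  qed
next
  case (Cons v vs)
  define \<alpha> where "\<alpha> = val_of m"
  define ces where "ces = filter (\<lambda>b. v \<in> batom_vars b) es"
  have set_ces: "set ces = edges_at v" by (auto simp: ces_def edges_at_def)
  have len_ces: "length ces \<le> length es" by (simp add: ces_def)
  have lenD: "length D \<le> length vars" using Cons.prems(1) by auto
  have vD: "v \<notin> set D" "v \<in> set vars" using Cons.prems(1) vars(1) by auto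
  have es: "b \<in> set es" if "b \<in> set ces" for b using that by (simp add: ces_def)
  let ?kc = "5 + 3 * length vars"
  have ccost: "exp_cost (countE tp D b) \<le> ?kc" if "b \<in> set ces" for b
    using countE_cost[of tp D b] len_tp[OF es[OF that]] lenD by simp
  have test_cost: "bexp_cost (conjB (map (\<lambda>b'. Not (Less (countE tp D b') (countE tp D b))) ces))
      \<le> 3 + length es * (3 + 2 * ?kc)" if b: "b \<in> set ces" for b
  proof -
    have "bexp_cost (conjB (map (\<lambda>b'. Not (Less (countE tp D b') (countE tp D b))) ces))
        \<le> 3 + length (map (\<lambda>b'. Not (Less (countE tp D b') (countE tp D b))) ces) * (1 + (2 + 2 * ?kc))"
    proof (rule conjB_cost)
      fix x assume "x \<in> set (map (\<lambda>b'. Not (Less (countE tp D b') (countE tp D b))) ces)"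
      then obtain b' where b': "b' \<in> set ces" "x = Not (Less (countE tp D b') (countE tp D b))" by auto
      then show "bexp_cost x \<le> 2 + 2 * ?kc" using ccost[OF b] ccost[OF b'(1)] by simp
    qed
    also have "\<dots> \<le> 3 + length es * (3 + 2 * ?kc)"
      using mult_le_mono1[OF len_ces, of "3 + 2 * ?kc"] by simp
    finally show ?thesis .
  qed
  have test_val: "bexp_val T m (conjB (map (\<lambda>b'. Not (Less (countE tp D b') (countE tp D b))) ces)) \<longleftrightarrow>
      (\<forall>b'\<in>set ces. card (cands D \<alpha> b) \<le> card (cands D \<alpha> b'))" if "b \<in> set ces" for b
    using that es Cons.prems(3) by (auto simp: countE_val \<alpha>_def not_less)
  have ne: "edges_at v \<noteq> {}" using vars(2) vD(2) by blast
  have md: "min_deg D \<alpha> v \<in> (\<lambda>b. card (cands D \<alpha> b)) ` edges_at v"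
    unfolding min_deg_def using ne finite_edges_at by (intro Min_in) auto
  have md_le: "min_deg D \<alpha> v \<le> card (cands D \<alpha> b)" if "b \<in> edges_at v" for b
    unfolding min_deg_def using that finite_edges_at by (intro Min_le) auto
  have fc: "finite (common D \<alpha> v)" using ne finite_common by blast
  have "run T (chainC (\<lambda>b. conjB (map (\<lambda>b'. Not (Less (countE tp D b') (countE tp D b))) ces))
       (\<lambda>b. forC (10 + v) (countE tp D b) (Seq (Assign (lits [Num 1, Num v]) (entryE tp D v b))
          (If (conjB (map (\<lambda>b'. Eq (markE tp D v b') (Lit (Num 1))) ces))
            (joinC tp es (D @ [v]) vs body) Skip))) ces) m out (joined \<beta>s D (v # vs) m)"
  proof (rule run_chainC[where K = "3 + length es * (3 + 2 * ?kc)"])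
    obtain b where b: "b \<in> edges_at v" "min_deg D \<alpha> v = card (cands D \<alpha> b)" using md by blast
    then have "bexp_val T m (conjB (map (\<lambda>b'. Not (Less (countE tp D b') (countE tp D b))) ces))"
      using test_val[of b] md_le set_ces by auto
    then show "\<exists>b\<in>set ces. bexp_val T m (conjB (map (\<lambda>b'. Not (Less (countE tp D b') (countE tp D b))) ces))"
      using b(1) set_ces by blast
  next
    fix b t0
    assume b: "b \<in> set ces" "bexp_val T m (conjB (map (\<lambda>b'. Not (Less (countE tp D b') (countE tp D b))) ces))"
      and t0: "t0 \<le> length ces * (1 + (3 + length es * (3 + 2 * ?kc)))"
    have bE: "b \<in> edges_at v" "b \<in> set es" using b(1) set_ces es by auto
    \<comment> \<open>An edge passes its test in the cascade only if its number of candidates is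
      minimal.\<close>
    have deg: "card (cands D \<alpha> b) = min_deg D \<alpha> v"
      using b test_val[OF b(1)] md md_le[OF bE(1)] set_ces by (auto intro: antisym)
    define w where "w = proj D (batom_vars b) \<alpha>"
    obtain xs where xs: "distinct xs" "set xs = exts (pfx (S b)) w" "m (Num 2 # tp b @ Num 1 # w) = Num (length xs)"
      "\<And>i. i < length xs \<Longrightarrow> m (Num 2 # tp b @ Num 2 # w @ [Num i]) = xs ! i"
      by (rule trie_entries[OF Cons.prems(3) bE(2), of w]) blast
    have set_xs: "set xs = cands D \<alpha> b" using xs(2) by (simp add: cands_def w_def)
    have len_xs: "length xs = min_deg D \<alpha> v" using deg distinct_card[OF xs(1)] unfolding set_xs by simp
    define jc where "jc z = join_cost lc cc cb (D @ [v]) vs (\<alpha>(v := z))" for z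
    define jn where "jn z = join_cost 0 0 1 (D @ [v]) vs (\<alpha>(v := z))" for z
    define keep where "keep m' \<longleftrightarrow> frame (Y \<union> {0, 1}) m m' \<and>
      (\<forall>u\<in>set D. val_of m' u = \<alpha> u \<and> m' [Num 0, Num (10 + u)] = m [Num 0, Num (10 + u)])" for m'
    \<comment> \<open>After \<open>i\<close> candidates the answers found so far represent all
      extensions whose value at \<open>v\<close> is among these candidates, and only the common ones
      among them have been charged for a recursive call.\<close>
    define I where "I i t m' out' \<longleftrightarrow> t \<le> 4 + i * cc + (\<Sum>z\<in>set (take i xs) \<inter> common D \<alpha> v. jc z) \<and>
      (\<exists>\<gamma>s. R (\<beta>s @ \<gamma>s) m' out' \<and> length \<gamma>s \<le> (\<Sum>z\<in>set (take i xs) \<inter> common D \<alpha> v. jn z) \<and>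
        (\<forall>\<beta>. (\<forall>u\<in>set D. \<beta> u = \<alpha> u) \<and> admissible vars \<beta> \<and> \<beta> v \<in> set (take i xs) \<longrightarrow>
          (\<exists>\<gamma>\<in>set \<gamma>s. \<forall>u\<in>set vars. \<gamma> u = \<beta> u))) \<and> keep m'" for i t m' out'
    have keep_proj: "proj D (batom_vars b') (val_of m') = proj D (batom_vars b') \<alpha>" if "keep m'" for m' b'
      using that by (intro proj_cong) (auto simp: keep_def)
    have keep_tries: "tries m'" if "keep m'" for m'
      using that Cons.prems(3) tries_frame by (auto simp: keep_def)
    have keep_cnt: "keep (m'([Num 0, Num (10 + v)] := x))" if "keep m'" for m' x
      using that vD(1) by (auto simp: keep_def val_of_def frame_upd)
    have R_cnt: "R \<gamma>s (m'([Num 0, Num (10 + v)] := x)) out'" if "R \<gamma>s m' out'" for \<gamma>s m' x out'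
      using that by (rule R_frame) (auto intro: frame_upd)
    show "run T (forC (10 + v) (countE tp D b) (Seq (Assign (lits [Num 1, Num v]) (entryE tp D v b))
          (If (conjB (map (\<lambda>b'. Eq (markE tp D v b') (Lit (Num 1))) ces))
            (joinC tp es (D @ [v]) vs body) Skip))) m out (\<lambda>t. joined \<beta>s D (v # vs) m (t0 + t))"
    proof (rule run_forC[where I = I and N = "length xs"])
      have "keep m" by (simp add: keep_def \<alpha>_def)
      then show "I 0 4 (m([Num 0, Num (10 + v)] := Num 0)) out"
        unfolding I_def using Cons.prems(2) keep_cnt R_cnt by (auto intro!: exI[of _ "[]"])
    next
      fix i t m' out' assume "I i t m' out'"
      then have "keep m'" by (simp add: I_def)
      then show "exp_val T m' (countE tp D b) = Num (length xs)"
        using countE_val[OF keep_tries bE(2), of m'] keep_proj[of m' b] set_xs distinct_card[OF xs(1)]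
        by (simp add: cands_def)
    next
      fix i t m' out' assume i: "i < length xs" and I: "I i t m' out'" and cnt: "m' [Num 0, Num (10 + v)] = Num i"
      have keep: "keep m'" using I by (simp add: I_def)
      define z where "z = xs ! i"
      have take: "set (take (Suc i) xs) = insert z (set (take i xs))"
        using i by (simp add: take_Suc_conv_app_nth z_def)
      \<comment> \<open>The candidates are listed without repetitions, so the new summand is added
        exactly once.\<close>
      have znew: "z \<notin> set (take i xs)"
        using xs(1) i by (metis z_def distinct_append distinct_take id_take_nth_drop not_distinct_conv_prefix take_Suc_conv_app_nth)
      define m1 where "m1 = m'([Num 1, Num v] := z)"
      have "m' (Num 2 # tp b @ Num 2 # w @ [Num i]) = z"
        using xs(4)[OF i] keep Y by (simp add: z_def keep_def frame_def)
      then have entry: "exp_val T m' (entryE tp D v b) = z"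
        using keep_proj[OF keep, of b] cnt by (simp add: entryE_def prefixE_val w_def)
      have keep1: "keep m1"
        using keep vD(1) by (auto simp: keep_def m1_def val_of_def frame_upd)
      have m1v: "val_of m1 v = z" by (simp add: m1_def val_of_def)
      have m1D: "val_of m1 u = (\<alpha>(v := z)) u" if "u \<in> set (D @ [v])" for u
        using that keep1 m1v vD(1) by (auto simp: keep_def)
      have cnt1: "m1 [Num 0, Num (10 + v)] = Num i" using cnt by (simp add: m1_def)
      have R1: "R \<gamma>s m1 out'" if "R \<gamma>s m' out'" for \<gamma>s
        using that by (rule R_frame) (auto simp: m1_def intro: frame_upd)
      have "exp_val T m1 (markE tp D v b') = Num 1 \<longleftrightarrow> z \<in> cands D \<alpha> b'" if "b' \<in> set ces" for b'
        using markE_val[OF keep_tries[OF keep1] es[OF that], of D v]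
        by (simp only: m1v cands_def keep_proj[OF keep1])
      then have mark: "bexp_val T m1 (conjB (map (\<lambda>b'. Eq (markE tp D v b') (Lit (Num 1))) ces)) \<longleftrightarrow> z \<in> common D \<alpha> v"
        by (simp add: common_def set_ces)
      let ?If = "1 + bexp_cost (conjB (map (\<lambda>b'. Eq (markE tp D v b') (Lit (Num 1))) ces))"
      have "bexp_cost (conjB (map (\<lambda>b'. Eq (markE tp D v b') (Lit (Num 1))) ces))
          \<le> 3 + length (map (\<lambda>b'. Eq (markE tp D v b') (Lit (Num 1))) ces) * (1 + (10 + 3 * length vars))"
      proof (rule conjB_cost)
        fix x assume "x \<in> set (map (\<lambda>b'. Eq (markE tp D v b') (Lit (Num 1))) ces)"
        then obtain b' where b': "b' \<in> set ces" "x = Eq (markE tp D v b') (Lit (Num 1))" by auto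
        then show "bexp_cost x \<le> 10 + 3 * length vars"
          using markE_cost[of tp D v b'] len_tp[OF es[OF b'(1)]] lenD by simp
      qed
      also have "\<dots> \<le> 3 + length es * (11 + 3 * length vars)"
        using mult_le_mono1[OF len_ces, of "11 + 3 * length vars"] by simp
      finally have step_cost: "(12 + exp_cost (countE tp D b)) + (1 + sum_list (map exp_cost (lits [Num 1, Num v] :: ('p, 'c) exp list)) +
          exp_cost (entryE tp D v b)) + ?If \<le> cc"
        using ccost[OF b(1)] entryE_cost[of tp D v b] len_tp[OF bE(2)] lenD by (simp add: cand_cost_def)
      let ?A = "1 + sum_list (map exp_cost (lits [Num 1, Num v] :: ('p, 'c) exp list)) + exp_cost (entryE tp D v b)"
      obtain \<gamma>s where \<gamma>s: "R (\<beta>s @ \<gamma>s) m' out'" "length \<gamma>s \<le> (\<Sum>z\<in>set (take i xs) \<inter> common D \<alpha> v. jn z)"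
        "\<And>\<beta>. \<forall>u\<in>set D. \<beta> u = \<alpha> u \<Longrightarrow> admissible vars \<beta> \<Longrightarrow> \<beta> v \<in> set (take i xs) \<Longrightarrow>
          \<exists>\<gamma>\<in>set \<gamma>s. \<forall>u\<in>set vars. \<gamma> u = \<beta> u"
        using I unfolding I_def by blast
      have t: "t \<le> 4 + i * cc + (\<Sum>z\<in>set (take i xs) \<inter> common D \<alpha> v. jc z)" using I by (simp add: I_def)
      let ?P = "\<lambda>t' m2 out2. m2 [Num 0, Num (10 + v)] = Num i \<and>
        I (Suc i) (t + (12 + exp_cost (countE tp D b)) + t') (m2([Num 0, Num (10 + v)] := Num (Suc i))) out2"
      have "run T (If (conjB (map (\<lambda>b'. Eq (markE tp D v b') (Lit (Num 1))) ces))
            (joinC tp es (D @ [v]) vs body) Skip) m1 out' (\<lambda>t'. ?P (?A + t'))"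
      proof (rule run_If)
        assume "bexp_val T m1 (conjB (map (\<lambda>b'. Eq (markE tp D v b') (Lit (Num 1))) ces))"
        then have z: "z \<in> common D \<alpha> v" using mark by blast
        have sums: "(\<Sum>z\<in>set (take (Suc i) xs) \<inter> common D \<alpha> v. f z) =
            f z + (\<Sum>z\<in>set (take i xs) \<inter> common D \<alpha> v. f z)" for f :: "'c val \<Rightarrow> nat"
          using z znew by (simp add: take)
        show "run T (joinC tp es (D @ [v]) vs body) m1 out' (\<lambda>t'. ?P (?A + (?If + t')))"
        proof (rule run_mono[OF Cons.IH])
          show "(D @ [v]) @ vs = vars" using Cons.prems(1) by simp
          show "R (\<beta>s @ \<gamma>s) m1 out'" using \<gamma>s(1) by (rule R1)
          show "tries m1" by (rule keep_tries[OF keep1])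
          show "admissible (D @ [v]) (val_of m1)"
            using Cons.prems(4) z vD(1) m1D by (intro admissible_step[of D \<alpha> z]) (auto simp: \<alpha>_def)
          fix t' m2 out2
          assume J: "joined (\<beta>s @ \<gamma>s) (D @ [v]) vs m1 t' m2 out2"
          have jc: "join_cost c c' cb (D @ [v]) vs (val_of m1) = join_cost c c' cb (D @ [v]) vs (\<alpha>(v := z))" for c c' cb
            by (rule join_cost_cong) (rule m1D)
          obtain \<delta>s where \<delta>s: "R ((\<beta>s @ \<gamma>s) @ \<delta>s) m2 out2" "length \<delta>s \<le> jn z"
            "\<And>\<beta>. \<forall>u\<in>set (D @ [v]). \<beta> u = val_of m1 u \<Longrightarrow> admissible vars \<beta> \<Longrightarrow>
              \<exists>\<gamma>\<in>set \<delta>s. \<forall>u\<in>set vars. \<gamma> u = \<beta> u"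
            using J unfolding joined_def jc jn_def by blast
          have t': "t' \<le> jc z" using J unfolding joined_def jc jc_def by blast
          have keep2: "keep m2"
            using J keep1 unfolding joined_def keep_def by (auto intro: frame_trans)
          have "m2 [Num 0, Num (10 + v)] = Num i" using J cnt1 unfolding joined_def by auto
          moreover have "I (Suc i) (t + (12 + exp_cost (countE tp D b)) + (?A + (?If + t')))
              (m2([Num 0, Num (10 + v)] := Num (Suc i))) out2"
            unfolding I_def
          proof (intro conjI exI[of _ "\<gamma>s @ \<delta>s"] allI impI)
            show "t + (12 + exp_cost (countE tp D b)) + (?A + (?If + t')) \<le>
                4 + Suc i * cc + (\<Sum>z\<in>set (take (Suc i) xs) \<inter> common D \<alpha> v. jc z)"
              using t t' step_cost unfolding sums by simp
            show "R (\<beta>s @ (\<gamma>s @ \<delta>s)) (m2([Num 0, Num (10 + v)] := Num (Suc i))) out2"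
              using \<delta>s(1) R_cnt by simp
            show "length (\<gamma>s @ \<delta>s) \<le> (\<Sum>z\<in>set (take (Suc i) xs) \<inter> common D \<alpha> v. jn z)"
              using \<gamma>s(2) \<delta>s(2) unfolding sums by simp
            show "keep (m2([Num 0, Num (10 + v)] := Num (Suc i)))" using keep2 by (rule keep_cnt)
            fix \<beta> assume B: "(\<forall>u\<in>set D. \<beta> u = \<alpha> u) \<and> admissible vars \<beta> \<and> \<beta> v \<in> set (take (Suc i) xs)"
            show "\<exists>\<gamma>\<in>set (\<gamma>s @ \<delta>s). \<forall>u\<in>set vars. \<gamma> u = \<beta> u"
            proof (cases "\<beta> v = z")
              case True
              then have "\<forall>u\<in>set (D @ [v]). \<beta> u = val_of m1 u" using B m1D vD(1) by auto
              then show ?thesis using \<delta>s(3)[of \<beta>] B by auto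
            next
              case False
              then show ?thesis using \<gamma>s(3)[of \<beta>] B take by auto
            qed
          qed
          ultimately show "?P (?A + (?If + t')) m2 out2" by blast
        qed
      next
        assume "\<not> bexp_val T m1 (conjB (map (\<lambda>b'. Eq (markE tp D v b') (Lit (Num 1))) ces))"
        then have z: "z \<notin> common D \<alpha> v" using mark by blast
        have same: "set (take (Suc i) xs) \<inter> common D \<alpha> v = set (take i xs) \<inter> common D \<alpha> v"
          using z by (auto simp: take)
        have "I (Suc i) (t + (12 + exp_cost (countE tp D b)) + (?A + (?If + 0)))
              (m1([Num 0, Num (10 + v)] := Num (Suc i))) out'"
          unfolding I_def
        proof (intro conjI exI[of _ \<gamma>s] allI impI)
          show "t + (12 + exp_cost (countE tp D b)) + (?A + (?If + 0)) \<le>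
                4 + Suc i * cc + (\<Sum>z\<in>set (take (Suc i) xs) \<inter> common D \<alpha> v. jc z)"
            using t step_cost unfolding same by simp
          show "R (\<beta>s @ \<gamma>s) (m1([Num 0, Num (10 + v)] := Num (Suc i))) out'"
            using \<gamma>s(1) R1 R_cnt by blast
          show "length \<gamma>s \<le> (\<Sum>z\<in>set (take (Suc i) xs) \<inter> common D \<alpha> v. jn z)"
            using \<gamma>s(2) unfolding same .
          show "keep (m1([Num 0, Num (10 + v)] := Num (Suc i)))" using keep1 by (rule keep_cnt)
          fix \<beta> assume B: "(\<forall>u\<in>set D. \<beta> u = \<alpha> u) \<and> admissible vars \<beta> \<and> \<beta> v \<in> set (take (Suc i) xs)"
          \<comment> \<open>An admissible assignment gives \<open>v\<close> a candidate of every
            edge at \<open>v\<close>, so rejecting a value that is not common loses no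
            answer.\<close>
          have "\<beta> v \<in> common D \<alpha> v"
          proof -
            have "\<beta> v \<in> cands D \<beta> b'" if "b' \<in> edges_at v" for b'
              using B Cons.prems(1) that admissible_cands[of D v vs \<beta> b'] by simp
            moreover have "cands D \<beta> b' = cands D \<alpha> b'" for b' using B by (intro cands_cong) auto
            ultimately show ?thesis by (simp add: common_def)
          qed
          then have "\<beta> v \<in> set (take i xs)" using B z take by auto
          then show "\<exists>\<gamma>\<in>set \<gamma>s. \<forall>u\<in>set vars. \<gamma> u = \<beta> u" using \<gamma>s(3)[of \<beta>] B by blast
        qed
        then show "run T Skip m1 out' (\<lambda>t'. ?P (?A + (?If + t')))"
          using cnt1 by (intro run_Skip) simp
      qed
      note inner = this
      show "run T (Seq (Assign (lits [Num 1, Num v]) (entryE tp D v b))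
          (If (conjB (map (\<lambda>b'. Eq (markE tp D v b') (Lit (Num 1))) ces))
            (joinC tp es (D @ [v]) vs body) Skip)) m' out' ?P"
      proof (intro run_Seq run_Assign)
        have "m'(map (exp_val T m') (lits [Num 1, Num v]) := exp_val T m' (entryE tp D v b)) = m1"
          by (simp add: m1_def entry)
        then show "run T (If (conjB (map (\<lambda>b'. Eq (markE tp D v b') (Lit (Num 1))) ces))
            (joinC tp es (D @ [v]) vs body) Skip)
            (m'(map (exp_val T m') (lits [Num 1, Num v]) := exp_val T m' (entryE tp D v b))) out' (\<lambda>t'. ?P (?A + t'))"
          using inner by (simp only:)
      qed
    next
      fix t m' out' assume I: "I (length xs) t m' out'"
      have "common D \<alpha> v \<subseteq> set xs" unfolding set_xs using bE(1) by (auto simp: common_def)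
      then have all: "set (take (length xs) xs) \<inter> common D \<alpha> v = common D \<alpha> v" by auto
      \<comment> \<open>For the same reason the candidates of a single edge include the value at
        \<open>v\<close> of every admissible assignment.\<close>
      have in_xs: "\<beta> v \<in> set xs" if "\<forall>u\<in>set D. \<beta> u = \<alpha> u" "admissible vars \<beta>" for \<beta>
      proof -
        have "\<beta> v \<in> cands D \<beta> b" using that Cons.prems(1) bE(1) admissible_cands[of D v vs \<beta> b] by simp
        moreover have "cands D \<beta> b = cands D \<alpha> b" using that by (intro cands_cong) auto
        ultimately show ?thesis by (simp add: set_xs)
      qed
      have "t0 + (t + (5 + exp_cost (countE tp D b))) \<le> join_cost lc cc cb D (v # vs) \<alpha>"
      proof -
        have "t0 \<le> length es * (1 + (3 + length es * (3 + 2 * ?kc)))"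
          using t0 mult_le_mono1[OF len_ces, of "1 + (3 + length es * (3 + 2 * ?kc))"] by linarith
        moreover have "t \<le> 4 + min_deg D \<alpha> v * cc + (\<Sum>z\<in>common D \<alpha> v. jc z)"
          using I unfolding I_def all by (simp add: len_xs)
        ultimately show ?thesis
          using ccost[OF b(1)] by (simp add: level_cost_def jc_def mult.commute)
      qed
      moreover have "\<exists>\<gamma>s. R (\<beta>s @ \<gamma>s) m' out' \<and> length \<gamma>s \<le> join_cost 0 0 1 D (v # vs) \<alpha> \<and>
         (\<forall>\<beta>. (\<forall>u\<in>set D. \<beta> u = \<alpha> u) \<and> admissible vars \<beta> \<longrightarrow> (\<exists>\<gamma>\<in>set \<gamma>s. \<forall>u\<in>set vars. \<gamma> u = \<beta> u))"
        using I in_xs unfolding I_def all by (auto simp: jn_def)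
      ultimately show "joined \<beta>s D (v # vs) m (t0 + (t + (5 + exp_cost (countE tp D b)))) m' out'"
        using I unfolding joined_def I_def keep_def \<alpha>_def by blast
    qed
  qed (rule test_cost)
  then show ?case by (simp add: ces_def)
qed

lemma run_full_join:
  assumes "R [] m out" "tries m"
  shows "run T (joinC tp es [] vars body) m out (\<lambda>t m' out'.
    t \<le> join_cost lc cc cb [] vars (val_of m) \<and>
    (\<exists>\<gamma>s. R \<gamma>s m' out' \<and> length \<gamma>s \<le> join_cost 0 0 1 [] vars (val_of m) \<and>
       (\<forall>\<beta>. admissible vars \<beta> \<longrightarrow> (\<exists>\<gamma>\<in>set \<gamma>s. \<forall>u\<in>set vars. \<gamma> u = \<beta> u))) \<and>
     frame (Y \<union> {0, 1}) m m')"
  by (rule run_mono[OF run_join[of "[]" vars "[]", OF _ assms]])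
    (simp_all add: joined_def admissible_def proj_def)

end

lemma frame_ext: "frame X m m' \<Longrightarrow> frame Y m' m'' \<Longrightarrow> Y \<subseteq> X \<Longrightarrow> frame X m m''"
  by (blast intro: frame_trans frame_mono)

section \<open>Inference with propositional Horn clauses in time linear in their number\<close>

section \<open>Forward chaining for ground clauses\<close>

text \<open>A ground atom is a vector of fixed length \<open>K\<close>, a clause the list of its head and exactly \<open>K\<close>
  body atoms, padded with the zero vector, which counts as derived.\<close>

inductive_set horn :: "nat \<Rightarrow> 'c val list list set \<Rightarrow> 'c val list set"
  for K :: nat and C :: "'c val list list set" where
  zero: "replicate K (Num 0) \<in> horn K C"
| step: "cl \<in> C \<Longrightarrow> (\<And>j. j \<in> {1..K} \<Longrightarrow> cl ! j \<in> horn K C) \<Longrightarrow> cl ! 0 \<in> horn K C"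

text \<open>Clauses are numbered from 1. Number 0 is a pseudo-clause with the zero vector
  everywhere, so that the zero vector can be queued like a derived head.\<close>

definition clause_atom :: "nat \<Rightarrow> 'c val list list list \<Rightarrow> nat \<Rightarrow> nat \<Rightarrow> 'c val list" where
  "clause_atom K cls c j = (if c = 0 then replicate K (Num 0) else cls ! (c - 1) ! j)"

text \<open>A word is a body atom followed by a clause number. In the trie of these words the
  children of an atom are the clauses to be reconsidered once it is derived.\<close>

definition watch :: "nat \<Rightarrow> 'c val list list list \<Rightarrow> 'c val list set" where
  "watch K cls = {clause_atom K cls c j @ [Num c] | c j. c \<in> {1..length cls} \<and> j \<in> {1..K}}"

lemma watch_eq: "watch K cls =
    (\<Union>c\<in>{1..length cls}. (\<lambda>j. clause_atom K cls c j @ [Num c]) ` {1..K})"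
  by (auto simp: watch_def)

text \<open>The range of \<open>c\<close> includes the pseudo-clause 0; its cells are never written
  and read \<open>Num 0\<close> from the empty memory.\<close>

definition store :: "nat \<Rightarrow> 'c mem \<Rightarrow> 'c val list list list \<Rightarrow> bool" where
  "store K m cls \<longleftrightarrow> m [Num 12, Num 0] = Num (length cls) \<and>
     (\<forall>c\<le>length cls. \<forall>j\<le>K. \<forall>i<K. m [Num 6, Num c, Num j, Num i] = clause_atom K cls c j ! i) \<and>
     trie m [Num 8] (watch K cls) \<and>
     (\<forall>c\<le>length cls. \<forall>j\<le>K. length (clause_atom K cls c j) = K)"

lemma store_cong:
  assumes "store K m cls" "\<And>r. m' (Num 6 # r) = m (Num 6 # r)" "\<And>r. m' (Num 8 # r) = m (Num 8 # r)"
    "m' [Num 12, Num 0] = m [Num 12, Num 0]"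
  shows "store K m' cls"
proof -
  have "trie m' [Num 8] (watch K cls)"
    using assms(1,3) by (auto simp: store_def intro: trie_cong)
  then show ?thesis using assms by (simp add: store_def)
qed

definition idE :: "('p, 'c) exp" where "idE = Cell (lits [Num 12, Num 0])"

definition clauseC :: "nat \<Rightarrow> ('p, 'c) exp list list \<Rightarrow> ('p, 'c) com" where
  "clauseC K ves = Seq (Assign (lits [Num 12, Num 0]) (Succ idE))
    (Seq (seqC (map (\<lambda>(j, i). Assign (Lit (Num 6) # idE # lits [Num j, Num i]) (ves ! j ! i))
        (List.product [0..<K + 1] [0..<K])))
      (seqC (map (\<lambda>j. addN [Num 8] (ves ! j) idE) [1..<K + 1])))"

text \<open>7 for increasing the clause number, 10 for each of the \<open>K * (K + 1)\<close> cells,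
  and \<open>32 + 18 * K\<close> for each of the \<open>K\<close> watch entries.\<close>

definition clause_cost :: "nat \<Rightarrow> nat" where
  "clause_cost K = 7 + 10 * (K * (K + 1)) + K * (32 + 18 * K)"

lemma run_clauseC:
  fixes m :: "'c mem" and out :: "('p, 'c) fact set" and ves :: "('p, 'c) exp list list"
  assumes st: "store K m cls" and len: "length ves = K + 1" "\<And>j. j \<le> K \<Longrightarrow> length (ves ! j) = K"
    and ind: "\<And>j e. j \<le> K \<Longrightarrow> e \<in> set (ves ! j) \<Longrightarrow> indep T {6, 8, 12} e \<and> exp_cost e \<le> 3"
  shows "run T (clauseC K ves) m out (\<lambda>t m' out'. t \<le> clause_cost K \<and> out' = out \<and>
    store K m' (cls @ [map (map (exp_val T m)) ves]) \<and> frame {6, 8, 12} m m')"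
proof -
  define M where "M = length cls"
  define vec where "vec j = map (exp_val T m) (ves ! j)" for j
  define m1 where "m1 = m([Num 12, Num 0] := Num (Suc M))"
  have fr1: "frame {6, 8, 12} m m1" by (simp add: m1_def frame_upd)
  have val: "exp_val T m' (ves ! j ! i) = vec j ! i" if "j \<le> K" "i < K" "frame {6, 8, 12} m m'" for m' j i
    using ind[of j "ves ! j ! i"] that len by (simp add: indep_def vec_def)
  have vals: "map (exp_val T m') (ves ! j) = vec j" if "j \<le> K" "frame {6, 8, 12} m m'" for m' j
    using indep_map[of "ves ! j" T "{6, 8, 12}" m m'] ind that by (simp add: vec_def)
  have idE: "exp_val T m' idE = Num (Suc M)" if "m' [Num 12, Num 0] = Num (Suc M)" for m'
    using that by (simp add: idE_def)
  have e1: "m(map (exp_val T m) (lits [Num 12, Num 0]) := exp_val T m (Succ idE)) = m1"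
    using st by (simp add: m1_def idE_def store_def M_def)
  define ps where "ps = List.product [0..<K + 1] [0..<K]"
  have ps: "(j, i) \<in> set ps \<longleftrightarrow> j \<le> K \<and> i < K" "length ps = (K + 1) * K" for j i
    by (auto simp: ps_def)
  let ?A = "\<lambda>(j, i). Assign (Lit (Num 6) # idE # lits [Num j, Num i]) (ves ! j ! i)"
  define I1 where "I1 n t m' out' \<longleftrightarrow> t \<le> n * 10 \<and> out' = out \<and> frame {6} m1 m' \<and>
    (\<forall>c j i. c \<noteq> Suc M \<longrightarrow> m' [Num 6, Num c, Num j, Num i] = m [Num 6, Num c, Num j, Num i]) \<and>
    (\<forall>(j, i)\<in>set (take n ps). m' [Num 6, Num (Suc M), Num j, Num i] = vec j ! i)" for n :: nat and t m' out'
  have s1: "run T (seqC (map ?A ps)) m1 out (I1 (length ps))"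
  proof (rule run_seqC[where I = I1])
    show "I1 0 0 m1 out" by (simp add: I1_def m1_def)
    fix n t m' out' assume n: "n < length (map ?A ps)" and I: "I1 n t m' out'"
    obtain j i where ji: "ps ! n = (j, i)" by (cases "ps ! n")
    then have "(j, i) \<in> set ps" using n nth_mem[of n ps] by simp
    then have jK: "j \<le> K" "i < K" by (simp_all add: ps)
    have fr: "frame {6, 8, 12} m m'"
      using I by (intro frame_ext[OF fr1, of "{6}"]) (auto simp: I1_def)
    have m12: "m' [Num 12, Num 0] = Num (Suc M)" using I by (simp add: I1_def frame_def m1_def)
    have c: "exp_cost (ves ! j ! i) \<le> 3" using ind[of j "ves ! j ! i"] jK len by simp
    have tk: "set (take (Suc n) ps) = insert (j, i) (set (take n ps))"
      using n ji by (simp add: take_Suc_conv_app_nth)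
    have "run T (Assign (Lit (Num 6) # idE # lits [Num j, Num i]) (ves ! j ! i)) m' out' (\<lambda>t'. I1 (Suc n) (t + t'))"
    proof (rule run_Assign)
      have upd: "m'(map (exp_val T m') (Lit (Num 6) # idE # lits [Num j, Num i]) := exp_val T m' (ves ! j ! i)) =
          m'([Num 6, Num (Suc M), Num j, Num i] := vec j ! i)"
        using idE[of m', OF m12] val[OF jK fr] by simp
      show "I1 (Suc n) (t + (1 + sum_list (map exp_cost (Lit (Num 6) # idE # lits [Num j, Num i])) + exp_cost (ves ! j ! i)))
        (m'(map (exp_val T m') (Lit (Num 6) # idE # lits [Num j, Num i]) := exp_val T m' (ves ! j ! i))) out'"
        unfolding upd using I c by (auto simp: I1_def tk idE_def frame_upd)
    qed
    then show "run T (map ?A ps ! n) m' out' (\<lambda>t'. I1 (Suc n) (t + t'))" using n ji by simp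
  qed simp
  define W where "W n = watch K cls \<union> (\<lambda>j. vec j @ [Num (Suc M)]) ` {1..n}" for n
  define J where "J m2 n t m' out' \<longleftrightarrow> t \<le> n * (32 + 18 * K) \<and> out' = out \<and> frame {8} m2 m' \<and> trie m' [Num 8] (W n)"
    for m2 :: "'c mem" and n t :: nat and m' :: "'c mem" and out' :: "('p, 'c) fact set"
  have s2: "run T (seqC (map (\<lambda>j. addN [Num 8] (ves ! j) idE) [1..<K + 1])) m2 out (J m2 K)"
    if I: "I1 (length ps) t m2 out2" for t m2 out2
  proof -
    have fr12: "frame {6} m1 m2" using I by (simp add: I1_def)
    have fr: "frame {6, 8, 12} m m2"
      by (rule frame_ext[OF fr1 fr12]) simp
    have m12: "m2 [Num 12, Num 0] = Num (Suc M)" using fr12 by (simp add: frame_def m1_def)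
    have trm: "trie m [Num 8] (watch K cls)" using st by (simp add: store_def)
    have "trie m2 [Num 8] (watch K cls)"
      by (rule trie_cong[OF trm]) (use fr12 in \<open>simp add: frame_def m1_def\<close>)
    then have J0: "J m2 0 0 m2 out" by (simp add: J_def W_def)
    have "run T (seqC (map (\<lambda>j. addN [Num 8] (ves ! j) idE) [1..<K + 1])) m2 out (J m2 (length (map (\<lambda>j. addN [Num 8] (ves ! j) idE) [1..<K + 1] :: ('p, 'c) com list)))"
    proof (rule run_seqC[where I = "J m2"])
      show "J m2 0 0 m2 out" by (rule J0)
      fix n t m' out' assume n: "n < length (map (\<lambda>j. addN [Num 8] (ves ! j) idE) [1..<K + 1] :: ('p, 'c) com list)"
        and J: "J m2 n t m' out'"
      then have nK: "n < K" by (simp del: upt_Suc)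
      have fr': "frame {6, 8, 12} m m'"
        using J by (intro frame_ext[OF fr, of "{8}"]) (auto simp: J_def)
      have m12': "m' [Num 12, Num 0] = Num (Suc M)" using J m12 by (simp add: J_def frame_def)
      have ins: "insert (map (exp_val T m') (ves ! Suc n) @ [exp_val T m' idE]) (W n) = W (Suc n)"
        using vals[of "Suc n" m'] nK fr' idE[of m', OF m12'] by (simp add: W_def atLeastAtMostSuc_conv)
      have cost: "sum_list (map exp_cost (ves ! Suc n)) \<le> K * 3"
        using sum_list_le[of "ves ! Suc n" exp_cost 3] ind[of "Suc n"] nK len(2)[of "Suc n"] by simp
      have "run T (addN [Num 8] (ves ! Suc n) idE) m' out' (\<lambda>t'. J m2 (Suc n) (t + t'))"
      proof (rule run_mono[OF run_addN[where X = "W n"]])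
        show "trie m' [Num 8] (W n)" using J by (simp add: J_def)
        fix e' assume "e' \<in> set (idE # ves ! Suc n)"
        then consider "e' = idE" | "e' \<in> set (ves ! Suc n)" by auto
        then show "indep T {8} e'"
        proof cases
          case 1
          then show ?thesis by (auto simp: idE_def intro: indep_Cell)
        next
          case 2
          then have "indep T {6, 8, 12} e'" using ind[of "Suc n" e'] nK by simp
          then show ?thesis unfolding indep_def using frame_mono[of "{8}" _ _ "{6, 8, 12}"] by blast
        qed
      next
        fix t' m'' out''
        assume A: "t' \<le> 17 + 6 * Suc (length []) + 6 * sum_list (map exp_cost (ves ! Suc n)) + 3 * exp_cost (idE :: ('p, 'c) exp) \<and>
          out'' = out' \<and> under [Num 8] m' m'' \<and>
          trie m'' [Num 8] (insert (map (exp_val T m') (ves ! Suc n) @ [exp_val T m' idE]) (W n))"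
        then have "frame {8} m' m''" using under_frame by blast
        moreover have "exp_cost (idE :: ('p, 'c) exp) = 3" by (simp add: idE_def)
        ultimately show "J m2 (Suc n) (t + t') m'' out''"
          using A J cost unfolding ins J_def by (auto intro: frame_trans)
      qed
      then show "run T (map (\<lambda>j. addN [Num 8] (ves ! j) idE) [1..<K + 1] ! n) m' out' (\<lambda>t'. J m2 (Suc n) (t + t'))"
        using nK by (simp del: upt_Suc)
    qed simp
    then show ?thesis by (simp del: upt_Suc)
  qed
  have fin: "t1 + (t2 + t3) \<le> clause_cost K \<and> out3 = out \<and>
      store K m3 (cls @ [map (map (exp_val T m)) ves]) \<and> frame {6, 8, 12} m m3"
    if I: "I1 (length ps) t2 m2 out2" and J: "J m2 K t3 m3 out3" and t1: "t1 \<le> 7" for t1 t2 t3 m2 m3 out2 out3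
  proof -
    have fr12: "frame {6} m1 m2" and fr23: "frame {8} m2 m3" using I J by (simp_all add: I1_def J_def)
    have "frame {6, 8, 12} m m2"
      by (rule frame_ext[OF fr1 fr12]) simp
    then have fr: "frame {6, 8, 12} m m3"
      by (rule frame_ext[OF _ fr23]) simp
    let ?cls = "cls @ [map (map (exp_val T m)) ves]"
    have old: "clause_atom K ?cls c j = clause_atom K cls c j" if "c \<le> M" for c j
      using that by (auto simp: clause_atom_def nth_append M_def)
    have new: "clause_atom K ?cls (Suc M) j = vec j" if "j \<le> K" for j
      using that len by (simp add: clause_atom_def M_def vec_def)
    have "watch K ?cls = W K"
    proof -
      have "{1..length ?cls} = insert (Suc M) {1..M}" by (auto simp: M_def)
      then have "watch K ?cls = (\<lambda>j. clause_atom K ?cls (Suc M) j @ [Num (Suc M)]) ` {1..K} \<union>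
          (\<Union>c\<in>{1..M}. (\<lambda>j. clause_atom K ?cls c j @ [Num c]) ` {1..K})"
        unfolding watch_eq by (simp only: UN_insert)
      also have "(\<lambda>j. clause_atom K ?cls (Suc M) j @ [Num (Suc M)]) ` {1..K} = (\<lambda>j. vec j @ [Num (Suc M)]) ` {1..K}"
        using new by (intro image_cong) auto
      also have "(\<Union>c\<in>{1..M}. (\<lambda>j. clause_atom K ?cls c j @ [Num c]) ` {1..K}) = watch K cls"
        unfolding watch_eq M_def[symmetric] using old by (intro SUP_cong image_cong) auto
      finally show ?thesis by (auto simp: W_def)
    qed
    moreover have "m3 [Num 12, Num 0] = Num (length ?cls)"
      using fr12 fr23 by (simp add: frame_def m1_def M_def)
    moreover have "m3 [Num 6, Num c, Num j, Num i] = clause_atom K ?cls c j ! i"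
      if "c \<le> length ?cls" "j \<le> K" "i < K" for c j i
    proof -
      have m32: "m3 [Num 6, Num c, Num j, Num i] = m2 [Num 6, Num c, Num j, Num i]"
        using fr23 by (simp add: frame_def)
      show ?thesis
      proof (cases "c = Suc M")
        case True
        have "(j, i) \<in> set ps" using that by (simp add: ps)
        then show ?thesis using I True m32 new that by (auto simp: I1_def)
      next
        case False
        then have "c \<le> M" using that(1) by (simp add: M_def)
        then show ?thesis using I False m32 old that st by (simp add: I1_def store_def M_def)
      qed
    qed
    moreover have "length (clause_atom K ?cls c j) = K" if "c \<le> length ?cls" "j \<le> K" for c j
    proof (cases "c = Suc M")
      case True
      then show ?thesis using new that len by (simp add: vec_def)
    next
      case False
      then show ?thesis using old that st by (simp add: store_def M_def)
    qed
    ultimately have "store K m3 ?cls" using J by (simp add: store_def J_def)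
    moreover have "t1 + (t2 + t3) \<le> clause_cost K"
      using I J t1 by (simp add: I1_def J_def clause_cost_def ps algebra_simps)
    ultimately show ?thesis using J fr by (simp add: J_def)
  qed
  show ?thesis
    unfolding clauseC_def ps_def[symmetric]
  proof (intro run_Seq run_Assign)
    show "run T (seqC (map ?A ps)) (m(map (exp_val T m) (lits [Num 12, Num 0]) := exp_val T m (Succ idE))) out
      (\<lambda>t' m' out'. run T (seqC (map (\<lambda>j. addN [Num 8] (ves ! j) idE) [1..<K + 1])) m' out'
        (\<lambda>t'a m' out'. 1 + sum_list (map exp_cost (lits [Num 12, Num 0] :: ('p, 'c) exp list)) + exp_cost (Succ idE :: ('p, 'c) exp) + (t' + t'a) \<le> clause_cost K \<and>
          out' = out \<and> store K m' (cls @ [map (map (exp_val T m)) ves]) \<and> frame {6, 8, 12} m m'))"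
      unfolding e1
    proof (rule run_mono[OF s1])
      fix t2 m2 out2 assume I: "I1 (length ps) t2 m2 out2"
      then have "out2 = out" by (simp add: I1_def)
      have "1 + sum_list (map exp_cost (lits [Num 12, Num 0] :: ('p, 'c) exp list)) + exp_cost (Succ idE :: ('p, 'c) exp) \<le> 7"
        by (simp add: idE_def)
      note f = fin[OF I _ this]
      show "run T (seqC (map (\<lambda>j. addN [Num 8] (ves ! j) idE) [1..<K + 1])) m2 out2
        (\<lambda>t'a m' out'. 1 + sum_list (map exp_cost (lits [Num 12, Num 0] :: ('p, 'c) exp list)) + exp_cost (Succ idE :: ('p, 'c) exp) + (t2 + t'a) \<le> clause_cost K \<and>
          out' = out \<and> store K m' (cls @ [map (map (exp_val T m)) ves]) \<and> frame {6, 8, 12} m m')"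
        unfolding \<open>out2 = out\<close> by (rule run_mono[OF s2[OF I]]) (rule f)
    qed
  qed
qed

definition vecE :: "nat \<Rightarrow> ('p, 'c) exp \<Rightarrow> nat \<Rightarrow> ('p, 'c) exp list" where
  "vecE K c j = map (\<lambda>i. Cell (Lit (Num 6) # c # lits [Num j, Num i])) [0..<K]"

definition derivedE :: "('p, 'c) exp list \<Rightarrow> ('p, 'c) bexp" where
  "derivedE w = Eq (Cell (Lit (Num 10) # w)) (Lit (Num 1))"

text \<open>The queue holds clause numbers that stand for their heads. All \<open>K\<close> body
  atoms are tested afresh, at a cost that depends on \<open>K\<close> alone, and a head that is
  already marked is not queued again.\<close>

definition fireC :: "nat \<Rightarrow> ('p, 'c) com" where
  "fireC K = (let c = Cell (lits [Num 12, Num 3]); q = Cell (lits [Num 12, Num 1]) in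
    If (And (conjB (map (\<lambda>j. derivedE (vecE K c j)) [1..<K + 1])) (Not (derivedE (vecE K c 0))))
      (Seq (Assign (Lit (Num 10) # vecE K c 0) (Lit (Num 1)))
        (Seq (Assign [Lit (Num 11), q] c) (Assign (lits [Num 12, Num 1]) (Succ q)))) Skip)"

definition visitC :: "nat \<Rightarrow> ('p, 'c) com" where
  "visitC K = (let f = vecE K (Cell (lits [Num 12, Num 2])) 0 in
    Seq (Assign (lits [Num 12, Num 2]) (Cell [Lit (Num 11), Cell (lits [Num 0, Num 2])]))
      (forC 3 (Cell (lits [Num 8, Num 1] @ f))
        (Seq (Assign (lits [Num 12, Num 3]) (Cell (lits [Num 8, Num 2] @ f @ [Cell (lits [Num 0, Num 3])])))
          (fireC K))))"

text \<open>The queue grows while it is processed, so the loop is bounded by the number of clauses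
  plus one, the largest possible queue length; iterations beyond the end of the queue only perform
  the test.\<close>

definition hornC :: "nat \<Rightarrow> ('p, 'c) com" where
  "hornC K = Seq (Assign (lits (Num 10 # replicate K (Num 0))) (Lit (Num 1)))
    (Seq (Assign (lits [Num 11, Num 0]) (Lit (Num 0)))
    (Seq (Assign (lits [Num 12, Num 1]) (Lit (Num 1)))
      (forC 2 (Succ (Cell (lits [Num 12, Num 0])))
        (If (Less (Cell (lits [Num 0, Num 2])) (Cell (lits [Num 12, Num 1]))) (visitC K) Skip))))"

lemma vecE_val:
  assumes "store K m cls" "exp_val T m c = Num n" "n \<le> length cls" "j \<le> K"
  shows "map (exp_val T m) (vecE K c j) = clause_atom K cls n j"
  using assms by (intro nth_equalityI) (auto simp: vecE_def store_def)

lemma vecE_cost: "sum_list (map exp_cost (vecE K c j)) = K * (4 + exp_cost c)"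
  by (simp add: vecE_def comp_def sum_list_triv algebra_simps)

text \<open>A word is counted only at its own parent. Hence visiting distinct atoms inspects each
  watch entry at most once, which is what makes the chaining linear.\<close>

lemma sum_card_exts_le:
  assumes "finite W" "finite A"
  shows "(\<Sum>w\<in>A. card (exts W w)) \<le> card W"
proof -
  have "(\<Sum>w\<in>A. card (exts W w)) = (\<Sum>w\<in>A. card ((\<lambda>x. w @ [x]) ` exts W w))"
    by (intro sum.cong refl card_image[symmetric]) (simp add: inj_on_def)
  also have "\<dots> = card (\<Union>w\<in>A. (\<lambda>x. w @ [x]) ` exts W w)"
    using assms by (intro card_UN_disjoint[symmetric])
      (auto intro: finite_subset[OF _ assms(1)] simp: exts_def)
  also have "\<dots> \<le> card W" using assms(1) by (intro card_mono) (auto simp: exts_def)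
  finally show ?thesis .
qed

lemma watch_finite: "finite (watch K cls)" and watch_card: "card (watch K cls) \<le> length cls * K"
proof -
  have eq: "watch K cls = (\<lambda>(c, j). clause_atom K cls c j @ [Num c]) ` ({1..length cls} \<times> {1..K})"
    by (auto simp: watch_def)
  show "finite (watch K cls)" by (simp add: eq)
  show "card (watch K cls) \<le> length cls * K"
    unfolding eq by (rule order.trans[OF card_image_le]) auto
qed

locale chaining =
  fixes T :: "('p, 'c) tables" and K :: nat and cls :: "'c val list list list"
  assumes K: "1 \<le> K"
begin

abbreviation "M \<equiv> length cls"
abbreviation "hd_of c \<equiv> clause_atom K cls c 0"

definition heads :: "nat list \<Rightarrow> 'c val list set" where "heads q = hd_of ` set q"

text \<open>Distinct heads bound the length of the queue and the work of the visits, the inclusion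
  in \<open>horn\<close> is soundness, and the entry 0 accounts for the zero vector.\<close>

definition queue :: "'c mem \<Rightarrow> nat list \<Rightarrow> bool" where
  "queue m q \<longleftrightarrow> store K m cls \<and> m [Num 12, Num 1] = Num (length q) \<and>
     (\<forall>i<length q. m [Num 11, Num i] = Num (q ! i) \<and> q ! i \<le> M) \<and>
     (\<forall>w. m (Num 10 # w) = Num (if w \<in> heads q then 1 else 0)) \<and>
     distinct (map hd_of q) \<and> heads q \<subseteq> horn K (set cls) \<and> 0 \<in> set q"

definition enabled :: "nat list \<Rightarrow> nat \<Rightarrow> bool" where
  "enabled q c \<longleftrightarrow> (\<forall>j\<in>{1..K}. clause_atom K cls c j \<in> heads q)"

abbreviation "fire_cost \<equiv> 28 + 14 * K + K * (5 + 7 * K)"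

lemma queue_cong:
  assumes "queue m q" "\<And>n r. n \<in> {6, 8, 10, 11} \<Longrightarrow> m' (Num n # r) = m (Num n # r)"
    "m' [Num 12, Num 0] = m [Num 12, Num 0]" "m' [Num 12, Num 1] = m [Num 12, Num 1]"
  shows "queue m' q"
proof -
  have "store K m' cls" using assms by (intro store_cong[of K m cls m']) (auto simp: queue_def)
  then show ?thesis using assms by (simp add: queue_def)
qed

lemma run_fireC:
  assumes q: "queue m q" and c: "m [Num 12, Num 3] = Num c" "c \<in> {1..M}"
  shows "run T (fireC K) m out (\<lambda>t m' out'. t \<le> fire_cost \<and> out' = out \<and> frame {10, 11, 12} m m' \<and>
    m' [Num 12, Num 2] = m [Num 12, Num 2] \<and>
    (\<exists>q'. queue m' (q @ q') \<and> (enabled q c \<longrightarrow> hd_of c \<in> heads (q @ q'))))"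
proof -
  let ?c = "Cell (lits [Num 12, Num 3]) :: ('p, 'c) exp" and ?q = "Cell (lits [Num 12, Num 1]) :: ('p, 'c) exp"
  let ?b = "And (conjB (map (\<lambda>j. derivedE (vecE K ?c j)) [1..<K + 1])) (Not (derivedE (vecE K ?c 0)))"
  have st: "store K m cls" using q by (simp add: queue_def)
  have vec: "map (exp_val T m) (vecE K ?c j) = clause_atom K cls c j" if "j \<le> K" for j
    using c that by (intro vecE_val[OF st]) auto
  have der: "bexp_val T m (derivedE (vecE K ?c j)) \<longleftrightarrow> clause_atom K cls c j \<in> heads q" if "j \<le> K" for j
    using q vec[OF that] by (simp add: derivedE_def queue_def)
  have b: "bexp_val T m ?b \<longleftrightarrow> enabled q c \<and> hd_of c \<notin> heads q"
    using der by (auto simp: enabled_def)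
  have dcost: "bexp_cost (derivedE (vecE K ?c j)) = 4 + 7 * K" for j
    by (simp add: derivedE_def vecE_cost)
  have "bexp_cost (conjB (map (\<lambda>j. derivedE (vecE K ?c j)) [1..<K + 1])) \<le> 3 + K * (5 + 7 * K)"
    using conjB_cost[of "map (\<lambda>j. derivedE (vecE K ?c j)) [1..<K + 1]" "4 + 7 * K"] dcost
    by (simp add: image_iff del: upt_Suc) (fastforce simp del: upt_Suc)
  then have bcost: "1 + bexp_cost ?b \<le> 10 + 7 * K + K * (5 + 7 * K)"
    by (simp add: dcost del: upt_Suc lits_simps)
  show ?thesis
    unfolding fireC_def Let_def
  proof (rule run_If)
    assume "bexp_val T m ?b"
    then have en: "enabled q c" "hd_of c \<notin> heads q" using b by auto
    let ?m1 = "m(Num 10 # hd_of c := Num 1)"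
    let ?m2 = "?m1([Num 11, Num (length q)] := Num c)"
    let ?m3 = "?m2([Num 12, Num 1] := Num (Suc (length q)))"
    have len: "m [Num 12, Num 1] = Num (length q)" using q by (simp add: queue_def)
    have e1: "m(map (exp_val T m) (Lit (Num 10) # vecE K ?c 0) := exp_val T m (Lit (Num 1))) = ?m1"
      using vec[of 0] by simp
    have e2: "?m1(map (exp_val T ?m1) [Lit (Num 11), ?q] := exp_val T ?m1 ?c) = ?m2"
      using len c by simp
    have e3: "?m2(map (exp_val T ?m2) (lits [Num 12, Num 1]) := exp_val T ?m2 (Succ ?q)) = ?m3"
      using len by simp
    have "cls ! (c - 1) \<in> set cls" using c(2) by (intro nth_mem) auto
    then have "cls ! (c - 1) ! 0 \<in> horn K (set cls)"
    proof (rule horn.step)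
      fix j assume "j \<in> {1..K}"
      then have "clause_atom K cls c j \<in> heads q" using en(1) by (simp add: enabled_def)
      then show "cls ! (c - 1) ! j \<in> horn K (set cls)"
        using q c(2) by (auto simp: queue_def clause_atom_def)
    qed
    then have hc: "hd_of c \<in> horn K (set cls)" using c(2) by (simp add: clause_atom_def)
    have st3: "store K ?m3 cls" by (rule store_cong[OF st]) auto
    have hq: "heads (q @ [c]) = insert (hd_of c) (heads q)" by (auto simp: heads_def)
    have "queue ?m3 (q @ [c])"
      unfolding queue_def
    proof (intro conjI allI impI)
      show "?m3 [Num 11, Num i] = Num ((q @ [c]) ! i)" if "i < length (q @ [c])" for i
        using q that by (auto simp: queue_def nth_append less_Suc_eq)
      show "(q @ [c]) ! i \<le> M" if "i < length (q @ [c])" for i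
        using q c(2) that by (auto simp: queue_def nth_append less_Suc_eq)
      show "distinct (map hd_of (q @ [c]))" using q en(2) by (auto simp: queue_def heads_def)
      show "heads (q @ [c]) \<subseteq> horn K (set cls)" using q hc unfolding hq by (simp add: queue_def)
    qed (use q st3 in \<open>auto simp: queue_def hq\<close>)
    moreover have "hd_of c \<in> heads (q @ [c])" by (simp add: hq)
    moreover have "frame {10, 11, 12} m ?m3" by (simp add: frame_upd)
    ultimately have post: "(1 + bexp_cost ?b + (1 + sum_list (map exp_cost (Lit (Num 10) # vecE K ?c 0)) + exp_cost (Lit (Num 1) :: ('p, 'c) exp) +
        (1 + sum_list (map exp_cost [Lit (Num 11), ?q]) + exp_cost ?c +
        (1 + sum_list (map exp_cost (lits [Num 12, Num 1] :: ('p, 'c) exp list)) + exp_cost (Succ ?q)))) \<le> fire_cost) \<and>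
        out = out \<and> frame {10, 11, 12} m ?m3 \<and> ?m3 [Num 12, Num 2] = m [Num 12, Num 2] \<and>
        (\<exists>q'. queue ?m3 (q @ q') \<and> (enabled q c \<longrightarrow> hd_of c \<in> heads (q @ q')))"
      using bcost by (auto simp: vecE_cost simp del: bexp_cost.simps intro!: exI[of _ "[c]"])
    show "run T (Seq (Assign (Lit (Num 10) # vecE K ?c 0) (Lit (Num 1)))
        (Seq (Assign [Lit (Num 11), ?q] ?c) (Assign (lits [Num 12, Num 1]) (Succ ?q)))) m out
      (\<lambda>t m' out'. 1 + bexp_cost ?b + t \<le> fire_cost \<and> out' = out \<and> frame {10, 11, 12} m m' \<and>
        m' [Num 12, Num 2] = m [Num 12, Num 2] \<and>
        (\<exists>q'. queue m' (q @ q') \<and> (enabled q c \<longrightarrow> hd_of c \<in> heads (q @ q'))))"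
      apply (intro run_Seq run_Assign)
      unfolding e1 e2 e3
      by (rule post)
  next
    assume "\<not> bexp_val T m ?b"
    then show "run T Skip m out
      (\<lambda>t m' out'. 1 + bexp_cost ?b + t \<le> fire_cost \<and> out' = out \<and> frame {10, 11, 12} m m' \<and>
        m' [Num 12, Num 2] = m [Num 12, Num 2] \<and>
        (\<exists>q'. queue m' (q @ q') \<and> (enabled q c \<longrightarrow> hd_of c \<in> heads (q @ q'))))"
      using b q bcost by (intro run_Skip) (auto simp del: bexp_cost.simps intro!: exI[of _ "[]"])
  qed
qed

abbreviation "watch_cost \<equiv> 60 + 40 * K + 7 * (K * K)"

text \<open>By \<open>closed\<close>, clauses enabled by the first \<open>i\<close> entries already
  have their heads in the queue. Entry \<open>i\<close> can newly enable only clauses that watch its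
  head, so these are the only ones to inspect.\<close>

lemma run_visitC:
  assumes q: "queue m q" and i: "i < length q" and cnt: "m [Num 0, Num 2] = Num i"
    and closed: "\<And>c. c \<in> {1..M} \<Longrightarrow> enabled (take i q) c \<Longrightarrow> hd_of c \<in> heads q"
  shows "run T (visitC K) m out (\<lambda>t m' out'.
    t \<le> 30 + 7 * K + watch_cost * card (exts (watch K cls) (hd_of (q ! i))) \<and> out' = out \<and>
    frame {0, 10, 11, 12} m m' \<and> m' [Num 0, Num 2] = Num i \<and>
    (\<exists>q'. queue m' (q @ q') \<and> (\<forall>c\<in>{1..M}. enabled (take (Suc i) q) c \<longrightarrow> hd_of c \<in> heads (q @ q'))))"
proof -
  let ?f = "vecE K (Cell (lits [Num 12, Num 2])) 0 :: ('p, 'c) exp list"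
  define f where "f = hd_of (q ! i)"
  have st: "store K m cls" using q by (simp add: queue_def)
  have qi: "q ! i \<le> M" "m [Num 11, Num i] = Num (q ! i)" using q i by (auto simp: queue_def)
  define m0 where "m0 = m([Num 12, Num 2] := Num (q ! i))"
  have e0: "m(map (exp_val T m) (lits [Num 12, Num 2]) := exp_val T m (Cell [Lit (Num 11), Cell (lits [Num 0, Num 2])])) = m0"
    using cnt qi by (simp add: m0_def)
  have q0: "queue m0 q" by (rule queue_cong[OF q]) (auto simp: m0_def)
  have vec: "map (exp_val T m') ?f = f" if "queue m' q'" "m' [Num 12, Num 2] = Num (q ! i)" for m' q'
    unfolding f_def using that qi(1) by (intro vecE_val) (auto simp: queue_def)
  have "trie m [Num 8] (watch K cls)" using st by (simp add: store_def)
  then have "\<exists>xs. distinct xs \<and> set xs = exts (watch K cls) f \<and> m ([Num 8] @ Num 1 # f) = Num (length xs) \<and>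
      (\<forall>i<length xs. m ([Num 8] @ Num 2 # f @ [Num i]) = xs ! i)" unfolding trie_def by blast
  then obtain xs where xs: "distinct xs" "set xs = exts (watch K cls) f" "m (Num 8 # Num 1 # f) = Num (length xs)"
      "\<And>i. i < length xs \<Longrightarrow> m (Num 8 # Num 2 # f @ [Num i]) = xs ! i" by auto
  have len_xs: "length xs = card (exts (watch K cls) f)" using distinct_card[OF xs(1)] xs(2) by simp
  define I where "I n t m' out' \<longleftrightarrow> t \<le> 4 + n * watch_cost \<and> out' = out \<and> frame {0, 10, 11, 12} m m' \<and>
    m' [Num 0, Num 2] = Num i \<and> m' [Num 12, Num 2] = Num (q ! i) \<and>
    (\<exists>q'. queue m' (q @ q') \<and> (\<forall>c\<in>{1..M}. enabled (take (Suc i) q) c \<and>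
        (f \<in> (\<lambda>j. clause_atom K cls c j) ` {1..K} \<longrightarrow> Num c \<in> set (take n xs)) \<longrightarrow> hd_of c \<in> heads (q @ q')))"
    for n t :: nat and m' :: "'c mem" and out' :: "('p, 'c) fact set"
  have tk: "heads (take (Suc i) q) = insert f (heads (take i q))"
    using i by (simp add: take_Suc_conv_app_nth heads_def f_def)
  have fcost: "sum_list (map exp_cost ?f) = 7 * K" by (simp add: vecE_cost)
  have m8: "m' (Num 8 # r) = m (Num 8 # r)" if "frame {0, 10, 11, 12} m m'" for m' r
    using that by (simp add: frame_def)
  have loop: "run T (forC 3 (Cell (lits [Num 8, Num 1] @ ?f))
        (Seq (Assign (lits [Num 12, Num 3]) (Cell (lits [Num 8, Num 2] @ ?f @ [Cell (lits [Num 0, Num 3])])))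
          (fireC K))) m0 out (\<lambda>t m' out'.
    8 + t \<le> 30 + 7 * K + watch_cost * card (exts (watch K cls) (hd_of (q ! i))) \<and> out' = out \<and>
    frame {0, 10, 11, 12} m m' \<and> m' [Num 0, Num 2] = Num i \<and>
    (\<exists>q'. queue m' (q @ q') \<and> (\<forall>c\<in>{1..M}. enabled (take (Suc i) q) c \<longrightarrow> hd_of c \<in> heads (q @ q'))))"
  proof (rule run_forC[where I = I and N = "length xs"])
    let ?m = "m0([Num 0, Num 3] := Num 0)"
    have "queue ?m (q @ [])" using q0 by (auto intro: queue_cong)
    moreover have "hd_of c \<in> heads (q @ [])"
      if c: "c \<in> {1..M}" "enabled (take (Suc i) q) c" "f \<notin> (\<lambda>j. clause_atom K cls c j) ` {1..K}" for c
    proof -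
      \<comment> \<open>The head of entry \<open>i\<close> is not in the body of this clause, so the
        earlier entries enable it already.\<close>
      have "enabled (take i q) c" using c(2,3) unfolding enabled_def tk by auto
      then show ?thesis using closed[OF c(1)] by simp
    qed
    moreover have "frame {0, 10, 11, 12} m ?m" by (simp add: m0_def frame_upd)
    ultimately show "I 0 4 ?m out"
      unfolding I_def using cnt by (auto simp: m0_def intro!: exI[of _ "[]"])
  next
    fix n t m' out' assume I: "I n t m' out'"
    then obtain q' where "queue m' (q @ q')" "m' [Num 12, Num 2] = Num (q ! i)" "frame {0, 10, 11, 12} m m'"
      by (auto simp: I_def)
    then show "exp_val T m' (Cell (lits [Num 8, Num 1] @ ?f)) = Num (length xs)"
      using vec xs(3) m8[of m'] by simp
  next
    fix n t m' out' assume n: "n < length xs" and I: "I n t m' out'" and cn: "m' [Num 0, Num 3] = Num n"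
    obtain q' where q': "queue m' (q @ q')" "m' [Num 12, Num 2] = Num (q ! i)" "frame {0, 10, 11, 12} m m'"
      "\<And>c. c \<in> {1..M} \<Longrightarrow> enabled (take (Suc i) q) c \<Longrightarrow>
        (f \<in> (\<lambda>j. clause_atom K cls c j) ` {1..K} \<Longrightarrow> Num c \<in> set (take n xs)) \<Longrightarrow> hd_of c \<in> heads (q @ q')"
      using I by (auto simp: I_def)
    have "xs ! n \<in> exts (watch K cls) f" using xs(2) n nth_mem by blast
    then obtain c where c: "xs ! n = Num c" "c \<in> {1..M}" by (auto simp: exts_def watch_def)
    have entry: "m' (Num 8 # Num 2 # f @ [Num n]) = Num c" using xs(4)[OF n] m8[OF q'(3)] c by simp
    define m1 where "m1 = m'([Num 12, Num 3] := Num c)"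
    have q1: "queue m1 (q @ q')" by (rule queue_cong[OF q'(1)]) (auto simp: m1_def)
    have e1: "m'(map (exp_val T m') (lits [Num 12, Num 3]) :=
        exp_val T m' (Cell (lits [Num 8, Num 2] @ ?f @ [Cell (lits [Num 0, Num 3])]))) = m1"
      using vec[OF q'(1,2)] cn entry by (simp add: m1_def)
    have m1c: "m1 [Num 12, Num 3] = Num c" by (simp add: m1_def)
    have takes: "set (take (Suc n) xs) = insert (Num c) (set (take n xs))"
      using n c(1) by (simp add: take_Suc_conv_app_nth)
    show "run T (Seq (Assign (lits [Num 12, Num 3]) (Cell (lits [Num 8, Num 2] @ ?f @ [Cell (lits [Num 0, Num 3])])))
          (fireC K)) m' out' (\<lambda>t' m'' out''. m'' [Num 0, Num 3] = Num n \<and>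
        I (Suc n) (t + (12 + exp_cost (Cell (lits [Num 8, Num 1] @ ?f))) + t') (m''([Num 0, Num 3] := Num (Suc n))) out'')"
      apply (intro run_Seq run_Assign)
      unfolding e1
    proof (rule run_mono[OF run_fireC[OF q1 m1c c(2)]])
      fix t' m2 out2
      assume A: "t' \<le> fire_cost \<and> out2 = out' \<and> frame {10, 11, 12} m1 m2 \<and>
        m2 [Num 12, Num 2] = m1 [Num 12, Num 2] \<and>
        (\<exists>q''. queue m2 ((q @ q') @ q'') \<and> (enabled (q @ q') c \<longrightarrow> hd_of c \<in> heads ((q @ q') @ q'')))"
      then obtain q'' where q'': "queue m2 (q @ (q' @ q''))" "enabled (q @ q') c \<longrightarrow> hd_of c \<in> heads (q @ (q' @ q''))"
        by auto
      have fr1: "frame {0, 10, 11, 12} m m1" using q'(3) by (simp add: m1_def frame_upd)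
      have "frame {0, 10, 11, 12} m1 m2" using A frame_mono by blast
      then have fr2: "frame {0, 10, 11, 12} m m2" using fr1 frame_trans by blast
      have m20: "m2 [Num 0, Num 3] = Num n" "m2 [Num 0, Num 2] = Num i"
        using A cn I by (simp_all add: frame_def m1_def I_def)
      have mono: "heads (q @ q') \<subseteq> heads (q @ (q' @ q''))" "heads (take (Suc i) q) \<subseteq> heads (q @ q')"
        using set_take_subset[of "Suc i" q] by (auto simp: heads_def)
      have "I (Suc n) (t + (12 + exp_cost (Cell (lits [Num 8, Num 1] @ ?f))) +
          (1 + sum_list (map exp_cost (lits [Num 12, Num 3] :: ('p, 'c) exp list)) +
           exp_cost (Cell (lits [Num 8, Num 2] @ ?f @ [Cell (lits [Num 0, Num 3])])) + t'))
          (m2([Num 0, Num 3] := Num (Suc n))) out2"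
        unfolding I_def
      proof (intro conjI exI[of _ "q' @ q''"] ballI impI)
        show "t + (12 + exp_cost (Cell (lits [Num 8, Num 1] @ ?f))) +
          (1 + sum_list (map exp_cost (lits [Num 12, Num 3] :: ('p, 'c) exp list)) +
           exp_cost (Cell (lits [Num 8, Num 2] @ ?f @ [Cell (lits [Num 0, Num 3])])) + t') \<le> 4 + Suc n * watch_cost"
          using I A by (simp add: I_def vecE_cost algebra_simps)
        show "queue (m2([Num 0, Num 3] := Num (Suc n))) (q @ q' @ q'')"
          by (rule queue_cong[OF q''(1)]) auto
        fix c' assume c': "c' \<in> {1..M}" "enabled (take (Suc i) q) c' \<and>
            (f \<in> (\<lambda>j. clause_atom K cls c' j) ` {1..K} \<longrightarrow> Num c' \<in> set (take (Suc n) xs))"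
        show "hd_of c' \<in> heads (q @ q' @ q'')"
        proof (cases "c' = c")
          case True
          have "enabled (q @ q') c" using c'(2) True mono(2) unfolding enabled_def by blast
          then show ?thesis using q''(2) True by blast
        next
          case False
          then have "hd_of c' \<in> heads (q @ q')" using c' takes by (intro q'(4)) auto
          then show ?thesis using mono(1) by blast
        qed
      qed (use A I fr2 m20 q'(2) in \<open>auto simp: I_def frame_upd m1_def\<close>)
      with m20 show "m2 [Num 0, Num 3] = Num n \<and>
        I (Suc n) (t + (12 + exp_cost (Cell (lits [Num 8, Num 1] @ ?f))) +
          (1 + sum_list (map exp_cost (lits [Num 12, Num 3] :: ('p, 'c) exp list)) +
           exp_cost (Cell (lits [Num 8, Num 2] @ ?f @ [Cell (lits [Num 0, Num 3])])) + t'))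
          (m2([Num 0, Num 3] := Num (Suc n))) out2" by blast
    qed
  next
    fix t m' out' assume I: "I (length xs) t m' out'"
    then obtain q' where q': "queue m' (q @ q')"
      "\<And>c. c \<in> {1..M} \<Longrightarrow> enabled (take (Suc i) q) c \<Longrightarrow>
        (f \<in> (\<lambda>j. clause_atom K cls c j) ` {1..K} \<Longrightarrow> Num c \<in> set xs) \<Longrightarrow> hd_of c \<in> heads (q @ q')"
      by (auto simp: I_def)
    have "hd_of c \<in> heads (q @ q')" if "c \<in> {1..M}" "enabled (take (Suc i) q) c" for c
    proof (rule q'(2)[OF that])
      assume "f \<in> (\<lambda>j. clause_atom K cls c j) ` {1..K}"
      then show "Num c \<in> set xs" using that(1) by (auto simp: xs(2) exts_def watch_def)
    qed
    then show "8 + (t + (5 + exp_cost (Cell (lits [Num 8, Num 1] @ ?f)))) \<le>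
        30 + 7 * K + watch_cost * card (exts (watch K cls) (hd_of (q ! i))) \<and> out' = out \<and>
      frame {0, 10, 11, 12} m m' \<and> m' [Num 0, Num 2] = Num i \<and>
      (\<exists>q'. queue m' (q @ q') \<and> (\<forall>c\<in>{1..M}. enabled (take (Suc i) q) c \<longrightarrow> hd_of c \<in> heads (q @ q')))"
      using I q'(1) by (auto simp: I_def vecE_cost len_xs f_def mult.commute)
  qed
  show ?thesis
    unfolding visitC_def Let_def
    apply (intro run_Seq run_Assign)
    unfolding e0
    by (rule run_mono[OF loop]) auto
qed

definition horn_cost :: "nat \<Rightarrow> nat" where
  "horn_cost n = 40 + K + (n + 1) * (60 + 7 * K) + n * K * watch_cost"

lemma run_hornC:
  assumes st: "store K m cls" and m10: "\<And>w. m (Num 10 # w) = Num 0"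
  shows "run T (hornC K) m out (\<lambda>t m' out'. t \<le> horn_cost M \<and> out' = out \<and>
    frame {0, 10, 11, 12} m m' \<and> (\<forall>w. m' (Num 10 # w) = Num (if w \<in> horn K (set cls) then 1 else 0)))"
proof -
  let ?z = "replicate K (Num 0) :: 'c val list"
  define m3 where "m3 = m(Num 10 # ?z := Num 1, [Num 11, Num 0] := Num 0, [Num 12, Num 1] := Num 1)"
  have hz: "hd_of 0 = ?z" by (simp add: clause_atom_def)
  have st3: "store K m3 cls" by (rule store_cong[OF st]) (auto simp: m3_def)
  have q0: "queue m3 [0]"
    using st3 m10 horn.zero[of K "set cls"] by (auto simp: queue_def heads_def hz m3_def)
  define wt where "wt q = sum_list (map (\<lambda>c. card (exts (watch K cls) (hd_of c))) q)" for q
  define I where "I i t m' out' \<longleftrightarrow> out' = out \<and> frame {0, 10, 11, 12} m m' \<and>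
    (\<exists>q. queue m' q \<and> t \<le> 4 + i * (60 + 7 * K) + watch_cost * wt (take i q) \<and>
      (\<forall>c\<in>{1..M}. enabled (take i q) c \<longrightarrow> hd_of c \<in> heads q))"
    for i t :: nat and m' :: "'c mem" and out' :: "('p, 'c) fact set"
  have loop: "run T (forC 2 (Succ (Cell (lits [Num 12, Num 0])))
        (If (Less (Cell (lits [Num 0, Num 2])) (Cell (lits [Num 12, Num 1]))) (visitC K) Skip)) m3 out
    (\<lambda>t m' out'. K + 15 + t \<le> horn_cost M \<and> out' = out \<and>
    frame {0, 10, 11, 12} m m' \<and> (\<forall>w. m' (Num 10 # w) = Num (if w \<in> horn K (set cls) then 1 else 0)))"
  proof (rule run_forC[where I = I and N = "Suc M"])
    have "queue (m3([Num 0, Num 2] := Num 0)) [0]" by (rule queue_cong[OF q0]) auto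
    \<comment> \<open>By \<open>K \<ge> 1\<close> every clause has a body position, so the empty
      queue enables nothing and the invariant holds at the start.\<close>
    moreover have "\<not> enabled [] c" for c using K by (auto simp: enabled_def heads_def)
    moreover have "frame {0, 10, 11, 12} m (m3([Num 0, Num 2] := Num 0))" by (simp add: m3_def frame_upd)
    ultimately show "I 0 4 (m3([Num 0, Num 2] := Num 0)) out" unfolding I_def by auto
  next
    fix i t m' out' assume "I i t m' out'"
    then show "exp_val T m' (Succ (Cell (lits [Num 12, Num 0]))) = Num (Suc M)"
      by (auto simp: I_def queue_def store_def)
  next
    fix i t m' out' assume i: "i < Suc M" and I: "I i t m' out'" and cn: "m' [Num 0, Num 2] = Num i"
    obtain q where q: "queue m' q" "t \<le> 4 + i * (60 + 7 * K) + watch_cost * wt (take i q)"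
      "\<And>c. c \<in> {1..M} \<Longrightarrow> enabled (take i q) c \<Longrightarrow> hd_of c \<in> heads q" using I by (auto simp: I_def)
    have out: "out' = out" and fr: "frame {0, 10, 11, 12} m m'" using I by (simp_all add: I_def)
    let ?b = "Less (Cell (lits [Num 0, Num 2])) (Cell (lits [Num 12, Num 1])) :: ('p, 'c) bexp"
    let ?P = "\<lambda>t' m'' out''. m'' [Num 0, Num 2] = Num i \<and>
      I (Suc i) (t + (12 + exp_cost (Succ (Cell (lits [Num 12, Num 0])) :: ('p, 'c) exp)) + t') (m''([Num 0, Num 2] := Num (Suc i))) out''"
    have b: "bexp_val T m' ?b \<longleftrightarrow> i < length q" using q(1) cn by (simp add: queue_def)
    show "run T (If ?b (visitC K) Skip) m' out' ?P"
    proof (rule run_If)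
      assume "bexp_val T m' ?b"
      then have iq: "i < length q" using b by simp
      show "run T (visitC K) m' out' (\<lambda>t'. ?P (1 + bexp_cost ?b + t'))"
      proof (rule run_mono[OF run_visitC[OF q(1) iq cn q(3)]])
        fix t' m2 out2
        assume A: "t' \<le> 30 + 7 * K + watch_cost * card (exts (watch K cls) (hd_of (q ! i))) \<and> out2 = out' \<and>
          frame {0, 10, 11, 12} m' m2 \<and> m2 [Num 0, Num 2] = Num i \<and>
          (\<exists>q'. queue m2 (q @ q') \<and> (\<forall>c\<in>{1..M}. enabled (take (Suc i) q) c \<longrightarrow> hd_of c \<in> heads (q @ q')))"
        then obtain q' where q': "queue m2 (q @ q')"
          "\<forall>c\<in>{1..M}. enabled (take (Suc i) q) c \<longrightarrow> hd_of c \<in> heads (q @ q')" by blast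
        have tk: "take (Suc i) (q @ q') = take (Suc i) q" using iq by simp
        have wt: "wt (take (Suc i) q) = wt (take i q) + card (exts (watch K cls) (hd_of (q ! i)))"
          using iq by (simp add: wt_def take_Suc_conv_app_nth)
        have "queue (m2([Num 0, Num 2] := Num (Suc i))) (q @ q')" by (rule queue_cong[OF q'(1)]) auto
        moreover have "frame {0, 10, 11, 12} m (m2([Num 0, Num 2] := Num (Suc i)))"
          using A fr by (auto intro: frame_upd frame_trans)
        moreover have "t + (12 + exp_cost (Succ (Cell (lits [Num 12, Num 0])) :: ('p, 'c) exp)) + (1 + bexp_cost ?b + t') \<le>
            4 + Suc i * (60 + 7 * K) + watch_cost * wt (take (Suc i) (q @ q'))"
          using A q(2) unfolding tk wt by (simp add: algebra_simps)
        ultimately show "?P (1 + bexp_cost ?b + t') m2 out2"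
          using A q'(2) out unfolding I_def tk[symmetric] by auto
      qed
    next
      assume "\<not> bexp_val T m' ?b"
      then have iq: "length q \<le> i" using b by simp
      have "queue (m'([Num 0, Num 2] := Num (Suc i))) q" by (rule queue_cong[OF q(1)]) auto
      moreover have "frame {0, 10, 11, 12} m (m'([Num 0, Num 2] := Num (Suc i)))" using fr by (auto intro: frame_upd)
      moreover have "t + (12 + exp_cost (Succ (Cell (lits [Num 12, Num 0])) :: ('p, 'c) exp)) + (1 + bexp_cost ?b + 0) \<le>
            4 + Suc i * (60 + 7 * K) + watch_cost * wt (take (Suc i) q)"
        using q(2) iq by simp
      ultimately have "I (Suc i) (t + (12 + exp_cost (Succ (Cell (lits [Num 12, Num 0])) :: ('p, 'c) exp)) + (1 + bexp_cost ?b + 0))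
          (m'([Num 0, Num 2] := Num (Suc i))) out'"
        unfolding I_def using q(3) iq out by auto
      then show "run T Skip m' out' (\<lambda>t'. ?P (1 + bexp_cost ?b + t'))"
        using cn by (intro run_Skip) simp
    qed
  next
    fix t m' out' assume I: "I (Suc M) t m' out'"
    then obtain q where q: "queue m' q" "t \<le> 4 + Suc M * (60 + 7 * K) + watch_cost * wt (take (Suc M) q)"
      "\<And>c. c \<in> {1..M} \<Longrightarrow> enabled (take (Suc M) q) c \<Longrightarrow> hd_of c \<in> heads q" by (auto simp: I_def)
    have dq: "distinct (map hd_of q)" "distinct q" using q(1) by (auto simp: queue_def distinct_map)
    have "set q \<subseteq> {..M}" using q(1) by (auto simp: queue_def in_set_conv_nth)
    then have "card (set q) \<le> card {..M}" by (intro card_mono) auto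
    \<comment> \<open>The queue consists of distinct numbers between 0 and \<open>M\<close>, so the
      loop has processed all of it.\<close>
    then have "length q \<le> Suc M" using distinct_card[OF dq(2)] by simp
    then have tk: "take (Suc M) q = q" by simp
    \<comment> \<open>Distinct heads turn the sum over the queue into a sum over atoms, which the
      number of watch entries bounds.\<close>
    have "wt q = (\<Sum>w\<in>heads q. card (exts (watch K cls) w))"
      using sum_list_distinct_conv_sum_set[OF dq(1), of "\<lambda>w. card (exts (watch K cls) w)"]
      by (simp add: wt_def heads_def comp_def)
    also have "\<dots> \<le> M * K"
      by (rule order.trans[OF sum_card_exts_le watch_card]) (auto simp: watch_finite heads_def)
    finally have wt: "watch_cost * wt q \<le> watch_cost * (M * K)" by (rule mult_le_mono2)
    have "w \<in> heads q" if "w \<in> horn K (set cls)" for w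
      using that
    proof induction
      case zero
      then show ?case using q(1) hz by (force simp: queue_def heads_def)
    next
      case (step cl)
      then obtain c where c: "c < M" "cl = cls ! c" by (auto simp: in_set_conv_nth)
      then have "enabled q (Suc c)" using step(3) by (simp add: enabled_def clause_atom_def)
      then show ?case using q(3)[of "Suc c"] c by (simp add: tk clause_atom_def)
    qed
    then have "heads q = horn K (set cls)" using q(1) by (auto simp: queue_def)
    then show "K + 15 + (t + (5 + exp_cost (Succ (Cell (lits [Num 12, Num 0])) :: ('p, 'c) exp))) \<le> horn_cost M \<and> out' = out \<and>
      frame {0, 10, 11, 12} m m' \<and> (\<forall>w. m' (Num 10 # w) = Num (if w \<in> horn K (set cls) then 1 else 0))"
      using I q(1,2) wt unfolding tk I_def by (simp add: queue_def horn_cost_def algebra_simps)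
  qed
  define m1 where "m1 = m(Num 10 # ?z := Num 1)"
  define m2 where "m2 = m1([Num 11, Num 0] := Num 0)"
  have e1: "m(map (exp_val T m) (lits (Num 10 # ?z)) := exp_val T m (Lit (Num 1))) = m1"
    by (simp add: m1_def)
  have e2: "m1(map (exp_val T m1) (lits [Num 11, Num 0]) := exp_val T m1 (Lit (Num 0))) = m2"
    by (simp add: m2_def)
  have e3: "m2(map (exp_val T m2) (lits [Num 12, Num 1]) := exp_val T m2 (Lit (Num 1))) = m3"
    by (simp add: m1_def m2_def m3_def)
  show ?thesis
    unfolding hornC_def
    apply (intro run_Seq run_Assign)
    unfolding e1 e2 e3
    by (rule run_mono[OF loop]) simp
qed

end

section \<open>The tuples that match an edge, and their insertion into its trie\<close>

section \<open>Loading an edge\<close>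

definition pos :: "'c trm option list \<Rightarrow> nat \<Rightarrow> nat" where
  "pos us v = (LEAST i. i < length us \<and> us ! i = Some (Var v))"

definition matches :: "'c trm option list \<Rightarrow> 'c list \<Rightarrow> bool" where
  "matches us t \<longleftrightarrow> length t = length us \<and> (\<forall>i<length us. case us ! i of None \<Rightarrow> True
     | Some (Var v) \<Rightarrow> t ! i = t ! pos us v | Some (Const c) \<Rightarrow> t ! i = c)"

definition row :: "'c trm option list \<Rightarrow> nat list \<Rightarrow> 'c list \<Rightarrow> 'c val list" where
  "row us vs t = map (\<lambda>v. Cst (t ! pos us v)) vs"

definition edge_vars :: "nat list \<Rightarrow> ('p, 'c) batom \<Rightarrow> nat list" where
  "edge_vars vs b = filter (\<lambda>v. v \<in> batom_vars b) vs"

definition rows :: "('p \<Rightarrow> 'c list set) \<Rightarrow> nat list \<Rightarrow> ('p, 'c) batom \<Rightarrow> 'c val list set" where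
  "rows E vs b = row (snd b) (edge_vars vs b) ` {t \<in> E (fst b). matches (snd b) t}"

lemma pos:
  assumes "v \<in> batom_vars b"
  shows "pos (snd b) v < length (snd b)" "snd b ! pos (snd b) v = Some (Var v)"
proof -
  obtain i where "i < length (snd b) \<and> snd b ! i = Some (Var v)"
    using assms by (auto simp: mem_batom_vars in_set_conv_nth)
  then have "pos (snd b) v < length (snd b) \<and> snd b ! pos (snd b) v = Some (Var v)"
    unfolding pos_def by (rule LeastI)
  then show "pos (snd b) v < length (snd b)" "snd b ! pos (snd b) v = Some (Var v)" by auto
qed

lemma sat_rows:
  assumes "sat E \<beta> b"
  shows "proj vs (batom_vars b) (Cst \<circ> \<beta>) \<in> rows E vs b"
proof -
  obtain t where t: "t \<in> E (fst b)"
    "list_all2 (\<lambda>u c. case u of None \<Rightarrow> True | Some s \<Rightarrow> trm_val \<beta> s = c) (snd b) t"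
    using assms by (auto simp: sat_def)
  have len: "length t = length (snd b)" using list_all2_lengthD[OF t(2)] by simp
  have nth: "case snd b ! i of None \<Rightarrow> True | Some s \<Rightarrow> trm_val \<beta> s = t ! i" if "i < length (snd b)" for i
    using list_all2_nthD[OF t(2) that] .
  have val: "t ! pos (snd b) v = \<beta> v" if "v \<in> batom_vars b" for v
    using nth[of "pos (snd b) v"] pos[OF that] by simp
  have "matches (snd b) t"
    unfolding matches_def
  proof (intro conjI allI impI)
    fix i assume i: "i < length (snd b)"
    show "case snd b ! i of None \<Rightarrow> True | Some (Var v) \<Rightarrow> t ! i = t ! pos (snd b) v | Some (Const c) \<Rightarrow> t ! i = c"
    proof (cases "snd b ! i")
      case (Some s)
      show ?thesis
      proof (cases s)
        case (Var v)
        then have "v \<in> batom_vars b" using i Some nth_mem[OF i] by (simp add: mem_batom_vars)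
        then show ?thesis using val nth[OF i] Some Var by simp
      qed (use nth[OF i] Some in simp)
    qed simp
  qed (rule len)
  moreover have "proj vs (batom_vars b) (Cst \<circ> \<beta>) = row (snd b) (edge_vars vs b) t"
    using val by (auto simp: proj_def row_def edge_vars_def)
  ultimately show ?thesis using t(1) by (auto simp: rows_def)
qed

definition tupleE :: "'p \<Rightarrow> nat \<Rightarrow> ('p, 'c) exp" where
  "tupleE p i = Comp p (Cell (lits [Num 0, Num 1])) i"

definition matchB :: "('p, 'c) batom \<Rightarrow> ('p, 'c) bexp" where
  "matchB b = conjB (map (\<lambda>i. case snd b ! i of None \<Rightarrow> Eq (Lit (Num 0)) (Lit (Num 0))
     | Some (Var v) \<Rightarrow> Eq (tupleE (fst b) i) (tupleE (fst b) (pos (snd b) v))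
     | Some (Const c) \<Rightarrow> Eq (tupleE (fst b) i) (Lit (Cst c))) [0..<length (snd b)])"

text \<open>The tuples of the instance are scanned at run time; the facts of the program are known
  in advance, so the matching ones are inserted by literal code.\<close>

definition edgeC :: "'c val list \<Rightarrow> nat list \<Rightarrow> 'c list list \<Rightarrow> ('p, 'c) batom \<Rightarrow> ('p, 'c) com" where
  "edgeC pre vs fs b = Seq
     (forC 1 (Card (fst b)) (If (matchB b)
       (insW (Num 2 # pre) [] (map (\<lambda>v. tupleE (fst b) (pos (snd b) v)) (edge_vars vs b))) Skip))
     (seqC (map (\<lambda>t. insW (Num 2 # pre) [] (lits (row (snd b) (edge_vars vs b) t))) (filter (matches (snd b)) fs)))"

definition word_cost :: "nat \<Rightarrow> nat" where "word_cost k = k * (47 + 24 * k)"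

definition edge_cost :: "nat \<Rightarrow> nat" where "edge_cost k = 40 + 10 * k + 2 * word_cost k"

lemma matchB_val:
  assumes "m [Num 0, Num 1] = Num i" "i < length (T (fst b))" "length (T (fst b) ! i) = length (snd b)"
  shows "bexp_val T m (matchB b) \<longleftrightarrow> matches (snd b) (T (fst b) ! i)"
proof -
  have tup: "exp_val T m (tupleE (fst b) j) = Cst (T (fst b) ! i ! j)" if "j < length (snd b)" for j
    using assms that by (simp add: tupleE_def)
  have "bexp_val T m (case snd b ! j of None \<Rightarrow> Eq (Lit (Num 0)) (Lit (Num 0))
     | Some (Var v) \<Rightarrow> Eq (tupleE (fst b) j) (tupleE (fst b) (pos (snd b) v))
     | Some (Const c) \<Rightarrow> Eq (tupleE (fst b) j) (Lit (Cst c))) \<longleftrightarrow>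
    (case snd b ! j of None \<Rightarrow> True
     | Some (Var v) \<Rightarrow> T (fst b) ! i ! j = T (fst b) ! i ! pos (snd b) v
     | Some (Const c) \<Rightarrow> T (fst b) ! i ! j = c)" if j: "j < length (snd b)" for j
  proof (cases "snd b ! j")
    case (Some s)
    show ?thesis
    proof (cases s)
      case (Var v)
      then have "v \<in> batom_vars b" using Some nth_mem[OF j] by (simp add: mem_batom_vars)
      then show ?thesis using Some Var tup[OF j] tup[of "pos (snd b) v"] pos[of v b] by simp
    qed (use Some tup[OF j] in simp)
  qed simp
  then show ?thesis using assms(3) by (simp add: matchB_def matches_def) (simp add: Ball_def)
qed

lemma matchB_cost: "bexp_cost (matchB b) \<le> 3 + length (snd b) * 10"
proof -
  have "bexp_cost (matchB b) \<le> 3 + length (map (\<lambda>i. case snd b ! i of None \<Rightarrow> Eq (Lit (Num 0)) (Lit (Num 0))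
     | Some (Var v) \<Rightarrow> Eq (tupleE (fst b) i) (tupleE (fst b) (pos (snd b) v))
     | Some (Const c) \<Rightarrow> Eq (tupleE (fst b) i) (Lit (Cst c))) [0..<length (snd b)]) * (1 + 9)"
    unfolding matchB_def by (rule conjB_cost) (auto simp: tupleE_def split: option.splits trm.splits)
  then show ?thesis by simp
qed

text \<open>Different variables have different first positions in the atom.\<close>

lemma length_edge_vars:
  assumes "distinct vs"
  shows "length (edge_vars vs b) \<le> length (snd b)"
proof -
  have "length (edge_vars vs b) = card (set (edge_vars vs b))"
    using assms by (intro distinct_card[symmetric]) (simp add: edge_vars_def)
  also have "\<dots> \<le> card (pos (snd b) ` set (edge_vars vs b))"
  proof (rule card_inj_on_le[of "pos (snd b)"])
    show "inj_on (pos (snd b)) (set (edge_vars vs b))"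
    proof (rule inj_onI)
      fix v w assume vw: "v \<in> set (edge_vars vs b)" "w \<in> set (edge_vars vs b)" "pos (snd b) v = pos (snd b) w"
      have "snd b ! pos (snd b) v = Some (Var v)" "snd b ! pos (snd b) w = Some (Var w)"
        using vw(1,2) by (auto simp: edge_vars_def intro: pos(2))
      then have "Some (Var v) = (Some (Var w) :: 'b trm option)" unfolding vw(3) by (rule trans[OF sym])
      then show "v = w" by simp
    qed
  qed auto
  also have "\<dots> \<le> card {..<length (snd b)}"
    by (intro card_mono) (auto simp: edge_vars_def intro: pos(1))
  finally show ?thesis by simp
qed

text \<open>The trie may already hold a part \<open>S0\<close> of the rows, so loading an edge
  repeatedly does no harm. Other tries stay intact because distinct prefixes of the same length 2
  are never nested.\<close>

lemma run_edgeC: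
  fixes b :: "('p, 'c) batom"
  assumes tr: "trie m (Num 2 # pre) (pfx S0)" "S0 \<subseteq> rows E vs b" and pre: "length pre = 2"
    and E: "E (fst b) = set (T (fst b)) \<union> set fs" "\<And>t. t \<in> E (fst b) \<Longrightarrow> length t = length (snd b)"
    and len: "length (T (fst b)) \<le> N" "length fs \<le> N" "1 \<le> N" "length (snd b) \<le> k" and vs: "distinct vs"
  shows "run T (edgeC pre vs fs b) m out (\<lambda>t m' out'. t \<le> edge_cost k * N \<and> out' = out \<and>
    frame {0, 2} m m' \<and> (\<forall>pre' r. length pre' = 2 \<and> pre' \<noteq> pre \<longrightarrow> m' (Num 2 # pre' @ r) = m (Num 2 # pre' @ r)) \<and>
    trie m' (Num 2 # pre) (pfx (rows E vs b)))"
proof -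
  let ?evs = "edge_vars vs b" and ?n = "length (T (fst b))"
  let ?es = "map (\<lambda>v. tupleE (fst b) (pos (snd b) v)) ?evs :: ('p, 'c) exp list"
  have lev: "length ?evs \<le> k" using length_edge_vars[OF vs, of b] len(4) by simp
  have wc: "length es * (23 + 6 * length pre + 6 * 4 * length es + 3 * 4) \<le> word_cost k"
    if "length es = length ?evs" for es :: "('p, 'c) exp list"
    unfolding word_cost_def using that lev pre by (intro mult_le_mono) simp_all
  define keep where "keep m' \<longleftrightarrow> frame {0, 2} m m' \<and>
    (\<forall>pre' r. length pre' = 2 \<and> pre' \<noteq> pre \<longrightarrow> m' (Num 2 # pre' @ r) = m (Num 2 # pre' @ r))" for m'
  have keep_under: "keep m''" if "keep m'" "under (Num 2 # pre) m' m''" for m' m''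
  proof -
    have "frame {0, 2} m' m''" using under_frame[OF that(2)] frame_mono by blast
    moreover have "m'' (Num 2 # pre' @ r) = m' (Num 2 # pre' @ r)" if "length pre' = 2" "pre' \<noteq> pre" for pre' r
      using \<open>under _ m' m''\<close> that pre by (auto simp: under_def)
    ultimately show ?thesis using that(1) unfolding keep_def by (auto intro: frame_trans)
  qed
  have keep_cnt: "keep (m'([Num 0, Num 1] := x))" if "keep m'" for m' x
    using that by (auto simp: keep_def frame_upd)
  define R where "R A = row (snd b) ?evs ` {t \<in> A. matches (snd b) t}" for A
  have R_insert: "R (insert t A) = (if matches (snd b) t then insert (row (snd b) ?evs t) (R A) else R A)" for t A
    by (auto simp: R_def)
  have rows_R: "rows E vs b = R (set (T (fst b))) \<union> R (set fs)"
    unfolding rows_def R_def E(1) by auto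
  have trie_cnt: "trie (m'([Num 0, Num 1] := x)) (Num 2 # pre) X" if "trie m' (Num 2 # pre) X" for m' x X
    using that by (rule trie_frame[where Y = "{0}"]) (auto intro: frame_upd)
  define I where "I i t m' out' \<longleftrightarrow> t \<le> 4 + i * (17 + 10 * k + word_cost k) \<and> out' = out \<and> keep m' \<and>
    trie m' (Num 2 # pre) (pfx (S0 \<union> R (set (take i (T (fst b))))))" for i t :: nat and m' out'
  have loop: "run T (forC 1 (Card (fst b)) (If (matchB b) (insW (Num 2 # pre) [] ?es) Skip)) m out
    (\<lambda>t m' out'. t \<le> 10 + ?n * (17 + 10 * k + word_cost k) \<and> out' = out \<and> keep m' \<and>
      trie m' (Num 2 # pre) (pfx (S0 \<union> R (set (T (fst b))))))"
  proof (rule run_forC[where I = I and N = ?n])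
    have "keep m" by (simp add: keep_def)
    then show "I 0 4 (m([Num 0, Num 1] := Num 0)) out"
      using keep_cnt trie_cnt tr(1) by (simp add: I_def R_def)
  next
    fix i t m' out' assume i: "i < ?n" and I: "I i t m' out'" and cn: "m' [Num 0, Num 1] = Num i"
    let ?t = "T (fst b) ! i"
    have "?t \<in> E (fst b)" using i E(1) by simp
    then have lt: "length ?t = length (snd b)" by (rule E(2))
    have tk: "set (take (Suc i) (T (fst b))) = insert ?t (set (take i (T (fst b))))"
      using i by (simp add: take_Suc_conv_app_nth)
    have vals: "map (exp_val T m') ?es = row (snd b) ?evs ?t"
      using i cn lt pos(1)[of _ b] by (auto simp: row_def tupleE_def edge_vars_def)
    have c: "bexp_cost (matchB b) \<le> 3 + k * 10"
      using matchB_cost[of b] mult_le_mono1[OF len(4), of 10] by linarith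
    let ?P = "\<lambda>t' m'' out''. m'' [Num 0, Num 1] = Num i \<and>
      I (Suc i) (t + (12 + exp_cost (Card (fst b) :: ('p, 'c) exp)) + t') (m''([Num 0, Num 1] := Num (Suc i))) out''"
    show "run T (If (matchB b) (insW (Num 2 # pre) [] ?es) Skip) m' out' ?P"
    proof (rule run_If)
      assume "bexp_val T m' (matchB b)"
      then have mt: "matches (snd b) ?t" using matchB_val[of m' i T b] cn i lt by simp
      show "run T (insW (Num 2 # pre) [] ?es) m' out' (\<lambda>t'. ?P (1 + bexp_cost (matchB b) + t'))"
      proof (rule run_mono[OF run_insert_word[where S = "S0 \<union> R (set (take i (T (fst b))))" and K = 4]])
        show "trie m' (Num 2 # pre) (pfx (S0 \<union> R (set (take i (T (fst b))))))" using I by (simp add: I_def)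
        show "indep T {2} e \<and> exp_cost e \<le> 4" if "e \<in> set ?es" for e
          using that by (auto simp: tupleE_def intro!: indep_Comp indep_Cell)
        fix t' m2 out2
        assume A: "t' \<le> length ?es * (23 + 6 * length pre + 6 * 4 * length ?es + 3 * 4) \<and> out2 = out' \<and>
          under (Num 2 # pre) m' m2 \<and> trie m2 (Num 2 # pre)
            (pfx (insert (map (exp_val T m') ?es) (S0 \<union> R (set (take i (T (fst b)))))))"
        have "t' \<le> word_cost k" using A wc[of ?es] by simp
        moreover have "keep m2" using I A keep_under[of m' m2] by (simp add: I_def)
        moreover have "m2 [Num 0, Num 1] = Num i" using A cn by (auto simp: under_def)
        ultimately show "?P (1 + bexp_cost (matchB b) + t') m2 out2"
          using A I c keep_cnt trie_cnt mt unfolding vals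
          by (simp add: I_def tk R_insert algebra_simps)
      qed
    next
      assume "\<not> bexp_val T m' (matchB b)"
      then have mt: "\<not> matches (snd b) ?t" using matchB_val[of m' i T b] cn i lt by simp
      then show "run T Skip m' out' (\<lambda>t'. ?P (1 + bexp_cost (matchB b) + t'))"
        using I c cn keep_cnt trie_cnt by (intro run_Skip) (simp add: I_def tk R_insert)
    qed
  qed (auto simp: I_def)
  define fs' where "fs' = filter (matches (snd b)) fs"
  define J where "J i t m' out' \<longleftrightarrow> t \<le> i * word_cost k \<and> out' = out \<and> keep m' \<and>
    trie m' (Num 2 # pre) (pfx (S0 \<union> R (set (T (fst b))) \<union> R (set (take i fs'))))" for i t :: nat and m' out'
  have facts: "run T (seqC (map (\<lambda>t. insW (Num 2 # pre) [] (lits (row (snd b) ?evs t))) fs')) m1 out (J (length fs'))"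
    if m1: "keep m1" "trie m1 (Num 2 # pre) (pfx (S0 \<union> R (set (T (fst b)))))" for m1
  proof (rule run_seqC[where I = J])
    show "J 0 0 m1 out" using m1 by (simp add: J_def R_def)
    fix i t m' out' assume i: "i < length (map (\<lambda>t. insW (Num 2 # pre) [] (lits (row (snd b) ?evs t)) :: ('p, 'c) com) fs')"
      and J: "J i t m' out'"
    then have i': "i < length fs'" by simp
    have tk: "set (take (Suc i) fs') = insert (fs' ! i) (set (take i fs'))"
      using i' by (simp add: take_Suc_conv_app_nth)
    have mt: "matches (snd b) (fs' ! i)" using nth_mem[OF i'] by (simp add: fs'_def)
    let ?ls = "lits (row (snd b) ?evs (fs' ! i)) :: ('p, 'c) exp list"
    have "run T (insW (Num 2 # pre) [] ?ls) m' out' (\<lambda>t'. J (Suc i) (t + t'))"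
    proof (rule run_mono[OF run_insert_word[where K = 4]])
      show "trie m' (Num 2 # pre) (pfx (S0 \<union> R (set (T (fst b))) \<union> R (set (take i fs'))))" using J by (simp add: J_def)
      show "indep T {2} e \<and> exp_cost e \<le> 4" if "e \<in> set ?ls" for e
        using that by (auto simp: lits_def)
      fix t' m2 out2
      assume A: "t' \<le> length ?ls * (23 + 6 * length pre + 6 * 4 * length ?ls + 3 * 4) \<and> out2 = out' \<and>
        under (Num 2 # pre) m' m2 \<and> trie m2 (Num 2 # pre)
          (pfx (insert (map (exp_val T m') ?ls) (S0 \<union> R (set (T (fst b))) \<union> R (set (take i fs')))))"
      have "t' \<le> word_cost k" using A wc[of ?ls] by (simp add: row_def)
      moreover have "keep m2" using J A keep_under[of m' m2] by (simp add: J_def)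
      ultimately show "J (Suc i) (t + t') m2 out2"
        using A J mt by (simp add: J_def tk R_insert)
    qed
    then show "run T (map (\<lambda>t. insW (Num 2 # pre) [] (lits (row (snd b) ?evs t))) fs' ! i) m' out' (\<lambda>t'. J (Suc i) (t + t'))"
      using i' by simp
  qed simp
  have Rfs: "R (set fs') = R (set fs)" by (auto simp: R_def fs'_def)
  have total: "10 + ?n * (17 + 10 * k + word_cost k) + length fs' * word_cost k \<le> edge_cost k * N"
  proof -
    have "?n * (17 + 10 * k + word_cost k) \<le> N * (17 + 10 * k + word_cost k)" using len(1) by (rule mult_le_mono1)
    moreover have "length fs' * word_cost k \<le> N * word_cost k"
      unfolding fs'_def by (intro mult_le_mono1 le_trans[OF length_filter_le len(2)])
    moreover have "10 * 1 \<le> 10 * N" using len(3) by simp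
    moreover have "edge_cost k * N = 23 * N + N * (17 + 10 * k + word_cost k) + N * word_cost k"
      by (simp add: edge_cost_def algebra_simps)
    ultimately show ?thesis by linarith
  qed
  show ?thesis
    unfolding edgeC_def fs'_def[symmetric]
  proof (rule run_Seq, rule run_mono[OF loop])
    fix t1 m1 out1
    assume A: "t1 \<le> 10 + ?n * (17 + 10 * k + word_cost k) \<and> out1 = out \<and> keep m1 \<and>
      trie m1 (Num 2 # pre) (pfx (S0 \<union> R (set (T (fst b)))))"
    then have "out1 = out" by simp
    have all: "S0 \<union> R (set (T (fst b))) \<union> R (set (take (length fs') fs')) = rows E vs b"
      using tr(2) rows_R Rfs by auto
    show "run T (seqC (map (\<lambda>t. insW (Num 2 # pre) [] (lits (row (snd b) ?evs t))) fs')) m1 out1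
      (\<lambda>t' m' out'. t1 + t' \<le> edge_cost k * N \<and> out' = out \<and> frame {0, 2} m m' \<and>
        (\<forall>pre' r. length pre' = 2 \<and> pre' \<noteq> pre \<longrightarrow> m' (Num 2 # pre' @ r) = m (Num 2 # pre' @ r)) \<and>
        trie m' (Num 2 # pre) (pfx (rows E vs b)))"
      unfolding \<open>out1 = out\<close>
    proof (rule run_mono[OF facts])
      fix t2 m2 out2 assume "J (length fs') t2 m2 out2"
      then show "t1 + t2 \<le> edge_cost k * N \<and> out2 = out \<and> frame {0, 2} m m2 \<and>
        (\<forall>pre' r. length pre' = 2 \<and> pre' \<noteq> pre \<longrightarrow> m2 (Num 2 # pre' @ r) = m (Num 2 # pre' @ r)) \<and>
        trie m2 (Num 2 # pre) (pfx (rows E vs b))"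
        using A total unfolding J_def all keep_def by auto
    qed (use A in auto)
  qed
qed

section \<open>Encoding of facts and clauses, the complete program, and the sizes of the EDB
  relations\<close>

section \<open>The evaluation program\<close>

definition index_of :: "'a list \<Rightarrow> 'a \<Rightarrow> nat" where
  "index_of xs x = length (takeWhile (\<lambda>y. y \<noteq> x) xs)"

lemma nth_index_of: "x \<in> set xs \<Longrightarrow> xs ! index_of xs x = x"
  unfolding index_of_def by (induction xs) auto

definition expT :: "'c trm \<Rightarrow> ('p, 'c) exp" where
  "expT t = (case t of Var v \<Rightarrow> varE v | Const c \<Rightarrow> Lit (Cst c))"

lemma expT_cost: "exp_cost (expT t) \<le> 3"
  by (cases t) (auto simp: expT_def varE_def)

lemma expT_indep: "1 \<notin> X \<Longrightarrow> indep T X (expT t)"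
  by (cases t) (auto simp: expT_def varE_def intro!: indep_Cell)

lemma expT_val:
  assumes "\<And>v. v \<in> args_vars ts \<Longrightarrow> val_of m v = Cst (\<beta> v)"
  shows "map (exp_val T m) (map expT ts) = map Cst (map (trm_val \<beta>) ts)"
proof -
  have "exp_val T m (expT t) = Cst (trm_val \<beta> t)" if "t \<in> set ts" for t
  proof (cases t)
    case (Var v)
    then have "val_of m v = Cst (\<beta> v)" using that by (intro assms) (simp add: mem_args_vars)
    then show ?thesis using Var by (simp add: expT_def varE_def val_of_def)
  qed (simp add: expT_def)
  then show ?thesis by simp
qed

text \<open>\<open>pc\<close> numbers the predicates, since memory addresses and cells consist of
  constants and numbers only.\<close>

locale evaluator =
  fixes ar :: "'p \<Rightarrow> nat" and k :: nat and P :: "('p, 'c) program" and Js :: "('p, 'c) job list"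
    and pc :: "'p \<Rightarrow> nat"
  assumes P: "datalog_program ar P"
    and ok: "\<And>J. J \<in> set Js \<Longrightarrow> job_ok ar P k J"
    and rule: "\<And>J. J \<in> set Js \<Longrightarrow> job_rule P J"
    and width: "\<And>J. J \<in> set Js \<Longrightarrow> job_width P J"
    and complete: "jobs_complete ar P (set Js)"
    and pc: "inj_on pc (idb P \<union> edb P)"
    and edb_arity: "\<And>p. p \<in> edb P \<Longrightarrow> ar p \<le> k"
begin

definition K :: nat where "K = Suc k"

definition facts :: "'p \<Rightarrow> 'c list set" where "facts p = {t. Rule (p, map Const t) [] \<in> P}"

definition fact_tuples :: "'p \<Rightarrow> 'c list list" where
  "fact_tuples p = (SOME ts. distinct ts \<and> set ts = facts p)"

definition edb_facts :: "('p, 'c) fact list" where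
  "edb_facts = (SOME fs. distinct fs \<and> set fs = {(p, t). p \<in> edb P \<and> t \<in> facts p})"

definition vs :: "('p, 'c) job \<Rightarrow> nat list" where "vs J = sorted_list_of_set (job_vars J)"

definition tp :: "nat \<Rightarrow> ('p, 'c) batom \<Rightarrow> 'c val list" where
  "tp g b = [Num g, Num (index_of (jedges (Js ! g)) b)]"

text \<open>\<open>Suc\<close> makes the first component nonzero, so that no atom is encoded by the
  zero vector that pads the clauses. The remaining zeros bring all vectors to the common length
  \<open>K\<close>.\<close>

definition atomE :: "('p, 'c) atom \<Rightarrow> ('p, 'c) exp list" where
  "atomE a = Lit (Num (Suc (pc (fst a)))) # map expT (snd a) @ replicate (k - length (snd a)) (Lit (Num 0))"

definition fvec :: "('p, 'c) fact \<Rightarrow> 'c val list" where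
  "fvec f = Num (Suc (pc (fst f))) # map Cst (snd f) @ replicate (k - length (snd f)) (Num 0)"

definition clauseE :: "('p, 'c) job \<Rightarrow> ('p, 'c) exp list list" where
  "clauseE J = atomE (jhead J) # map atomE (jidb J) @
     replicate (K - length (jidb J)) (replicate K (Lit (Num 0)))"

definition clause :: "('p, 'c) job \<Rightarrow> (nat \<Rightarrow> 'c) \<Rightarrow> 'c val list list" where
  "clause J \<beta> = fvec (ground \<beta> (jhead J)) # map (\<lambda>a. fvec (ground \<beta> a)) (jidb J) @
     replicate (K - length (jidb J)) (replicate K (Num 0))"

text \<open>A disjunction, expressed by \<open>Not\<close> and \<open>And\<close>: an EDB fact is
  either a tuple of the instance or a marked fact of the program.\<close>

definition checkB :: "('p, 'c) atom \<Rightarrow> ('p, 'c) bexp" where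
  "checkB a = Not (And (Not (Eq (Member (fst a) (map expT (snd a))) (Lit (Num 1))))
     (Not (Eq (Cell (lits [Num 5, Num (pc (fst a))] @ map expT (snd a))) (Lit (Num 1)))))"

text \<open>Blanking and pruning weaken the query, so an answer may violate an EDB atom of the rule;
  the explicit test restores soundness.\<close>

definition recordC :: "('p, 'c) job \<Rightarrow> ('p, 'c) com" where
  "recordC J = If (conjB (map checkB (jedb J))) (clauseC K (clauseE J)) Skip"

definition outputC :: "('p, 'c) job \<Rightarrow> ('p, 'c) com" where
  "outputC J = If (derivedE (atomE (jhead J))) (Emit (fst (jhead J)) (map expT (snd (jhead J)))) Skip"

definition jobC :: "(('p, 'c) job \<Rightarrow> ('p, 'c) com) \<Rightarrow> nat \<Rightarrow> ('p, 'c) com" where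
  "jobC body g = joinC (tp g) (jedges (Js ! g)) [] (vs (Js ! g)) (body (Js ! g))"

definition all_edges :: "(nat \<times> ('p, 'c) batom) list" where
  "all_edges = concat (map (\<lambda>g. map (Pair g) (jedges (Js ! g))) [0..<length Js])"

definition loadC :: "('p, 'c) com" where
  "loadC = seqC (map (\<lambda>(g, b). edgeC (tp g b) (vs (Js ! g)) (fact_tuples (fst b)) b) all_edges)"

definition factC :: "('p, 'c) com" where
  "factC = seqC (map (\<lambda>(p, t). Assign (lits (Num 5 # Num (pc p) # map Cst t)) (Lit (Num 1))) edb_facts)"

text \<open>If the number of adornments or of rules is 0, the bound is 0 and there are no queries;
  only a command that takes no time is then admissible, hence \<open>Skip\<close>.\<close>

definition evalC :: "('p, 'c) com" where
  "evalC = (if Js = [] then Skip else Seq factC (Seq loadC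
     (Seq (seqC (map (jobC recordC) [0..<length Js])) (Seq (hornC K)
       (seqC (map (jobC outputC) [0..<length Js]))))))"

lemma finite_P: "finite P" using P by (simp add: datalog_program_def)

lemma inj_fact: "inj (\<lambda>(p, t). Rule (p, map Const t) [] :: ('p, 'c) dl_rule)"
  by (auto simp: inj_def dest!: map_injective[of Const, rotated])

lemma finite_facts: "finite (facts p)" and edb_facts: "distinct edb_facts"
    "set edb_facts = {(p, t). p \<in> edb P \<and> t \<in> facts p}" and length_edb_facts: "length edb_facts \<le> card P"
proof -
  let ?A = "{(p, t). p \<in> edb P \<and> t \<in> facts p}" and ?f = "\<lambda>(p, t). Rule (p, map Const t) [] :: ('p, 'c) dl_rule"
  have sub: "?f ` ?A \<subseteq> P" by (auto simp: facts_def)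
  have inj: "inj_on ?f B" for B using inj_fact inj_on_subset by blast
  have "?f ` ({p} \<times> facts p) \<subseteq> P" by (auto simp: facts_def)
  then have "finite ({p} \<times> facts p)" using inj finite_P by (meson finite_imageD finite_subset)
  then show "finite (facts p)" by (auto dest: finite_cartesian_productD2)
  have finA: "finite ?A" using sub inj finite_P by (meson finite_imageD finite_subset)
  have "\<exists>fs. distinct fs \<and> set fs = ?A" using finite_distinct_list[OF finA] by blast
  from someI_ex[OF this] show d: "distinct edb_facts" "set edb_facts = ?A"
    by (simp_all add: edb_facts_def)
  have "card ?A \<le> card P" by (rule card_inj_on_le[OF inj sub finite_P])
  then show "length edb_facts \<le> card P" using distinct_card[OF d(1)] unfolding d(2) by simp
qed

lemma fact_tuples: "distinct (fact_tuples p)" "set (fact_tuples p) = facts p"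
proof -
  have "\<exists>ts. distinct ts \<and> set ts = facts p" using finite_distinct_list[OF finite_facts] by blast
  from someI_ex[OF this] show "distinct (fact_tuples p)" "set (fact_tuples p) = facts p"
    by (simp_all add: fact_tuples_def)
qed

lemma okD:
  assumes "J \<in> set Js"
  shows "length (jedges J) \<le> k + 2 ^ k" "card (job_vars J) \<le> 2 * k"
    "b \<in> set (jedges J) \<Longrightarrow> fst b \<in> edb P" "b \<in> set (jedges J) \<Longrightarrow> length (snd b) = ar (fst b)"
    "b \<in> set (jedges J) \<Longrightarrow> length (snd b) \<le> k" "b \<in> set (jedges J) \<Longrightarrow> batom_vars b \<noteq> {}"
    "a \<in> set (jhead J # jidb J @ jedb J) \<Longrightarrow> atom_vars a \<subseteq> job_vars J"
    "a \<in> set (jhead J # jidb J @ jedb J) \<Longrightarrow> length (snd a) \<le> k"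
    "length (jidb J) \<le> k" "length (jedb J) \<le> k" "fst (jhead J) \<in> idb P"
    "a \<in> set (jidb J) \<Longrightarrow> fst a \<in> idb P" "a \<in> set (jedb J) \<Longrightarrow> fst a \<in> edb P"
  using ok[OF assms] by (auto simp: job_ok_def)

lemma vs: "distinct (vs J)" "set (vs J) = job_vars J" "length (vs J) = card (job_vars J)"
proof -
  have "finite (job_vars J)" by (simp add: job_vars_def finite_batom_vars)
  then show "distinct (vs J)" "set (vs J) = job_vars J" "length (vs J) = card (job_vars J)"
    by (simp_all add: vs_def)
qed

lemma tp: "length (tp g b) = 2" by (simp add: tp_def)

lemma tp_inj:
  assumes "b \<in> set (jedges (Js ! g))" "b' \<in> set (jedges (Js ! g'))" "tp g b = tp g' b'"
  shows "g = g' \<and> b = b'"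
proof -
  have eq: "g = g'" using assms(3) by (simp add: tp_def)
  have ix: "index_of (jedges (Js ! g)) b = index_of (jedges (Js ! g')) b'"
    using assms(3) unfolding tp_def list.inject val.inject by blast
  have "b = jedges (Js ! g) ! index_of (jedges (Js ! g)) b" using nth_index_of[OF assms(1)] by simp
  also have "\<dots> = b'" unfolding ix using nth_index_of[OF assms(2)] by (simp add: eq)
  finally show ?thesis using eq by simp
qed

lemma set_all_edges: "(g, b) \<in> set all_edges \<longleftrightarrow> g < length Js \<and> b \<in> set (jedges (Js ! g))"
  by (auto simp: all_edges_def)

lemma length_all_edges: "length all_edges \<le> length Js * (k + 2 ^ k)"
proof -
  have "length all_edges = sum_list (map (\<lambda>g. length (jedges (Js ! g))) [0..<length Js])"
    by (simp add: all_edges_def length_concat comp_def)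
  also have "\<dots> \<le> length [0..<length Js] * (k + 2 ^ k)"
    by (rule sum_list_le) (auto intro: okD(1))
  finally show ?thesis by simp
qed

lemma atomE: "length (snd a) \<le> k \<Longrightarrow> length (atomE a) = K"
    "e \<in> set (atomE a) \<Longrightarrow> exp_cost e \<le> 3" "1 \<notin> X \<Longrightarrow> e \<in> set (atomE a) \<Longrightarrow> indep T X e"
  by (auto simp: atomE_def K_def intro: expT_cost expT_indep le_trans[of 1 3])

text \<open>Arguments are encoded by \<open>Cst\<close> and the padding by \<open>Num\<close>, so
  deleting the numbers after the first component recovers the arguments.\<close>

lemma fvec_inj:
  assumes "fvec f = fvec f'" "fst f \<in> idb P" "fst f' \<in> idb P"
  shows "f = f'"
proof -
  have "fst f = fst f'" using assms inj_onD[OF pc, of "fst f" "fst f'"] by (auto simp: fvec_def)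
  moreover have "filter (\<lambda>v. \<exists>c. v = Cst c) (map Cst (snd g) @ replicate (k - length (snd g)) (Num 0)) = map Cst (snd g)"
    for g :: "('p, 'c) fact" by (simp add: filter_map comp_def)
  then have "map Cst (snd f) = map Cst (snd f')"
    using assms(1) unfolding fvec_def by (metis list.inject)
  then have "snd f = snd f'" by (rule map_injective[OF _ inj_Cst])
  ultimately show ?thesis by (simp add: prod_eq_iff)
qed

lemma fvec_neq_zero: "fvec f \<noteq> replicate K (Num 0)"
  by (simp add: fvec_def K_def)

lemma atomE_val:
  assumes "\<And>v. v \<in> atom_vars a \<Longrightarrow> val_of m v = Cst (\<beta> v)"
  shows "map (exp_val T m) (atomE a) = fvec (ground \<beta> a)"
  using expT_val[of "snd a" m \<beta> T] assms by (simp add: atomE_def fvec_def ground_def atom_vars_def)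

lemma clauseE:
  assumes "J \<in> set Js"
  shows "length (clauseE J) = K + 1" "j \<le> K \<Longrightarrow> length (clauseE J ! j) = K"
    "j \<le> K \<Longrightarrow> e \<in> set (clauseE J ! j) \<Longrightarrow> indep T {6, 8, 12} e \<and> exp_cost e \<le> 3"
proof -
  show len: "length (clauseE J) = K + 1" using okD(9)[OF assms] by (simp add: clauseE_def K_def)
  have mem: "x \<in> atomE ` set (jhead J # jidb J @ jedb J) \<or> x = replicate K (Lit (Num 0))"
    if "x \<in> set (clauseE J)" for x
    using that by (auto simp: clauseE_def)
  have "clauseE J ! j \<in> set (clauseE J)" if "j \<le> K" using that len by simp
  note mem = mem[OF this]
  show "length (clauseE J ! j) = K" if j: "j \<le> K"
  proof -
    consider a where "a \<in> set (jhead J # jidb J @ jedb J)" "clauseE J ! j = atomE a"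
      | "clauseE J ! j = replicate K (Lit (Num 0))"
      using mem[OF j] by blast
    then show ?thesis
    proof cases
      case 1
      then show ?thesis using atomE(1)[OF okD(8)[OF assms 1(1)]] by simp
    qed simp
  qed
  show "indep T {6, 8, 12} e \<and> exp_cost e \<le> 3" if j: "j \<le> K" "e \<in> set (clauseE J ! j)"
  proof -
    consider a where "clauseE J ! j = atomE a" | "clauseE J ! j = replicate K (Lit (Num 0))"
      using mem[OF j(1)] by blast
    then show ?thesis
    proof cases
      case 1
      then have "e \<in> set (atomE a)" using j(2) by simp
      then show ?thesis by (intro conjI atomE(3)[where a = a] atomE(2)[where a = a]) auto
    qed (use j(2) in auto)
  qed
qed

lemma clauseE_val:
  assumes "J \<in> set Js" "\<And>v. v \<in> job_vars J \<Longrightarrow> val_of m v = Cst (\<beta> v)"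
  shows "map (map (exp_val T m)) (clauseE J) = clause J \<beta>"
proof -
  have "map (exp_val T m) (atomE a) = fvec (ground \<beta> a)" if "a \<in> set (jhead J # jidb J @ jedb J)" for a
    using okD(7)[OF assms(1) that] assms(2) by (intro atomE_val) blast
  then show ?thesis by (simp add: clauseE_def clause_def)
qed

end

locale evaluation = evaluator ar k P Js pc
  for ar :: "'p \<Rightarrow> nat" and k :: nat and P :: "('p, 'c) program" and Js pc +
  fixes T :: "('p, 'c) tables" and N :: nat
  assumes T: "edb_instance ar P T" and N: "1 \<le> N" and tuples: "edb_tuples_at_most P T N"
begin

abbreviation "LF \<equiv> least_fixpoint P (facts_of T)"
abbreviation "E \<equiv> relation P (facts_of T)"
abbreviation "W \<equiv> real N powr ew_program P"

definition S :: "nat \<Rightarrow> ('p, 'c) batom \<Rightarrow> 'c val list set" where "S g b = rows E (vs (Js ! g)) b"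

lemma W: "1 \<le> W"
  using N ew_program_nonneg[OF P] by (intro ge_one_powr_ge_zero) auto

lemma mem_E: "t \<in> E p \<longleftrightarrow> (p, t) \<in> LF" by (simp add: relation_def)

text \<open>A rule whose head predicate is not IDB has an empty body and is therefore, by safety, a
  ground fact.\<close>

lemma E_edb:
  assumes "p \<notin> idb P"
  shows "E p = set (T p) \<union> facts p" "t \<in> E p \<Longrightarrow> length t = ar p"
proof -
  have cons: "(p, t) \<in> LF \<longleftrightarrow> t \<in> set (T p) \<or> (\<exists>\<nu> r. r \<in> P \<and> (p, t) = ground \<nu> (rhead r) \<and>
      (\<forall>a\<in>set (rbody r). ground \<nu> a \<in> LF))" for t
    by (subst least_fixpoint_unfold) (auto simp: consequence_def facts_of_def)
  have fact: "rbody r = [] \<and> rhead r = (p, map Const t)"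
    if r: "r \<in> P" "(p, t) = ground \<nu> (rhead r)" for \<nu> r t
  proof -
    have hd: "fst (rhead r) = p" "t = map (trm_val \<nu>) (snd (rhead r))" using r(2) by (auto simp: ground_def)
    have b: "rbody r = []" using assms r(1) hd(1) by (auto simp: idb_def)
    then have "atom_vars (rhead r) = {}" using P r(1) by (auto simp: datalog_program_def)
    then have "s = Const (trm_val \<nu> s)" if "s \<in> set (snd (rhead r))" for s
      using that by (cases s) (auto simp: mem_atom_vars set_eq_iff)
    then have "map Const t = snd (rhead r)" unfolding hd(2) map_map comp_def by (intro map_idI) metis
    then show ?thesis using b hd(1) by (simp add: prod_eq_iff)
  qed
  show eq: "E p = set (T p) \<union> facts p"
  proof (intro set_eqI iffI)
    fix t assume "t \<in> E p"
    then consider "t \<in> set (T p)" | \<nu> r where "r \<in> P" "(p, t) = ground \<nu> (rhead r)"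
      unfolding mem_E cons by blast
    then show "t \<in> set (T p) \<union> facts p"
    proof cases
      case 2
      then have "r = Rule (p, map Const t) []" using fact[OF 2] by (cases r) simp
      then show ?thesis using 2(1) by (simp add: facts_def)
    qed simp
  next
    fix t assume "t \<in> set (T p) \<union> facts p"
    then consider "t \<in> set (T p)" | "Rule (p, map Const t) [] \<in> P" by (auto simp: facts_def)
    then show "t \<in> E p"
    proof cases
      case 2
      have "ground \<nu> (p, map Const t) = (p, t)" for \<nu> by (simp add: ground_def comp_def)
      then have "(p, t) = ground \<nu> (rhead (Rule (p, map Const t) []))" for \<nu> by simp
      then show ?thesis unfolding mem_E cons using 2 by fastforce
    qed (simp add: mem_E cons)
  qed
  show "length t = ar p" if "t \<in> E p"
  proof -
    have "t \<in> set (T p) \<union> facts p" using \<open>t \<in> E p\<close> unfolding eq .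
    then consider "t \<in> set (T p)" | "Rule (p, map Const t) [] \<in> P" unfolding facts_def by blast
    then show ?thesis
    proof cases
      case 1
      then show ?thesis using T by (auto simp: edb_instance_def)
    next
      case 2
      then show ?thesis using datalog_programD(1)[OF P 2] by simp
    qed
  qed
qed

lemma edb_not_idb: "p \<in> edb P \<Longrightarrow> p \<notin> idb P" by (simp add: edb_def)

lemma E_size:
  assumes "p \<in> edb P"
  shows "finite (E p)" "card (E p) \<le> N" "length (T p) \<le> N" "length (fact_tuples p) \<le> N"
proof -
  have eq: "E p = set (T p) \<union> facts p" using E_edb(1)[OF edb_not_idb[OF assms]] .
  show fin: "finite (E p)" by (simp add: eq finite_facts)
  show c: "card (E p) \<le> N" using tuples assms by (simp add: edb_tuples_at_most_def)
  have "distinct (T p)" using T by (simp add: edb_instance_def)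
  then have "length (T p) = card (set (T p))" by (simp add: distinct_card)
  also have "\<dots> \<le> card (E p)" using fin by (intro card_mono) (auto simp: eq)
  finally show "length (T p) \<le> N" using c by simp
  have "length (fact_tuples p) = card (facts p)" using distinct_card[OF fact_tuples(1)[of p]] unfolding fact_tuples(2) by simp
  also have "\<dots> \<le> card (E p)" using fin by (intro card_mono) (auto simp: eq)
  finally show "length (fact_tuples p) \<le> N" using c by simp
qed

lemma S_size:
  assumes "g < length Js" "b \<in> set (jedges (Js ! g))"
  shows "finite (S g b) \<and> card (S g b) \<le> N"
proof -
  have p: "fst b \<in> edb P" using okD(3)[OF nth_mem[OF assms(1)] assms(2)] .
  have "S g b \<subseteq> row (snd b) (edge_vars (vs (Js ! g)) b) ` E (fst b)" by (auto simp: S_def rows_def)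
  then show ?thesis
    using E_size(2)[OF p] finite_surj[OF E_size(1)[OF p]] surj_card_le[OF E_size(1)[OF p]] by (meson le_trans)
qed

lemma join_bound:
  assumes g: "g < length Js"
  shows "real (join.join_cost (set (jedges (Js ! g))) batom_vars (S g) c c' cb [] (vs (Js ! g)) \<alpha>) \<le>
    real (cb + 2 * k * (c + c')) * W"
proof -
  have J: "Js ! g \<in> set Js" using g by simp
  have "real (join.join_cost (set (jedges (Js ! g))) batom_vars (S g) c c' cb [] (vs (Js ! g)) \<alpha>) \<le>
      real (cb + length (vs (Js ! g)) * (c + c')) * W"
    by (rule join_cost_width[OF width[OF J]]) (use S_size[OF g] N vs(1,2)[of "Js ! g"] in blast)+
  also have "\<dots> \<le> real (cb + 2 * k * (c + c')) * W"
  proof (intro mult_right_mono)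
    have "length (vs (Js ! g)) * (c + c') \<le> 2 * k * (c + c')"
      using okD(2)[OF J] vs(3) by (intro mult_le_mono1) simp
    then show "real (cb + length (vs (Js ! g)) * (c + c')) \<le> real (cb + 2 * k * (c + c'))"
      by (intro of_nat_mono) simp
  qed simp
  finally show ?thesis .
qed

text \<open>Each edge has a variable, so every cover has total weight at least 1. This pays for
  reading the EDB relations, which takes time proportional to \<open>N\<close>.\<close>

lemma N_le_W:
  assumes J: "J \<in> set Js" and e: "e \<in> set (jedges J)"
  shows "real N \<le> W"
proof -
  obtain v where v: "v \<in> batom_vars e" using okD(6)[OF J e] by blast
  have "real N \<le> real N powr (\<Sum>b\<in>set (jedges J). x b)" if x: "job_cover J x" for x
  proof -
    have "v \<in> job_vars J" using v e by (auto simp: job_vars_def)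
    then have "1 \<le> (\<Sum>b\<in>{b \<in> set (jedges J). v \<in> batom_vars b}. x b)" using x by (simp add: job_cover_def)
    also have "\<dots> \<le> (\<Sum>b\<in>set (jedges J). x b)"
      using x by (intro sum_mono2) (auto simp: job_cover_def)
    finally have "real N powr 1 \<le> real N powr (\<Sum>b\<in>set (jedges J). x b)" using N by (intro powr_mono) auto
    then show ?thesis using N by simp
  qed
  then show ?thesis using width[OF J] N unfolding job_width_def by (metis of_nat_1 of_nat_le_iff)
qed

definition marked :: "'c mem \<Rightarrow> bool" where
  "marked m \<longleftrightarrow> (\<forall>p\<in>edb P. \<forall>w. m (Num 5 # Num (pc p) # w) = Num (if w \<in> map Cst ` facts p then 1 else 0))"

definition loaded :: "'c mem \<Rightarrow> bool" where
  "loaded m \<longleftrightarrow> (\<forall>g<length Js. \<forall>b\<in>set (jedges (Js ! g)). trie m (Num 2 # tp g b) (pfx (S g b)))"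

definition checks :: "('p, 'c) job \<Rightarrow> (nat \<Rightarrow> 'c) \<Rightarrow> bool" where
  "checks J \<beta> \<longleftrightarrow> (\<forall>a\<in>set (jedb J). ground \<beta> a \<in> LF)"

definition sound :: "'c val list list list \<Rightarrow> bool" where
  "sound cls \<longleftrightarrow> (\<forall>cl\<in>set cls. \<exists>J\<in>set Js. \<exists>\<beta>. checks J \<beta> \<and> cl = clause J \<beta>)"

definition covers :: "'c val list list list \<Rightarrow> ('p, 'c) job \<Rightarrow> bool" where
  "covers cls J \<longleftrightarrow> (\<forall>\<beta>. (\<forall>b\<in>set (jedges J). sat E \<beta> b) \<and> checks J \<beta> \<longrightarrow> clause J \<beta> \<in> set cls)"

lemma marked_frame: "marked m \<Longrightarrow> frame X m m' \<Longrightarrow> 5 \<notin> X \<Longrightarrow> marked m'"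
  by (simp add: marked_def frame_def)

lemma loaded_frame: "loaded m \<Longrightarrow> frame X m m' \<Longrightarrow> 2 \<notin> X \<Longrightarrow> loaded m'"
  unfolding loaded_def using trie_frame by blast

lemma run_factC:
  assumes m: "\<And>a. m a = Num 0"
  shows "run T factC m out (\<lambda>t m' out'. t \<le> length edb_facts * (k + 4) \<and> out' = out \<and> frame {5} m m' \<and> marked m')"
proof -
  define mk where "mk fs m' \<longleftrightarrow> (\<forall>p\<in>edb P. \<forall>w. m' (Num 5 # Num (pc p) # w) =
      Num (if \<exists>t. w = map Cst t \<and> (p, t) \<in> set fs then 1 else 0))" for fs and m' :: "'c mem"
  define I where "I i t m' out' \<longleftrightarrow> t \<le> i * (k + 4) \<and> out' = out \<and> frame {5} m m' \<and> mk (take i edb_facts) m'"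
    for i t :: nat and m' out'
  show ?thesis
    unfolding factC_def
  proof (rule run_seqC[where I = I])
    show "I 0 0 m out" using m by (simp add: I_def mk_def)
    fix i t m' out'
    assume i: "i < length (map (\<lambda>(p, t). Assign (lits (Num 5 # Num (pc p) # map Cst t)) (Lit (Num 1)) :: ('p, 'c) com) edb_facts)"
      and I: "I i t m' out'"
    then have i': "i < length edb_facts" by simp
    obtain p u where pu: "edb_facts ! i = (p, u)" by (cases "edb_facts ! i")
    then have mem: "p \<in> edb P" "u \<in> facts p" using nth_mem[OF i'] edb_facts(2) by auto
    have "u \<in> E p" using E_edb(1)[OF edb_not_idb[OF mem(1)]] mem(2) by simp
    then have ul: "length u \<le> k" using E_edb(2)[OF edb_not_idb[OF mem(1)]] edb_arity[OF mem(1)] by simp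
    have tk: "set (take (Suc i) edb_facts) = insert (p, u) (set (take i edb_facts))"
      using i' pu by (simp add: take_Suc_conv_app_nth)
    have upd: "mk (take (Suc i) edb_facts) (m'(Num 5 # Num (pc p) # map Cst u := Num 1))"
      unfolding mk_def
    proof (intro ballI allI)
      fix q w assume q: "q \<in> edb P"
      have "Num (pc q) = (Num (pc p) :: 'c val) \<longleftrightarrow> q = p" using q mem(1) inj_onD[OF pc, of q p] by auto
      moreover have "map Cst u = map Cst u' \<longleftrightarrow> u = u'" for u' :: "'c list"
        using map_injective[OF _ inj_Cst] by blast
      moreover have "m' (Num 5 # Num (pc q) # w) = Num (if \<exists>t. w = map Cst t \<and> (q, t) \<in> set (take i edb_facts) then 1 else 0)"
        using I q by (simp add: I_def mk_def)
      ultimately show "(m'(Num 5 # Num (pc p) # map Cst u := Num 1)) (Num 5 # Num (pc q) # w) =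
          Num (if \<exists>t. w = map Cst t \<and> (q, t) \<in> set (take (Suc i) edb_facts) then 1 else 0)"
        unfolding tk by auto
    qed
    have "run T (Assign (lits (Num 5 # Num (pc p) # map Cst u)) (Lit (Num 1))) m' out' (\<lambda>t'. I (Suc i) (t + t'))"
      using I upd ul by (intro run_Assign) (simp add: I_def frame_upd)
    then show "run T (map (\<lambda>(p, t). Assign (lits (Num 5 # Num (pc p) # map Cst t)) (Lit (Num 1))) edb_facts ! i) m' out' (\<lambda>t'. I (Suc i) (t + t'))"
      using i' pu by simp
  next
    fix t m' out' assume "I (length (map (\<lambda>(p, t). Assign (lits (Num 5 # Num (pc p) # map Cst t)) (Lit (Num 1)) :: ('p, 'c) com) edb_facts)) t m' out'"
    then have A: "t \<le> length edb_facts * (k + 4)" "out' = out" "frame {5} m m'" "mk edb_facts m'"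
      by (simp_all add: I_def)
    have "marked m'"
      unfolding marked_def
    proof (intro ballI allI)
      fix p w assume p: "p \<in> edb P"
      then have "(\<exists>t. w = map Cst t \<and> (p, t) \<in> set edb_facts) \<longleftrightarrow> w \<in> map Cst ` facts p"
        using edb_facts(2) by auto
      then show "m' (Num 5 # Num (pc p) # w) = Num (if w \<in> map Cst ` facts p then 1 else 0)"
        using A(4) p by (simp add: mk_def)
    qed
    with A show "t \<le> length edb_facts * (k + 4) \<and> out' = out \<and> frame {5} m m' \<and> marked m'" by blast
  qed
qed

end

section \<open>Soundness and completeness of the recorded clauses, and the sum of all costs\<close>

section \<open>Correctness and running time of the evaluation\<close>

lemma level_cost_mono: "n \<le> n' \<Longrightarrow> v \<le> v' \<Longrightarrow> level_cost n v \<le> level_cost n' v'"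
  unfolding level_cost_def by (intro add_mono mult_le_mono order_refl) auto

lemma cand_cost_mono: "n \<le> n' \<Longrightarrow> v \<le> v' \<Longrightarrow> cand_cost n v \<le> cand_cost n' v'"
  unfolding cand_cost_def by (intro add_mono mult_le_mono order_refl) auto

context evaluation
begin

lemma run_loadC:
  assumes m: "\<And>r. m (Num 2 # r) = Num 0"
  shows "run T loadC m out (\<lambda>t m' out'. t \<le> length all_edges * (edge_cost k * N) \<and> out' = out \<and>
    frame {0, 2} m m' \<and> loaded m')"
proof -
  \<comment> \<open>The trie of an edge is empty before its first load and complete from then on,
    whether or not the pair occurs again in the list.\<close>
  define Z where "Z i g b = (if (g, b) \<in> set (take i all_edges) then S g b else {})" for i g b
  define I where "I i t m' out' \<longleftrightarrow> t \<le> i * (edge_cost k * N) \<and> out' = out \<and> frame {0, 2} m m' \<and>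
    (\<forall>g b. (g, b) \<in> set all_edges \<longrightarrow> trie m' (Num 2 # tp g b) (pfx (Z i g b)))" for i t :: nat and m' out'
  let ?c = "\<lambda>(g, b). edgeC (tp g b) (vs (Js ! g)) (fact_tuples (fst b)) b"
  show ?thesis
    unfolding loadC_def
  proof (rule run_seqC[where I = I])
    have "trie m (Num 2 # tp g b) {}" for g b by (rule trie_empty) (simp add: m)
    then show "I 0 0 m out" by (simp add: I_def Z_def pfx_def)
  next
    fix i t m' out' assume i: "i < length (map ?c all_edges)" and I: "I i t m' out'"
    then have i': "i < length all_edges" by simp
    obtain g b where gb: "all_edges ! i = (g, b)" by (cases "all_edges ! i")
    then have mem: "(g, b) \<in> set all_edges" using nth_mem[OF i'] by simp
    then have g: "g < length Js" "b \<in> set (jedges (Js ! g))" by (simp_all add: set_all_edges)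
    have J: "Js ! g \<in> set Js" using g by simp
    have p: "fst b \<in> edb P" using okD(3)[OF J g(2)] .
    note np = edb_not_idb[OF p]
    have tk: "set (take (Suc i) all_edges) = insert (g, b) (set (take i all_edges))"
      using i' gb by (simp add: take_Suc_conv_app_nth)
    have "run T (edgeC (tp g b) (vs (Js ! g)) (fact_tuples (fst b)) b) m' out' (\<lambda>t'. I (Suc i) (t + t'))"
    proof (rule run_mono[OF run_edgeC[where ?S0.0 = "Z i g b" and E = E and N = N and k = k]])
      show "trie m' (Num 2 # tp g b) (pfx (Z i g b))" using I mem unfolding I_def by blast
      show "Z i g b \<subseteq> rows E (vs (Js ! g)) b" by (simp add: Z_def S_def)
      show "length (tp g b) = 2" by (rule tp)
      show "E (fst b) = set (T (fst b)) \<union> set (fact_tuples (fst b))" using E_edb(1)[OF np] fact_tuples(2) by simp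
      show "length u = length (snd b)" if "u \<in> E (fst b)" for u
        using E_edb(2)[OF np that] okD(4)[OF J g(2)] by simp
      show "length (T (fst b)) \<le> N" "length (fact_tuples (fst b)) \<le> N" using E_size(3,4)[OF p] by auto
      show "1 \<le> N" by (rule N)
      show "length (snd b) \<le> k" using okD(5)[OF J g(2)] .
      show "distinct (vs (Js ! g))" by (rule vs(1))
      fix t' m2 out2
      assume A: "t' \<le> edge_cost k * N \<and> out2 = out' \<and> frame {0, 2} m' m2 \<and>
        (\<forall>pre' r. length pre' = 2 \<and> pre' \<noteq> tp g b \<longrightarrow> m2 (Num 2 # pre' @ r) = m' (Num 2 # pre' @ r)) \<and>
        trie m2 (Num 2 # tp g b) (pfx (rows E (vs (Js ! g)) b))"
      have "trie m2 (Num 2 # tp g' b') (pfx (Z (Suc i) g' b'))" if gb': "(g', b') \<in> set all_edges" for g' b'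
      proof (cases "(g', b') = (g, b)")
        case True
        then show ?thesis using A by (simp add: Z_def tk S_def)
      next
        case False
        then have ne: "tp g' b' \<noteq> tp g b" using tp_inj[of b' g' b g] gb' g by (auto simp: set_all_edges)
        have "Z (Suc i) g' b' = Z i g' b'" by (simp only: Z_def tk insert_iff False simp_thms)
        moreover have "trie m' (Num 2 # tp g' b') (pfx (Z i g' b'))" using I gb' unfolding I_def by blast
        then have "trie m2 (Num 2 # tp g' b') (pfx (Z i g' b'))"
          by (rule trie_cong) (use A ne tp in simp)
        ultimately show ?thesis by simp
      qed
      then show "I (Suc i) (t + t') m2 out2"
        using A I frame_trans[of "{0, 2}" m m' m2] unfolding I_def by auto
    qed
    then show "run T (map ?c all_edges ! i) m' out' (\<lambda>t'. I (Suc i) (t + t'))" using i' gb by simp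
  next
    fix t m' out' assume I: "I (length (map ?c all_edges)) t m' out'"
    then have "loaded m'" by (auto simp: I_def loaded_def Z_def set_all_edges)
    then show "t \<le> length all_edges * (edge_cost k * N) \<and> out' = out \<and> frame {0, 2} m m' \<and> loaded m'"
      using I by (simp add: I_def)
  qed
qed

text \<open>A cell could also hold a number, but each query variable lies in some edge, and the rows
  of an edge consist of constants.\<close>

lemma admissible_Cst:
  assumes g: "g < length Js"
    and a: "join.admissible (set (jedges (Js ! g))) batom_vars (S g) (vs (Js ! g)) \<alpha>"
  shows "\<exists>\<beta>. \<forall>v\<in>job_vars (Js ! g). \<alpha> v = Cst (\<beta> v)"
proof -
  interpret join "set (jedges (Js ! g))" batom_vars "S g"
    by unfold_locales (use S_size[OF g] in auto)
  have "\<exists>c. \<alpha> v = Cst c" if v: "v \<in> job_vars (Js ! g)" for v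
  proof -
    obtain b where b: "b \<in> set (jedges (Js ! g))" "v \<in> batom_vars b" using v by (auto simp: job_vars_def)
    have mem: "\<alpha> v \<in> set (proj (vs (Js ! g)) (batom_vars b) \<alpha>)"
      using v b(2) vs(2)[of "Js ! g"] by (auto simp: proj_def)
    then have "proj (vs (Js ! g)) (batom_vars b) \<alpha> \<in> pfx (S g b)"
      using a b(1) unfolding admissible_def by (metis emptyE insertE list.set(1))
    then obtain u where "proj (vs (Js ! g)) (batom_vars b) \<alpha> @ u \<in> S g b" by (auto simp: pfx_def)
    then obtain t where "proj (vs (Js ! g)) (batom_vars b) \<alpha> @ u = row (snd b) (edge_vars (vs (Js ! g)) b) t"
      by (auto simp: S_def rows_def)
    then have "\<alpha> v \<in> set (row (snd b) (edge_vars (vs (Js ! g)) b) t)" using mem by (metis UnI1 set_append)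
    then show ?thesis by (auto simp: row_def)
  qed
  then show ?thesis by metis
qed

lemma sat_admissible:
  assumes g: "g < length Js" and s: "\<forall>b\<in>set (jedges (Js ! g)). sat E \<beta> b"
  shows "join.admissible (set (jedges (Js ! g))) batom_vars (S g) (vs (Js ! g)) (Cst \<circ> \<beta>)"
proof -
  interpret join "set (jedges (Js ! g))" batom_vars "S g"
    by unfold_locales (use S_size[OF g] in auto)
  show ?thesis
    unfolding admissible_def
  proof
    fix b assume "b \<in> set (jedges (Js ! g))"
    then have "proj (vs (Js ! g)) (batom_vars b) (Cst \<circ> \<beta>) \<in> S g b"
      unfolding S_def using s by (intro sat_rows) blast
    then show "proj (vs (Js ! g)) (batom_vars b) (Cst \<circ> \<beta>) \<in> insert [] (pfx (S g b))"
      unfolding pfx_def by (metis (mono_tags, lifting) append_Nil2 insertCI mem_Collect_eq)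
  qed
qed

lemma checkB_val:
  assumes "a \<in> set (jedb J)" "J \<in> set Js" "marked m" "\<And>v. v \<in> job_vars J \<Longrightarrow> val_of m v = Cst (\<beta> v)"
  shows "bexp_val T m (checkB a) \<longleftrightarrow> ground \<beta> a \<in> LF"
proof -
  have p: "fst a \<in> edb P" using okD(13)[OF assms(2,1)] .
  have "atom_vars a \<subseteq> job_vars J" using okD(7)[OF assms(2)] assms(1) by auto
  define es :: "('p, 'c) exp list" where "es = map expT (snd a)"
  define u where "u = map (trm_val \<beta>) (snd a)"
  have vals: "map (exp_val T m) es = map Cst u"
    unfolding es_def u_def using assms(4) \<open>atom_vars a \<subseteq> job_vars J\<close>
    by (intro expT_val) (auto simp: atom_vars_def)
  have inj: "map Cst u \<in> map Cst ` A \<longleftrightarrow> u \<in> A" for A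
    using map_injective[OF _ inj_Cst] by blast
  have "m (Num 5 # Num (pc (fst a)) # map Cst u) = Num (if map Cst u \<in> map Cst ` facts (fst a) then 1 else 0)"
    using assms(3) p unfolding marked_def by blast
  then have "bexp_val T m (checkB a) \<longleftrightarrow> u \<in> set (T (fst a)) \<or> u \<in> facts (fst a)"
    unfolding checkB_def es_def[symmetric] by (simp add: vals inj)
  then show ?thesis using E_edb(1)[OF edb_not_idb[OF p]] by (simp add: ground_relation u_def)
qed

definition record_cost :: nat where "record_cost = 4 + k * (13 + 6 * k) + clause_cost K"

lemma run_recordC:
  assumes J: "J \<in> set Js" and m: "marked m" "store K m cls"
    and \<beta>: "\<And>v. v \<in> job_vars J \<Longrightarrow> val_of m v = Cst (\<beta> v)"
  shows "run T (recordC J) m out (\<lambda>t m' out'. t \<le> record_cost \<and> out' = out \<and> frame {6, 8, 12} m m' \<and>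
    store K m' (cls @ (if checks J \<beta> then [clause J \<beta>] else [])))"
proof -
  have val: "bexp_val T m (conjB (map checkB (jedb J))) \<longleftrightarrow> checks J \<beta>"
    using checkB_val[OF _ J m(1) \<beta>] by (auto simp: checks_def)
  have "bexp_cost (conjB (map checkB (jedb J))) \<le> 3 + length (map checkB (jedb J)) * (1 + (12 + 6 * k))"
  proof (rule conjB_cost)
    fix x assume "x \<in> set (map checkB (jedb J))"
    then obtain a where a: "a \<in> set (jedb J)" "x = checkB a" by auto
    have "sum_list (map exp_cost (map expT (snd a) :: ('p, 'c) exp list)) \<le> length (map expT (snd a) :: ('p, 'c) exp list) * 3"
      by (rule sum_list_le) (auto intro: expT_cost)
    then show "bexp_cost x \<le> 12 + 6 * k" using okD(8)[OF J, of a] a by (simp add: checkB_def)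
  qed
  also have "\<dots> \<le> 3 + k * (13 + 6 * k)"
    using mult_le_mono1[OF okD(10)[OF J], of "13 + 6 * k"] by simp
  finally have cost: "bexp_cost (conjB (map checkB (jedb J))) \<le> 3 + k * (13 + 6 * k)" .
  show ?thesis
    unfolding recordC_def
  proof (rule run_If)
    assume "bexp_val T m (conjB (map checkB (jedb J)))"
    then have "checks J \<beta>" using val by blast
    show "run T (clauseC K (clauseE J)) m out (\<lambda>t m' out'. 1 + bexp_cost (conjB (map checkB (jedb J))) + t \<le> record_cost \<and>
        out' = out \<and> frame {6, 8, 12} m m' \<and> store K m' (cls @ (if checks J \<beta> then [clause J \<beta>] else [])))"
    proof (rule run_mono[OF run_clauseC[OF m(2)]])
      fix t m' out'
      assume "t \<le> clause_cost K \<and> out' = out \<and> store K m' (cls @ [map (map (exp_val T m)) (clauseE J)]) \<and>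
        frame {6, 8, 12} m m'"
      then show "1 + bexp_cost (conjB (map checkB (jedb J))) + t \<le> record_cost \<and>
          out' = out \<and> frame {6, 8, 12} m m' \<and> store K m' (cls @ (if checks J \<beta> then [clause J \<beta>] else []))"
        using cost \<open>checks J \<beta>\<close> clauseE_val[OF J \<beta>, of T] by (simp add: record_cost_def)
    qed (use clauseE[OF J] in auto)
  next
    assume "\<not> bexp_val T m (conjB (map checkB (jedb J)))"
    then have "\<not> checks J \<beta>" using val by blast
    then show "run T Skip m out (\<lambda>t m' out'. 1 + bexp_cost (conjB (map checkB (jedb J))) + t \<le> record_cost \<and>
        out' = out \<and> frame {6, 8, 12} m m' \<and> store K m' (cls @ (if checks J \<beta> then [clause J \<beta>] else [])))"
      using cost m(2) by (intro run_Skip) (simp add: record_cost_def)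
  qed
qed

definition query_cost :: nat where
  "query_cost = 2 * k * (level_cost (k + 2 ^ k) (2 * k) + cand_cost (k + 2 ^ k) (2 * k))"

lemma join_cost_bound:
  assumes g: "g < length Js"
  shows "real (join.join_cost (set (jedges (Js ! g))) batom_vars (S g)
      (level_cost (length (jedges (Js ! g))) (length (vs (Js ! g))))
      (cand_cost (length (jedges (Js ! g))) (length (vs (Js ! g)))) cb [] (vs (Js ! g)) \<alpha>) \<le>
    real (cb + query_cost) * W"
proof -
  have J: "Js ! g \<in> set Js" using g by simp
  have len: "length (jedges (Js ! g)) \<le> k + 2 ^ k" "length (vs (Js ! g)) \<le> 2 * k"
    using okD(1,2)[OF J] vs(3)[of "Js ! g"] by auto
  have "2 * k * (level_cost (length (jedges (Js ! g))) (length (vs (Js ! g))) +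
      cand_cost (length (jedges (Js ! g))) (length (vs (Js ! g)))) \<le> query_cost"
    unfolding query_cost_def by (intro mult_le_mono2 add_mono level_cost_mono cand_cost_mono len)
  then have "real (cb + 2 * k * (level_cost (length (jedges (Js ! g))) (length (vs (Js ! g))) +
      cand_cost (length (jedges (Js ! g))) (length (vs (Js ! g))))) * W \<le> real (cb + query_cost) * W"
    by (intro mult_right_mono of_nat_mono add_left_mono) auto
  with join_bound[OF g] show ?thesis by (rule order.trans)
qed

lemma edges_at_vs:
  assumes "v \<in> set (vs J)"
  shows "{b \<in> set (jedges J). v \<in> batom_vars b} \<noteq> {}"
  using assms by (auto simp: vs(2) job_vars_def)

text \<open>An answer records at most one clause. The number of new clauses is thus bounded by the
  number of answers, which is \<open>join_cost\<close> with the parameters \<open>0 0 1\<close> and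
  at most \<open>W\<close>.\<close>

lemma run_record_job:
  assumes g: "g < length Js" and m: "loaded m" "marked m" "store K m cls"
  shows "run T (jobC recordC g) m out (\<lambda>t m' out'. real t \<le> real (record_cost + query_cost) * W \<and> out' = out \<and>
    frame {0, 1, 6, 8, 12} m m' \<and>
    (\<exists>cls'. store K m' (cls @ cls') \<and> real (length cls') \<le> W \<and> sound cls' \<and> covers cls' (Js ! g)))"
proof -
  define J where "J = Js ! g"
  have J: "J \<in> set Js" using g by (simp add: J_def)
  define R where "R \<beta>s m' out' \<longleftrightarrow> out' = out \<and> frame {0, 1, 6, 8, 12} m m' \<and>
    (\<exists>cls'. store K m' (cls @ cls') \<and> length cls' \<le> length \<beta>s \<and> sound cls' \<and>
      (\<forall>\<alpha>\<in>set \<beta>s. \<forall>\<beta>. (\<forall>v\<in>job_vars J. \<alpha> v = Cst (\<beta> v)) \<and> checks J \<beta> \<longrightarrow> clause J \<beta> \<in> set cls'))"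
    for \<beta>s :: "(nat \<Rightarrow> 'c val) list" and m' out'
  interpret j: join "set (jedges J)" batom_vars "S g"
    by unfold_locales (use S_size[OF g] J_def in auto)
  interpret join_code "jedges J" "S g" T "tp g" "recordC J" R record_cost "{6, 8, 12}" "vs J"
  proof unfold_locales
    show "length (tp g b) = 2" for b by (rule tp)
    show "{6, 8, 12} \<inter> {0, 1, 2 :: nat} = {}" by simp
    show "distinct (vs J)" by (rule vs(1))
    show "j.edges_at v \<noteq> {}" if "v \<in> set (vs J)" for v
      using edges_at_vs[OF that] by (simp add: j.edges_at_def)
  next
    fix \<beta>s m' out' m'' assume A: "R \<beta>s m' out'" "frame {0, 1} m' m''"
    have "store K m'' c" if "store K m' c" for c
      by (rule store_cong[OF that]) (use A(2) in \<open>simp_all add: frame_def\<close>)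
    moreover have "frame {0, 1, 6, 8, 12} m m'" using A(1) unfolding R_def by blast
    then have "frame {0, 1, 6, 8, 12} m m''" by (rule frame_ext[OF _ A(2)]) simp
    ultimately show "R \<beta>s m'' out'" using A(1) unfolding R_def by blast
  next
    fix \<beta>s m' out' assume A: "R \<beta>s m' out'" and adm: "j.admissible (vs J) (val_of m')"
    obtain \<beta> where \<beta>: "\<forall>v\<in>job_vars J. val_of m' v = Cst (\<beta> v)"
      using admissible_Cst[OF g, of "val_of m'"] adm unfolding J_def by blast
    obtain cls' where cls': "store K m' (cls @ cls')" "length cls' \<le> length \<beta>s" "sound cls'"
      "\<forall>\<alpha>\<in>set \<beta>s. \<forall>\<beta>. (\<forall>v\<in>job_vars J. \<alpha> v = Cst (\<beta> v)) \<and> checks J \<beta> \<longrightarrow> clause J \<beta> \<in> set cls'"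
      using A unfolding R_def by blast
    have out: "out' = out" and fr: "frame {0, 1, 6, 8, 12} m m'" using A unfolding R_def by blast+
    have mk: "marked m'" by (rule marked_frame[OF m(2) fr]) simp
    define new where "new = (if checks J \<beta> then [clause J \<beta>] else [])"
    \<comment> \<open>The clause and the outcome of the tests are determined by the memory contents,
      so any other assignment read from the same cells gives the same clause.\<close>
    have same: "checks J \<gamma> = checks J \<beta> \<and> clause J \<gamma> = clause J \<beta>"
      if \<gamma>: "\<forall>v\<in>job_vars J. val_of m' v = Cst (\<gamma> v)" for \<gamma>
    proof
      show "checks J \<gamma> = checks J \<beta>"
        unfolding checks_def using checkB_val[OF _ J mk, of _ \<gamma>] checkB_val[OF _ J mk, of _ \<beta>] \<gamma> \<beta> by blast
      show "clause J \<gamma> = clause J \<beta>"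
        using clauseE_val[OF J, of m' \<gamma> T] clauseE_val[OF J, of m' \<beta> T] \<gamma> \<beta> by simp
    qed
    show "run T (recordC J) m' out' (\<lambda>t m'' out''. t \<le> record_cost \<and> R (\<beta>s @ [val_of m']) m'' out'' \<and> frame {6, 8, 12} m' m'')"
    proof (rule run_mono[OF run_recordC[OF J mk cls'(1)]])
      show "val_of m' v = Cst (\<beta> v)" if "v \<in> job_vars J" for v using \<beta> that by blast
      fix t m'' out''
      assume B: "t \<le> record_cost \<and> out'' = out' \<and> frame {6, 8, 12} m' m'' \<and>
        store K m'' ((cls @ cls') @ (if checks J \<beta> then [clause J \<beta>] else []))"
      then have st: "store K m'' (cls @ (cls' @ new))" by (simp add: new_def)
      have "frame {0, 1, 6, 8, 12} m m''"
        by (rule frame_ext[OF fr, of "{6, 8, 12}"]) (use B in auto)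
      moreover have "sound (cls' @ new)" using cls'(3) J by (auto simp: sound_def new_def)
      moreover have "length (cls' @ new) \<le> length (\<beta>s @ [val_of m'])" using cls'(2) by (simp add: new_def)
      moreover have "clause J \<gamma> \<in> set (cls' @ new)"
        if "\<alpha> \<in> set (\<beta>s @ [val_of m'])" "\<forall>v\<in>job_vars J. \<alpha> v = Cst (\<gamma> v)" "checks J \<gamma>" for \<alpha> \<gamma>
      proof (cases "\<alpha> \<in> set \<beta>s")
        case True
        then show ?thesis using cls'(4) that by auto
      next
        case False
        then have "\<alpha> = val_of m'" using that(1) by simp
        then show ?thesis using same[of \<gamma>] that(2,3) by (simp add: new_def)
      qed
      ultimately have "R (\<beta>s @ [val_of m']) m'' out''" unfolding R_def using st B out by blast
      then show "t \<le> record_cost \<and> R (\<beta>s @ [val_of m']) m'' out'' \<and> frame {6, 8, 12} m' m''" using B by blast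
    qed
  qed
  have R0: "R [] m out"
    unfolding R_def using m(3) by (auto intro!: exI[of _ "[]"] simp: sound_def)
  have "\<forall>b\<in>set (jedges J). trie m (Num 2 # tp g b) (pfx (S g b))"
    using m(1) g by (simp add: loaded_def J_def)
  then have tr: "tries m" by (simp add: tries_def)
  show ?thesis
    unfolding jobC_def J_def[symmetric]
  proof (rule run_mono[OF run_full_join[OF R0 tr]])
    fix t m' out'
    assume A: "t \<le> j.join_cost lc cc record_cost [] (vs J) (val_of m) \<and>
      (\<exists>\<gamma>s. R \<gamma>s m' out' \<and> length \<gamma>s \<le> j.join_cost 0 0 1 [] (vs J) (val_of m) \<and>
        (\<forall>\<beta>. j.admissible (vs J) \<beta> \<longrightarrow> (\<exists>\<gamma>\<in>set \<gamma>s. \<forall>u\<in>set (vs J). \<gamma> u = \<beta> u))) \<and>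
      frame ({6, 8, 12} \<union> {0, 1}) m m'"
    obtain \<gamma>s where \<gamma>s: "R \<gamma>s m' out'" "length \<gamma>s \<le> j.join_cost 0 0 1 [] (vs J) (val_of m)"
      "\<And>\<beta>. j.admissible (vs J) \<beta> \<Longrightarrow> \<exists>\<gamma>\<in>set \<gamma>s. \<forall>u\<in>set (vs J). \<gamma> u = \<beta> u" using A by blast
    have "real t \<le> real (j.join_cost lc cc record_cost [] (vs J) (val_of m))" using A by simp
    also have "\<dots> \<le> real (record_cost + query_cost) * W"
      using join_cost_bound[OF g, of record_cost "val_of m"] by (simp add: J_def)
    finally have time: "real t \<le> real (record_cost + query_cost) * W" .
    have "real (length \<gamma>s) \<le> real (j.join_cost 0 0 1 [] (vs J) (val_of m))" using \<gamma>s(2) by simp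
    also have "\<dots> \<le> W" using join_bound[OF g, of 0 0 1 "val_of m"] by (simp add: J_def)
    finally have cnt: "real (length \<gamma>s) \<le> W" .
    obtain cls' where cls': "store K m' (cls @ cls')" "length cls' \<le> length \<gamma>s" "sound cls'"
      "\<forall>\<alpha>\<in>set \<gamma>s. \<forall>\<beta>. (\<forall>v\<in>job_vars J. \<alpha> v = Cst (\<beta> v)) \<and> checks J \<beta> \<longrightarrow> clause J \<beta> \<in> set cls'"
      using \<gamma>s(1) unfolding R_def by blast
    have "covers cls' J"
      unfolding covers_def
    proof (intro allI impI)
      fix \<beta> assume B: "(\<forall>b\<in>set (jedges J). sat E \<beta> b) \<and> checks J \<beta>"
      then have "j.admissible (vs J) (Cst \<circ> \<beta>)" using sat_admissible[OF g, of \<beta>] by (simp add: J_def)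
      then obtain \<gamma> where "\<gamma> \<in> set \<gamma>s" "\<forall>u\<in>job_vars J. \<gamma> u = Cst (\<beta> u)"
        using \<gamma>s(3)[of "Cst \<circ> \<beta>"] vs(2) by auto
      then show "clause J \<beta> \<in> set cls'" using cls'(4) B by blast
    qed
    then show "real t \<le> real (record_cost + query_cost) * W \<and> out' = out \<and> frame {0, 1, 6, 8, 12} m m' \<and>
      (\<exists>cls'. store K m' (cls @ cls') \<and> real (length cls') \<le> W \<and> sound cls' \<and> covers cls' J)"
      using time cnt cls' \<gamma>s(1) unfolding R_def by (meson of_nat_mono order.trans)
  qed
qed

lemma clause_nth:
  assumes "J \<in> set Js"
  shows "clause J \<beta> ! 0 = fvec (ground \<beta> (jhead J))"
    "i < length (jidb J) \<Longrightarrow> clause J \<beta> ! Suc i = fvec (ground \<beta> (jidb J ! i))"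
    "length (jidb J) \<le> i \<Longrightarrow> i < K \<Longrightarrow> clause J \<beta> ! Suc i = replicate K (Num 0)"
  by (auto simp: clause_def nth_append)

lemma ground_subst: "ground \<beta> (subst_atom \<theta> a) = ground (\<lambda>x. trm_val \<beta> (\<theta> x)) a"
  by (simp add: ground_def subst_atom_def trm_val_subst)

lemma horn_sound:
  assumes "sound cls" "w \<in> horn K (set cls)"
  shows "w = replicate K (Num 0) \<or> (\<exists>f\<in>LF. fst f \<in> idb P \<and> w = fvec f)"
  using assms(2)
proof induction
  case (step cl)
  obtain J \<beta> where J: "J \<in> set Js" "checks J \<beta>" "cl = clause J \<beta>"
    using step(1) assms(1) by (auto simp: sound_def)
  have body: "ground \<beta> a \<in> LF" if a: "a \<in> set (jidb J)" for a
  proof -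
    obtain i where i: "i < length (jidb J)" "a = jidb J ! i" using a by (auto simp: in_set_conv_nth)
    then have "Suc i \<in> {1..K}" using okD(9)[OF J(1)] by (simp add: K_def)
    then have "cl ! Suc i = replicate K (Num 0) \<or> (\<exists>f\<in>LF. fst f \<in> idb P \<and> cl ! Suc i = fvec f)" by (rule step(3))
    then obtain f where f: "f \<in> LF" "fst f \<in> idb P" "fvec (ground \<beta> a) = fvec f"
      using clause_nth(2)[OF J(1) i(1)] J(3) i(2) fvec_neq_zero by metis
    moreover have "fst (ground \<beta> a) \<in> idb P" using okD(12)[OF J(1) a] by (simp add: ground_def)
    ultimately show ?thesis using fvec_inj by metis
  qed
  obtain R \<theta> where R: "R \<in> P" "jhead J = subst_atom \<theta> (rhead R)"
    "jidb J = map (subst_atom \<theta>) (idb_atoms P R)" "jedb J = map (subst_atom \<theta>) (edb_atoms P R)"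
    using rule[OF J(1)] by (auto simp: job_rule_def)
  have "ground (\<lambda>x. trm_val \<beta> (\<theta> x)) (rhead R) \<in> LF"
  proof (rule least_fixpoint_rule[OF R(1)])
    fix a assume "a \<in> set (rbody R)"
    then consider "a \<in> set (idb_atoms P R)" | "a \<in> set (edb_atoms P R)" using set_idb_edb_atoms[of R P] by blast
    then have "ground \<beta> (subst_atom \<theta> a) \<in> LF"
      using body J(2) R(3,4) by cases (auto simp: checks_def)
    then show "ground (\<lambda>x. trm_val \<beta> (\<theta> x)) a \<in> LF" by (simp add: ground_subst)
  qed
  then have "ground \<beta> (jhead J) \<in> LF" by (simp add: R(2) ground_subst)
  moreover have "fst (ground \<beta> (jhead J)) \<in> idb P" using okD(11)[OF J(1)] by (simp add: ground_def)
  ultimately show ?case using clause_nth(1)[OF J(1)] J(3) by auto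
qed simp

lemma horn_sound_fact:
  assumes "sound cls" "fvec f \<in> horn K (set cls)" "fst f \<in> idb P"
  shows "f \<in> LF"
  using horn_sound[OF assms(1,2)] fvec_neq_zero fvec_inj[OF _ assms(3)] by metis

text \<open>Unfolding the fixpoint once exhibits a rule instance with head \<open>f\<close>, which
  is an answer of some query; the output phase meets \<open>f\<close> at this answer.\<close>

lemma fact_job:
  assumes "f \<in> LF" "fst f \<in> idb P"
  obtains J \<beta> where "J \<in> set Js" "\<forall>b\<in>set (jedges J). sat E \<beta> b" "ground \<beta> (jhead J) = f" "checks J \<beta>"
    "\<And>a. a \<in> set (jidb J) \<Longrightarrow> ground \<beta> a \<in> LF"
proof -
  have "f \<in> consequence P (facts_of T) LF" using assms(1) least_fixpoint_unfold by blast
  moreover have "f \<notin> facts_of T" using T assms(2) by (auto simp: facts_of_def edb_instance_def)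
  ultimately obtain \<nu> R where R: "R \<in> P" "f = ground \<nu> (rhead R)" "\<forall>a\<in>set (rbody R). ground \<nu> a \<in> LF"
    by (auto simp: consequence_def)
  have "fst (rhead R) \<in> idb P" using R(2) assms(2) by (simp add: ground_def)
  then obtain J \<beta> where J: "J \<in> set Js" "\<forall>b\<in>set (jedges J). sat E \<beta> b" "ground \<beta> (jhead J) = ground \<nu> (rhead R)"
    "map (ground \<beta>) (jidb J) = map (ground \<nu>) (idb_atoms P R)"
    "map (ground \<beta>) (jedb J) = map (ground \<nu>) (edb_atoms P R)"
    using complete T R(1,3) unfolding jobs_complete_def by blast
  have im: "ground \<beta> ` set (jidb J) = ground \<nu> ` set (idb_atoms P R)"
    "ground \<beta> ` set (jedb J) = ground \<nu> ` set (edb_atoms P R)"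
    using arg_cong[OF J(4), of set] arg_cong[OF J(5), of set] by simp_all
  have lf: "ground \<beta> a \<in> LF" if a: "a \<in> set (jidb J) \<union> set (jedb J)" for a
  proof -
    have "ground \<beta> a \<in> ground \<beta> ` set (jidb J) \<union> ground \<beta> ` set (jedb J)" using a by blast
    then have "ground \<beta> a \<in> ground \<nu> ` set (rbody R)" unfolding im set_idb_edb_atoms[of R P] by blast
    then show ?thesis using R(3) by auto
  qed
  then have "checks J \<beta>" by (simp add: checks_def)
  with J(1-3) R(2) lf show thesis by (intro that[of J \<beta>]) simp_all
qed

text \<open>Fixpoint induction: every rule instance is an answer of some query and passes its EDB
  tests, so its clause is recorded. Its body atoms are derivable by induction and the padding by
  \<open>horn.zero\<close>.\<close>

lemma horn_complete:
  assumes c: "\<And>J. J \<in> set Js \<Longrightarrow> covers cls J" and "f \<in> LF" "fst f \<in> idb P"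
  shows "fvec f \<in> horn K (set cls)"
proof -
  let ?Q = "\<lambda>f. fst f \<in> idb P \<longrightarrow> fvec f \<in> horn K (set cls)"
  have "?Q f"
    using assms(2) unfolding least_fixpoint_def
  proof (rule lfp_induct_set[OF _ mono_consequence])
    fix f assume f: "f \<in> consequence P (facts_of T) (lfp (consequence P (facts_of T)) \<inter> {f. ?Q f})"
    show "?Q f"
    proof
      assume q: "fst f \<in> idb P"
      then have "f \<notin> facts_of T" using T by (auto simp: facts_of_def edb_instance_def)
      then obtain \<nu> R where R: "R \<in> P" "f = ground \<nu> (rhead R)"
        "\<forall>a\<in>set (rbody R). ground \<nu> a \<in> LF \<and> ?Q (ground \<nu> a)"
        using f by (auto simp: consequence_def least_fixpoint_def)
      have "fst (rhead R) \<in> idb P" using R(2) q by (simp add: ground_def)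
      then obtain J \<beta> where J: "J \<in> set Js" "\<forall>b\<in>set (jedges J). sat E \<beta> b" "ground \<beta> (jhead J) = ground \<nu> (rhead R)"
        "map (ground \<beta>) (jidb J) = map (ground \<nu>) (idb_atoms P R)"
        "map (ground \<beta>) (jedb J) = map (ground \<nu>) (edb_atoms P R)"
        using complete T R(1,3) unfolding jobs_complete_def by blast
      have im: "ground \<beta> ` set (jidb J) = ground \<nu> ` set (idb_atoms P R)"
        "ground \<beta> ` set (jedb J) = ground \<nu> ` set (edb_atoms P R)"
        using arg_cong[OF J(4), of set] arg_cong[OF J(5), of set] by simp_all
      have all: "ground \<nu> a \<in> LF \<and> ?Q (ground \<nu> a)" if "a \<in> set (idb_atoms P R) \<union> set (edb_atoms P R)" for a
        using that R(3) set_idb_edb_atoms[of R P] by blast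
      have "checks J \<beta>"
        unfolding checks_def
      proof
        fix a assume "a \<in> set (jedb J)"
        then have "ground \<beta> a \<in> ground \<nu> ` set (edb_atoms P R)" unfolding im(2)[symmetric] by (rule imageI)
        then show "ground \<beta> a \<in> LF" using all by auto
      qed
      then have "clause J \<beta> \<in> set cls" using c[OF J(1)] J(2) by (simp add: covers_def)
      then have "clause J \<beta> ! 0 \<in> horn K (set cls)"
      proof (rule horn.step)
        fix j assume j: "j \<in> {1..K}"
        then obtain i where i: "j = Suc i" "i < K" by (cases j) auto
        show "clause J \<beta> ! j \<in> horn K (set cls)"
        proof (cases "i < length (jidb J)")
          case True
          then have a: "jidb J ! i \<in> set (jidb J)" by simp
          then have "ground \<beta> (jidb J ! i) \<in> ground \<nu> ` set (idb_atoms P R)" unfolding im(1)[symmetric] by (rule imageI)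
          then have "?Q (ground \<beta> (jidb J ! i))" using all by auto
          moreover have "fst (ground \<beta> (jidb J ! i)) \<in> idb P" using okD(12)[OF J(1) a] by (simp add: ground_def)
          ultimately show ?thesis using clause_nth(2)[OF J(1) True] i(1) by simp
        next
          case False
          then show ?thesis using clause_nth(3)[OF J(1), of i] i horn.zero by simp
        qed
      qed
      then show "fvec f \<in> horn K (set cls)" using clause_nth(1)[OF J(1)] J(3) R(2) by simp
    qed
  qed
  with assms(3) show ?thesis by blast
qed

definition output_cost :: nat where "output_cost = 6 + 3 * K + 3 * k"

text \<open>The join is repeated on the same tries, and a head is emitted if it is marked as
  derived. \<open>H\<close> is the set of marked vectors; the assumption on it guarantees that only
  facts of the fixpoint are emitted.\<close>

lemma run_output_job:
  assumes g: "g < length Js" and m: "loaded m" "\<And>w. m (Num 10 # w) = Num (if w \<in> H then 1 else 0)"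
    and H: "\<And>f. fst f \<in> idb P \<Longrightarrow> fvec f \<in> H \<Longrightarrow> f \<in> LF"
  shows "run T (jobC outputC g) m out (\<lambda>t m' out'. real t \<le> real (output_cost + query_cost) * W \<and>
    frame {0, 1} m m' \<and> out \<subseteq> out' \<and> out' \<subseteq> out \<union> LF \<and>
    (\<forall>\<beta>. (\<forall>b\<in>set (jedges (Js ! g)). sat E \<beta> b) \<and> fvec (ground \<beta> (jhead (Js ! g))) \<in> H \<longrightarrow>
      ground \<beta> (jhead (Js ! g)) \<in> out'))"
proof -
  define J where "J = Js ! g"
  have J: "J \<in> set Js" using g by (simp add: J_def)
  define R where "R \<beta>s m' out' \<longleftrightarrow> frame {0, 1} m m' \<and> out \<subseteq> out' \<and> out' \<subseteq> out \<union> LF \<and>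
    (\<forall>\<alpha>\<in>set \<beta>s. \<forall>\<beta>. (\<forall>v\<in>job_vars J. \<alpha> v = Cst (\<beta> v)) \<and> fvec (ground \<beta> (jhead J)) \<in> H \<longrightarrow>
      ground \<beta> (jhead J) \<in> out')"
    for \<beta>s :: "(nat \<Rightarrow> 'c val) list" and m' out'
  have hv: "atom_vars (jhead J) \<subseteq> job_vars J" "length (snd (jhead J)) \<le> k" "fst (jhead J) \<in> idb P"
    using okD(7,8)[OF J, of "jhead J"] okD(11)[OF J] by auto
  interpret j: join "set (jedges J)" batom_vars "S g"
    by unfold_locales (use S_size[OF g] J_def in auto)
  interpret join_code "jedges J" "S g" T "tp g" "outputC J" R output_cost "{}" "vs J"
  proof unfold_locales
    show "length (tp g b) = 2" for b by (rule tp)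
    show "{} \<inter> {0, 1, 2 :: nat} = {}" by simp
    show "distinct (vs J)" by (rule vs(1))
    show "j.edges_at v \<noteq> {}" if "v \<in> set (vs J)" for v
      using edges_at_vs[OF that] by (simp add: j.edges_at_def)
  next
    fix \<beta>s m' out' m'' assume A: "R \<beta>s m' out'" "frame {0, 1} m' m''"
    then have "frame {0, 1} m m''" unfolding R_def using frame_trans by blast
    then show "R \<beta>s m'' out'" using A(1) unfolding R_def by blast
  next
    fix \<beta>s m' out' assume A: "R \<beta>s m' out'" and adm: "j.admissible (vs J) (val_of m')"
    obtain \<beta> where \<beta>: "\<forall>v\<in>job_vars J. val_of m' v = Cst (\<beta> v)"
      using admissible_Cst[OF g, of "val_of m'"] adm unfolding J_def by blast
    have "m' (Num 10 # w) = Num (if w \<in> H then 1 else 0)" for w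
      using A m(2) by (simp add: R_def frame_def)
    moreover have vec: "map (exp_val T m') (atomE (jhead J)) = fvec (ground \<beta> (jhead J))"
      using \<beta> hv(1) by (intro atomE_val) blast
    ultimately have b: "bexp_val T m' (derivedE (atomE (jhead J))) \<longleftrightarrow> fvec (ground \<beta> (jhead J)) \<in> H"
      by (simp add: derivedE_def)
    have args: "map (exp_val T m') (map expT (snd (jhead J))) = map Cst (map (trm_val \<beta>) (snd (jhead J)))"
      using \<beta> hv(1) by (intro expT_val) (auto simp: atom_vars_def)
    have "sum_list (map exp_cost (atomE (jhead J))) \<le> length (atomE (jhead J)) * 3"
      by (rule sum_list_le) (rule atomE(2))
    then have c1: "1 + bexp_cost (derivedE (atomE (jhead J))) \<le> 5 + 3 * K"
      using atomE(1)[OF hv(2)] by (simp add: derivedE_def)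
    have "sum_list (map exp_cost (map expT (snd (jhead J)) :: ('p, 'c) exp list)) \<le> length (map expT (snd (jhead J)) :: ('p, 'c) exp list) * 3"
      by (rule sum_list_le) (auto intro: expT_cost)
    then have c2: "1 + sum_list (map exp_cost (map expT (snd (jhead J)) :: ('p, 'c) exp list)) \<le> 1 + 3 * k"
      using hv(2) by simp
    have same: "ground \<gamma> (jhead J) = ground \<beta> (jhead J)" if \<gamma>: "\<forall>v\<in>job_vars J. val_of m' v = Cst (\<gamma> v)" for \<gamma>
    proof -
      have "map (trm_val \<gamma>) (snd (jhead J)) = map (trm_val \<beta>) (snd (jhead J))"
      proof (rule map_trm_val_cong)
        fix x assume "x \<in> args_vars (snd (jhead J))"
        then have "x \<in> job_vars J" using hv(1) by (auto simp: atom_vars_def)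
        then have "Cst (\<gamma> x) = Cst (\<beta> x)" using \<gamma> \<beta> by metis
        then show "\<gamma> x = \<beta> x" by simp
      qed
      then show ?thesis by (simp add: ground_def)
    qed
    show "run T (outputC J) m' out' (\<lambda>t m'' out''. t \<le> output_cost \<and> R (\<beta>s @ [val_of m']) m'' out'' \<and> frame {} m' m'')"
      unfolding outputC_def
    proof (rule run_If)
      assume "bexp_val T m' (derivedE (atomE (jhead J)))"
      then have h: "fvec (ground \<beta> (jhead J)) \<in> H" using b by simp
      then have lf: "ground \<beta> (jhead J) \<in> LF" using hv(3) by (intro H) (simp_all add: ground_def)
      have "R (\<beta>s @ [val_of m']) m' (insert (ground \<beta> (jhead J)) out')"
        using A lf same by (auto simp: R_def)
      then show "run T (Emit (fst (jhead J)) (map expT (snd (jhead J)))) m' out'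
        (\<lambda>t m'' out''. 1 + bexp_cost (derivedE (atomE (jhead J))) + t \<le> output_cost \<and>
          R (\<beta>s @ [val_of m']) m'' out'' \<and> frame {} m' m'')"
        using c1 c2 by (intro run_Emit[OF args]) (simp add: output_cost_def ground_def)
    next
      assume "\<not> bexp_val T m' (derivedE (atomE (jhead J)))"
      then have "R (\<beta>s @ [val_of m']) m' out'" using A same b by (auto simp: R_def)
      then show "run T Skip m' out'
        (\<lambda>t m'' out''. 1 + bexp_cost (derivedE (atomE (jhead J))) + t \<le> output_cost \<and>
          R (\<beta>s @ [val_of m']) m'' out'' \<and> frame {} m' m'')"
        using c1 by (intro run_Skip) (simp add: output_cost_def)
    qed
  qed
  have R0: "R [] m out" by (simp add: R_def)
  have "\<forall>b\<in>set (jedges J). trie m (Num 2 # tp g b) (pfx (S g b))"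
    using m(1) g by (simp add: loaded_def J_def)
  then have tr: "tries m" by (simp add: tries_def)
  show ?thesis
    unfolding jobC_def J_def[symmetric]
  proof (rule run_mono[OF run_full_join[OF R0 tr]])
    fix t m' out'
    assume A: "t \<le> j.join_cost lc cc output_cost [] (vs J) (val_of m) \<and>
      (\<exists>\<gamma>s. R \<gamma>s m' out' \<and> length \<gamma>s \<le> j.join_cost 0 0 1 [] (vs J) (val_of m) \<and>
        (\<forall>\<beta>. j.admissible (vs J) \<beta> \<longrightarrow> (\<exists>\<gamma>\<in>set \<gamma>s. \<forall>u\<in>set (vs J). \<gamma> u = \<beta> u))) \<and>
      frame ({} \<union> {0, 1}) m m'"
    obtain \<gamma>s where \<gamma>s: "R \<gamma>s m' out'"
      "\<And>\<beta>. j.admissible (vs J) \<beta> \<Longrightarrow> \<exists>\<gamma>\<in>set \<gamma>s. \<forall>u\<in>set (vs J). \<gamma> u = \<beta> u" using A by blast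
    have "real t \<le> real (j.join_cost lc cc output_cost [] (vs J) (val_of m))" using A by simp
    also have "\<dots> \<le> real (output_cost + query_cost) * W"
      using join_cost_bound[OF g, of output_cost "val_of m"] by (simp add: J_def)
    finally have time: "real t \<le> real (output_cost + query_cost) * W" .
    have "ground \<beta> (jhead J) \<in> out'"
      if B: "\<forall>b\<in>set (jedges J). sat E \<beta> b" "fvec (ground \<beta> (jhead J)) \<in> H" for \<beta>
    proof -
      have "j.admissible (vs J) (Cst \<circ> \<beta>)" using sat_admissible[OF g, of \<beta>] B(1) by (simp add: J_def)
      then obtain \<gamma> where "\<gamma> \<in> set \<gamma>s" "\<forall>u\<in>job_vars J. \<gamma> u = Cst (\<beta> u)"
        using \<gamma>s(2)[of "Cst \<circ> \<beta>"] vs(2) by auto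
      then show ?thesis using \<gamma>s(1) B(2) unfolding R_def by blast
    qed
    then show "real t \<le> real (output_cost + query_cost) * W \<and> frame {0, 1} m m' \<and> out \<subseteq> out' \<and> out' \<subseteq> out \<union> LF \<and>
      (\<forall>\<beta>. (\<forall>b\<in>set (jedges J). sat E \<beta> b) \<and> fvec (ground \<beta> (jhead J)) \<in> H \<longrightarrow> ground \<beta> (jhead J) \<in> out')"
      using time \<gamma>s(1) unfolding R_def by blast
  qed
qed

end

context evaluation
begin

lemma run_record_jobs:
  assumes m: "loaded m" "marked m" "store K m []"
  shows "run T (seqC (map (jobC recordC) [0..<length Js])) m out (\<lambda>t m' out'.
    real t \<le> real (length Js) * (real (record_cost + query_cost) * W) \<and> out' = out \<and>
    frame {0, 1, 6, 8, 12} m m' \<and> (\<exists>cls. store K m' cls \<and> real (length cls) \<le> real (length Js) * W \<and>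
      sound cls \<and> (\<forall>J\<in>set Js. covers cls J)))"
proof -
  define I where "I g t m' out' \<longleftrightarrow> real t \<le> real g * (real (record_cost + query_cost) * W) \<and> out' = out \<and>
    frame {0, 1, 6, 8, 12} m m' \<and> (\<exists>cls. store K m' cls \<and> real (length cls) \<le> real g * W \<and>
      sound cls \<and> (\<forall>h<g. covers cls (Js ! h)))" for g t :: nat and m' out'
  show ?thesis
  proof (rule run_seqC[where I = I])
    show "I 0 0 m out" unfolding I_def using m(3) by (auto intro!: exI[of _ "[]"] simp: sound_def)
  next
    fix g t m' out' assume g: "g < length (map (jobC recordC) [0..<length Js])" and I: "I g t m' out'"
    then have g': "g < length Js" by simp
    obtain cls where cls: "store K m' cls" "real (length cls) \<le> real g * W" "sound cls"
      "\<forall>h<g. covers cls (Js ! h)" using I unfolding I_def by blast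
    have t: "real t \<le> real g * (real (record_cost + query_cost) * W)" and out: "out' = out"
      and fr: "frame {0, 1, 6, 8, 12} m m'" using I unfolding I_def by blast+
    have ld: "loaded m'" by (rule loaded_frame[OF m(1) fr]) simp
    have mk: "marked m'" by (rule marked_frame[OF m(2) fr]) simp
    have "run T (jobC recordC g) m' out' (\<lambda>t'. I (Suc g) (t + t'))"
    proof (rule run_mono[OF run_record_job[OF g' ld mk cls(1)]])
      fix t' m'' out''
      assume A: "real t' \<le> real (record_cost + query_cost) * W \<and> out'' = out' \<and> frame {0, 1, 6, 8, 12} m' m'' \<and>
        (\<exists>cls'. store K m'' (cls @ cls') \<and> real (length cls') \<le> W \<and> sound cls' \<and> covers cls' (Js ! g))"
      then obtain cls' where cls': "store K m'' (cls @ cls')" "real (length cls') \<le> W" "sound cls'"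
        "covers cls' (Js ! g)" by blast
      have "real (t + t') \<le> real (Suc g) * (real (record_cost + query_cost) * W)"
        using t A by (simp add: distrib_right)
      moreover have "frame {0, 1, 6, 8, 12} m m''" using fr A frame_trans by blast
      moreover have "real (length (cls @ cls')) \<le> real (Suc g) * W"
        using cls(2) cls'(2) by (simp add: distrib_right)
      moreover have "sound (cls @ cls')" using cls(3) cls'(3) by (auto simp: sound_def)
      moreover have "covers (cls @ cls') (Js ! h)" if "h < Suc g" for h
        using that cls(4) cls'(4) by (auto simp: covers_def less_Suc_eq)
      ultimately show "I (Suc g) (t + t') m'' out''"
        unfolding I_def using cls'(1) out A by blast
    qed
    then show "run T (map (jobC recordC) [0..<length Js] ! g) m' out' (\<lambda>t'. I (Suc g) (t + t'))"
      using g' by simp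
  next
    fix t m' out' assume "I (length (map (jobC recordC) [0..<length Js])) t m' out'"
    then have "I (length Js) t m' out'" by simp
    then show "real t \<le> real (length Js) * (real (record_cost + query_cost) * W) \<and> out' = out \<and>
      frame {0, 1, 6, 8, 12} m m' \<and> (\<exists>cls. store K m' cls \<and> real (length cls) \<le> real (length Js) * W \<and>
      sound cls \<and> (\<forall>J\<in>set Js. covers cls J))"
      unfolding I_def by (metis in_set_conv_nth)
  qed
qed

lemma run_output_jobs:
  assumes m: "loaded m" "\<And>w. m (Num 10 # w) = Num (if w \<in> H then 1 else 0)"
    and H: "\<And>f. fst f \<in> idb P \<Longrightarrow> fvec f \<in> H \<Longrightarrow> f \<in> LF"
  shows "run T (seqC (map (jobC outputC) [0..<length Js])) m {} (\<lambda>t m' out'.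
    real t \<le> real (length Js) * (real (output_cost + query_cost) * W) \<and> out' \<subseteq> LF \<and>
    (\<forall>J\<in>set Js. \<forall>\<beta>. (\<forall>b\<in>set (jedges J). sat E \<beta> b) \<and> fvec (ground \<beta> (jhead J)) \<in> H \<longrightarrow>
      ground \<beta> (jhead J) \<in> out'))"
proof -
  define emits where "emits out' J \<longleftrightarrow> (\<forall>\<beta>. (\<forall>b\<in>set (jedges J). sat E \<beta> b) \<and>
    fvec (ground \<beta> (jhead J)) \<in> H \<longrightarrow> ground \<beta> (jhead J) \<in> out')" for out' J
  define I where "I g t m' out' \<longleftrightarrow> real t \<le> real g * (real (output_cost + query_cost) * W) \<and>
    frame {0, 1} m m' \<and> out' \<subseteq> LF \<and> (\<forall>h<g. emits out' (Js ! h))" for g t :: nat and m' out'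
  have "run T (seqC (map (jobC outputC) [0..<length Js])) m {} (\<lambda>t m' out'. I (length Js) t m' out')"
  proof (rule run_seqC[where I = I])
    show "I 0 0 m {}" by (simp add: I_def)
  next
    fix g t m' out' assume g: "g < length (map (jobC outputC) [0..<length Js])" and I: "I g t m' out'"
    then have g': "g < length Js" by simp
    have fr: "frame {0, 1} m m'" using I unfolding I_def by blast
    have ld: "loaded m'" by (rule loaded_frame[OF m(1) fr]) simp
    have d: "m' (Num 10 # w) = Num (if w \<in> H then 1 else 0)" for w
      using m(2) fr by (simp add: frame_def)
    have "run T (jobC outputC g) m' out' (\<lambda>t'. I (Suc g) (t + t'))"
    proof (rule run_mono[OF run_output_job[where H = H, OF g' ld d]])
      show "f \<in> LF" if "fst f \<in> idb P" "fvec f \<in> H" for f using H that by blast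
      fix t' m'' out''
      assume A: "real t' \<le> real (output_cost + query_cost) * W \<and> frame {0, 1} m' m'' \<and> out' \<subseteq> out'' \<and>
        out'' \<subseteq> out' \<union> LF \<and> (\<forall>\<beta>. (\<forall>b\<in>set (jedges (Js ! g)). sat E \<beta> b) \<and> fvec (ground \<beta> (jhead (Js ! g))) \<in> H \<longrightarrow>
          ground \<beta> (jhead (Js ! g)) \<in> out'')"
      have "real (t + t') \<le> real (Suc g) * (real (output_cost + query_cost) * W)"
        using I A by (simp add: I_def distrib_right)
      moreover have "frame {0, 1} m m''" using fr A frame_trans by blast
      moreover have "out'' \<subseteq> LF" using I A unfolding I_def by blast
      moreover have "emits out'' (Js ! h)" if "h < Suc g" for h
      proof (cases "h = g")
        case False
        then have "emits out' (Js ! h)" using I that unfolding I_def by simp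
        then show ?thesis using A unfolding emits_def by blast
      qed (use A emits_def in blast)
      ultimately show "I (Suc g) (t + t') m'' out''" unfolding I_def by blast
    qed
    then show "run T (map (jobC outputC) [0..<length Js] ! g) m' out' (\<lambda>t'. I (Suc g) (t + t'))"
      using g' by simp
  qed simp
  then show ?thesis
  proof (rule run_mono)
    fix t m' out' assume I: "I (length Js) t m' out'"
    then have "emits out' J" if "J \<in> set Js" for J using that unfolding I_def by (metis in_set_conv_nth)
    with I show "real t \<le> real (length Js) * (real (output_cost + query_cost) * W) \<and> out' \<subseteq> LF \<and>
      (\<forall>J\<in>set Js. \<forall>\<beta>. (\<forall>b\<in>set (jedges J). sat E \<beta> b) \<and> fvec (ground \<beta> (jhead J)) \<in> H \<longrightarrow>
        ground \<beta> (jhead J) \<in> out')" unfolding I_def emits_def by blast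
  qed
qed

lemma store_empty:
  assumes "\<And>n r. n \<in> {6, 8, 12} \<Longrightarrow> m (Num n # r) = Num 0"
  shows "store K m []"
proof -
  have "trie m [Num 8] {}" by (rule trie_empty) (simp add: assms)
  then show ?thesis using assms by (simp add: store_def clause_atom_def watch_def)
qed

definition horn_factor :: nat where
  "horn_factor = 40 + K + 2 * (60 + 7 * K) + K * (60 + 40 * K + 7 * (K * K))"

text \<open>One summand per phase: marking facts, loading, recording, chaining, output. The value
  depends on \<open>k\<close> alone, so it can be fixed before the program and the instance.\<close>

definition total_cost :: nat where
  "total_cost = (k + 4) + (k + 2 ^ k) * edge_cost k + (record_cost + query_cost) + horn_factor +
     (output_cost + query_cost)"

text \<open>\<open>B\<close> bounds both the number of queries, which governs loading, joins and
  chaining, and the number of rules, which governs the marking of the facts of the program.\<close>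

lemma run_evalC:
  assumes ne: "Js \<noteq> []" and n: "length Js \<le> B" "card P \<le> B"
  shows "run T evalC (\<lambda>_. Num 0) {} (\<lambda>t m out. real t \<le> real total_cost * (real B * W) \<and>
    (\<forall>q\<in>idb P. {u. (q, u) \<in> out} = E q))"
proof -
  let ?n = "real (length Js)" and ?X = "real B * W"
  have n1: "1 \<le> length Js" using ne by (cases Js) auto
  then have B: "1 \<le> real B" using n(1) by linarith
  have "1 * 1 \<le> ?X" using B W by (intro mult_mono) auto
  then have X1: "1 \<le> ?X" by simp
  have nX: "?n * W \<le> ?X" using n(1) by (intro mult_right_mono) auto
  have BX: "real B \<le> ?X" using mult_left_mono[OF W, of "real B"] by simp
  have init: "run T factC (\<lambda>_. Num 0) {} (\<lambda>t' m' out'. t' \<le> length edb_facts * (k + 4) \<and> out' = {} \<and>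
      frame {5} (\<lambda>_. Num 0) m' \<and> marked m')" by (rule run_factC) simp
  have fin: "real (t1 + (t2 + (t3 + (t4 + t5)))) \<le> real total_cost * ?X"
    if t: "t1 \<le> length edb_facts * (k + 4)" "t2 \<le> length all_edges * (edge_cost k * N)"
      "real t3 \<le> ?n * (real (record_cost + query_cost) * W)"
      "t4 \<le> chaining.horn_cost K M" "real M \<le> ?n * W"
      "real t5 \<le> ?n * (real (output_cost + query_cost) * W)" for t1 t2 t3 t4 t5 M
  proof -
    have "t1 \<le> B * (k + 4)"
      using t(1) mult_le_mono1[of "length edb_facts" B "k + 4"] length_edb_facts n(2) by linarith
    then have "real t1 \<le> real B * real (k + 4)" by (metis of_nat_le_iff of_nat_mult)
    also have "\<dots> \<le> ?X * real (k + 4)" using BX by (intro mult_right_mono) auto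
    finally have b1: "real t1 \<le> real (k + 4) * ?X" by (simp add: mult.commute)
    \<comment> \<open>Without edges nothing is loaded. With an edge, \<open>N_le_W\<close> bounds
      the \<open>N\<close> tuples per edge by the join bound.\<close>
    have b2: "real t2 \<le> real ((k + 2 ^ k) * edge_cost k) * ?X"
    proof (cases all_edges)
      case Nil
      then show ?thesis using t(2) X1 by simp
    next
      case (Cons ge ges)
      obtain g e where "ge = (g, e)" by (cases ge)
      then have "(g, e) \<in> set all_edges" using Cons by simp
      then have ge: "g < length Js" "e \<in> set (jedges (Js ! g))" by (simp_all add: set_all_edges)
      then have NW: "real N \<le> W" using N_le_W[of "Js ! g" e] by simp
      have "t2 \<le> (length Js * (k + 2 ^ k)) * (edge_cost k * N)"
        using t(2) mult_le_mono1[OF length_all_edges, of "edge_cost k * N"] by linarith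
      then have "real t2 \<le> real ((length Js * (k + 2 ^ k)) * (edge_cost k * N))" by (rule of_nat_mono)
      also have "\<dots> = real ((k + 2 ^ k) * edge_cost k) * (?n * real N)" by (simp add: algebra_simps)
      also have "\<dots> \<le> real ((k + 2 ^ k) * edge_cost k) * (?n * W)"
        using NW by (intro mult_left_mono) auto
      also have "\<dots> \<le> real ((k + 2 ^ k) * edge_cost k) * ?X" using nX by (intro mult_left_mono) auto
      finally show ?thesis .
    qed
    have scale: "?n * (real c * W) \<le> real c * ?X" for c
      using mult_left_mono[OF nX, of "real c"] by (simp add: mult.left_commute)
    have b3: "real t3 \<le> real (record_cost + query_cost) * ?X" using t(3) scale by (rule order.trans)
    have b5: "real t5 \<le> real (output_cost + query_cost) * ?X" using t(6) scale by (rule order.trans)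
    have MX: "real M \<le> ?X" using t(5) nX by (rule order.trans)
    have K1: "chaining K" by unfold_locales (simp add: K_def)
    let ?a = "real (60 + 7 * K)" and ?b = "real (K * (60 + 40 * K + 7 * (K * K)))"
    have "real t4 \<le> real (chaining.horn_cost K M)" using t(4) by simp
    also have "\<dots> = real (40 + K) + ?a + real M * ?a + real M * ?b"
      unfolding chaining.horn_cost_def[OF K1] by (simp add: algebra_simps)
    also have "\<dots> \<le> real (40 + K) * ?X + ?a * ?X + ?X * ?a + ?X * ?b"
    proof (intro add_mono)
      show "real (40 + K) \<le> real (40 + K) * ?X" using mult_left_mono[OF X1, of "real (40 + K)"] by simp
      show "?a \<le> ?a * ?X" using mult_left_mono[OF X1, of ?a] by simp
      show "real M * ?a \<le> ?X * ?a" "real M * ?b \<le> ?X * ?b" using MX by (intro mult_right_mono; simp)+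
    qed
    also have "\<dots> = real horn_factor * ?X" by (simp add: horn_factor_def algebra_simps)
    finally have b4: "real t4 \<le> real horn_factor * ?X" .
    have "real total_cost * ?X = real (k + 4) * ?X + real ((k + 2 ^ k) * edge_cost k) * ?X +
        real (record_cost + query_cost) * ?X + real horn_factor * ?X + real (output_cost + query_cost) * ?X"
      unfolding total_cost_def of_nat_add[of _ "output_cost + query_cost"] of_nat_add[of _ horn_factor]
        of_nat_add[of _ "record_cost + query_cost"] of_nat_add[of "k + 4"] by (simp only: distrib_right)
    then show ?thesis using b1 b2 b3 b4 b5 by simp
  qed
  \<comment> \<open>The clauses are known only after the first run of the joins, so the list is left
    arbitrary here.\<close>
  interpret chaining T K cls for cls by unfold_locales (simp add: K_def)
  have "run T (Seq factC (Seq loadC (Seq (seqC (map (jobC recordC) [0..<length Js])) (Seq (hornC K)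
       (seqC (map (jobC outputC) [0..<length Js])))))) (\<lambda>_. Num 0) {} (\<lambda>t m out. real t \<le> real total_cost * ?X \<and>
    (\<forall>q\<in>idb P. {u. (q, u) \<in> out} = E q))"
  proof (rule run_Seq, rule run_mono[OF init], rule run_Seq)
    fix t1 m1 and out1 :: "('p, 'c) fact set"
    assume A1: "t1 \<le> length edb_facts * (k + 4) \<and> out1 = {} \<and> frame {5} (\<lambda>_. Num 0) m1 \<and> marked m1"
    then have z1: "m1 (Num i # r) = Num 0" if "i \<noteq> 5" for i r using that by (simp add: frame_def)
    show "run T loadC m1 out1 (\<lambda>t m' out'. run T (Seq (seqC (map (jobC recordC) [0..<length Js])) (Seq (hornC K)
       (seqC (map (jobC outputC) [0..<length Js])))) m' out' (\<lambda>t' m out. real (t1 + (t + t')) \<le> real total_cost * ?X \<and>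
        (\<forall>q\<in>idb P. {u. (q, u) \<in> out} = E q)))"
    proof (rule run_mono[OF run_loadC], simp add: z1, rule run_Seq)
      fix t2 m2 and out2 :: "('p, 'c) fact set"
      assume A2: "t2 \<le> length all_edges * (edge_cost k * N) \<and> out2 = out1 \<and> frame {0, 2} m1 m2 \<and> loaded m2"
      then have z2: "m2 (Num i # r) = Num 0" if "i \<notin> {0, 2, 5}" for i r
        using that z1 by (simp add: frame_def)
      have mk2: "marked m2" using A1 A2 by (intro marked_frame[of m1 "{0, 2}" m2]) auto
      have st2: "store K m2 []" by (rule store_empty) (auto simp: z2)
      have ld2: "loaded m2" using A2 by blast
      show "run T (seqC (map (jobC recordC) [0..<length Js])) m2 out2 (\<lambda>t m' out'. run T (Seq (hornC K)
       (seqC (map (jobC outputC) [0..<length Js]))) m' out' (\<lambda>t' m out. real (t1 + (t2 + (t + t'))) \<le> real total_cost * ?X \<and>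
        (\<forall>q\<in>idb P. {u. (q, u) \<in> out} = E q)))"
      proof (rule run_mono[OF run_record_jobs[OF ld2 mk2 st2]], rule run_Seq)
        fix t3 m3 and out3 :: "('p, 'c) fact set"
        assume A3: "real t3 \<le> ?n * (real (record_cost + query_cost) * W) \<and> out3 = out2 \<and>
          frame {0, 1, 6, 8, 12} m2 m3 \<and> (\<exists>cls. store K m3 cls \<and> real (length cls) \<le> ?n * W \<and>
            sound cls \<and> (\<forall>J\<in>set Js. covers cls J))"
        then obtain cls where cls: "store K m3 cls" "real (length cls) \<le> ?n * W" "sound cls"
          "\<And>J. J \<in> set Js \<Longrightarrow> covers cls J" by blast
        have fr3: "frame {0, 1, 6, 8, 12} m2 m3" using A3 by blast
        have z3: "m3 (Num 10 # r) = Num 0" for r using fr3 z2[of 10 r] by (simp add: frame_def)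
        have ld3: "loaded m3" by (rule loaded_frame[OF ld2 fr3]) simp
        let ?H = "horn K (set cls)"
        show "run T (hornC K) m3 out3 (\<lambda>t m' out'. run T (seqC (map (jobC outputC) [0..<length Js])) m' out'
          (\<lambda>t' m out. real (t1 + (t2 + (t3 + (t + t')))) \<le> real total_cost * ?X \<and>
          (\<forall>q\<in>idb P. {u. (q, u) \<in> out} = E q)))"
        proof (rule run_mono[OF run_hornC[OF cls(1) z3]])
          fix t4 m4 and out4 :: "('p, 'c) fact set"
          assume A4: "t4 \<le> horn_cost (length cls) \<and> out4 = out3 \<and> frame {0, 10, 11, 12} m3 m4 \<and>
            (\<forall>w. m4 (Num 10 # w) = Num (if w \<in> ?H then 1 else 0))"
          then have d4: "m4 (Num 10 # w) = Num (if w \<in> ?H then 1 else 0)" for w by blast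
          have ld4: "loaded m4" using A4 by (intro loaded_frame[OF ld3, of "{0, 10, 11, 12}"]) auto
          have out4: "out4 = {}" using A1 A2 A3 A4 by simp
          show "run T (seqC (map (jobC outputC) [0..<length Js])) m4 out4
            (\<lambda>t' m out. real (t1 + (t2 + (t3 + (t4 + t')))) \<le> real total_cost * ?X \<and>
            (\<forall>q\<in>idb P. {u. (q, u) \<in> out} = E q))"
            unfolding out4
          proof (rule run_mono[OF run_output_jobs[where H = ?H, OF ld4 d4]])
            show "f \<in> LF" if "fst f \<in> idb P" "fvec f \<in> ?H" for f
              using horn_sound_fact[OF cls(3) that(2,1)] .
            fix t5 m5 and out5 :: "('p, 'c) fact set"
            assume A5: "real t5 \<le> ?n * (real (output_cost + query_cost) * W) \<and> out5 \<subseteq> LF \<and>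
              (\<forall>J\<in>set Js. \<forall>\<beta>. (\<forall>b\<in>set (jedges J). sat E \<beta> b) \<and> fvec (ground \<beta> (jhead J)) \<in> ?H \<longrightarrow>
                ground \<beta> (jhead J) \<in> out5)"
            have "f \<in> out5" if f: "f \<in> LF" "fst f \<in> idb P" for f
            proof -
              obtain J \<beta> where J: "J \<in> set Js" "\<forall>b\<in>set (jedges J). sat E \<beta> b" "ground \<beta> (jhead J) = f"
                by (rule fact_job[OF f])
              have "fvec f \<in> ?H" using cls(4) f by (rule horn_complete)
              then show ?thesis using A5 J by blast
            qed
            then have "{u. (q, u) \<in> out5} = E q" if "q \<in> idb P" for q
              using that A5 by (auto simp: relation_def)
            moreover have "real (t1 + (t2 + (t3 + (t4 + t5)))) \<le> real total_cost * ?X"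
              using A1 A2 A3 A4 A5 cls(2) by (intro fin[of t1 t2 t3 t4 "length cls" t5]) auto
            ultimately show "real (t1 + (t2 + (t3 + (t4 + t5)))) \<le> real total_cost * ?X \<and>
              (\<forall>q\<in>idb P. {u. (q, u) \<in> out5} = E q)" by blast
          qed
        qed
      qed
    qed
  qed
  then show ?thesis using ne by (simp add: evalC_def)
qed

text \<open>Each IDB fact requires a query, by completeness; without queries the empty output is
  therefore correct.\<close>

lemma no_jobs:
  assumes "Js = []" "q \<in> idb P"
  shows "E q = {}"
proof -
  have False if u: "(q, u) \<in> LF" for u
  proof -
    have "fst (q, u) \<in> idb P" using assms(2) by simp
    from u this obtain J \<beta> where "J \<in> set Js" by (rule fact_job)
    then show False using assms(1) by simp
  qed
  then show ?thesis by (auto simp: relation_def)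
qed

end

theorem theorem7p8:
  fixes k :: nat
  shows "\<exists>C::real. \<forall>(ar :: 'p \<Rightarrow> nat) (P :: ('p, 'c) program).
    datalog_program ar P \<and> adornment_groundable P \<and> (\<forall>r\<in>P. rule_size r \<le> k) \<longrightarrow>
    (\<exists>c :: ('p, 'c) com. \<forall>(T :: ('p, 'c) tables) (N :: nat).
       edb_instance ar P T \<and> N \<ge> 1 \<and> edb_tuples_at_most P T N \<longrightarrow>
       (\<exists>t. evaluates_in c P T t \<and>
            real t \<le> C * (real (num_adornments P) * real (card P) * real N powr ew_program P)))"
proof (intro exI[of _ "real (evaluation.total_cost k)"] allI impI)
  fix ar :: "'p \<Rightarrow> nat" and P :: "('p, 'c) program"
  assume A: "datalog_program ar P \<and> adornment_groundable P \<and> (\<forall>r\<in>P. rule_size r \<le> k)"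
  then obtain Js where Js: "length Js \<le> num_adornments P * card P"
    "\<forall>J\<in>set Js. job_ok ar P k J \<and> job_rule P J \<and> job_width P J" "jobs_complete ar P (set Js)"
    using jobs_exist[of ar P k] by blast
  have fin: "finite P" using A by (simp add: datalog_program_def)
  have "finite (idb P \<union> edb P)" using fin by (simp add: finite_idb finite_edb)
  then obtain pc :: "'p \<Rightarrow> nat" where pc: "inj_on pc (idb P \<union> edb P)"
    using finite_imp_inj_to_nat_seg by blast
  have ar: "ar p \<le> k" if p: "p \<in> edb P" for p
  proof -
    obtain r a where "r \<in> P" "a \<in> set (atoms_of r)" "p = fst a" using p unfolding edb_def by blast
    then show ?thesis using rule_size_bounds(1)[of r k a] A by (auto simp: datalog_program_def)
  qed
  interpret evaluator ar k P Js pc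
    by unfold_locales (use A Js pc ar in auto)
  show "\<exists>c :: ('p, 'c) com. \<forall>(T :: ('p, 'c) tables) (N :: nat).
       edb_instance ar P T \<and> N \<ge> 1 \<and> edb_tuples_at_most P T N \<longrightarrow>
       (\<exists>t. evaluates_in c P T t \<and>
            real t \<le> real (evaluation.total_cost k) * (real (num_adornments P) * real (card P) * real N powr ew_program P))"
  proof (intro exI[of _ evalC] allI impI)
    fix T :: "('p, 'c) tables" and N :: nat
    assume TN: "edb_instance ar P T \<and> N \<ge> 1 \<and> edb_tuples_at_most P T N"
    interpret evaluation ar k P Js pc T N by unfold_locales (use TN in auto)
    let ?B = "num_adornments P * card P"
    show "\<exists>t. evaluates_in evalC P T t \<and>
        real t \<le> real (evaluation.total_cost k) * (real (num_adornments P) * real (card P) * real N powr ew_program P)"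
    proof (cases "Js = []")
      case True
      have "exec T evalC ((\<lambda>_. Num 0), {}) 0 ((\<lambda>_. Num 0), {})"
        unfolding evalC_def using True by (simp add: exec.Skip)
      then have "evaluates_in evalC P T 0"
        unfolding evaluates_in_def using no_jobs[OF True] by auto
      moreover have "real 0 \<le> real (evaluation.total_cost k) * (real (num_adornments P) * real (card P) * real N powr ew_program P)"
        by simp
      ultimately show ?thesis by blast
    next
      case False
      then have "0 < length Js" by simp
      \<comment> \<open>A non-empty list of queries makes the product positive, so
        \<open>num_adornments P\<close> is at least 1 and the product also bounds
        \<open>card P\<close>.\<close>
      then have "0 < ?B" using Js(1) by linarith
      then have "1 \<le> num_adornments P" by simp
      then have "card P \<le> ?B" using mult_le_mono1[of 1 "num_adornments P" "card P"] by simp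
      from run_evalC[OF False Js(1) this] obtain t m out where
        "exec T evalC ((\<lambda>_. Num 0), {}) t (m, out)" "real t \<le> real total_cost * (real ?B * W)"
        "\<forall>q\<in>idb P. {u. (q, u) \<in> out} = E q"
        unfolding run_def by blast
      then have "evaluates_in evalC P T t" "real t \<le> real total_cost * (real (num_adornments P) * real (card P) * W)"
        unfolding evaluates_in_def by auto
      then show ?thesis by blast
    qed
  qed
qed

end
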